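(* Let $\mathsf A\subseteq B(\mathsf h)$ be a universal $C^*$-algebra generated by the set $\{a_i:i\in I\}$ (subject to relations $\{p_k:k\in K\}$), let $\{a_j:j\in J\}$, $J\subseteq I$, be a subset consisting of balanced generators, let $\mathsf A_0$ be the unital $*$-subalgebra generated by $\{a_i:i\in I\}$, and let $\mathsf k:=\ell^2(J)$ with standard orthonormal basis $\{e_j:j\in J\}$. For any choice of constants $\{c_j\in\mathbb C:j\in J\}$, setting $$\delta(x)=\sum_{j\in J}c_jd_j(x)\otimes|e_j\rangle,\qquad\tau(x)=-\tfrac12\sum_{j\in J}|c_j|^2d_j^2(x),\qquad\pi(x)=x\otimes I_{\mathsf k}\qquad(x\in\mathsf A_0)$$ defines a map $$\phi=\begin{bmatrix}\tau&\delta^\dagger\\ \delta&\pi-\iota\end{bmatrix}=\begin{bmatrix}\tau&\delta^\dagger\\ \delta&0\end{bmatrix}:\mathsf A_0\to\mathsf A_0\,\underline\otimes\,B(\widehat{\mathsf k})$$ in standard form. There is a weakly multiplicative strong solution $j$ to the quantum stochastic differential equation $j_0(x)=x\otimes I_{\mathcal F}$, $\mathrm dj_t(x)=\widetilde{\jmath}_t(\phi(x))\,\mathrm d\Lambda_t$ $(x\in\mathsf A_0)$ for this $\phi$. If, in addition, the generators $a_i$ $(i\in I)$ are all isometries, then $j$ is $*$-homomorphic, that is, each $j_t$ extends to a unital $*$-homomorphism from $\mathsf A$ to $B(\mathsf h\otimes\mathcal F)$.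
   Context: Universal algebras. Let $\mathsf A$ be a unital $C^*$-algebra and $\{a_i:i\in I\}\subseteq\mathsf A$. $\mathsf W$ is the set of words in $\{a_i,a_i^*:i\in I\}$ (including the empty word $1_{\mathsf A}$) and $\mathsf A_0=\operatorname{lin}\mathsf W$; the $a_i$ generate $\mathsf A$ if $\mathsf A_0$ is norm dense. They satisfy the relations $\{p_k:k\in K\}$ if each $p_k$ is a complex polynomial in non-commuting indeterminates $X_i,X_i^*$ $(i\in I)$ which vanishes when $X_i,X_i^*$ are replaced by $a_i,a_i^*$. $\mathsf A$ is universal if, given any unital $C^*$-algebra $\mathsf B$ with elements $\{b_i:i\in I\}$ satisfying the same relations, there is a unique (unital) $*$-homomorphism $\mathsf A\to\mathsf B$ with $a_i\mapsto b_i$ for all $i$. A generator $a_i$ is balanced if, for each relation $p_k$, the difference between the number of instances of $X_i$ and of $X_i^*$ is the same for every monomial appearing in $p_k$. If $a_j$ is balanced, there is a well-defined derivation $d_j:\mathsf A_0\to\mathsf A_0$ with $d_j(b)=n_j(b)b$ for each word $b\in\mathsf W$, where $n_j(b)$ is the number of copies of $a_j$ in $b$ minus the number of copies of $a_j^*$ in $b$. $\mathsf A$ is regarded as a concrete algebra in $B(\mathsf h)$ with $1_{\mathsf A}=I_{\mathsf h}$. Standard form. Inner products are linear in the second argument; $\underline\otimes$ is the algebraic tensor product; $\widehat{\mathsf k}:=\mathbb C\oplus\mathsf k$. For a Hilbert space $\mathsf H$ (and any first tensor factor $\mathsf h'$) and $z\in\mathsf H$, $E_z:\mathsf h'\to\mathsf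 h'\otimes\mathsf H$, $u\mapsto u\otimes z$, and $E^z:=E_z^*$. For Hilbert spaces $\mathsf H_1,\mathsf H_2$, $\mathsf A\otimes_{\mathrm m}B(\mathsf H_1;\mathsf H_2):=\{T\in B(\mathsf h\otimes\mathsf H_1;\mathsf h\otimes\mathsf H_2):E^zTE_w\in\mathsf A\ \forall z\in\mathsf H_2,w\in\mathsf H_1\}$; $|\mathsf k\rangle=B(\mathbb C;\mathsf k)$, $\langle\mathsf k|=B(\mathsf k;\mathbb C)$. A linear map $\phi=\begin{bmatrix}\tau&\delta^\dagger\\ \delta&\pi-\iota\end{bmatrix}$ (blocks with respect to $\widehat{\mathsf k}=\mathbb C\oplus\mathsf k$) on a norm-dense $*$-subalgebra $\mathsf A_0\ni1_{\mathsf A}$ has standard form if: $\tau:\mathsf A_0\to\mathsf A$ is $*$-linear with $\tau(xy)-\tau(x)y-x\tau(y)=\delta^\dagger(x)\delta(y)$; $\delta:\mathsf A_0\to\mathsf A\otimes_{\mathrm m}|\mathsf k\rangle$ satisfies $\delta(xy)=\delta(x)y+\pi(x)\delta(y)$; $\delta^\dagger(x)=\delta(x^* )^*$; $\pi:\mathsf A_0\to\mathsf A\otimes_{\mathrm m}B(\mathsf k)$ is a unital $*$-homomorphism; and $\iota(x)=x\otimes I_{\mathsf k}$. Solutions. $\widehat z:=(1,z)$ for $z\in\mathsf k$. $\Delta:=I_{\mathsf h\otimes\mathcal F}\otimes P_{\mathsf k}$ with $P_{\mathsf k}$ the orthogonal projection of $\widehat{\mathsf k}$ onto $\{0\}\oplus\mathsf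 k$, and $\Delta^\perp:=I-\Delta$. $\mathcal F$ is the Boson Fock space over $L^2(\mathbb R_+;\mathsf k)$, with exponential vectors $\varepsilon(f)=((n!)^{-1/2}f^{\otimes n})_{n\ge0}$ and $\varpi(f)=\exp(-\frac12\|f\|^2)\varepsilon(f)$; $L^{\mathrm{step}}$ denotes the $\mathsf k$-valued, right-continuous, compactly supported step functions and $\mathcal E$ the linear span of their exponential vectors. A solution $j$ is a family of linear maps $j_t$, $t\ge0$, from $\mathsf A_0$ to the linear operators $\mathsf h\underline\otimes\mathcal E\to\mathsf h\otimes\mathcal F$ such that, for each $x\in\mathsf A_0$, $X_t=j_t(x)$ is an operator process: $t\mapsto X_t\xi$ is weakly measurable for $\xi\in\mathsf h\underline\otimes\mathcal E$, and $E^{\varpi(f)}X_tE_{\varpi(g)}=\langle\varpi(1_{[t,\infty)}f),\varpi(1_{[t,\infty)}g)\rangle E^{\varpi(1_{[0,t)}f)}X_tE_{\varpi(1_{[0,t)}g)}$ for all $f,g\in L^{\mathrm{step}}$. Let $\widetilde{\jmath}_t(y\otimes T):=j_t(y)\underline\otimes T$ for $y\in\mathsf A_0$, $T\in B(\widehat{\mathsf k})$, extended linearly to $\mathsf A_0\underline\otimes B(\widehat{\mathsf k})$. It is a strong solution if, for each $x\in\mathsf A_0$: $j_0(x)=x\otimes I_{\mathcal F}$; $L_t=\widetilde{\jmath}_t(\phi(x))$ is an integrable process, i.e. $E^{\varpi(f)\otimes\xi}L_tE_{\varpi(g)\otimes\zeta}=\langle\varpi(1_{[t,\infty)}f),\varpi(1_{[t,\infty)}g)\rangle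 E^{\varpi(1_{[0,t)}f)\otimes\xi}L_tE_{\varpi(1_{[0,t)}g)\otimes\zeta}$ for almost all $t$ (all $f,g\in L^{\mathrm{step}}$, $\xi,\zeta\in\widehat{\mathsf k}$), $t\mapsto L_t\theta$ is strongly measurable for $\theta\in\mathsf h\underline\otimes\mathcal E\underline\otimes\widehat{\mathsf k}$, $t\mapsto\Delta^\perp L_t(u\otimes\varpi(f)\otimes\widehat{f(t)})$ is locally integrable and $t\mapsto\Delta L_t(u\otimes\varpi(f)\otimes\widehat{f(t)})$ is locally square-integrable for all $u\in\mathsf h$, $f\in L^{\mathrm{step}}$; and $$\langle u\otimes\varpi(f),(j_t(x)-j_0(x))v\otimes\varpi(g)\rangle=\int_0^t\langle u\otimes\varpi(f),E^{\widehat{f(s)}}\widetilde{\jmath}_s(\phi(x))E_{\widehat{g(s)}}\,v\otimes\varpi(g)\rangle\,\mathrm ds$$ for all $u,v\in\mathsf h$, $f,g\in L^{\mathrm{step}}$, $t\ge0$. It is weakly multiplicative if $\langle j_t(x)\zeta,j_t(y)\xi\rangle=\langle\zeta,j_t(x^*y)\xi\rangle$ for all $x,y\in\mathsf A_0$, $\zeta,\xi\in\mathsf h\underline\otimes\mathcal E$, $t\ge0$. *)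

theory Defs
  imports "HOL-Analysis.Analysis" "HOL-Library.Poly_Mapping" "HOL-Combinatorics.Permutations"
    "HOL-Algebra.Module"
begin

text \<open>Complex inner products are linear in the second argument. The product type carries the
  Hilbert direct sum, so \<^typ>\<open>complex \<times> 'k\<close> is the Hilbert space written $\widehat{k}$.\<close>

class complex_inner = real_normed_vector +
  fixes scaleC :: "complex \<Rightarrow> 'a \<Rightarrow> 'a"  (infixr \<open>*\<^sub>C\<close> 75)
    and cinner :: "'a \<Rightarrow> 'a \<Rightarrow> complex"
  assumes scaleC_add_right: "c *\<^sub>C (x + y) = c *\<^sub>C x + c *\<^sub>C y"
    and scaleC_add_left: "(b + c) *\<^sub>C x = b *\<^sub>C x + c *\<^sub>C x"
    and scaleC_scaleC: "b *\<^sub>C c *\<^sub>C x = (b * c) *\<^sub>C x"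
    and scaleR_scaleC: "r *\<^sub>R x = complex_of_real r *\<^sub>C x"
    and cinner_commute: "cinner x y = cnj (cinner y x)"
    and cinner_add_right: "cinner x (y + z) = cinner x y + cinner x z"
    and cinner_scaleC_right: "cinner x (c *\<^sub>C y) = c * cinner x y"
    and norm_eq_sqrt_cinner: "norm x = sqrt (Re (cinner x x))"
begin

lemma scaleC_one: "1 *\<^sub>C x = x"
  by (metis scaleR_scaleC of_real_1 scaleR_one)

lemma cinner_add_left: "cinner (x + y) z = cinner x z + cinner y z"
  by (metis cinner_add_right cinner_commute complex_cnj_add)

lemma cinner_scaleC_left: "cinner (c *\<^sub>C x) y = cnj c * cinner x y"
  by (metis cinner_scaleC_right cinner_commute complex_cnj_mult)

lemma scaleC_zero_left: "0 *\<^sub>C x = 0"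
  using scaleC_add_left[of 0 0 x] by simp

lemma cinner_zero_right: "cinner x 0 = 0"
  using cinner_scaleC_right[of x 0 0] by (simp add: scaleC_zero_left)

lemma cinner_zero_left: "cinner 0 x = 0"
  using cinner_commute[of 0 x] by (simp add: cinner_zero_right)

lemma cinner_sum_right: "cinner x (\<Sum>i\<in>S. f i) = (\<Sum>i\<in>S. cinner x (f i))"
  by (induction S rule: infinite_finite_induct) (simp_all add: cinner_zero_right cinner_add_right)

lemma cinner_sum_left: "cinner (\<Sum>i\<in>S. f i) x = (\<Sum>i\<in>S. cinner (f i) x)"
  by (induction S rule: infinite_finite_induct) (simp_all add: cinner_zero_left cinner_add_left)

lemma cinner_self_nonneg: "0 \<le> Re (cinner x x)"
  using norm_eq_sqrt_cinner[of x] norm_ge_zero[of x] by simp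

lemma power2_norm_eq_cinner: "Re (cinner x x) = (norm x)\<^sup>2"
  using norm_eq_sqrt_cinner[of x] cinner_self_nonneg[of x] by simp

end

class chilbert_space = complex_inner + complete_space
begin

subclass banach ..

end

instantiation complex :: chilbert_space
begin

definition scaleC_complex :: "complex \<Rightarrow> complex \<Rightarrow> complex"
  where "scaleC_complex c z = c * z"

definition cinner_complex :: "complex \<Rightarrow> complex \<Rightarrow> complex"
  where "cinner_complex w z = cnj w * z"

instance
  by standard
    (simp_all add: scaleC_complex_def cinner_complex_def algebra_simps scaleR_conv_of_real
      cmod_def power2_eq_square)

end

instantiation prod :: (complex_inner, complex_inner) complex_inner
begin

definition scaleC_prod :: "complex \<Rightarrow> 'a \<times> 'b \<Rightarrow> 'a \<times> 'b"
  where "scaleC_prod c x = (c *\<^sub>C fst x, c *\<^sub>C snd x)"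

definition cinner_prod :: "'a \<times> 'b \<Rightarrow> 'a \<times> 'b \<Rightarrow> complex"
  where "cinner_prod x y = cinner (fst x) (fst y) + cinner (snd x) (snd y)"

instance
proof
  fix x y :: "'a \<times> 'b"
  show "cinner x y = cnj (cinner y x)"
    by (simp add: cinner_prod_def cinner_commute[of "fst x"] cinner_commute[of "snd x"])
  show "norm x = sqrt (Re (cinner x x))"
    by (simp add: cinner_prod_def norm_prod_def power2_norm_eq_cinner)
qed (auto simp: scaleC_prod_def cinner_prod_def scaleC_add_right scaleC_add_left scaleC_scaleC
    scaleR_scaleC cinner_add_right cinner_scaleC_right algebra_simps prod_eq_iff)

end

instance prod :: (chilbert_space, chilbert_space) chilbert_space ..

text \<open>Tensor products and Fock spaces are obtained from one construction: for a positive
  semidefinite kernel on a type, \<open>completion\<close> is the Hilbert space completion of the free complex vector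
  space on that type with respect to the semi-inner product determined by the kernel, vectors of
  norm zero being identified with 0; \<open>kvec x\<close> is the class of the generator \<open>x\<close>.\<close>

class pos_def_kernel =
  fixes kern :: "'a \<Rightarrow> 'a \<Rightarrow> complex"
  assumes kern_commute: "kern x y = cnj (kern y x)"
    and kern_pos: "finite S \<Longrightarrow> 0 \<le> Re (\<Sum>x\<in>S. \<Sum>y\<in>S. cnj (c x) * c y * kern x y)"

definition kcoef :: "complex \<Rightarrow> ('a \<Rightarrow>\<^sub>0 complex) \<Rightarrow> ('a \<Rightarrow>\<^sub>0 complex)"
  where "kcoef c f = Poly_Mapping.map ((*) c) f"

definition kinner :: "('a::pos_def_kernel \<Rightarrow>\<^sub>0 complex) \<Rightarrow> ('a \<Rightarrow>\<^sub>0 complex) \<Rightarrow> complex"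
  where "kinner f g = (\<Sum>x\<in>Poly_Mapping.keys f. \<Sum>y\<in>Poly_Mapping.keys g.
           cnj (Poly_Mapping.lookup f x) * Poly_Mapping.lookup g y * kern x y)"

definition knorm :: "('a::pos_def_kernel \<Rightarrow>\<^sub>0 complex) \<Rightarrow> real"
  where "knorm f = sqrt (Re (kinner f f))"

lemma lookup_kcoef [simp]: "Poly_Mapping.lookup (kcoef c f) x = c * Poly_Mapping.lookup f x"
  unfolding kcoef_def by (transfer) (auto simp: when_def)

lemma kinner_superset:
  assumes "finite A" "finite B" "Poly_Mapping.keys f \<subseteq> A" "Poly_Mapping.keys g \<subseteq> B"
  shows "kinner f g = (\<Sum>x\<in>A. \<Sum>y\<in>B.
    cnj (Poly_Mapping.lookup f x) * Poly_Mapping.lookup g y * kern x y)"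
proof -
  have "kinner f g = (\<Sum>x\<in>Poly_Mapping.keys f. \<Sum>y\<in>B.
      cnj (Poly_Mapping.lookup f x) * Poly_Mapping.lookup g y * kern x y)"
    unfolding kinner_def
    by (intro sum.cong refl sum.mono_neutral_left assms) (auto simp: in_keys_iff)
  also have "\<dots> = (\<Sum>x\<in>A. \<Sum>y\<in>B.
      cnj (Poly_Mapping.lookup f x) * Poly_Mapping.lookup g y * kern x y)"
    by (intro sum.mono_neutral_left assms) (auto simp: in_keys_iff)
  finally show ?thesis .
qed

lemma kinner_add_right: "kinner f (g + h) = kinner f g + kinner f h"
proof -
  let ?B = "Poly_Mapping.keys g \<union> Poly_Mapping.keys h"
  have "Poly_Mapping.keys (g + h) \<subseteq> ?B" by (rule Poly_Mapping.keys_add)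
  then show ?thesis
    by (simp add: kinner_superset[where A="Poly_Mapping.keys f" and B="?B"] lookup_add
        algebra_simps sum.distrib)
qed

lemma keys_kcoef: "Poly_Mapping.keys (kcoef c f) \<subseteq> Poly_Mapping.keys f"
  by (auto simp: in_keys_iff)

lemma kinner_kcoef_right: "kinner f (kcoef c g) = c * kinner f g"
  by (simp add: kinner_superset[where A="Poly_Mapping.keys f" and B="Poly_Mapping.keys g"]
     keys_kcoef sum_distrib_left mult_ac)

lemma kinner_commute: "kinner f g = cnj (kinner g f)"
proof -
  have "cnj (kinner g f) = (\<Sum>y\<in>Poly_Mapping.keys g. \<Sum>x\<in>Poly_Mapping.keys f.
     cnj (Poly_Mapping.lookup f x) * Poly_Mapping.lookup g y * kern x y)"
    unfolding kinner_def by (simp add: kern_commute[symmetric] mult_ac)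
  also have "\<dots> = kinner f g"
    unfolding kinner_def by (rule sum.swap)
  finally show ?thesis by simp
qed

lemma kinner_add_left: "kinner (f + g) h = kinner f h + kinner g h"
  by (metis kinner_add_right kinner_commute complex_cnj_add)

lemma kinner_kcoef_left: "kinner (kcoef c f) g = cnj c * kinner f g"
  by (metis kinner_kcoef_right kinner_commute complex_cnj_mult)

lemma kinner_nonneg: "0 \<le> Re (kinner f f)"
  unfolding kinner_def by (rule kern_pos) simp

lemma kcoef_minus_one: "kcoef (-1) f = - f"
  by (rule poly_mapping_eqI) simp

lemma kinner_uminus_right: "kinner f (- g) = - kinner f g"
  using kinner_kcoef_right[of f "-1" g] by (simp add: kcoef_minus_one)

lemma kinner_uminus_left: "kinner (- f) g = - kinner f g"
  using kinner_kcoef_left[of "-1" f g] by (simp add: kcoef_minus_one)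

lemma kinner_diff_right: "kinner f (g - h) = kinner f g - kinner f h"
  using kinner_add_right[of f g "- h"] by (simp add: kinner_uminus_right)

lemma kinner_diff_left: "kinner (f - g) h = kinner f h - kinner g h"
  using kinner_add_left[of f "- g" h] by (simp add: kinner_uminus_left)

lemma knorm_nonneg [simp]: "0 \<le> knorm f"
  by (simp add: knorm_def kinner_nonneg)

lemma knorm_sq: "(knorm f)\<^sup>2 = Re (kinner f f)"
  by (simp add: knorm_def kinner_nonneg)

lemma kinner_self_real: "kinner f f = complex_of_real ((knorm f)\<^sup>2)"
  using kinner_commute[of f f] by (simp add: complex_eq_iff knorm_sq)

lemma kinner_Cauchy_Schwarz: "cmod (kinner f g) \<le> knorm f * knorm g"
proof -
  define a where "a = kinner f g"
  have *: "0 \<le> (knorm f)\<^sup>2 * t\<^sup>2 - 2 * t * (cmod a)\<^sup>2 + (cmod a)\<^sup>2 * (knorm g)\<^sup>2" for t :: real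
  proof -
    have gf: "kinner g f = cnj a" using kinner_commute[of g f] by (simp add: a_def)
    have "0 \<le> Re (kinner (kcoef t f - kcoef (cnj a) g) (kcoef t f - kcoef (cnj a) g))"
      by (rule kinner_nonneg)
    also have "\<dots> = (knorm f)\<^sup>2 * t\<^sup>2 - 2 * t * (cmod a)\<^sup>2 + (cmod a)\<^sup>2 * (knorm g)\<^sup>2"
      by (simp add: kinner_diff_left kinner_diff_right kinner_kcoef_left kinner_kcoef_right gf
          a_def[symmetric] kinner_self_real[of f] kinner_self_real[of g] cmod_power2)
         (simp add: algebra_simps power2_eq_square)
    finally show ?thesis .
  qed
  have "(cmod a)\<^sup>2 \<le> (knorm f)\<^sup>2 * (knorm g)\<^sup>2"
  proof (cases "cmod a = 0")
    case True then show ?thesis by simp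
  next
    case False
    have ff: "(knorm f)\<^sup>2 > 0"
    proof (rule ccontr)
      assume "\<not> ?thesis"
      then have z: "(knorm f)\<^sup>2 = 0" using zero_le_power2[of "knorm f"] by linarith
      have "0 \<le> (cmod a)\<^sup>2 * (knorm g)\<^sup>2 - 2 * (((knorm g)\<^sup>2 + 1) / 2) * (cmod a)\<^sup>2"
        using *[of "((knorm g)\<^sup>2 + 1) / 2"] unfolding z by linarith
      then have "(cmod a)\<^sup>2 \<le> 0" by (simp add: algebra_simps)
      then show False using False by simp
    qed
    have "0 \<le> (knorm f)\<^sup>2 * ((cmod a)\<^sup>2 / (knorm f)\<^sup>2)\<^sup>2 - 2 * ((cmod a)\<^sup>2 / (knorm f)\<^sup>2) * (cmod a)\<^sup>2
        + (cmod a)\<^sup>2 * (knorm g)\<^sup>2" by (rule *)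
    also have "\<dots> = (cmod a)\<^sup>2 * ((knorm g)\<^sup>2 - (cmod a)\<^sup>2 / (knorm f)\<^sup>2)"
      using ff by (simp add: field_simps power2_eq_square)
    finally have "0 \<le> (knorm g)\<^sup>2 - (cmod a)\<^sup>2 / (knorm f)\<^sup>2"
      using False by (simp add: zero_le_mult_iff)
    then show ?thesis using ff by (simp add: field_simps)
  qed
  then have "(cmod a)\<^sup>2 \<le> (knorm f * knorm g)\<^sup>2" by (simp add: power_mult_distrib)
  then show ?thesis unfolding a_def by (rule power2_le_imp_le) simp
qed

lemma knorm_triangle: "knorm (f + g) \<le> knorm f + knorm g"
proof (rule power2_le_imp_le)
  have "(knorm (f + g))\<^sup>2 = (knorm f)\<^sup>2 + (knorm g)\<^sup>2 + 2 * Re (kinner f g)"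
    by (simp add: knorm_sq kinner_add_left kinner_add_right kinner_commute[of g f])
  also have "Re (kinner f g) \<le> knorm f * knorm g"
    using kinner_Cauchy_Schwarz[of f g] complex_Re_le_cmod[of "kinner f g"] by linarith
  finally show "(knorm (f + g))\<^sup>2 \<le> (knorm f + knorm g)\<^sup>2"
    by (simp add: power2_sum)
qed simp

lemma knorm_kcoef: "knorm (kcoef c f) = cmod c * knorm f"
proof -
  have "(knorm (kcoef c f))\<^sup>2 = (cmod c * knorm f)\<^sup>2"
    by (simp add: knorm_sq[of "kcoef c f"] kinner_kcoef_left kinner_kcoef_right kinner_self_real[of f]
        power_mult_distrib cmod_power2) (simp add: algebra_simps power2_eq_square)
  then show ?thesis by (simp add: power2_eq_iff_nonneg)
qed

lemma knorm_uminus [simp]: "knorm (- f) = knorm f"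
  using knorm_kcoef[of "-1" f] by (simp add: kcoef_minus_one)

lemma knorm_minus_commute: "knorm (f - g) = knorm (g - f)"
  using knorm_uminus[of "f - g"] by simp

lemma knorm_zero [simp]: "knorm 0 = 0"
  by (simp add: knorm_def kinner_def)

lemma knorm_triangle_sub: "knorm (f - h) \<le> knorm (f - g) + knorm (g - h)"
  using knorm_triangle[of "f - g" "g - h"] by simp

lemma knorm_triangle3: "\<bar>knorm f - knorm g\<bar> \<le> knorm (f - g)"
  using knorm_triangle[of "f - g" g] knorm_triangle[of "g - f" f] knorm_minus_commute[of f g] by simp

definition kcauchy :: "(nat \<Rightarrow> 'a::pos_def_kernel \<Rightarrow>\<^sub>0 complex) \<Rightarrow> bool"
  where "kcauchy X \<longleftrightarrow> (\<forall>e>0. \<exists>M. \<forall>m\<ge>M. \<forall>n\<ge>M. knorm (X m - X n) < e)"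

definition krel :: "(nat \<Rightarrow> 'a::pos_def_kernel \<Rightarrow>\<^sub>0 complex) \<Rightarrow> (nat \<Rightarrow> 'a \<Rightarrow>\<^sub>0 complex) \<Rightarrow> bool"
  where "krel X Y \<longleftrightarrow> kcauchy X \<and> kcauchy Y \<and> (\<lambda>n. knorm (X n - Y n)) \<longlonglongrightarrow> 0"

lemma kcauchy_const [simp]: "kcauchy (\<lambda>_. f)"
  by (simp add: kcauchy_def)

lemma kcauchy_add:
  assumes "kcauchy X" "kcauchy Y" shows "kcauchy (\<lambda>n. X n + Y n)"
  unfolding kcauchy_def
proof (intro allI impI)
  fix e :: real assume "e > 0"
  then obtain M N where M: "\<forall>m\<ge>M. \<forall>n\<ge>M. knorm (X m - X n) < e / 2"
    and N: "\<forall>m\<ge>N. \<forall>n\<ge>N. knorm (Y m - Y n) < e / 2"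
    using assms unfolding kcauchy_def by (meson half_gt_zero)
  have "knorm (X m + Y m - (X n + Y n)) < e" if "m \<ge> max M N" "n \<ge> max M N" for m n
  proof -
    have "knorm (X m + Y m - (X n + Y n)) = knorm ((X m - X n) + (Y m - Y n))"
      by (simp add: algebra_simps)
    also have "\<dots> \<le> knorm (X m - X n) + knorm (Y m - Y n)" by (rule knorm_triangle)
    also have "\<dots> < e / 2 + e / 2" using M N that by (intro add_strict_mono) auto
    finally show ?thesis by simp
  qed
  then show "\<exists>M. \<forall>m\<ge>M. \<forall>n\<ge>M. knorm (X m + Y m - (X n + Y n)) < e" by blast
qed

lemma kcoef_diff: "kcoef c f - kcoef c g = kcoef c (f - g)"
  by (rule poly_mapping_eqI) (simp add: lookup_minus algebra_simps)

lemma kcoef_add: "kcoef c (f + g) = kcoef c f + kcoef c g"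
  by (rule poly_mapping_eqI) (simp add: lookup_add algebra_simps)

lemma kcoef_add_left: "kcoef (b + c) f = kcoef b f + kcoef c f"
  by (rule poly_mapping_eqI) (simp add: lookup_add algebra_simps)

lemma kcoef_kcoef: "kcoef b (kcoef c f) = kcoef (b * c) f"
  by (rule poly_mapping_eqI) simp

lemma kcauchy_kcoef:
  assumes "kcauchy X" shows "kcauchy (\<lambda>n. kcoef c (X n))"
  unfolding kcauchy_def
proof (intro allI impI)
  fix e :: real assume "e > 0"
  then have "e / (cmod c + 1) > 0"
    by (simp add: add_nonneg_pos)
  then obtain M where M: "\<forall>m\<ge>M. \<forall>n\<ge>M. knorm (X m - X n) < e / (cmod c + 1)"
    using assms unfolding kcauchy_def by meson
  have "knorm (kcoef c (X m) - kcoef c (X n)) < e" if "m \<ge> M" "n \<ge> M" for m n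
  proof -
    have "knorm (kcoef c (X m) - kcoef c (X n)) = cmod c * knorm (X m - X n)"
      by (simp add: kcoef_diff knorm_kcoef)
    also have "\<dots> \<le> (cmod c + 1) * knorm (X m - X n)"
      by (intro mult_right_mono) auto
    also have "\<dots> < e"
      using M that by (simp add: pos_less_divide_eq mult.commute add_nonneg_pos)
    finally show ?thesis .
  qed
  then show "\<exists>M. \<forall>m\<ge>M. \<forall>n\<ge>M. knorm (kcoef c (X m) - kcoef c (X n)) < e" by blast
qed

lemma kcauchy_bounded:
  assumes "kcauchy X" obtains B where "B > 0" "\<And>n. knorm (X n) \<le> B"
proof -
  obtain M where M: "\<forall>m\<ge>M. \<forall>n\<ge>M. knorm (X m - X n) < 1"
    using assms unfolding kcauchy_def by (meson zero_less_one)
  define B where "B = Max ((\<lambda>n. knorm (X n)) ` {..M}) + 1"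
  have le: "knorm (X n) \<le> B - 1" if "n \<le> M" for n
    using that unfolding B_def by (simp add: Max_ge)
  have "knorm (X n) \<le> B" for n
  proof (cases "n \<le> M")
    case True then show ?thesis using le[of n] by simp
  next
    case False
    then have "knorm (X n - X M) < 1" using M by auto
    then show ?thesis
      using knorm_triangle3[of "X n" "X M"] le[of M] by simp
  qed
  moreover have "B > 0" using le[of 0] knorm_nonneg[of "X 0"] by linarith
  ultimately show ?thesis using that by blast
qed

lemma kinner_Cauchy:
  assumes "kcauchy X" "kcauchy Y" shows "Cauchy (\<lambda>n. kinner (X n) (Y n))"
proof (rule CauchyI)
  fix e :: real assume e: "e > 0"
  obtain A where A: "A > 0" "\<And>n. knorm (X n) \<le> A" using kcauchy_bounded[OF assms(1)] by blast
  obtain B where B: "B > 0" "\<And>n. knorm (Y n) \<le> B" using kcauchy_bounded[OF assms(2)] by blast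
  have "e / (2 * B) > 0" "e / (2 * A) > 0" using e A B by simp_all
  then obtain M N where M: "\<forall>m\<ge>M. \<forall>n\<ge>M. knorm (X m - X n) < e / (2 * B)"
    and N: "\<forall>m\<ge>N. \<forall>n\<ge>N. knorm (Y m - Y n) < e / (2 * A)"
    using assms unfolding kcauchy_def by meson
  have "norm (kinner (X m) (Y m) - kinner (X n) (Y n)) < e" if mn: "m \<ge> max M N" "n \<ge> max M N" for m n
  proof -
    have "kinner (X m) (Y m) - kinner (X n) (Y n) =
        kinner (X m - X n) (Y m) + kinner (X n) (Y m - Y n)"
      by (simp add: kinner_diff_left kinner_diff_right)
    then have "norm (kinner (X m) (Y m) - kinner (X n) (Y n)) \<le>
        cmod (kinner (X m - X n) (Y m)) + cmod (kinner (X n) (Y m - Y n))"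
      by (simp add: norm_triangle_ineq)
    also have "\<dots> \<le> knorm (X m - X n) * knorm (Y m) + knorm (X n) * knorm (Y m - Y n)"
      by (intro add_mono kinner_Cauchy_Schwarz)
    also have "\<dots> \<le> knorm (X m - X n) * B + A * knorm (Y m - Y n)"
      by (intro add_mono mult_left_mono mult_right_mono A B) auto
    also have "\<dots> < e / (2 * B) * B + A * (e / (2 * A))"
      using M N mn A(1) B(1) by (intro add_strict_mono mult_strict_right_mono mult_strict_left_mono) auto
    also have "\<dots> = e" using A(1) B(1) by simp
    finally show ?thesis .
  qed
  then show "\<exists>M. \<forall>m\<ge>M. \<forall>n\<ge>M. norm (kinner (X m) (Y m) - kinner (X n) (Y n)) < e" by blast
qed

lemma kinner_lim:
  assumes "kcauchy X" "kcauchy Y"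
  shows "(\<lambda>n. kinner (X n) (Y n)) \<longlonglongrightarrow> lim (\<lambda>n. kinner (X n) (Y n))"
  using kinner_Cauchy[OF assms] by (simp add: Cauchy_convergent_iff convergent_LIMSEQ_iff)

lemma kinner_lim_cong:
  assumes "krel X X'" "krel Y Y'"
  shows "lim (\<lambda>n. kinner (X n) (Y n)) = lim (\<lambda>n. kinner (X' n) (Y' n))"
proof -
  have c: "kcauchy X" "kcauchy X'" "kcauchy Y" "kcauchy Y'" using assms by (auto simp: krel_def)
  obtain A where A: "A > 0" "\<And>n. knorm (X' n) \<le> A" using kcauchy_bounded[OF c(2)] by blast
  obtain B where B: "B > 0" "\<And>n. knorm (Y n) \<le> B" using kcauchy_bounded[OF c(3)] by blast
  have lim0: "(\<lambda>n. kinner (X n) (Y n) - kinner (X' n) (Y' n)) \<longlonglongrightarrow> 0"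
  proof (rule Lim_null_comparison)
    show "\<forall>\<^sub>F n in sequentially. norm (kinner (X n) (Y n) - kinner (X' n) (Y' n)) \<le>
      knorm (X n - X' n) * B + A * knorm (Y n - Y' n)"
    proof (rule always_eventually, rule allI)
      fix n
      have "kinner (X n) (Y n) - kinner (X' n) (Y' n) =
          kinner (X n - X' n) (Y n) + kinner (X' n) (Y n - Y' n)"
        by (simp add: kinner_diff_left kinner_diff_right)
      then have "norm (kinner (X n) (Y n) - kinner (X' n) (Y' n)) \<le>
          cmod (kinner (X n - X' n) (Y n)) + cmod (kinner (X' n) (Y n - Y' n))"
        by (simp add: norm_triangle_ineq)
      also have "\<dots> \<le> knorm (X n - X' n) * knorm (Y n) + knorm (X' n) * knorm (Y n - Y' n)"
        by (intro add_mono kinner_Cauchy_Schwarz)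
      also have "\<dots> \<le> knorm (X n - X' n) * B + A * knorm (Y n - Y' n)"
        by (intro add_mono mult_left_mono mult_right_mono A B) auto
      finally show "norm (kinner (X n) (Y n) - kinner (X' n) (Y' n)) \<le>
        knorm (X n - X' n) * B + A * knorm (Y n - Y' n)" .
    qed
    show "(\<lambda>n. knorm (X n - X' n) * B + A * knorm (Y n - Y' n)) \<longlonglongrightarrow> 0"
      using assms unfolding krel_def by (auto intro!: tendsto_eq_intros)
  qed
  have "(\<lambda>n. kinner (X' n) (Y' n)) \<longlonglongrightarrow> lim (\<lambda>n. kinner (X n) (Y n)) - 0"
    using tendsto_diff[OF kinner_lim[OF c(1,3)] lim0] by simp
  then show ?thesis using limI by fastforce
qed

lemma krel_refl: "kcauchy X \<Longrightarrow> krel X X"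
  by (simp add: krel_def)

lemma krel_part_equivp: "part_equivp krel"
proof (rule part_equivpI)
  show "\<exists>X. krel X X" using krel_refl kcauchy_const by blast
  show "symp krel" by (rule sympI) (simp add: krel_def knorm_minus_commute)
  show "transp krel"
  proof (rule transpI)
    fix X Y Z assume *: "krel X Y" "krel Y Z"
    have "(\<lambda>n. knorm (X n - Z n)) \<longlonglongrightarrow> 0"
    proof (rule Lim_null_comparison)
      show "\<forall>\<^sub>F n in sequentially. norm (knorm (X n - Z n)) \<le> knorm (X n - Y n) + knorm (Y n - Z n)"
        by (intro always_eventually allI) (simp add: knorm_triangle_sub)
      show "(\<lambda>n. knorm (X n - Y n) + knorm (Y n - Z n)) \<longlonglongrightarrow> 0"
        using * unfolding krel_def by (auto intro!: tendsto_eq_intros)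
    qed
    then show "krel X Z" using * by (simp add: krel_def)
  qed
qed

quotient_type (overloaded) 'a completion =
  "nat \<Rightarrow> ('a::pos_def_kernel \<Rightarrow>\<^sub>0 complex)" / partial: krel
  by (rule krel_part_equivp)

lemma krel_add:
  assumes "krel X X'" "krel Y Y'" shows "krel (\<lambda>n. X n + Y n) (\<lambda>n. X' n + Y' n)"
proof -
  have "(\<lambda>n. knorm (X n + Y n - (X' n + Y' n))) \<longlonglongrightarrow> 0"
  proof (rule Lim_null_comparison)
    show "\<forall>\<^sub>F n in sequentially. norm (knorm (X n + Y n - (X' n + Y' n))) \<le>
        knorm (X n - X' n) + knorm (Y n - Y' n)"
      by (intro always_eventually allI)
         (use knorm_triangle in \<open>simp add: add_diff_add\<close>)
    show "(\<lambda>n. knorm (X n - X' n) + knorm (Y n - Y' n)) \<longlonglongrightarrow> 0"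
      using assms unfolding krel_def by (auto intro!: tendsto_eq_intros)
  qed
  then show ?thesis using assms by (simp add: krel_def kcauchy_add)
qed

lemma krel_kcoef:
  assumes "krel X X'" shows "krel (\<lambda>n. kcoef c (X n)) (\<lambda>n. kcoef c (X' n))"
  using assms unfolding krel_def
  by (auto simp: kcauchy_kcoef kcoef_diff knorm_kcoef intro!: tendsto_eq_intros)

instantiation completion :: (pos_def_kernel) complex_inner
begin

lift_definition zero_completion :: "'a completion" is "\<lambda>_. 0"
  by (simp add: krel_refl)

lift_definition plus_completion :: "'a completion \<Rightarrow> 'a completion \<Rightarrow> 'a completion"
  is "\<lambda>X Y n. X n + Y n" by (rule krel_add)

lift_definition scaleC_completion :: "complex \<Rightarrow> 'a completion \<Rightarrow> 'a completion"
  is "\<lambda>c X n. kcoef c (X n)" by (rule krel_kcoef)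

lift_definition cinner_completion :: "'a completion \<Rightarrow> 'a completion \<Rightarrow> complex"
  is "\<lambda>X Y. lim (\<lambda>n. kinner (X n) (Y n))" by (rule kinner_lim_cong)

definition uminus_completion :: "'a completion \<Rightarrow> 'a completion"
  where "uminus_completion x = (- 1) *\<^sub>C x"

definition minus_completion :: "'a completion \<Rightarrow> 'a completion \<Rightarrow> 'a completion"
  where "minus_completion x y = x + (- y)"

definition scaleR_completion :: "real \<Rightarrow> 'a completion \<Rightarrow> 'a completion"
  where "scaleR_completion r x = complex_of_real r *\<^sub>C x"

definition norm_completion :: "'a completion \<Rightarrow> real"
  where "norm_completion x = sqrt (Re (cinner x x))"

definition sgn_completion :: "'a completion \<Rightarrow> 'a completion"
  where "sgn_completion x = complex_of_real (inverse (norm x)) *\<^sub>C x"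

definition dist_completion :: "'a completion \<Rightarrow> 'a completion \<Rightarrow> real"
  where "dist_completion x y = norm (x - y)"

definition uniformity_completion :: "('a completion \<times> 'a completion) filter"
  where "uniformity_completion = (INF e\<in>{0 <..}. principal {(x, y). dist x y < (e::real)})"

definition open_completion :: "'a completion set \<Rightarrow> bool"
  where "open_completion U = (\<forall>x\<in>U. eventually (\<lambda>(x', y). x' = x \<longrightarrow> y \<in> U) (uniformity :: ('a completion \<times> 'a completion) filter))"

lemma norm_tendsto_completion:
  assumes "kcauchy X" shows "(\<lambda>n. knorm (X n)) \<longlonglongrightarrow> norm (abs_completion X)"
proof -
  have "cinner (abs_completion X) (abs_completion X) = lim (\<lambda>n. kinner (X n) (X n))"
    using assms by (simp add: cinner_completion.abs_eq krel_refl)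
  moreover have "(\<lambda>n. sqrt (Re (kinner (X n) (X n)))) \<longlonglongrightarrow> sqrt (Re (lim (\<lambda>n. kinner (X n) (X n))))"
    by (intro tendsto_intros kinner_lim assms)
  ultimately show ?thesis by (simp add: norm_completion_def knorm_def)
qed

lemma completion_cases:
  obtains X where "kcauchy X" "x = abs_completion X"
  by (metis (no_types) Quotient_completion Quotient_abs_rep Quotient_rep_reflp krel_def)

lemma abs_completion_add:
  "kcauchy X \<Longrightarrow> kcauchy Y \<Longrightarrow> abs_completion X + abs_completion Y = abs_completion (\<lambda>n. X n + Y n)"
  by (simp add: plus_completion.abs_eq krel_refl)

lemma abs_completion_scaleC:
  "kcauchy X \<Longrightarrow> c *\<^sub>C abs_completion X = abs_completion (\<lambda>n. kcoef c (X n))"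
  by (simp add: scaleC_completion.abs_eq krel_refl)

lemma abs_completion_zero: "0 = abs_completion (\<lambda>_. 0)"
  by (simp add: zero_completion_def)

lemma abs_completion_eqI:
  "krel X Y \<Longrightarrow> abs_completion X = abs_completion Y"
  using Quotient_completion Quotient_rel_abs by fastforce

instance
proof
  fix x y z :: "'a completion" and b c :: complex and r s :: real
  obtain X where X: "kcauchy X" "x = abs_completion X" by (rule completion_cases)
  obtain Y where Y: "kcauchy Y" "y = abs_completion Y" by (rule completion_cases)
  obtain Z where Z: "kcauchy Z" "z = abs_completion Z" by (rule completion_cases)
  note * = X Y Z abs_completion_add abs_completion_scaleC kcauchy_add kcauchy_kcoef
    abs_completion_zero
  show "x + y + z = x + (y + z)" by (simp add: * add.assoc)
  show "x + y = y + x" by (simp add: * add.commute)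
  show "0 + x = x" by (simp add: *)
  have kz: "kcoef (-1) f + f = 0" for f :: "'a \<Rightarrow>\<^sub>0 complex"
    by (rule poly_mapping_eqI) (simp add: lookup_add)
  show "- x + x = 0" by (simp add: uminus_completion_def * kz)
  show "x - y = x + - y" by (simp add: minus_completion_def)
  show sCr: "c *\<^sub>C (x + y) = c *\<^sub>C x + c *\<^sub>C y" by (simp add: * kcoef_add)
  show sCl: "(b + c) *\<^sub>C x = b *\<^sub>C x + c *\<^sub>C x" by (simp add: * kcoef_add_left)
  show sCC: "b *\<^sub>C c *\<^sub>C x = (b * c) *\<^sub>C x" by (simp add: * kcoef_kcoef)
  show "r *\<^sub>R x = complex_of_real r *\<^sub>C x" by (simp add: scaleR_completion_def)
  show "r *\<^sub>R (x + y) = r *\<^sub>R x + r *\<^sub>R y"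
    by (simp add: scaleR_completion_def * kcoef_add)
  show "(r + s) *\<^sub>R x = r *\<^sub>R x + s *\<^sub>R x"
    by (simp add: scaleR_completion_def * kcoef_add_left)
  show "r *\<^sub>R s *\<^sub>R x = (r * s) *\<^sub>R x"
    by (simp add: scaleR_completion_def * kcoef_kcoef)
  have k1: "kcoef 1 f = f" for f :: "'a \<Rightarrow>\<^sub>0 complex"
    by (rule poly_mapping_eqI) simp
  show "1 *\<^sub>R x = x" by (simp add: scaleR_completion_def * k1)
  have ci: "cinner (abs_completion U) (abs_completion V) = lim (\<lambda>n. kinner (U n) (V n))"
    if "kcauchy U" "kcauchy V" for U V :: "nat \<Rightarrow> 'a \<Rightarrow>\<^sub>0 complex"
    using that by (simp add: cinner_completion.abs_eq krel_refl)
  show "cinner x y = cnj (cinner y x)"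
  proof -
    have "(\<lambda>n. cnj (kinner (Y n) (X n))) \<longlonglongrightarrow> cnj (lim (\<lambda>n. kinner (Y n) (X n)))"
      by (intro tendsto_cnj kinner_lim X Y)
    then have "(\<lambda>n. kinner (X n) (Y n)) \<longlonglongrightarrow> cnj (lim (\<lambda>n. kinner (Y n) (X n)))"
      by (simp add: kinner_commute[symmetric])
    then show ?thesis by (simp add: X Y ci limI)
  qed
  show "cinner x (y + z) = cinner x y + cinner x z"
  proof -
    have "(\<lambda>n. kinner (X n) (Y n) + kinner (X n) (Z n)) \<longlonglongrightarrow>
        lim (\<lambda>n. kinner (X n) (Y n)) + lim (\<lambda>n. kinner (X n) (Z n))"
      by (intro tendsto_add kinner_lim X Y Z)
    then show ?thesis by (simp add: * ci kinner_add_right limI)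
  qed
  show "cinner x (c *\<^sub>C y) = c * cinner x y"
  proof -
    have "(\<lambda>n. c * kinner (X n) (Y n)) \<longlonglongrightarrow> c * lim (\<lambda>n. kinner (X n) (Y n))"
      by (intro tendsto_mult_left kinner_lim X Y)
    then show ?thesis by (simp add: * ci kinner_kcoef_right limI)
  qed
  show "norm x = sqrt (Re (cinner x x))" by (simp add: norm_completion_def)
  show "sgn x = inverse (norm x) *\<^sub>R x" by (simp add: sgn_completion_def scaleR_completion_def)
  show "dist x y = norm (x - y)" by (simp add: dist_completion_def)
  show "(uniformity :: ('a completion \<times> 'a completion) filter) =
      (INF e\<in>{0 <..}. principal {(x, y). dist x y < e})" by (rule uniformity_completion_def)
  show "open U = (\<forall>x\<in>U. \<forall>\<^sub>F (x', y) in uniformity. x' = x \<longrightarrow> y \<in> U)" for U :: "'a completion set"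
    by (rule open_completion_def)
  show "(norm x = 0) = (x = 0)"
  proof
    assume "norm x = 0"
    then have "(\<lambda>n. knorm (X n)) \<longlonglongrightarrow> 0" using norm_tendsto_completion[OF X(1)] X(2) by simp
    then have "krel X (\<lambda>_. 0)" using X by (simp add: krel_def)
    then show "x = 0" unfolding X(2) abs_completion_zero by (rule abs_completion_eqI)
  next
    assume "x = 0"
    then have "norm x = norm (abs_completion (\<lambda>_. 0 :: 'a \<Rightarrow>\<^sub>0 complex))"
      by (simp add: abs_completion_zero)
    moreover have "(\<lambda>_. knorm (0 :: 'a \<Rightarrow>\<^sub>0 complex)) \<longlonglongrightarrow> norm (abs_completion (\<lambda>_. 0 :: 'a \<Rightarrow>\<^sub>0 complex))"
      using norm_tendsto_completion[of "\<lambda>_. 0 :: 'a \<Rightarrow>\<^sub>0 complex"] by simp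
    ultimately show "norm x = 0" by (simp add: LIMSEQ_const_iff)
  qed
  show "norm (x + y) \<le> norm x + norm y"
  proof (rule LIMSEQ_le)
    show "(\<lambda>n. knorm (X n + Y n)) \<longlonglongrightarrow> norm (x + y)"
      using norm_tendsto_completion[OF kcauchy_add[OF X(1) Y(1)]] by (simp add: *)
    show "(\<lambda>n. knorm (X n) + knorm (Y n)) \<longlonglongrightarrow> norm x + norm y"
      by (rule tendsto_add) (simp_all add: X Y norm_tendsto_completion)
    show "\<exists>N. \<forall>n\<ge>N. knorm (X n + Y n) \<le> knorm (X n) + knorm (Y n)"
      using knorm_triangle by blast
  qed
  show "norm (r *\<^sub>R x) = \<bar>r\<bar> * norm x"
  proof (rule LIMSEQ_unique)
    show "(\<lambda>n. knorm (kcoef r (X n))) \<longlonglongrightarrow> norm (r *\<^sub>R x)"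
      using norm_tendsto_completion[OF kcauchy_kcoef[OF X(1)]] by (simp add: * scaleR_completion_def)
    have kr: "knorm (kcoef r f) = \<bar>r\<bar> * knorm f" for f :: "'a \<Rightarrow>\<^sub>0 complex"
      by (simp add: knorm_kcoef)
    show "(\<lambda>n. knorm (kcoef r (X n))) \<longlonglongrightarrow> \<bar>r\<bar> * norm x"
      unfolding kr by (rule tendsto_mult_left) (simp add: X norm_tendsto_completion)
  qed
qed

end

definition kembed :: "('a::pos_def_kernel \<Rightarrow>\<^sub>0 complex) \<Rightarrow> 'a completion"
  where "kembed f = abs_completion (\<lambda>_. f)"

lemma abs_completion_minus:
  "kcauchy X \<Longrightarrow> kcauchy Y \<Longrightarrow> abs_completion X - abs_completion Y = abs_completion (\<lambda>n. X n - Y n)"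
  using abs_completion_add[of X "\<lambda>n. kcoef (-1) (Y n)"] abs_completion_scaleC[of Y "-1"]
    kcauchy_kcoef[of Y "-1"]
  by (simp add: minus_completion_def uminus_completion_def kcoef_minus_one)

lemma norm_kembed_diff: "norm (kembed f - kembed g) = knorm (f - g)"
  using norm_tendsto_completion[of "\<lambda>_. f - g"]
  by (simp add: kembed_def abs_completion_minus LIMSEQ_const_iff)

lemma kembed_tendsto:
  assumes "kcauchy X" shows "(\<lambda>n. kembed (X n)) \<longlonglongrightarrow> abs_completion X"
proof (rule LIMSEQ_I)
  fix e :: real assume "e > 0"
  then obtain M where M: "\<forall>m\<ge>M. \<forall>n\<ge>M. knorm (X m - X n) < e / 2"
    using assms unfolding kcauchy_def by (meson half_gt_zero)
  have "norm (kembed (X n) - abs_completion X) < e" if "n \<ge> M" for n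
  proof -
    have "kcauchy (\<lambda>m. X n - X m)"
      using kcauchy_add[OF kcauchy_const[of "X n"] kcauchy_kcoef[OF assms, of "-1"]]
      by (simp add: kcoef_minus_one)
    then have "(\<lambda>m. knorm (X n - X m)) \<longlonglongrightarrow> norm (kembed (X n) - abs_completion X)"
      using norm_tendsto_completion[of "\<lambda>m. X n - X m"] assms
      by (simp add: kembed_def abs_completion_minus)
    moreover have "\<forall>m\<ge>M. knorm (X n - X m) \<le> e / 2" using M that by (meson less_imp_le)
    ultimately have "norm (kembed (X n) - abs_completion X) \<le> e / 2"
      by (intro LIMSEQ_le_const2) auto
    then show ?thesis using \<open>e > 0\<close> by simp
  qed
  then show "\<exists>no. \<forall>n\<ge>no. norm (kembed (X n) - abs_completion X) < e" by blast
qed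

instance completion :: (pos_def_kernel) chilbert_space
proof
  fix x :: "nat \<Rightarrow> 'a completion" assume C: "Cauchy x"
  have "\<exists>f. norm (kembed f - x n) < inverse (real (Suc n))" for n
  proof -
    obtain X where X: "kcauchy X" "x n = abs_completion X" by (rule completion_cases)
    then show ?thesis
      using LIMSEQ_D[OF kembed_tendsto[OF X(1)], of "inverse (real (Suc n))"] by auto
  qed
  then obtain f where f: "\<And>n. norm (kembed (f n) - x n) < inverse (real (Suc n))" by metis
  have lim0: "(\<lambda>n. kembed (f n) - x n) \<longlonglongrightarrow> 0"
    by (rule Lim_null_comparison[OF _ LIMSEQ_inverse_real_of_nat])
       (intro always_eventually allI less_imp_le f)
  have "Cauchy (\<lambda>n. kembed (f n))"
  proof (rule CauchyI)
    fix e :: real assume "e > 0"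
    then have e3: "e / 3 > 0" by simp
    obtain M where M: "\<And>n. n \<ge> M \<Longrightarrow> norm (kembed (f n) - x n) < e / 3"
      using LIMSEQ_D[OF lim0 e3] by auto
    obtain N where N: "\<And>m n. m \<ge> N \<Longrightarrow> n \<ge> N \<Longrightarrow> norm (x m - x n) < e / 3"
      using CauchyD[OF C e3] by blast
    have "norm (kembed (f m) - kembed (f n)) < e" if "m \<ge> max M N" "n \<ge> max M N" for m n
    proof -
      have "kembed (f m) - kembed (f n) =
          (kembed (f m) - x m) + (x m - x n) + (x n - kembed (f n))" by simp
      then have "norm (kembed (f m) - kembed (f n)) \<le>
          norm (kembed (f m) - x m) + norm (x m - x n) + norm (x n - kembed (f n))"
        by (metis (no_types) norm_triangle_ineq norm_triangle_le add_right_mono order_trans)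
      also have "norm (x n - kembed (f n)) = norm (kembed (f n) - x n)" by (rule norm_minus_commute)
      finally show ?thesis using M[of m] M[of n] N[of m n] that by simp
    qed
    then show "\<exists>M. \<forall>m\<ge>M. \<forall>n\<ge>M. norm (kembed (f m) - kembed (f n)) < e" by blast
  qed
  then have "kcauchy f"
    unfolding kcauchy_def using CauchyD norm_kembed_diff by metis
  then have "(\<lambda>n. kembed (f n) - (kembed (f n) - x n)) \<longlonglongrightarrow> abs_completion f - 0"
    by (intro tendsto_diff kembed_tendsto lim0)
  then show "convergent x" by (auto simp: convergent_def)
qed

definition kvec :: "'a::pos_def_kernel \<Rightarrow> 'a completion"
  where "kvec x = kembed (Poly_Mapping.single x 1)"

lemma cinner_kvec: "cinner (kvec x) (kvec y) = kern x y"
  by (simp add: kvec_def kembed_def cinner_completion.abs_eq krel_refl kinner_def limI)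

lemma psd_mult_gram:
  fixes u :: "'i \<Rightarrow> 'a::complex_inner" and K :: "'i \<Rightarrow> 'i \<Rightarrow> complex"
  assumes A: "finite A"
    and K: "\<And>c. 0 \<le> Re (\<Sum>x\<in>A. \<Sum>y\<in>A. cnj (c x) * c y * K x y)"
  shows "0 \<le> Re (\<Sum>x\<in>A. \<Sum>y\<in>A. cnj (c x) * c y * (cinner (u x) (u y) * K x y))"
proof (induction "card {x\<in>A. u x \<noteq> 0}" arbitrary: u rule: less_induct)
  case less
  show ?case
  proof (cases "\<forall>x\<in>A. u x = 0")
    case True
    then show ?thesis by (simp add: cinner_zero_left)
  next
    case False
    then obtain a where a: "a \<in> A" "u a \<noteq> 0" by blast
    define e where "e = (1 / norm (u a)) *\<^sub>R u a"
    define u' where "u' x = u x - cinner e (u x) *\<^sub>C e" for x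
    have ee: "cinner e e = 1"
    proof -
      have "norm e = 1" using a by (simp add: e_def)
      then have "Re (cinner e e) = 1" by (simp add: power2_norm_eq_cinner)
      moreover have "Im (cinner e e) = 0" using cinner_commute[of e e] by (simp add: complex_eq_iff)
      ultimately show ?thesis by (simp add: complex_eq_iff)
    qed
    have sub: "u x - z = u x + (- 1) *\<^sub>C z" for x z
      using scaleR_scaleC[of "-1" z] by simp
    have split: "cinner (u x) (u y) = cnj (cinner e (u x)) * cinner e (u y) + cinner (u' x) (u' y)" for x y
      using cinner_commute[of "u x" e]
      by (simp add: u'_def sub cinner_add_left cinner_add_right cinner_scaleC_left cinner_scaleC_right ee
          algebra_simps)
    have "u a = norm (u a) *\<^sub>R e" using a by (simp add: e_def)
    then have "u a = complex_of_real (norm (u a)) *\<^sub>C e" by (simp only: scaleR_scaleC)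
    then have ua: "u' a = 0"
      unfolding u'_def by (metis cinner_scaleC_right ee mult.right_neutral diff_self)
    have u0: "u' x = 0" if "u x = 0" for x
      using that by (simp add: u'_def cinner_zero_right scaleC_zero_left)
    have "card {x\<in>A. u' x \<noteq> 0} < card {x\<in>A. u x \<noteq> 0}"
      using A a ua u0 by (intro psubset_card_mono) auto
    then have 1: "0 \<le> Re (\<Sum>x\<in>A. \<Sum>y\<in>A. cnj (c x) * c y * (cinner (u' x) (u' y) * K x y))"
      by (rule less.hyps)
    have 2: "0 \<le> Re (\<Sum>x\<in>A. \<Sum>y\<in>A. cnj (c x * cinner e (u x)) * (c y * cinner e (u y)) * K x y)"
      by (rule K)
    have "(\<Sum>x\<in>A. \<Sum>y\<in>A. cnj (c x) * c y * (cinner (u x) (u y) * K x y)) =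
        (\<Sum>x\<in>A. \<Sum>y\<in>A. cnj (c x * cinner e (u x)) * (c y * cinner e (u y)) * K x y) +
        (\<Sum>x\<in>A. \<Sum>y\<in>A. cnj (c x) * c y * (cinner (u' x) (u' y) * K x y))"
      unfolding split by (simp add: algebra_simps sum.distrib)
    then show ?thesis using 1 2 by simp
  qed
qed

lemma psd_one:
  fixes c :: "'i \<Rightarrow> complex"
  shows "0 \<le> Re (\<Sum>x\<in>A. \<Sum>y\<in>A. cnj (c x) * c y * 1)"
proof -
  have "(\<Sum>x\<in>A. \<Sum>y\<in>A. cnj (c x) * c y * 1) = cnj (\<Sum>x\<in>A. c x) * (\<Sum>x\<in>A. c x)"
    by (simp add: sum_product)
  also have "Re \<dots> = (cmod (\<Sum>x\<in>A. c x))\<^sup>2"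
    by (metis complex_norm_square mult.commute Re_complex_of_real)
  finally show ?thesis by simp
qed

lemma psd_prod_gram:
  fixes u :: "nat \<Rightarrow> 'i \<Rightarrow> 'a::complex_inner"
  assumes A: "finite A"
  shows "0 \<le> Re (\<Sum>x\<in>A. \<Sum>y\<in>A. cnj (c x) * c y * (\<Prod>i<n. cinner (u i x) (u i y)))"
proof (induction n arbitrary: c)
  case 0
  then show ?case using psd_one[of c A] by simp
next
  case (Suc n)
  show ?case
    using psd_mult_gram[OF A Suc.IH, of c "u n"] by (simp add: mult_ac)
qed

text \<open>The kernel below is the inner product of elementary tensors in the algebraic tensor product.\<close>

datatype ('a, 'b) pure_tensor = Pure_Tensor 'a 'b

instantiation pure_tensor :: (complex_inner, complex_inner) pos_def_kernel
begin

primrec kern_pure_tensor :: "('a, 'b) pure_tensor \<Rightarrow> ('a, 'b) pure_tensor \<Rightarrow> complex" where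
  "kern_pure_tensor (Pure_Tensor u v) s =
     (case s of Pure_Tensor u' v' \<Rightarrow> cinner u u' * cinner v v')"

instance
proof
  fix x y :: "('a, 'b) pure_tensor"
  show "kern x y = cnj (kern y x)"
    by (cases x; cases y) (simp add: cinner_commute[symmetric])
next
  fix S :: "('a, 'b) pure_tensor set" and c :: "('a, 'b) pure_tensor \<Rightarrow> complex"
  assume S: "finite S"
  define p where "p = (\<lambda>t::('a, 'b) pure_tensor. case t of Pure_Tensor u v \<Rightarrow> u)"
  define q where "q = (\<lambda>t::('a, 'b) pure_tensor. case t of Pure_Tensor u v \<Rightarrow> v)"
  have k: "kern x y = cinner (p x) (p y) * cinner (q x) (q y)" for x y
    by (cases x; cases y) (simp add: p_def q_def)
  have "0 \<le> Re (\<Sum>x\<in>S. \<Sum>y\<in>S. cnj (c x) * c y * (cinner (q x) (q y) * 1))" for c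
    by (rule psd_mult_gram[OF S psd_one])
  then have "0 \<le> Re (\<Sum>x\<in>S. \<Sum>y\<in>S. cnj (c x) * c y * (cinner (p x) (p y) * cinner (q x) (q y)))"
    by (intro psd_mult_gram[OF S]) simp
  then show "0 \<le> Re (\<Sum>x\<in>S. \<Sum>y\<in>S. cnj (c x) * c y * kern x y)" by (simp add: k)
qed

end

type_synonym ('a, 'b) tensor = "('a, 'b) pure_tensor completion"

definition tensor :: "'a::complex_inner \<Rightarrow> 'b::complex_inner \<Rightarrow> ('a, 'b) tensor"  (infixr \<open>\<otimes>\<^sub>H\<close> 70)
  where "u \<otimes>\<^sub>H v = kvec (Pure_Tensor u v)"

lemma cinner_tensor: "cinner (u \<otimes>\<^sub>H v) (u' \<otimes>\<^sub>H v') = cinner u u' * cinner v v'"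
  by (simp add: tensor_def cinner_kvec)

text \<open>\<open>Sym_Word [x\<^sub>1, \<dots>, x\<^sub>n]\<close> stands for \<open>P (x\<^sub>1 \<otimes> \<dots> \<otimes> x\<^sub>n)\<close>, where \<open>P\<close> is the symmetrising projection of the
  n-fold tensor power: \<open>sym_inner\<close> is the inner product of two such vectors (words of different
  lengths lie in different summands). Hence \<open>'a fock\<close> is the direct sum of the symmetric tensor powers,
  \<open>Sym_Word (replicate n x)\<close> is the n-th tensor power of \<open>x\<close>, and \<open>exp_vector\<close> below is the vector with
  components \<open>x\<^sup>\<otimes>\<^sup>n / sqrt (n!)\<close>.\<close>

datatype 'a sym_word = Sym_Word "'a list"

definition sym_inner :: "'a::pos_def_kernel list \<Rightarrow> 'a list \<Rightarrow> complex" where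
  "sym_inner xs ys = (if length xs = length ys
     then (\<Sum>\<sigma> | \<sigma> permutes {..<length xs}. \<Prod>i<length xs. kern (xs ! i) (ys ! \<sigma> i)) / fact (length xs)
     else 0)"

lemma sym_inner_commute: "sym_inner xs ys = cnj (sym_inner ys xs)"
proof (cases "length xs = length ys")
  case True
  define n where "n = length xs"
  have "(\<Sum>\<sigma> | \<sigma> permutes {..<n}. \<Prod>i<n. kern (xs ! i) (ys ! \<sigma> i)) =
      (\<Sum>\<sigma> | \<sigma> permutes {..<n}. \<Prod>i<n. kern (xs ! i) (ys ! inv_into UNIV \<sigma> i))"
    by (rule sum_permutations_inverse)
  also have "\<dots> = (\<Sum>\<sigma> | \<sigma> permutes {..<n}. \<Prod>i<n. kern (xs ! \<sigma> i) (ys ! i))"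
  proof (rule sum.cong[OF refl])
    fix \<sigma> assume "\<sigma> \<in> {\<sigma>. \<sigma> permutes {..<n}}"
    then have s: "\<sigma> permutes {..<n}" by simp
    show "(\<Prod>i<n. kern (xs ! i) (ys ! inv_into UNIV \<sigma> i)) = (\<Prod>i<n. kern (xs ! \<sigma> i) (ys ! i))"
      using prod.permute[OF s, of "\<lambda>i. kern (xs ! i) (ys ! inv_into UNIV \<sigma> i)"] permutes_inverses[OF s]
      by simp
  qed
  finally show ?thesis
    using True by (simp add: sym_inner_def n_def kern_commute[symmetric])
next
  case False then show ?thesis by (simp add: sym_inner_def)
qed

lemma sym_inner_symmetrised:
  assumes "length xs = n" "length ys = n"
  shows "sym_inner xs ys = (\<Sum>\<tau> | \<tau> permutes {..<n}. \<Sum>\<sigma> | \<sigma> permutes {..<n}.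
    \<Prod>i<n. kern (xs ! \<tau> i) (ys ! \<sigma> i)) / (fact n)\<^sup>2"
proof -
  have "(\<Sum>\<sigma> | \<sigma> permutes {..<n}. \<Prod>i<n. kern (xs ! \<tau> i) (ys ! \<sigma> i)) =
      (\<Sum>\<sigma> | \<sigma> permutes {..<n}. \<Prod>i<n. kern (xs ! i) (ys ! \<sigma> i))" if t: "\<tau> permutes {..<n}" for \<tau>
  proof -
    have "(\<Prod>i<n. kern (xs ! i) (ys ! \<sigma> i)) = (\<Prod>i<n. kern (xs ! \<tau> i) (ys ! (\<sigma> \<circ> \<tau>) i))" for \<sigma>
      using prod.permute[OF t, of "\<lambda>i. kern (xs ! i) (ys ! \<sigma> i)"] by (simp add: o_def)
    then show ?thesis
      using sum_permutations_compose_right[OF t, of "\<lambda>\<sigma>. \<Prod>i<n. kern (xs ! \<tau> i) (ys ! \<sigma> i)"] by simp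
  qed
  moreover have "card {\<tau>. \<tau> permutes {..<n}} = fact n" by (simp add: card_permutations)
  ultimately show ?thesis
    using assms by (simp add: sym_inner_def power2_eq_square)
qed

lemma sym_inner_pos_length:
  assumes S: "finite S" "\<And>xs. xs \<in> S \<Longrightarrow> length xs = n"
  shows "0 \<le> Re (\<Sum>xs\<in>S. \<Sum>ys\<in>S. cnj (c xs) * c ys * sym_inner xs ys)"
proof -
  let ?P = "{\<tau>. \<tau> permutes {..<n}}"
  have P: "finite ?P" by (simp add: finite_permutations)
  define G where "G = (\<Sum>x\<in>S \<times> ?P. \<Sum>y\<in>S \<times> ?P. cnj (c (fst x)) * c (fst y) *
      (\<Prod>i<n. cinner (kvec (fst x ! snd x i)) (kvec (fst y ! snd y i))))"
  have "0 \<le> Re G"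
    unfolding G_def by (rule psd_prod_gram) (use S P in simp)
  have "(\<Sum>xs\<in>S. \<Sum>ys\<in>S. cnj (c xs) * c ys * sym_inner xs ys) =
     (\<Sum>xs\<in>S. \<Sum>ys\<in>S. \<Sum>\<tau>\<in>?P. \<Sum>\<sigma>\<in>?P. cnj (c xs) * c ys *
        (\<Prod>i<n. kern (xs ! \<tau> i) (ys ! \<sigma> i))) / (fact n)\<^sup>2"
    by (simp add: sum_divide_distrib sum_distrib_left sym_inner_symmetrised[OF S(2) S(2)] cong: sum.cong)
  also have "(\<Sum>xs\<in>S. \<Sum>ys\<in>S. \<Sum>\<tau>\<in>?P. \<Sum>\<sigma>\<in>?P. cnj (c xs) * c ys *
        (\<Prod>i<n. kern (xs ! \<tau> i) (ys ! \<sigma> i))) = G"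
    unfolding G_def cinner_kvec
    by (subst sum.swap[of _ ?P S])
       (simp add: sum.cartesian_product' sum.swap[of _ ?P S])
  also have "Re (G / (fact n)\<^sup>2) = Re G / (fact n)\<^sup>2"
    using Re_divide_of_real[of G "(fact n)\<^sup>2"] by simp
  finally show ?thesis using \<open>0 \<le> Re G\<close> by simp
qed

instantiation sym_word :: (pos_def_kernel) pos_def_kernel
begin

primrec kern_sym_word :: "'a sym_word \<Rightarrow> 'a sym_word \<Rightarrow> complex" where
  "kern_sym_word (Sym_Word xs) s = (case s of Sym_Word ys \<Rightarrow> sym_inner xs ys)"

instance
proof
  fix x y :: "'a sym_word"
  show "kern x y = cnj (kern y x)"
    by (cases x; cases y) (simp add: sym_inner_commute[symmetric])
next
  fix S :: "'a sym_word set" and c :: "'a sym_word \<Rightarrow> complex"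
  assume S: "finite S"
  define W where "W = {xs. Sym_Word xs \<in> S}"
  have SW: "S = Sym_Word ` W" and inj: "inj_on Sym_Word W"
    unfolding W_def by (auto simp: inj_on_def image_iff) (metis sym_word.exhaust)
  have W: "finite W" using S inj unfolding SW by (rule finite_imageD)
  define d where "d xs = c (Sym_Word xs)" for xs
  have "(\<Sum>x\<in>S. \<Sum>y\<in>S. cnj (c x) * c y * kern x y) =
      (\<Sum>xs\<in>W. \<Sum>ys\<in>W. cnj (d xs) * d ys * sym_inner xs ys)"
    unfolding SW d_def using inj by (simp add: sum.reindex)
  also have "\<dots> = (\<Sum>n\<in>length ` W. \<Sum>xs | xs \<in> W \<and> length xs = n.
      \<Sum>ys\<in>W. cnj (d xs) * d ys * sym_inner xs ys)"
    by (rule sum.group[symmetric]) (use W in auto)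
  also have "\<dots> = (\<Sum>n\<in>length ` W. \<Sum>xs | xs \<in> W \<and> length xs = n.
      \<Sum>ys | ys \<in> W \<and> length ys = n. cnj (d xs) * d ys * sym_inner xs ys)"
    using W by (intro sum.cong refl sum.mono_neutral_right) (auto simp: sym_inner_def)
  finally have eq: "(\<Sum>x\<in>S. \<Sum>y\<in>S. cnj (c x) * c y * kern x y) = \<dots>" .
  show "0 \<le> Re (\<Sum>x\<in>S. \<Sum>y\<in>S. cnj (c x) * c y * kern x y)"
    unfolding eq Re_sum[of _ "length ` W"]
    by (rule sum_nonneg, rule sym_inner_pos_length) (use W in auto)
qed

end

type_synonym 'a fock = "'a sym_word completion"

lemma cinner_Cauchy_Schwarz: "cmod (cinner x y) \<le> norm x * norm (y :: 'a::complex_inner)"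
proof (cases "y = 0")
  case True then show ?thesis by (simp add: cinner_zero_right)
next
  case False
  then have ny: "(norm y)\<^sup>2 > 0" by simp
  define a where "a = - (cinner y x / of_real ((norm y)\<^sup>2))"
  have real: "cinner z z = of_real ((norm z)\<^sup>2)" for z :: 'a
    using cinner_commute[of z z] by (simp add: complex_eq_iff power2_norm_eq_cinner)
  have "0 \<le> Re (cinner (x + a *\<^sub>C y) (x + a *\<^sub>C y))" by (rule cinner_self_nonneg)
  also have "cinner (x + a *\<^sub>C y) (x + a *\<^sub>C y) =
      cinner x x + a * cinner x y + cnj a * cinner y x + cnj a * a * cinner y y"
    by (simp add: cinner_add_left cinner_add_right cinner_scaleC_left cinner_scaleC_right algebra_simps)
  also have "cinner x y = cnj (cinner y x)" by (rule cinner_commute)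
  also have "cinner x x + a * cnj (cinner y x) + cnj a * cinner y x + cnj a * a * cinner y y =
      of_real ((norm x)\<^sup>2) - cinner y x * cnj (cinner y x) / of_real ((norm y)\<^sup>2)"
    using ny unfolding a_def real by (simp add: field_simps power2_eq_square)
  also have "\<dots> = of_real ((norm x)\<^sup>2 - (cmod (cinner y x))\<^sup>2 / (norm y)\<^sup>2)"
    by (simp add: complex_norm_square[symmetric])
  finally have "(cmod (cinner y x))\<^sup>2 / (norm y)\<^sup>2 \<le> (norm x)\<^sup>2" by simp
  then have "(cmod (cinner y x))\<^sup>2 \<le> (norm x * norm y)\<^sup>2"
    using ny by (simp add: field_simps)
  then have "cmod (cinner y x) \<le> norm x * norm y" by (rule power2_le_imp_le) simp
  then show ?thesis by (subst cinner_commute) simp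
qed

lemma tendsto_cinner:
  fixes f g :: "nat \<Rightarrow> 'a::complex_inner"
  assumes f: "f \<longlonglongrightarrow> x" and g: "g \<longlonglongrightarrow> y"
  shows "(\<lambda>n. cinner (f n) (g n)) \<longlonglongrightarrow> cinner x y"
proof (rule LIM_zero_cancel, rule Lim_null_comparison)
  have sub: "u - z = u + (- 1) *\<^sub>C z" for u z :: 'a
    using scaleR_scaleC[of "-1" z] by simp
  show "\<forall>\<^sub>F n in sequentially. norm (cinner (f n) (g n) - cinner x y) \<le>
      norm (f n - x) * norm (g n) + norm x * norm (g n - y)"
  proof (intro always_eventually allI)
    fix n
    have "cinner (f n) (g n) - cinner x y = cinner (f n - x) (g n) + cinner x (g n - y)"
      by (simp add: sub cinner_add_left cinner_add_right cinner_scaleC_left cinner_scaleC_right)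
    then show "norm (cinner (f n) (g n) - cinner x y) \<le>
      norm (f n - x) * norm (g n) + norm x * norm (g n - y)"
      by (metis (no_types, lifting) add_mono cinner_Cauchy_Schwarz norm_triangle_le)
  qed
  have "(\<lambda>n. norm (f n - x) * norm (g n) + norm x * norm (g n - y)) \<longlonglongrightarrow> 0 * norm y + norm x * 0"
    using f g by (intro tendsto_intros) (auto intro: tendsto_norm_zero LIM_zero)
  then show "(\<lambda>n. norm (f n - x) * norm (g n) + norm x * norm (g n - y)) \<longlonglongrightarrow> 0" by simp
qed

definition strongly_measurable :: "'a measure \<Rightarrow> ('a \<Rightarrow> 'b::topological_space) \<Rightarrow> bool"
  where "strongly_measurable M f \<longleftrightarrow>
    (\<exists>s. (\<forall>n. simple_function M (s n)) \<and> (AE x in M. (\<lambda>n. s n x) \<longlonglongrightarrow> f x))"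

abbreviation half_line :: "real measure"
  where "half_line \<equiv> lebesgue_on {0..}"

lemma strongly_measurable_cinner:
  fixes f g :: "real \<Rightarrow> 'k::complex_inner"
  assumes "strongly_measurable half_line f" "strongly_measurable half_line g"
  shows "(\<lambda>t. cinner (f t) (g t)) \<in> borel_measurable half_line"
proof -
  obtain r where r: "\<And>n. simple_function half_line (r n)" "AE t in half_line. (\<lambda>n. r n t) \<longlonglongrightarrow> f t"
    using assms(1) unfolding strongly_measurable_def by blast
  obtain s where s: "\<And>n. simple_function half_line (s n)" "AE t in half_line. (\<lambda>n. s n t) \<longlonglongrightarrow> g t"
    using assms(2) unfolding strongly_measurable_def by blast
  have S: "{0::real..} \<in> sets lebesgue" by simp
  define h where "h n t = (if t \<in> {0..} then cinner (r n t) (s n t) else 0)" for n t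
  define H where "H t = (if t \<in> {0..} then cinner (f t) (g t) else 0)" for t
  have hm: "h n \<in> borel_measurable lebesgue" for n
  proof -
    have "simple_function half_line (\<lambda>t. cinner (r n t) (s n t))"
      using simple_function_compose2[OF r(1) s(1), of cinner] .
    then have "(\<lambda>t. cinner (r n t) (s n t)) \<in> borel_measurable half_line"
      by (rule borel_measurable_simple_function)
    then show ?thesis unfolding h_def by (rule borel_measurable_if_I[OF _ S])
  qed
  have "AE t in half_line. (\<lambda>n. r n t) \<longlonglongrightarrow> f t \<and> (\<lambda>n. s n t) \<longlonglongrightarrow> g t"
    using r(2) s(2) by eventually_elim simp
  then have "AE t in lebesgue. t \<in> {0..} \<longrightarrow> (\<lambda>n. r n t) \<longlonglongrightarrow> f t \<and> (\<lambda>n. s n t) \<longlonglongrightarrow> g t"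
    by (rule AE_restrict_space_iff[THEN iffD1, rotated]) simp
  then have "AE t in lebesgue. lim (\<lambda>n. h n t) = H t"
  proof (rule AE_mp, intro AE_I2 impI)
    fix t :: real
    assume t: "t \<in> {0..} \<longrightarrow> (\<lambda>n. r n t) \<longlonglongrightarrow> f t \<and> (\<lambda>n. s n t) \<longlonglongrightarrow> g t"
    show "lim (\<lambda>n. h n t) = H t"
      using t tendsto_cinner by (cases "t \<in> {0..}") (auto simp: h_def H_def intro!: limI)
  qed
  moreover have "(\<lambda>t. lim (\<lambda>n. h n t)) \<in> borel_measurable lebesgue"
    using hm by (intro borel_measurable_lim_metric) auto
  ultimately have "H \<in> borel_measurable lebesgue" using borel_measurable_AE by blast
  then show ?thesis unfolding H_def by (rule borel_measurable_if_D)
qed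

text \<open>Square-integrable functions on the half line, not classes modulo null sets: replacing a letter
  by an almost everywhere equal one changes a word by a vector of norm zero, so
  \<open>'k l2fun fock\<close> is the Boson Fock space over the Hilbert space of classes. Values at negative
  arguments are irrelevant. Measurability is Bochner measurability because \<open>'k\<close> may be
  non-separable.\<close>

typedef (overloaded) 'k l2fun = "{f :: real \<Rightarrow> 'k::complex_inner.
    strongly_measurable half_line f \<and> integrable half_line (\<lambda>t. (norm (f t))\<^sup>2)}"
proof (rule exI[of _ "\<lambda>_. 0"])
  have "strongly_measurable half_line (\<lambda>_. 0 :: 'k)"
    unfolding strongly_measurable_def by (rule exI[of _ "\<lambda>_ _. 0"]) auto
  then show "(\<lambda>_. 0) \<in> {f :: real \<Rightarrow> 'k::complex_inner.
    strongly_measurable half_line f \<and> integrable half_line (\<lambda>t. (norm (f t))\<^sup>2)}" by simp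
qed

lemma l2fun_integrable:
  "integrable half_line (\<lambda>t. cinner (Rep_l2fun f t) (Rep_l2fun g t))"
proof (rule Bochner_Integration.integrable_bound)
  show "integrable half_line (\<lambda>t. (norm (Rep_l2fun f t))\<^sup>2 + (norm (Rep_l2fun g t))\<^sup>2)"
    using Rep_l2fun[of f] Rep_l2fun[of g] by simp
  show "(\<lambda>t. cinner (Rep_l2fun f t) (Rep_l2fun g t)) \<in> borel_measurable half_line"
    using Rep_l2fun[of f] Rep_l2fun[of g] strongly_measurable_cinner by blast
  show "AE t in half_line. norm (cinner (Rep_l2fun f t) (Rep_l2fun g t)) \<le>
      norm ((norm (Rep_l2fun f t))\<^sup>2 + (norm (Rep_l2fun g t))\<^sup>2)"
  proof (intro AE_I2)
    fix t
    have "norm (cinner (Rep_l2fun f t) (Rep_l2fun g t)) \<le> norm (Rep_l2fun f t) * norm (Rep_l2fun g t)"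
      by (rule cinner_Cauchy_Schwarz)
    also have "\<dots> \<le> (norm (Rep_l2fun f t))\<^sup>2 + (norm (Rep_l2fun g t))\<^sup>2"
      using sum_squares_bound[of "norm (Rep_l2fun f t)" "norm (Rep_l2fun g t)"]
        mult_nonneg_nonneg[OF norm_ge_zero[of "Rep_l2fun f t"] norm_ge_zero[of "Rep_l2fun g t"]]
      by linarith
    finally show "norm (cinner (Rep_l2fun f t) (Rep_l2fun g t)) \<le>
      norm ((norm (Rep_l2fun f t))\<^sup>2 + (norm (Rep_l2fun g t))\<^sup>2)" by simp
  qed
qed

instantiation l2fun :: (complex_inner) pos_def_kernel
begin

definition kern_l2fun :: "'a l2fun \<Rightarrow> 'a l2fun \<Rightarrow> complex"
  where "kern_l2fun f g = (\<integral>t. cinner (Rep_l2fun f t) (Rep_l2fun g t) \<partial>half_line)"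

instance
proof
  fix f g :: "'a l2fun"
  show "kern f g = cnj (kern g f)"
    unfolding kern_l2fun_def
    by (simp add: Bochner_Integration.integral_cnj[symmetric] cinner_commute[symmetric]
        del: Bochner_Integration.integral_cnj)
next
  fix S :: "'a l2fun set" and c :: "'a l2fun \<Rightarrow> complex"
  assume "finite S"
  have "(\<Sum>f\<in>S. \<Sum>g\<in>S. cnj (c f) * c g * kern f g) =
      (\<integral>t. (\<Sum>f\<in>S. \<Sum>g\<in>S. cnj (c f) * c g * cinner (Rep_l2fun f t) (Rep_l2fun g t)) \<partial>half_line)"
    unfolding kern_l2fun_def
    by (simp add: Bochner_Integration.integral_sum l2fun_integrable)
  also have "\<dots> = (\<integral>t. of_real ((norm (\<Sum>f\<in>S. c f *\<^sub>C Rep_l2fun f t))\<^sup>2) \<partial>half_line)"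
  proof (rule Bochner_Integration.integral_cong[OF refl])
    fix t
    let ?v = "\<Sum>f\<in>S. c f *\<^sub>C Rep_l2fun f t"
    have "(\<Sum>f\<in>S. \<Sum>g\<in>S. cnj (c f) * c g * cinner (Rep_l2fun f t) (Rep_l2fun g t)) = cinner ?v ?v"
      by (simp add: cinner_sum_left cinner_sum_right cinner_scaleC_left cinner_scaleC_right
          sum_distrib_left mult_ac) (rule sum.swap)
    also have "\<dots> = of_real ((norm ?v)\<^sup>2)"
      using cinner_commute[of ?v ?v] by (simp add: complex_eq_iff power2_norm_eq_cinner)
    finally show "(\<Sum>f\<in>S. \<Sum>g\<in>S. cnj (c f) * c g * cinner (Rep_l2fun f t) (Rep_l2fun g t)) =
        of_real ((norm ?v)\<^sup>2)" .
  qed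
  also have "\<dots> = of_real (\<integral>t. (norm (\<Sum>f\<in>S. c f *\<^sub>C Rep_l2fun f t))\<^sup>2 \<partial>half_line)"
    by (rule integral_complex_of_real)
  finally show "0 \<le> Re (\<Sum>f\<in>S. \<Sum>g\<in>S. cnj (c f) * c g * kern f g)" by simp
qed

end

definition exp_vector :: "'a::pos_def_kernel \<Rightarrow> 'a fock"
  where "exp_vector x = suminf (\<lambda>n. (1 / sqrt (fact n)) *\<^sub>R kvec (Sym_Word (replicate n x)))"

lemma sym_inner_replicate:
  "sym_inner (replicate m x) (replicate n y) = (if m = n then kern x y ^ n else 0)"
proof -
  have "(\<Prod>i<n. kern (replicate n x ! i) (replicate n y ! \<sigma> i)) = kern x y ^ n"
    if "\<sigma> permutes {..<n}" for \<sigma>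
    using permutes_in_image[OF that] by simp
  moreover have "card {\<sigma>. \<sigma> permutes {..<n}} = fact n" by (simp add: card_permutations)
  ultimately show ?thesis by (simp add: sym_inner_def)
qed

lemma norm_kvec_replicate:
  "(norm (kvec (Sym_Word (replicate n x))))\<^sup>2 = (Re (kern x x)) ^ n"
proof -
  have r: "kern x x = of_real (Re (kern x x))"
    using kern_commute[of x x] by (simp add: complex_eq_iff)
  have "cinner (kvec (Sym_Word (replicate n x))) (kvec (Sym_Word (replicate n x))) = kern x x ^ n"
    by (simp add: cinner_kvec sym_inner_replicate)
  also have "\<dots> = of_real (Re (kern x x) ^ n)"
    by (subst r) simp
  finally show ?thesis by (simp add: power2_norm_eq_cinner[symmetric])
qed

lemma exp_vector_sums:
  "(\<lambda>n. (1 / sqrt (fact n)) *\<^sub>R kvec (Sym_Word (replicate n x))) sums exp_vector x"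
  unfolding exp_vector_def
proof (rule summable_sums, rule summable_norm_cancel, rule summable_comparison_test)
  define r where "r = Re (kern x x)"
  have "0 \<le> (norm (kvec (Sym_Word (replicate 1 x))))\<^sup>2" by simp
  then have r0: "0 \<le> r" unfolding norm_kvec_replicate r_def by simp
  have "norm (norm ((1 / sqrt (fact n)) *\<^sub>R kvec (Sym_Word (replicate n x)))) \<le>
      (2 * r) ^ n / fact n + (1 / 2) ^ n" for n
  proof -
    let ?a = "norm (kvec (Sym_Word (replicate n x)))"
    have a2: "?a\<^sup>2 = r ^ n" by (simp add: norm_kvec_replicate r_def)
    have "(?a / sqrt (fact n))\<^sup>2 = (2 * r) ^ n / fact n * (1 / 2) ^ n"
      by (simp add: power_divide a2 power_mult_distrib)
    also have "\<dots> \<le> ((2 * r) ^ n / fact n + (1 / 2) ^ n)\<^sup>2"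
    proof -
      have "u * v \<le> (u + v)\<^sup>2" if "0 \<le> u" "0 \<le> v" for u v :: real
        using that by (simp add: power2_sum)
      note uv = this
      show ?thesis by (rule uv) (use r0 in simp_all)
    qed
    finally have "?a / sqrt (fact n) \<le> (2 * r) ^ n / fact n + (1 / 2) ^ n"
      by (rule power2_le_imp_le) (use r0 in simp)
    then show ?thesis by simp
  qed
  then show "\<exists>N. \<forall>n\<ge>N. norm (norm ((1 / sqrt (fact n)) *\<^sub>R kvec (Sym_Word (replicate n x)))) \<le>
      (2 * r) ^ n / fact n + (1 / 2) ^ n" by blast
  show "summable (\<lambda>n. (2 * r) ^ n / fact n + (1 / 2) ^ n)"
    using summable_exp[of "2 * r"]
    by (intro summable_add summable_geometric) (simp_all add: field_simps)
qed

lemma cinner_exp_vector: "cinner (exp_vector x) (exp_vector y) = exp (kern x y)"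
proof (rule LIMSEQ_unique)
  define X where "X x n = (1 / sqrt (fact n)) *\<^sub>R kvec (Sym_Word (replicate n x))" for x :: 'a and n
  have XY: "cinner (X x m) (X y n) = (if m = n then kern x y ^ n /\<^sub>R fact n else 0)" for m n
  proof -
    have s: "complex_of_real (1 / sqrt (fact n)) * complex_of_real (1 / sqrt (fact n)) =
        complex_of_real (inverse (fact n))"
      unfolding of_real_mult[symmetric] by (simp add: inverse_eq_divide)
    have "cinner (X x m) (X y n) = complex_of_real (1 / sqrt (fact m)) *
        (complex_of_real (1 / sqrt (fact n)) * sym_inner (replicate m x) (replicate n y))"
      unfolding X_def scaleR_scaleC cinner_scaleC_left cinner_scaleC_right cinner_kvec
      by (simp del: of_real_divide)
    also have "\<dots> = (if m = n then kern x y ^ n /\<^sub>R fact n else 0)"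
      unfolding sym_inner_replicate scaleR_conv_of_real s[symmetric] by simp
    finally show ?thesis .
  qed
  show "(\<lambda>N. cinner (\<Sum>n<N. X x n) (\<Sum>n<N. X y n)) \<longlonglongrightarrow> cinner (exp_vector x) (exp_vector y)"
    using exp_vector_sums unfolding sums_def X_def by (intro tendsto_cinner)
  have "(\<Sum>n<N. \<Sum>m<N. cinner (X x m) (X y n)) = (\<Sum>n<N. kern x y ^ n /\<^sub>R fact n)" for N
    unfolding XY by (intro sum.cong refl) (simp add: sum.delta)
  then show "(\<lambda>N. cinner (\<Sum>n<N. X x n) (\<Sum>n<N. X y n)) \<longlonglongrightarrow> exp (kern x y)"
    using exp_converges[of "kern x y"] unfolding sums_def
    by (simp add: cinner_sum_left cinner_sum_right)
qed

global_interpretation complex_vector: vector_space "scaleC :: complex \<Rightarrow> 'a \<Rightarrow> 'a::complex_inner"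
  by standard (simp_all add: scaleC_add_right scaleC_add_left scaleC_scaleC scaleC_one)

abbreviation cspan :: "'a::complex_inner set \<Rightarrow> 'a set"
  where "cspan \<equiv> module.span scaleC"

text \<open>A type cannot depend on the set \<open>J\<close>, so $\ell^2(J)$ with its standard basis is represented by an
  arbitrary Hilbert space with an orthonormal basis indexed by \<open>J\<close>, to which it is unitarily
  equivalent; \<open>J\<close> may be empty, the Hilbert space then being 0.\<close>

definition orthonormal_basis :: "'i set \<Rightarrow> ('i \<Rightarrow> 'k::chilbert_space) \<Rightarrow> bool"
  where "orthonormal_basis J e \<longleftrightarrow>
    (\<forall>i\<in>J. \<forall>j\<in>J. cinner (e i) (e j) = (if i = j then 1 else 0)) \<and>
    closure (cspan (e ` J)) = UNIV"

definition bounded_clinear :: "('a::complex_inner \<Rightarrow> 'b::complex_inner) \<Rightarrow> bool"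
  where "bounded_clinear T \<longleftrightarrow> bounded_linear T \<and> (\<forall>c x. T (c *\<^sub>C x) = c *\<^sub>C T x)"

text \<open>The descriptions in \<open>cadjoint\<close> and \<open>tensor_op\<close> are proper for bounded operators.\<close>

definition cadjoint :: "('a::chilbert_space \<Rightarrow> 'b::chilbert_space) \<Rightarrow> 'b \<Rightarrow> 'a"
  where "cadjoint T = (THE S. \<forall>x y. cinner (T x) y = cinner x (S y))"

definition tensor_op :: "('a::chilbert_space \<Rightarrow> 'c::chilbert_space) \<Rightarrow> ('b::chilbert_space \<Rightarrow> 'd::chilbert_space)
    \<Rightarrow> ('a, 'b) tensor \<Rightarrow> ('c, 'd) tensor"  (infixr \<open>\<otimes>\<^sub>o\<close> 70)
  where "S \<otimes>\<^sub>o T = (THE R. bounded_clinear R \<and> (\<forall>u v. R (u \<otimes>\<^sub>H v) = S u \<otimes>\<^sub>H T v))"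

definition Eket :: "'b::chilbert_space \<Rightarrow> 'a::chilbert_space \<Rightarrow> ('a, 'b) tensor"
  where "Eket z = (\<lambda>u. u \<otimes>\<^sub>H z)"

definition Ebra :: "'b::chilbert_space \<Rightarrow> ('a::chilbert_space, 'b) tensor \<Rightarrow> 'a"
  where "Ebra z = cadjoint (Eket z)"

text \<open>Abstract unital C*-algebras, over the rings and modules of \<open>HOL-Algebra\<close>.\<close>

record 'a cstar = "(complex, 'a) module" +
  cs_star :: "'a \<Rightarrow> 'a"
  cs_norm :: "'a \<Rightarrow> real"

definition complex_ring :: "complex ring"
  where "complex_ring = \<lparr>carrier = UNIV, mult = (*), one = 1, zero = 0, add = (+)\<rparr>"

definition cstar_algebra :: "'a cstar \<Rightarrow> bool"
  where "cstar_algebra B \<longleftrightarrow>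
    ring B \<and> module complex_ring B \<and>
    (\<forall>c. \<forall>x\<in>carrier B. \<forall>y\<in>carrier B.
       (c \<odot>\<^bsub>B\<^esub> x) \<otimes>\<^bsub>B\<^esub> y = c \<odot>\<^bsub>B\<^esub> (x \<otimes>\<^bsub>B\<^esub> y) \<and>
       x \<otimes>\<^bsub>B\<^esub> (c \<odot>\<^bsub>B\<^esub> y) = c \<odot>\<^bsub>B\<^esub> (x \<otimes>\<^bsub>B\<^esub> y)) \<and>
    (\<forall>c. \<forall>x\<in>carrier B. \<forall>y\<in>carrier B.
       cs_star B x \<in> carrier B \<and>
       cs_star B (cs_star B x) = x \<and>
       cs_star B (x \<oplus>\<^bsub>B\<^esub> y) = cs_star B x \<oplus>\<^bsub>B\<^esub> cs_star B y \<and>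
       cs_star B (c \<odot>\<^bsub>B\<^esub> x) = cnj c \<odot>\<^bsub>B\<^esub> cs_star B x \<and>
       cs_star B (x \<otimes>\<^bsub>B\<^esub> y) = cs_star B y \<otimes>\<^bsub>B\<^esub> cs_star B x) \<and>
    (\<forall>c. \<forall>x\<in>carrier B. \<forall>y\<in>carrier B.
       0 \<le> cs_norm B x \<and>
       (cs_norm B x = 0 \<longleftrightarrow> x = \<zero>\<^bsub>B\<^esub>) \<and>
       cs_norm B (x \<oplus>\<^bsub>B\<^esub> y) \<le> cs_norm B x + cs_norm B y \<and>
       cs_norm B (c \<odot>\<^bsub>B\<^esub> x) = cmod c * cs_norm B x \<and>
       cs_norm B (x \<otimes>\<^bsub>B\<^esub> y) \<le> cs_norm B x * cs_norm B y \<and>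
       cs_norm B (cs_star B x \<otimes>\<^bsub>B\<^esub> x) = (cs_norm B x)\<^sup>2) \<and>
    (\<forall>s. (\<forall>n. s n \<in> carrier B) \<and>
       (\<forall>\<epsilon>>0. \<exists>N::nat. \<forall>m\<ge>N. \<forall>n\<ge>N. cs_norm B (s m \<ominus>\<^bsub>B\<^esub> s n) < \<epsilon>) \<longrightarrow>
       (\<exists>x\<in>carrier B. (\<lambda>n. cs_norm B (s n \<ominus>\<^bsub>B\<^esub> x)) \<longlonglongrightarrow> 0))"

definition star_hom :: "'a cstar \<Rightarrow> 'b cstar \<Rightarrow> ('a \<Rightarrow> 'b) \<Rightarrow> bool"
  where "star_hom A B \<rho> \<longleftrightarrow> \<rho> \<in> ring_hom A B \<and>
    (\<forall>x\<in>carrier A. \<rho> (cs_star A x) = cs_star B (\<rho> x) \<and>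
      (\<forall>c. \<rho> (c \<odot>\<^bsub>A\<^esub> x) = c \<odot>\<^bsub>B\<^esub> \<rho> x))"

text \<open>A set of operators containing the identity with the operations and norm of $B(h)$. Completeness
  makes a \<open>concrete_cstar_algebra\<close> norm closed; its unit is the identity operator.\<close>

definition operator_algebra :: "('h::chilbert_space \<Rightarrow> 'h) set \<Rightarrow> ('h \<Rightarrow> 'h) cstar"
  where "operator_algebra A =
    \<lparr>carrier = A, mult = (\<circ>), one = id, zero = (\<lambda>_. 0), add = (\<lambda>S T u. S u + T u),
     smult = (\<lambda>c T u. c *\<^sub>C T u), cs_star = cadjoint, cs_norm = onorm\<rparr>"

definition concrete_cstar_algebra :: "('h::chilbert_space \<Rightarrow> 'h) set \<Rightarrow> bool"
  where "concrete_cstar_algebra A \<longleftrightarrow>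
    A \<subseteq> Collect bounded_clinear \<and> cstar_algebra (operator_algebra A)"

datatype 'i letter = Gen 'i | Gen_Star 'i

type_synonym 'i nc_poly = "'i letter list \<Rightarrow>\<^sub>0 complex"

definition words :: "'i set \<Rightarrow> 'i letter list set"
  where "words I = lists (Gen ` I \<union> Gen_Star ` I)"

definition nc_polys :: "'i set \<Rightarrow> 'i nc_poly set"
  where "nc_polys I = {q. Poly_Mapping.keys q \<subseteq> words I}"

primrec letter_val :: "'a cstar \<Rightarrow> ('i \<Rightarrow> 'a) \<Rightarrow> 'i letter \<Rightarrow> 'a" where
  "letter_val B b (Gen i) = b i"
| "letter_val B b (Gen_Star i) = cs_star B (b i)"

definition word_val :: "'a cstar \<Rightarrow> ('i \<Rightarrow> 'a) \<Rightarrow> 'i letter list \<Rightarrow> 'a"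
  where "word_val B b w = foldr (\<lambda>l x. letter_val B b l \<otimes>\<^bsub>B\<^esub> x) w \<one>\<^bsub>B\<^esub>"

definition poly_val :: "'a cstar \<Rightarrow> ('i \<Rightarrow> 'a) \<Rightarrow> 'i nc_poly \<Rightarrow> 'a"
  where "poly_val B b q =
    (\<Oplus>\<^bsub>B\<^esub>w\<in>Poly_Mapping.keys q. Poly_Mapping.lookup q w \<odot>\<^bsub>B\<^esub> word_val B b w)"

text \<open>The linear span of the words in the generators and their adjoints.\<close>

definition star_subalgebra_generated :: "'a cstar \<Rightarrow> 'i set \<Rightarrow> ('i \<Rightarrow> 'a) \<Rightarrow> 'a set"
  where "star_subalgebra_generated B I b = poly_val B b ` nc_polys I"

definition norm_dense :: "'a cstar \<Rightarrow> 'a set \<Rightarrow> bool"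
  where "norm_dense B S \<longleftrightarrow>
    (\<forall>x\<in>carrier B. \<forall>\<epsilon>>0. \<exists>y\<in>S. cs_norm B (x \<ominus>\<^bsub>B\<^esub> y) < \<epsilon>)"

definition satisfies_relations :: "'a cstar \<Rightarrow> ('i \<Rightarrow> 'a) \<Rightarrow> 'r set \<Rightarrow> ('r \<Rightarrow> 'i nc_poly) \<Rightarrow> bool"
  where "satisfies_relations B b K p \<longleftrightarrow> (\<forall>k\<in>K. poly_val B b (p k) = \<zero>\<^bsub>B\<^esub>)"

text \<open>The universal property has to quantify over algebras carried by a fixed type. This type is large
  enough: a C*-algebra generated by a family indexed by a subset of \<open>'i\<close> consists of limits of
  sequences of polynomials in that family, hence embeds into \<open>nat \<Rightarrow> 'i nc_poly\<close>. So each such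
  algebra has a copy here, and *-homomorphisms into an arbitrary C*-algebra mapping generators to \<open>b\<close>
  are the same as those into the C*-subalgebra generated by \<open>b\<close>.\<close>

type_synonym 'i universe = "nat \<Rightarrow> 'i nc_poly"

definition universal_cstar_algebra ::
    "'a cstar \<Rightarrow> 'i set \<Rightarrow> ('i \<Rightarrow> 'a) \<Rightarrow> 'r set \<Rightarrow> ('r \<Rightarrow> 'i nc_poly) \<Rightarrow> bool"
  where "universal_cstar_algebra A I a K p \<longleftrightarrow>
    cstar_algebra A \<and> a \<in> I \<rightarrow> carrier A \<and>
    norm_dense A (star_subalgebra_generated A I a) \<and>
    p \<in> K \<rightarrow> nc_polys I \<and> satisfies_relations A a K p \<and>
    (\<forall>(B :: 'i universe cstar) b.
       cstar_algebra B \<and> b \<in> I \<rightarrow> carrier B \<and> satisfies_relations B b K p \<longrightarrow>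
       (\<exists>!\<rho>. \<rho> \<in> extensional (carrier A) \<and> star_hom A B \<rho> \<and> (\<forall>i\<in>I. \<rho> (a i) = b i)))"

definition gen_degree :: "'i \<Rightarrow> 'i letter list \<Rightarrow> int"
  where "gen_degree j w = int (count_list w (Gen j)) - int (count_list w (Gen_Star j))"

definition balanced :: "'r set \<Rightarrow> ('r \<Rightarrow> 'i nc_poly) \<Rightarrow> 'i \<Rightarrow> bool"
  where "balanced K p j \<longleftrightarrow> (\<forall>k\<in>K. \<forall>w\<in>Poly_Mapping.keys (p k). \<forall>w'\<in>Poly_Mapping.keys (p k).
    gen_degree j w = gen_degree j w')"

text \<open>The linear map $d_j$ on the algebra generated by \<open>a\<close> which multiplies each word by the
  degree of that word in the j-th generator; it exists if the j-th generator of a universal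
  algebra is balanced.\<close>

definition gauge_derivation :: "'a cstar \<Rightarrow> 'i set \<Rightarrow> ('i \<Rightarrow> 'a) \<Rightarrow> 'i \<Rightarrow> 'a \<Rightarrow> 'a"
  where "gauge_derivation A I a j = (let A0 = star_subalgebra_generated A I a in
    (THE d. d \<in> A0 \<rightarrow>\<^sub>E A0 \<and>
      (\<forall>x\<in>A0. \<forall>y\<in>A0. d (x \<oplus>\<^bsub>A\<^esub> y) = d x \<oplus>\<^bsub>A\<^esub> d y) \<and>
      (\<forall>c. \<forall>x\<in>A0. d (c \<odot>\<^bsub>A\<^esub> x) = c \<odot>\<^bsub>A\<^esub> d x) \<and>
      (\<forall>w\<in>words I. d (word_val A a w) = of_int (gen_degree j w) \<odot>\<^bsub>A\<^esub> word_val A a w)))"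

definition matrix_space :: "('h::chilbert_space \<Rightarrow> 'h) set \<Rightarrow>
    (('h, 'a::chilbert_space) tensor \<Rightarrow> ('h, 'b::chilbert_space) tensor) set"
  where "matrix_space A = {T. bounded_clinear T \<and> (\<forall>z w. Ebra z \<circ> T \<circ> Eket w \<in> A)}"

definition algebraic_tensor :: "('h::chilbert_space \<Rightarrow> 'h) set \<Rightarrow>
    (('h, 'a::chilbert_space) tensor \<Rightarrow> ('h, 'a) tensor) set"
  where "algebraic_tensor A0 = {Z. \<exists>(n::nat) y T. (\<forall>m<n. y m \<in> A0 \<and> bounded_clinear (T m)) \<and>
    Z = (\<lambda>v. \<Sum>m<n. (y m \<otimes>\<^sub>o T m) v)}"

definition op_linear_on :: "('h::complex_inner \<Rightarrow> 'h) set \<Rightarrow>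
    (('h \<Rightarrow> 'h) \<Rightarrow> 'a::complex_inner \<Rightarrow> 'b::complex_inner) \<Rightarrow> bool"
  where "op_linear_on A0 f \<longleftrightarrow>
    (\<forall>x\<in>A0. \<forall>y\<in>A0. f (\<lambda>u. x u + y u) = (\<lambda>v. f x v + f y v)) \<and>
    (\<forall>c. \<forall>x\<in>A0. f (\<lambda>u. c *\<^sub>C x u) = (\<lambda>v. c *\<^sub>C f x v))"

definition dense_star_subalgebra ::
    "('h::chilbert_space \<Rightarrow> 'h) set \<Rightarrow> ('h \<Rightarrow> 'h) set \<Rightarrow> bool"
  where "dense_star_subalgebra A A0 \<longleftrightarrow>
    A0 \<subseteq> A \<and> id \<in> A0 \<and>
    (\<forall>c. \<forall>x\<in>A0. \<forall>y\<in>A0. (\<lambda>u. x u + y u) \<in> A0 \<and> (\<lambda>u. c *\<^sub>C x u) \<in> A0 \<and> x \<circ> y \<in> A0 \<and>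
       cadjoint x \<in> A0) \<and>
    norm_dense (operator_algebra A) A0"

definition ampliation :: "('h::chilbert_space \<Rightarrow> 'h) \<Rightarrow> ('h, 'a::chilbert_space) tensor \<Rightarrow> ('h, 'a) tensor"
  where "ampliation x = x \<otimes>\<^sub>o id"

text \<open>The blocks are listed as $\tau$, $\delta^\dagger$, $\delta$, $\pi$. The Hilbert spaces
  $h \otimes \mathbb{C}$ and $h$ are identified: \<open>Ebra 1\<close> is the canonical unitary from the former
  to the latter, so \<open>\<delta> x \<circ> Ebra 1\<close> is $\delta(x)$ as an operator on $h \otimes \mathbb{C}$.\<close>

definition standard_form ::
    "('h::chilbert_space \<Rightarrow> 'h) set \<Rightarrow> ('h \<Rightarrow> 'h) set \<Rightarrow>
     (('h \<Rightarrow> 'h) \<Rightarrow> 'h \<Rightarrow> 'h) \<Rightarrow>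
     (('h \<Rightarrow> 'h) \<Rightarrow> ('h, 'k::chilbert_space) tensor \<Rightarrow> 'h) \<Rightarrow>
     (('h \<Rightarrow> 'h) \<Rightarrow> 'h \<Rightarrow> ('h, 'k) tensor) \<Rightarrow>
     (('h \<Rightarrow> 'h) \<Rightarrow> ('h, 'k) tensor \<Rightarrow> ('h, 'k) tensor) \<Rightarrow> bool"
  where "standard_form A A0 \<tau> \<delta>' \<delta> \<pi> \<longleftrightarrow>
    dense_star_subalgebra A A0 \<and>
    \<tau> \<in> A0 \<rightarrow> A \<and> op_linear_on A0 \<tau> \<and> (\<forall>x\<in>A0. \<tau> (cadjoint x) = cadjoint (\<tau> x)) \<and>
    (\<forall>x\<in>A0. \<forall>y\<in>A0. \<forall>u. \<tau> (x \<circ> y) u - \<tau> x (y u) - x (\<tau> y u) = \<delta>' x (\<delta> y u)) \<and>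
    (\<forall>x\<in>A0. \<delta> x \<circ> Ebra (1::complex) \<in> matrix_space A) \<and> op_linear_on A0 \<delta> \<and>
    (\<forall>x\<in>A0. \<forall>y\<in>A0. \<forall>u. \<delta> (x \<circ> y) u = \<delta> x (y u) + \<pi> x (\<delta> y u)) \<and>
    (\<forall>x\<in>A0. \<delta>' x = cadjoint (\<delta> (cadjoint x))) \<and>
    \<pi> \<in> A0 \<rightarrow> matrix_space A \<and> op_linear_on A0 \<pi> \<and> \<pi> id = id \<and>
    (\<forall>x\<in>A0. \<forall>y\<in>A0. \<pi> (x \<circ> y) = \<pi> x \<circ> \<pi> y) \<and>
    (\<forall>x\<in>A0. \<pi> (cadjoint x) = cadjoint (\<pi> x))"

text \<open>The operator on $h \otimes \widehat{k} = h \oplus (h \otimes k)$ with rows \<open>(t, b)\<close> and \<open>(c, d)\<close>: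
  \<open>Ebra (1, 0)\<close> and \<open>id \<otimes>\<^sub>o snd\<close> are the adjoints of the two inclusions \<open>Eket (1, 0)\<close> and \<open>id \<otimes>\<^sub>o Pair 0\<close>.\<close>

definition block_operator :: "('h::chilbert_space \<Rightarrow> 'h) \<Rightarrow> (('h, 'k::chilbert_space) tensor \<Rightarrow> 'h) \<Rightarrow>
    ('h \<Rightarrow> ('h, 'k) tensor) \<Rightarrow> (('h, 'k) tensor \<Rightarrow> ('h, 'k) tensor) \<Rightarrow>
    ('h, complex \<times> 'k) tensor \<Rightarrow> ('h, complex \<times> 'k) tensor"
  where "block_operator t b c d v =
    (let v0 = Ebra (1, 0) v; v1 = (id \<otimes>\<^sub>o snd) v
     in Eket (1, 0) (t v0 + b v1) + (id \<otimes>\<^sub>o Pair 0) (c v0 + d v1))"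

text \<open>Right-continuous step functions with compact support in the half line.\<close>

definition step_fun :: "(real \<Rightarrow> 'k::complex_inner) \<Rightarrow> bool"
  where "step_fun f \<longleftrightarrow> (\<exists>(n::nat) a b z. (\<forall>m<n. 0 \<le> a m) \<and>
    f = (\<lambda>t. \<Sum>m<n. if a m \<le> t \<and> t < b m then z m else 0))"

definition cut :: "real set \<Rightarrow> (real \<Rightarrow> 'k::complex_inner) \<Rightarrow> real \<Rightarrow> 'k"
  where "cut S f = (\<lambda>t. if t \<in> S then f t else 0)"

type_synonym 'k noise = "'k l2fun fock"

text \<open>Exponential vectors of square-integrable functions, and their normalisations.\<close>

definition expv :: "(real \<Rightarrow> 'k::complex_inner) \<Rightarrow> 'k noise"
  where "expv f = exp_vector (Abs_l2fun f)"

definition nexpv :: "(real \<Rightarrow> 'k::complex_inner) \<Rightarrow> 'k noise"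
  where "nexpv f = exp (- (\<integral>t. (norm (f t))\<^sup>2 \<partial>half_line) / 2) *\<^sub>R expv f"

definition exp_domain :: "'k::complex_inner noise set"
  where "exp_domain = cspan {expv f | f. step_fun f}"

definition alg_tensor_space :: "'a::complex_inner set \<Rightarrow> 'b::complex_inner set \<Rightarrow> ('a, 'b) tensor set"
  where "alg_tensor_space U V = cspan {u \<otimes>\<^sub>H v | u v. u \<in> U \<and> v \<in> V}"

abbreviation process_domain :: "('h::chilbert_space, 'k::chilbert_space noise) tensor set"
  where "process_domain \<equiv> alg_tensor_space UNIV exp_domain"

text \<open>\<open>X\<close> is only relevant on its domain \<open>D\<close>; unbounded operators and the maps \<open>j t x\<close> below are total
  functions whose values outside their algebraic domains are never used.\<close>

definition alg_tensor_op :: "'a::complex_inner set \<Rightarrow> ('a \<Rightarrow> 'a) \<Rightarrow> ('b::complex_inner \<Rightarrow> 'b) \<Rightarrow>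
    ('a, 'b) tensor \<Rightarrow> ('a, 'b) tensor"
  where "alg_tensor_op D X T \<theta> = (THE \<eta>. \<exists>(n::nat) \<xi> \<zeta>. (\<forall>m<n. \<xi> m \<in> D) \<and>
    \<theta> = (\<Sum>m<n. \<xi> m \<otimes>\<^sub>H \<zeta> m) \<and> \<eta> = (\<Sum>m<n. X (\<xi> m) \<otimes>\<^sub>H T (\<zeta> m)))"

type_synonym ('h, 'k) process_map =
  "real \<Rightarrow> ('h \<Rightarrow> 'h) \<Rightarrow> ('h, 'k noise) tensor \<Rightarrow> ('h, 'k noise) tensor"

text \<open>\<open>lifted A0 j t Z\<close> is the linear extension to \<open>algebraic_tensor A0\<close>, evaluated at \<open>Z\<close>, of the map
  sending \<open>y \<otimes>\<^sub>o T\<close> to the algebraic tensor product of \<open>j t y\<close> and \<open>T\<close>. The value does not depend on the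
  representation of \<open>Z\<close> as a finite sum.\<close>

definition lifted :: "('h::chilbert_space \<Rightarrow> 'h) set \<Rightarrow> ('h, 'k::chilbert_space) process_map \<Rightarrow>
    real \<Rightarrow> (('h, complex \<times> 'k) tensor \<Rightarrow> ('h, complex \<times> 'k) tensor) \<Rightarrow>
    (('h, 'k noise) tensor, complex \<times> 'k) tensor \<Rightarrow> (('h, 'k noise) tensor, complex \<times> 'k) tensor"
  where "lifted A0 j t Z \<theta> = (THE \<eta>. \<exists>(n::nat) y T.
    (\<forall>m<n. y m \<in> A0 \<and> bounded_clinear (T m)) \<and>
    Z = (\<lambda>v. \<Sum>m<n. (y m \<otimes>\<^sub>o T m) v) \<and>
    \<eta> = (\<Sum>m<n. alg_tensor_op process_domain (j t (y m)) (T m) \<theta>))"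

definition clinear_on :: "'a::complex_inner set \<Rightarrow> ('a \<Rightarrow> 'b::complex_inner) \<Rightarrow> bool"
  where "clinear_on D X \<longleftrightarrow> (\<forall>\<xi>\<in>D. \<forall>\<eta>\<in>D. \<forall>c. X (\<xi> + \<eta>) = X \<xi> + X \<eta> \<and> X (c *\<^sub>C \<xi>) = c *\<^sub>C X \<xi>)"

definition operator_process ::
    "(real \<Rightarrow> ('h::chilbert_space, 'k::chilbert_space noise) tensor \<Rightarrow> ('h, 'k noise) tensor) \<Rightarrow> bool"
  where "operator_process X \<longleftrightarrow>
    (\<forall>t\<ge>0. clinear_on process_domain (X t)) \<and>
    (\<forall>\<xi>\<in>process_domain. \<forall>\<eta>. (\<lambda>t. cinner \<eta> (X t \<xi>)) \<in> borel_measurable half_line) \<and>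
    (\<forall>t\<ge>0. \<forall>f g u. step_fun f \<and> step_fun g \<longrightarrow>
      Ebra (nexpv f) (X t (Eket (nexpv g) u)) =
      cinner (nexpv (cut {t..} f)) (nexpv (cut {t..} g)) *\<^sub>C
        Ebra (nexpv (cut {0..<t} f)) (X t (Eket (nexpv (cut {0..<t} g)) u)))"

definition proj_noise :: "(('h::chilbert_space, 'k::chilbert_space noise) tensor, complex \<times> 'k) tensor \<Rightarrow>
    (('h, 'k noise) tensor, complex \<times> 'k) tensor"  (\<open>\<Delta>\<close>)
  where "\<Delta> = id \<otimes>\<^sub>o (\<lambda>\<zeta>. (0, snd \<zeta>))"

definition proj_time :: "(('h::chilbert_space, 'k::chilbert_space noise) tensor, complex \<times> 'k) tensor \<Rightarrow>
    (('h, 'k noise) tensor, complex \<times> 'k) tensor"  (\<open>\<Delta>\<^sup>\<bottom>\<close>)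
  where "\<Delta>\<^sup>\<bottom> \<theta> = \<theta> - \<Delta> \<theta>"

definition locally_integrable :: "(real \<Rightarrow> 'a::real_normed_vector) \<Rightarrow> bool"
  where "locally_integrable F \<longleftrightarrow> strongly_measurable half_line F \<and>
    (\<forall>T\<ge>0. set_integrable lebesgue {0..T} (\<lambda>t. norm (F t)))"

definition locally_square_integrable :: "(real \<Rightarrow> 'a::real_normed_vector) \<Rightarrow> bool"
  where "locally_square_integrable F \<longleftrightarrow> strongly_measurable half_line F \<and>
    (\<forall>T\<ge>0. set_integrable lebesgue {0..T} (\<lambda>t. (norm (F t))\<^sup>2))"

text \<open>Since the noise dimension space is the last factor of $(h \otimes F) \otimes \widehat{k}$, the operators
  $E_{\varpi(g) \otimes \zeta}$ and $E^{\varpi(f) \otimes \xi}$ are \<open>Eket \<zeta> \<circ> Eket (nexpv g)\<close> and \<open>Ebra (nexpv f) \<circ> Ebra \<xi>\<close>.\<close>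

definition integrable_process ::
    "(real \<Rightarrow> (('h::chilbert_space, 'k::chilbert_space noise) tensor, complex \<times> 'k) tensor \<Rightarrow>
       (('h, 'k noise) tensor, complex \<times> 'k) tensor) \<Rightarrow> bool"
  where "integrable_process L \<longleftrightarrow>
    (\<forall>f g \<xi> \<zeta>. step_fun f \<and> step_fun g \<longrightarrow> (AE t in half_line. \<forall>u.
      Ebra (nexpv f) (Ebra \<xi> (L t (Eket \<zeta> (Eket (nexpv g) u)))) =
      cinner (nexpv (cut {t..} f)) (nexpv (cut {t..} g)) *\<^sub>C
        Ebra (nexpv (cut {0..<t} f)) (Ebra \<xi> (L t (Eket \<zeta> (Eket (nexpv (cut {0..<t} g)) u)))))) \<and>
    (\<forall>\<theta>\<in>alg_tensor_space process_domain UNIV. strongly_measurable half_line (\<lambda>t. L t \<theta>)) \<and>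
    (\<forall>u f. step_fun f \<longrightarrow>
      locally_integrable (\<lambda>t. \<Delta>\<^sup>\<bottom> (L t ((u \<otimes>\<^sub>H nexpv f) \<otimes>\<^sub>H (1, f t)))) \<and>
      locally_square_integrable (\<lambda>t. \<Delta> (L t ((u \<otimes>\<^sub>H nexpv f) \<otimes>\<^sub>H (1, f t)))))"

definition adapted_family ::
    "('h::chilbert_space \<Rightarrow> 'h) set \<Rightarrow> ('h, 'k::chilbert_space) process_map \<Rightarrow> bool"
  where "adapted_family A0 j \<longleftrightarrow>
    (\<forall>t\<ge>0. \<forall>\<xi>\<in>process_domain. \<forall>x\<in>A0. \<forall>y\<in>A0. \<forall>c.
      j t (\<lambda>u. x u + y u) \<xi> = j t x \<xi> + j t y \<xi> \<and> j t (\<lambda>u. c *\<^sub>C x u) \<xi> = c *\<^sub>C j t x \<xi>) \<and>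
    (\<forall>x\<in>A0. operator_process (\<lambda>t. j t x))"

definition strong_solution ::
    "('h::chilbert_space \<Rightarrow> 'h) set \<Rightarrow>
     (('h \<Rightarrow> 'h) \<Rightarrow> ('h, complex \<times> 'k::chilbert_space) tensor \<Rightarrow> ('h, complex \<times> 'k) tensor) \<Rightarrow>
     ('h, 'k) process_map \<Rightarrow> bool"
  where "strong_solution A0 \<phi> j \<longleftrightarrow> adapted_family A0 j \<and>
    (\<forall>x\<in>A0.
      (\<forall>\<xi>\<in>process_domain. j 0 x \<xi> = ampliation x \<xi>) \<and>
      integrable_process (\<lambda>t. lifted A0 j t (\<phi> x)) \<and>
      (\<forall>u v f g t. step_fun f \<and> step_fun g \<and> 0 \<le> t \<longrightarrow>
        (let F = (\<lambda>s. cinner (u \<otimes>\<^sub>H nexpv f)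
               (Ebra (1, f s) (lifted A0 j s (\<phi> x) (Eket (1, g s) (v \<otimes>\<^sub>H nexpv g)))))
         in set_integrable lebesgue {0..t} F \<and>
            cinner (u \<otimes>\<^sub>H nexpv f) (j t x (v \<otimes>\<^sub>H nexpv g) - j 0 x (v \<otimes>\<^sub>H nexpv g)) =
            (LINT s:{0..t}|lebesgue. F s))))"

definition weakly_multiplicative ::
    "('h::chilbert_space \<Rightarrow> 'h) set \<Rightarrow> ('h, 'k::chilbert_space) process_map \<Rightarrow> bool"
  where "weakly_multiplicative A0 j \<longleftrightarrow>
    (\<forall>x\<in>A0. \<forall>y\<in>A0. \<forall>\<zeta>\<in>process_domain. \<forall>\<xi>\<in>process_domain. \<forall>t\<ge>0.
      cinner (j t x \<zeta>) (j t y \<xi>) = cinner \<zeta> (j t (cadjoint x \<circ> y) \<xi>))"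

definition star_homomorphic ::
    "('h::chilbert_space \<Rightarrow> 'h) set \<Rightarrow> ('h \<Rightarrow> 'h) set \<Rightarrow> ('h, 'k::chilbert_space) process_map \<Rightarrow> bool"
  where "star_homomorphic A A0 j \<longleftrightarrow>
    (\<forall>t\<ge>0. \<exists>\<rho>. star_hom (operator_algebra A) (operator_algebra (Collect bounded_clinear)) \<rho> \<and>
      (\<forall>x\<in>A0. \<forall>\<xi>\<in>process_domain. \<rho> x \<xi> = j t x \<xi>))"

end

theory Submission
  imports Defs
begin

text \<open>A word $w$ in the generators has a vector $\nu(w) = \sum_j c_j n_j(w) e_j$ in $k$, and the
  equation for $w$ is solved by $j_t(w) = w \otimes W(1_{[0,t)} \nu(w))$ with Weyl operators $W$. All inner
  products $\langle \nu(v), \nu(w) \rangle$ are real, so these Weyl operators commute and multiply as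
  the words do. Since the generators $a_j$ with $j \in J$ are balanced, the words in one relation share
  the same $\nu$, whence the elements $a_i \otimes W(1_{[0,t)} \nu(a_i))$ satisfy the relations again and
  universality extends $a_i \mapsto a_i \otimes W(1_{[0,t)} \nu(a_i))$ to a *-homomorphism on the
  whole algebra; its restriction is $j_t$. The derivations $d_j$ are well defined for the same reason:
  differentiate the gauge automorphisms $a_j \mapsto e^{i\theta} a_j$ at $\theta = 0$.\<close>

section \<open>Hilbert spaces and bounded operators\<close>

text \<open>The inner products of the shift vectors are real because the \<open>e j\<close> are
  orthonormal and degrees are integers: \<open>\<langle>\<nu>(v), \<nu>(w)\<rangle>\<close> is the
  sum of \<open>|c j|^2 * n j(v) * n j(w)\<close>. Otherwise a product of Weyl operators would carry
  a phase and the twisted generators would not multiply as the words do. The equation needs no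
  iteration. Everything is linear in \<open>x\<close>, so a word \<open>w\<close> suffices, and
  there each \<open>d j\<close> acts as a scalar. Between the normalised exponential vectors of
  \<open>f\<close> and \<open>g\<close> the Weyl operator has as matrix element the exponential of a
  piecewise linear function of \<open>t\<close>; its slope \<open>\<langle>f,\<nu>\<rangle> -
  \<langle>\<nu>,g\<rangle> - \<langle>\<nu>,\<nu>\<rangle>/2\<close> is the scalar by which the
  entry of \<open>\<phi> w\<close> at \<open>(1, f)\<close> and \<open>(1, g)\<close> acts. So the
  weak equation is the fundamental theorem of calculus, and weak multiplicativity comes from the
  homomorphism instead of a quantum Ito formula. Two obstacles shape the rest: universality ranges
  over algebras on one fixed type, so operator algebras must be encoded there; and adjoints, tensor
  products and lifted maps are definite descriptions, resolved through boundedness of all operators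
  that occur.\<close>

lemma cinner_minus_right: "cinner x (- y) = - cinner x (y::'a::complex_inner)"
  using cinner_scaleC_right[of x "-1" y] scaleR_scaleC[of "-1" y] by simp

lemma cinner_minus_left: "cinner (- x) y = - cinner x (y::'a::complex_inner)"
  by (metis cinner_commute cinner_minus_right complex_cnj_minus)

lemma cinner_diff_right: "cinner x (y - z) = cinner x y - cinner x (z::'a::complex_inner)"
  using cinner_add_right[of x y "- z"] by (simp add: cinner_minus_right)

lemma cinner_diff_left: "cinner (x - y) z = cinner x z - cinner y (z::'a::complex_inner)"
  by (metis cinner_commute cinner_diff_right complex_cnj_diff)

lemma cinner_scaleR_right: "cinner x (r *\<^sub>R y) = of_real r * cinner x (y::'a::complex_inner)"
  by (simp add: scaleR_scaleC cinner_scaleC_right)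

lemma cinner_scaleR_left: "cinner (r *\<^sub>R x) y = of_real r * cinner x (y::'a::complex_inner)"
  by (simp add: scaleR_scaleC cinner_scaleC_left)

lemmas cinner_simps = cinner_add_left cinner_add_right cinner_diff_left cinner_diff_right
  cinner_scaleC_left cinner_scaleC_right cinner_minus_left cinner_minus_right
  cinner_scaleR_left cinner_scaleR_right cinner_zero_left cinner_zero_right

lemma cinner_self: "cinner x x = of_real ((norm (x::'a::complex_inner))\<^sup>2)"
  using cinner_commute[of x x] by (simp add: complex_eq_iff power2_norm_eq_cinner)

lemma norm_scaleC: "norm (c *\<^sub>C x) = cmod c * norm (x::'a::complex_inner)"
proof -
  have "cinner (c *\<^sub>C x) (c *\<^sub>C x) = of_real ((cmod c * norm x)\<^sup>2)"
    unfolding cinner_scaleC_left cinner_scaleC_right cinner_self[of x]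
    by (simp add: power_mult_distrib complex_norm_square del: of_real_power)
  then have "(norm (c *\<^sub>C x))\<^sup>2 = (cmod c * norm x)\<^sup>2"
    by (simp only: cinner_self of_real_eq_iff)
  then show ?thesis by (simp add: power2_eq_iff_nonneg)
qed

lemma scaleC_zero_right: "c *\<^sub>C (0::'a::complex_inner) = 0"
  using norm_scaleC[of c 0] by simp

lemma scaleC_sum_right: "c *\<^sub>C (\<Sum>i\<in>S. f i) = (\<Sum>i\<in>S. c *\<^sub>C (f i::'a::complex_inner))"
  by (induction S rule: infinite_finite_induct) (simp_all add: scaleC_zero_right scaleC_add_right)

lemma cinner_norm_eqI:
  assumes "cinner x x = cinner y y" shows "norm (x::'a::complex_inner) = norm (y::'b::complex_inner)"
  using assms norm_eq_sqrt_cinner[of x] norm_eq_sqrt_cinner[of y] by simp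

lemma tendsto_scaleC:
  assumes "(f \<longlongrightarrow> (x::'a::complex_inner)) F" shows "((\<lambda>n. c *\<^sub>C f n) \<longlongrightarrow> c *\<^sub>C x) F"
proof -
  have "((\<lambda>n. cmod c * norm (f n - x)) \<longlongrightarrow> cmod c * 0) F"
    by (intro tendsto_mult tendsto_const) (use assms in \<open>simp add: LIM_zero tendsto_norm_zero\<close>)
  moreover have "norm (c *\<^sub>C f n - c *\<^sub>C x) = cmod c * norm (f n - x)" for n
    by (metis complex_vector.scale_right_diff_distrib norm_scaleC)
  ultimately have "((\<lambda>n. norm (c *\<^sub>C f n - c *\<^sub>C x)) \<longlongrightarrow> 0) F" by simp
  then show ?thesis by (metis tendsto_norm_zero_iff LIM_zero_cancel)
qed

section \<open>Nearest points, orthogonal decomposition and totality\<close>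

lemma parallelogram:
  "(norm (x + y))\<^sup>2 + (norm (x - y))\<^sup>2 = 2 * (norm x)\<^sup>2 + 2 * (norm (y::'a::complex_inner))\<^sup>2"
  unfolding power2_norm_eq_cinner[symmetric] by (simp add: cinner_simps)

text \<open>A minimising sequence \<open>Y\<close> is Cauchy: midpoints of its members lie in the
  convex set \<open>M\<close>, hence at distance at least \<open>d\<close> from \<open>x\<close>,
  and the parallelogram law bounds the squared distance of two members by their excesses over
  \<open>d\<close>.\<close>

lemma nearest_point:
  fixes M :: "'a::chilbert_space set"
  assumes M: "closed M" "convex M" "M \<noteq> {}"
  obtains y where "y \<in> M" "\<And>z. z \<in> M \<Longrightarrow> norm (x - y) \<le> norm (x - z)"
proof -
  define d where "d = infdist x M"
  have d0: "0 \<le> d" by (simp add: d_def infdist_nonneg)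
  have dle: "d \<le> norm (x - z)" if "z \<in> M" for z
    using infdist_le[OF that, of x] by (simp add: d_def dist_norm)
  have "\<exists>y\<in>M. norm (x - y) < d + inverse (real (Suc n))" for n
  proof -
    have "(INF z\<in>M. dist x z) < d + inverse (real (Suc n))"
      using M(3) by (simp add: d_def infdist_notempty)
    moreover have "bdd_below (dist x ` M)" by (rule bdd_belowI[of _ 0]) auto
    ultimately show ?thesis using M(3) by (simp add: cINF_less_iff dist_norm)
  qed
  then obtain Y where Y: "\<And>n. Y n \<in> M" "\<And>n. norm (x - Y n) < d + inverse (real (Suc n))" by metis
  have lim: "(\<lambda>n. norm (x - Y n)) \<longlonglongrightarrow> d"
  proof (rule tendsto_sandwich)
    show "\<forall>\<^sub>F n in sequentially. d \<le> norm (x - Y n)" using dle Y by simp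
    show "\<forall>\<^sub>F n in sequentially. norm (x - Y n) \<le> d + inverse (real (Suc n))"
      using Y by (simp add: less_imp_le)
    show "(\<lambda>n. d + inverse (real (Suc n))) \<longlonglongrightarrow> d"
      using tendsto_add[OF tendsto_const LIMSEQ_inverse_real_of_nat, of d] by simp
  qed simp
  have key: "(norm (Y m - Y n))\<^sup>2 \<le> 2 * (norm (x - Y m))\<^sup>2 + 2 * (norm (x - Y n))\<^sup>2 - 4 * d\<^sup>2" for m n
  proof -
    have "(1/2) *\<^sub>R Y m + (1/2) *\<^sub>R Y n \<in> M" using M Y by (intro convexD) auto
    then have "d \<le> norm (x - ((1/2) *\<^sub>R Y m + (1/2) *\<^sub>R Y n))" by (rule dle)
    moreover have "(x - Y m) + (x - Y n) = 2 *\<^sub>R (x - ((1/2) *\<^sub>R Y m + (1/2) *\<^sub>R Y n))"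
      by (simp add: algebra_simps scaleR_2)
    ultimately have "2 * d \<le> norm ((x - Y m) + (x - Y n))" by simp
    then have "(2 * d)\<^sup>2 \<le> (norm ((x - Y m) + (x - Y n)))\<^sup>2" using d0 by (intro power_mono) auto
    then show ?thesis
      using parallelogram[of "x - Y m" "x - Y n"] by (simp add: norm_minus_commute power_mult_distrib)
  qed
  have "Cauchy Y"
  proof (rule CauchyI)
    fix e :: real assume e: "0 < e"
    have "(\<lambda>n. 2 * (norm (x - Y n))\<^sup>2 - 2 * d\<^sup>2) \<longlonglongrightarrow> 2 * d\<^sup>2 - 2 * d\<^sup>2"
      by (intro tendsto_intros lim)
    then have "(\<lambda>n. 2 * (norm (x - Y n))\<^sup>2 - 2 * d\<^sup>2) \<longlonglongrightarrow> 0" by simp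
    from LIMSEQ_D[OF this, of "e\<^sup>2 / 2"] e
    obtain N where N: "\<And>n. n \<ge> N \<Longrightarrow> \<bar>2 * (norm (x - Y n))\<^sup>2 - 2 * d\<^sup>2\<bar> < e\<^sup>2 / 2" by auto
    have "norm (Y m - Y n) < e" if "m \<ge> N" "n \<ge> N" for m n
    proof (rule power2_less_imp_less)
      show "(norm (Y m - Y n))\<^sup>2 < e\<^sup>2"
        using key[of m n] N[OF that(1)] N[OF that(2)] by linarith
    qed (use e in simp)
    then show "\<exists>N. \<forall>m\<ge>N. \<forall>n\<ge>N. norm (Y m - Y n) < e" by blast
  qed
  then obtain y where y: "Y \<longlonglongrightarrow> y" using Cauchy_convergent convergent_def by blast
  have "y \<in> M" using M(1) Y(1) y closed_sequentially by blast
  moreover have "norm (x - y) = d"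
    using LIMSEQ_unique[OF lim tendsto_norm[OF tendsto_diff[OF tendsto_const y]]] by simp
  ultimately show ?thesis using that dle by metis
qed

text \<open>The point of \<open>M\<close> nearest to \<open>x\<close> serves as \<open>y\<close>: a
  nonzero component of \<open>x - y\<close> along some \<open>z\<close> in \<open>M\<close> could be
  removed by moving \<open>y\<close> inside \<open>M\<close>, which would give a strictly nearer
  point.\<close>

lemma orthogonal_decomposition:
  fixes M :: "'a::chilbert_space set"
  assumes M: "closed M" "complex_vector.subspace M"
  obtains y where "y \<in> M" "\<And>z. z \<in> M \<Longrightarrow> cinner z (x - y) = 0"
proof -
  have "convex M"
    using M(2) by (auto simp: convex_def scaleR_scaleC complex_vector.subspace_add complex_vector.subspace_scale)
  moreover have "M \<noteq> {}" using complex_vector.subspace_0[OF M(2)] by blast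
  ultimately obtain y where y: "y \<in> M" "\<And>z. z \<in> M \<Longrightarrow> norm (x - y) \<le> norm (x - z)"
    using nearest_point M(1) by metis
  have "cinner z (x - y) = 0" if z: "z \<in> M" for z
  proof (cases "z = 0")
    case True then show ?thesis by (simp add: cinner_simps)
  next
    case False
    define w where "w = x - y"
    \<comment> \<open>The coefficient of the orthogonal projection of \<open>w\<close> onto the line
      through \<open>z\<close>. Removing this projection lowers the squared norm by
      \<open>(cmod (cinner z w))\<^sup>2 / (norm z)\<^sup>2\<close>.\<close>
    define c where "c = cinner z w / of_real ((norm z)\<^sup>2)"
    have "y + c *\<^sub>C z \<in> M"
      using M(2) y(1) z by (simp add: complex_vector.subspace_add complex_vector.subspace_scale)
    from y(2)[OF this] have "norm w \<le> norm (w - c *\<^sub>C z)" by (simp add: w_def algebra_simps)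
    then have le: "(norm w)\<^sup>2 \<le> (norm (w - c *\<^sub>C z))\<^sup>2" by (simp add: power_mono)
    have "cinner (w - c *\<^sub>C z) (w - c *\<^sub>C z) =
       of_real ((norm w)\<^sup>2) - c * cnj (cinner z w) - cnj c * cinner z w + c * cnj c * of_real ((norm z)\<^sup>2)"
      by (simp add: cinner_simps cinner_self[of w] cinner_self[of z] cinner_commute[of w z] algebra_simps)
    also have "\<dots> = of_real ((norm w)\<^sup>2) - cinner z w * cnj (cinner z w) / of_real ((norm z)\<^sup>2)"
      using False by (simp add: c_def field_simps power2_eq_square)
    also have "\<dots> = of_real ((norm w)\<^sup>2 - (cmod (cinner z w))\<^sup>2 / (norm z)\<^sup>2)"
      by (simp add: complex_norm_square[symmetric])
    finally have "(norm (w - c *\<^sub>C z))\<^sup>2 = (norm w)\<^sup>2 - (cmod (cinner z w))\<^sup>2 / (norm z)\<^sup>2"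
      unfolding cinner_self of_real_eq_iff .
    with le have "(cmod (cinner z w))\<^sup>2 / (norm z)\<^sup>2 \<le> 0" by simp
    then have "cinner z w = 0" using False by (simp add: divide_le_0_iff)
    then show ?thesis by (simp add: w_def)
  qed
  with y(1) show ?thesis using that by blast
qed

lemma closed_cspan_closure: "complex_vector.subspace (closure (cspan (S::'a::complex_inner set)))"
proof (rule complex_vector.subspaceI)
  show "0 \<in> closure (cspan S)"
    using complex_vector.span_zero closure_subset by blast
next
  fix x y assume "x \<in> closure (cspan S)" "y \<in> closure (cspan S)"
  then obtain X Y where "\<And>n. X n \<in> cspan S" "X \<longlonglongrightarrow> x" "\<And>n. Y n \<in> cspan S" "Y \<longlonglongrightarrow> y"
    unfolding closure_sequential by metis
  then show "x + y \<in> closure (cspan S)"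
    unfolding closure_sequential by (intro exI[of _ "\<lambda>n. X n + Y n"]) (auto intro: tendsto_add complex_vector.span_add)
next
  fix c x assume "x \<in> closure (cspan S)"
  then obtain X where "\<And>n. X n \<in> cspan S" "X \<longlonglongrightarrow> x"
    unfolding closure_sequential by metis
  then show "c *\<^sub>C x \<in> closure (cspan S)"
    unfolding closure_sequential
    by (intro exI[of _ "\<lambda>n. c *\<^sub>C X n"]) (auto intro: tendsto_scaleC complex_vector.span_scale)
qed

text \<open>Adjoining the orthogonal complement makes every set total. Applied to exponential
  vectors of step functions, it lets operators be defined and compared on these together with the
  vectors orthogonal to them.\<close>

lemma total_union_orthogonal:
  fixes S :: "'a::chilbert_space set"
  shows "closure (cspan (S \<union> {z. \<forall>x\<in>S. cinner x z = 0})) = UNIV"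
proof -
  {fix x
  let ?T = "S \<union> {z. \<forall>x\<in>S. cinner x z = 0}"
  obtain y where y: "y \<in> closure (cspan S)" "\<And>z. z \<in> closure (cspan S) \<Longrightarrow> cinner z (x - y) = 0"
    using orthogonal_decomposition[OF closed_closure closed_cspan_closure] by metis
  have "S \<subseteq> closure (cspan S)"
    using complex_vector.span_superset closure_subset by fast
  then have "x - y \<in> ?T" using y(2) by auto
  then have "x - y \<in> closure (cspan ?T)"
    using complex_vector.span_superset closure_subset by fast
  moreover have "closure (cspan S) \<subseteq> closure (cspan ?T)"
    by (intro closure_mono complex_vector.span_mono) simp
  then have "y \<in> closure (cspan ?T)" using y(1) by blast
  ultimately have "(x - y) + y \<in> closure (cspan ?T)"
    by (rule complex_vector.subspace_add[OF closed_cspan_closure])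
  then have "x \<in> closure (cspan ?T)" by simp}
  then show ?thesis by blast
qed

lemma bounded_clinearI:
  fixes T :: "'a::complex_inner \<Rightarrow> 'b::complex_inner"
  assumes "\<And>x y. T (x + y) = T x + T y" "\<And>c x. T (c *\<^sub>C x) = c *\<^sub>C T x" "\<And>x. norm (T x) \<le> M * norm x"
  shows "bounded_clinear T"
  unfolding bounded_clinear_def
proof (intro conjI allI)
  show "bounded_linear T"
    by (rule bounded_linear_intro[where K=M])
       (use assms in \<open>auto simp: scaleR_scaleC mult.commute\<close>)
qed (rule assms(2))

lemma bounded_clinear_linear: "bounded_clinear T \<Longrightarrow> bounded_linear T"
  by (simp add: bounded_clinear_def)

lemma bounded_clinear_scaleC: "bounded_clinear T \<Longrightarrow> T (c *\<^sub>C x) = c *\<^sub>C T x"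
  by (simp add: bounded_clinear_def)

lemma bounded_clinear_addD: "bounded_clinear T \<Longrightarrow> T (x + y) = T x + T y"
  using bounded_linear.linear linear_add bounded_clinear_linear by blast

lemma bounded_clinear_diffD: "bounded_clinear T \<Longrightarrow> T (x - y) = T x - T y"
  using bounded_linear.linear linear_diff bounded_clinear_linear by blast

lemma bounded_clinear_zeroD: "bounded_clinear T \<Longrightarrow> T 0 = 0"
  using bounded_linear.linear linear_0 bounded_clinear_linear by blast

lemma bounded_clinear_minusD: "bounded_clinear T \<Longrightarrow> T (- x) = - T x"
  using bounded_linear.linear linear_neg bounded_clinear_linear by blast

lemma bounded_clinear_sumD: "bounded_clinear T \<Longrightarrow> T (\<Sum>i\<in>S. f i) = (\<Sum>i\<in>S. T (f i))"
  using bounded_linear.linear linear_sum bounded_clinear_linear by blast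

lemma bounded_clinear_scaleRD: "bounded_clinear T \<Longrightarrow> T (r *\<^sub>R x) = r *\<^sub>R T x"
  by (simp add: scaleR_scaleC bounded_clinear_scaleC)

lemmas bounded_clinearD = bounded_clinear_scaleC bounded_clinear_addD bounded_clinear_diffD
  bounded_clinear_zeroD bounded_clinear_minusD bounded_clinear_sumD bounded_clinear_scaleRD

lemma bounded_clinear_norm: "bounded_clinear T \<Longrightarrow> norm (T x) \<le> onorm T * norm x"
  by (intro onorm bounded_clinear_linear)

lemma bounded_clinear_id: "bounded_clinear id"
  by (rule bounded_clinearI[where M=1]) auto

lemma bounded_clinear_ident: "bounded_clinear (\<lambda>x. x)"
  by (rule bounded_clinearI[where M=1]) auto

lemma bounded_clinear_zero: "bounded_clinear (\<lambda>_. 0)"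
  by (rule bounded_clinearI[where M=0]) (auto simp: scaleC_zero_right)

lemma bounded_clinear_compose: "bounded_clinear S \<Longrightarrow> bounded_clinear T \<Longrightarrow> bounded_clinear (S \<circ> T)"
  unfolding bounded_clinear_def by (auto simp: o_def intro: bounded_linear_compose)

lemma bounded_clinear_comp: "bounded_clinear S \<Longrightarrow> bounded_clinear T \<Longrightarrow> bounded_clinear (\<lambda>u. S (T u))"
  using bounded_clinear_compose[of S T] by (simp add: o_def)

lemma bounded_clinear_add: "bounded_clinear S \<Longrightarrow> bounded_clinear T \<Longrightarrow> bounded_clinear (\<lambda>u. S u + T u)"
  unfolding bounded_clinear_def by (auto simp: scaleC_add_right intro: bounded_linear_add)

lemma bounded_clinear_scale:
  assumes "bounded_clinear T" shows "bounded_clinear (\<lambda>u. c *\<^sub>C T u)"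
proof (rule bounded_clinearI[where M="cmod c * onorm T"])
  fix x show "norm (c *\<^sub>C T x) \<le> cmod c * onorm T * norm x"
    using mult_left_mono[OF bounded_clinear_norm[OF assms, of x] norm_ge_zero[of c]]
    by (simp add: norm_scaleC mult.assoc)
qed (use assms in \<open>simp_all add: bounded_clinearD scaleC_add_right scaleC_scaleC mult.commute\<close>)

lemma bounded_clinear_sum:
  "(\<And>i. i \<in> F \<Longrightarrow> bounded_clinear (T i)) \<Longrightarrow> bounded_clinear (\<lambda>u. \<Sum>i\<in>F. T i u)"
  by (induction F rule: infinite_finite_induct) (auto intro: bounded_clinear_zero bounded_clinear_add)

lemma bounded_clinear_diff: "bounded_clinear S \<Longrightarrow> bounded_clinear T \<Longrightarrow> bounded_clinear (\<lambda>u. S u - T u)"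
  using bounded_clinear_add[of S "\<lambda>u. (-1) *\<^sub>C T u"] bounded_clinear_scale[of T "-1"] scaleR_scaleC[of "-1"]
  by simp

lemma bounded_clinear_tendsto:
  assumes "bounded_clinear T" "(f \<longlongrightarrow> x) F" shows "((\<lambda>n. T (f n)) \<longlongrightarrow> T x) F"
  using bounded_linear.tendsto[OF bounded_clinear_linear] assms by blast

lemma bounded_clinear_cinner: "bounded_clinear (\<lambda>x. cinner y x)"
  by (rule bounded_clinearI[where M="norm y"])
     (auto simp: cinner_simps scaleC_complex_def cinner_Cauchy_Schwarz)

lemma bounded_clinear_scaleC_left: "bounded_clinear (\<lambda>c. c *\<^sub>C x)"
  by (rule bounded_clinearI[where M="norm x"])
     (auto simp: scaleC_add_left scaleC_complex_def scaleC_scaleC norm_scaleC mult.commute)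

lemma bounded_clinear_eq_on_total:
  assumes "bounded_clinear S" "bounded_clinear T" "closure (cspan X) = UNIV" "\<And>x. x \<in> X \<Longrightarrow> S x = T x"
  shows "S = T"
proof
  fix u
  obtain U where U: "\<And>n. U n \<in> cspan X" "U \<longlonglongrightarrow> u"
    using assms(3) closure_sequential[of u "cspan X"] by auto
  have "S v = T v" if "v \<in> cspan X" for v
    using that
    by (induction rule: complex_vector.span_induct_alt)
       (use assms in \<open>auto simp: bounded_clinearD\<close>)
  then have "(\<lambda>n. S (U n)) \<longlonglongrightarrow> T u"
    using bounded_clinear_tendsto[OF assms(2) U(2)] U(1) by simp
  then show "S u = T u"
    using bounded_clinear_tendsto[OF assms(1) U(2)] LIMSEQ_unique by blast
qed

lemma eq_on_total_cinner:
  assumes "closure (cspan X) = UNIV" "\<And>x. x \<in> X \<Longrightarrow> cinner x u = cinner x (v::'a::complex_inner)"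
  shows "u = v"
proof -
  have "(\<lambda>x. cinner u x) = (\<lambda>x. cinner v x)"
    by (rule bounded_clinear_eq_on_total[OF bounded_clinear_cinner bounded_clinear_cinner assms(1)])
       (use assms(2) cinner_commute in metis)
  then have "cinner x u = cinner x v" for x
    using cinner_commute[of x u] cinner_commute[of x v] by metis
  then have "cinner (u - v) (u - v) = 0" by (simp add: cinner_diff_right)
  then show ?thesis by (simp add: cinner_self)
qed

lemma cinner_ext: "(\<And>x. cinner x u = cinner x (v::'a::complex_inner)) \<Longrightarrow> u = v"
  by (rule eq_on_total_cinner[of UNIV]) auto

section \<open>Riesz representation, adjoints and the operator norm\<close>

lemma Riesz_representation:
  fixes f :: "'a::chilbert_space \<Rightarrow> complex"
  assumes f: "bounded_clinear f"
  obtains y where "\<And>x. f x = cinner y x"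
proof (cases "\<forall>x. f x = 0")
  case True then show ?thesis using that[of 0] by (simp add: cinner_simps)
next
  case False
  then obtain x0 where x0: "f x0 \<noteq> 0" by blast
  let ?M = "f -` {0}"
  have "closed ?M"
    by (intro closed_vimage linear_continuous_on bounded_clinear_linear f continuous_on_closed_vimage) auto
  moreover have "complex_vector.subspace ?M"
    by (rule complex_vector.subspaceI) (use f in \<open>auto simp: bounded_clinearD scaleC_zero_right\<close>)
  ultimately obtain m where m: "m \<in> ?M" "\<And>z. z \<in> ?M \<Longrightarrow> cinner z (x0 - m) = 0"
    using orthogonal_decomposition by metis
  \<comment> \<open>The part of \<open>x0\<close> orthogonal to the kernel. Every \<open>x\<close>
    differs from \<open>(f x / f w) *\<^sub>C w\<close> by an element of the kernel, so pairing with
    \<open>w\<close> recovers \<open>f x\<close>.\<close>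
  define w where "w = x0 - m"
  have fw: "f w \<noteq> 0" using m x0 f by (simp add: w_def bounded_clinearD)
  then have w0: "w \<noteq> 0" using f by (auto simp: bounded_clinearD)
  have "f x = cinner ((cnj (f w) / of_real ((norm w)\<^sup>2)) *\<^sub>C w) x" for x
  proof -
    have "f (x - (f x / f w) *\<^sub>C w) = 0" using fw f by (simp add: bounded_clinearD scaleC_complex_def)
    then have "cinner (x - (f x / f w) *\<^sub>C w) w = 0" using m(2) by (simp add: w_def)
    then have "cinner w (x - (f x / f w) *\<^sub>C w) = 0" using cinner_commute by (metis complex_cnj_zero)
    then have "cinner w x = (f x / f w) * of_real ((norm w)\<^sup>2)"
      by (simp add: cinner_simps cinner_self)
    then show ?thesis using w0 fw by (simp add: cinner_simps)
  qed
  then show ?thesis using that by blast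
qed

text \<open>Resolves the definite description: the inner product is nondegenerate, so at most one
  map satisfies the adjoint identity. Explicit adjoints are computed by exhibiting \<open>S\<close>
  and checking this identity.\<close>

lemma cadjoint_eqI:
  assumes "\<And>x y. cinner (T x) y = cinner x (S y)" shows "cadjoint T = S"
  unfolding cadjoint_def
proof (rule the_equality)
  fix S' assume "\<forall>x y. cinner (T x) y = cinner x (S' y)"
  then show "S' = S" using assms by (metis cinner_ext ext)
qed (simp add: assms)

lemma cinner_cadjoint:
  assumes "bounded_clinear T" shows "cinner (T x) y = cinner x (cadjoint T y)"
proof -
  have "\<exists>s. \<forall>x. cinner (T x) y = cinner x s" for y
  proof -
    have "bounded_clinear (\<lambda>x. cinner y (T x))"
      by (rule bounded_clinear_comp[OF bounded_clinear_cinner assms])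
    then obtain s where "\<And>x. cinner y (T x) = cinner s x" using Riesz_representation by blast
    then show ?thesis using cinner_commute by metis
  qed
  then obtain S where S: "\<And>x y. cinner (T x) y = cinner x (S y)" by metis
  then show ?thesis using cadjoint_eqI[OF S] by simp
qed

lemma cinner_cadjoint2:
  "bounded_clinear T \<Longrightarrow> cinner x (T y) = cinner (cadjoint T x) y"
  by (metis cinner_cadjoint cinner_commute)

text \<open>The squared norm of \<open>cadjoint T y\<close> equals the inner product of
  \<open>T (cadjoint T y)\<close> with \<open>y\<close>; Cauchy-Schwarz and division by one factor
  give the bound.\<close>

lemma norm_cadjoint_le:
  assumes "bounded_clinear T" shows "norm (cadjoint T y) \<le> onorm T * norm y"
proof -
  have "(norm (cadjoint T y))\<^sup>2 = cmod (cinner (T (cadjoint T y)) y)"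
    using assms by (simp add: cinner_cadjoint cinner_self norm_power)
  also have "\<dots> \<le> norm (T (cadjoint T y)) * norm y" by (rule cinner_Cauchy_Schwarz)
  also have "\<dots> \<le> onorm T * norm (cadjoint T y) * norm y"
    by (intro mult_right_mono bounded_clinear_norm assms) simp
  finally have "norm (cadjoint T y) * norm (cadjoint T y) \<le> (onorm T * norm y) * norm (cadjoint T y)"
    by (simp add: power2_eq_square mult_ac)
  then show ?thesis
    using onorm_pos_le[OF bounded_clinear_linear[OF assms]]
    by (cases "norm (cadjoint T y) = 0") (auto simp: mult_le_cancel_right)
qed

lemma bounded_clinear_cadjoint:
  assumes "bounded_clinear T" shows "bounded_clinear (cadjoint T)"
  by (rule bounded_clinearI[OF _ _ norm_cadjoint_le[OF assms]])
     (rule cinner_ext, simp add: cinner_simps cinner_cadjoint[OF assms, symmetric])+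

lemma cadjoint_cadjoint: "bounded_clinear T \<Longrightarrow> cadjoint (cadjoint T) = T"
  by (rule cadjoint_eqI) (simp add: cinner_cadjoint2)

lemma cadjoint_add:
  "bounded_clinear S \<Longrightarrow> bounded_clinear T \<Longrightarrow> cadjoint (\<lambda>u. S u + T u) = (\<lambda>u. cadjoint S u + cadjoint T u)"
  by (rule cadjoint_eqI) (simp add: cinner_simps cinner_cadjoint)

lemma cadjoint_scaleC:
  "bounded_clinear S \<Longrightarrow> cadjoint (\<lambda>u. c *\<^sub>C S u) = (\<lambda>u. cnj c *\<^sub>C cadjoint S u)"
  by (rule cadjoint_eqI) (simp add: cinner_simps cinner_cadjoint)

lemma cadjoint_compose:
  "bounded_clinear S \<Longrightarrow> bounded_clinear T \<Longrightarrow> cadjoint (S \<circ> T) = cadjoint T \<circ> cadjoint S"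
  by (rule cadjoint_eqI) (simp add: cinner_cadjoint)

lemma cadjoint_id: "cadjoint id = id"
  by (rule cadjoint_eqI) simp

lemma onorm_leI: "(\<And>x. norm (f x) \<le> b * norm x) \<Longrightarrow> 0 \<le> b \<Longrightarrow> onorm f \<le> b"
  by (rule onorm_bound) (simp_all)

lemma onorm_scaleC:
  assumes "bounded_clinear T" shows "onorm (\<lambda>u. c *\<^sub>C T u) = cmod c * onorm T"
  using onorm_scaleR[OF bounded_clinear_linear[OF assms], of "cmod c"]
  unfolding onorm_def norm_scaleC by simp

lemma onorm_cadjoint_le:
  assumes "bounded_clinear T" shows "onorm (cadjoint T) \<le> onorm T"
  by (rule onorm_leI[OF norm_cadjoint_le[OF assms] onorm_pos_le[OF bounded_clinear_linear[OF assms]]])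

lemma onorm_cadjoint:
  assumes "bounded_clinear T" shows "onorm (cadjoint T) = onorm T"
  using onorm_cadjoint_le[OF assms] onorm_cadjoint_le[OF bounded_clinear_cadjoint[OF assms]]
  by (simp add: cadjoint_cadjoint[OF assms])

lemma onorm_comp_le:
  assumes "bounded_clinear S" "bounded_clinear T" shows "onorm (S \<circ> T) \<le> onorm S * onorm T"
  by (intro onorm_compose bounded_clinear_linear assms)

lemma onorm_cadjoint_comp:
  assumes T: "bounded_clinear T" shows "onorm (cadjoint T \<circ> T) = (onorm T)\<^sup>2"
proof (rule antisym)
  note T' = bounded_clinear_cadjoint[OF T]
  show "onorm (cadjoint T \<circ> T) \<le> (onorm T)\<^sup>2"
    using onorm_comp_le[OF T' T] onorm_cadjoint[OF T] by (simp add: power2_eq_square)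
  let ?c = "onorm (cadjoint T \<circ> T)"
  have c0: "0 \<le> ?c" by (rule onorm_pos_le[OF bounded_clinear_linear[OF bounded_clinear_compose[OF T' T]]])
  have "onorm T \<le> sqrt ?c"
  proof (rule onorm_leI)
    fix x
    have "(norm (T x))\<^sup>2 = cmod (cinner x (cadjoint T (T x)))"
      using T by (simp add: cinner_cadjoint[symmetric] cinner_self norm_power)
    also have "\<dots> \<le> norm x * norm ((cadjoint T \<circ> T) x)" using cinner_Cauchy_Schwarz by fastforce
    also have "\<dots> \<le> norm x * (?c * norm x)"
      by (intro mult_left_mono bounded_clinear_norm bounded_clinear_compose T T') simp
    also have "\<dots> = (sqrt ?c * norm x)\<^sup>2" using c0 by (simp add: power_mult_distrib power2_eq_square)
    finally show "norm (T x) \<le> sqrt ?c * norm x"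
      by (rule power2_le_imp_le) (use c0 in simp)
  qed (use c0 in simp)
  then have "(onorm T)\<^sup>2 \<le> (sqrt ?c)\<^sup>2"
    by (intro power_mono onorm_pos_le bounded_clinear_linear T)
  then show "(onorm T)\<^sup>2 \<le> ?c" using c0 by simp
qed

section \<open>Extension of operators and tensor products\<close>

text \<open>The vectors \<open>x i\<close> may be linearly dependent, so the map is built as a
  relation: \<open>R\<close> collects the pairs of corresponding finite combinations and
  \<open>Q\<close> is its sequential closure. Applied to differences, the norm estimate makes
  \<open>Q\<close> single-valued, and it carries Cauchy sequences of first components to Cauchy
  sequences of second components.\<close>

lemma bounded_clinear_extension:
  fixes x :: "'i \<Rightarrow> 'a::chilbert_space" and y :: "'i \<Rightarrow> 'b::chilbert_space"
  assumes total: "closure (cspan (x ` S)) = UNIV"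
    and le: "\<And>F c. finite F \<Longrightarrow> F \<subseteq> S \<Longrightarrow>
      norm (\<Sum>i\<in>F. c i *\<^sub>C y i) \<le> M * norm (\<Sum>i\<in>F. c i *\<^sub>C x i)"
  obtains T where "bounded_clinear T" "\<And>i. i \<in> S \<Longrightarrow> T (x i) = y i"
proof -
  define R where "R u v \<longleftrightarrow> (\<exists>F c. finite F \<and> F \<subseteq> S \<and> u = (\<Sum>i\<in>F. c i *\<^sub>C x i) \<and> v = (\<Sum>i\<in>F. c i *\<^sub>C y i))"
    for u v
  have R_add: "R (u + u') (v + v')" if uv: "R u v" "R u' v'" for u v u' v'
  proof -
    obtain F c G d where F: "finite F" "F \<subseteq> S" "u = (\<Sum>i\<in>F. c i *\<^sub>C x i)" "v = (\<Sum>i\<in>F. c i *\<^sub>C y i)"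
      and G: "finite G" "G \<subseteq> S" "u' = (\<Sum>i\<in>G. d i *\<^sub>C x i)" "v' = (\<Sum>i\<in>G. d i *\<^sub>C y i)"
      using uv unfolding R_def by blast
    \<comment> \<open>Padding with zeros lets both combinations run over
      \<open>F \<union> G\<close>, where coefficients can be added.\<close>
    define c' d' where "c' i = (if i \<in> F then c i else 0)" and "d' i = (if i \<in> G then d i else 0)" for i
    have F': "(\<Sum>i\<in>F. c i *\<^sub>C z i) = (\<Sum>i\<in>F \<union> G. c' i *\<^sub>C z i)" for z :: "'i \<Rightarrow> 'c::complex_inner"
      by (rule sum.mono_neutral_cong_left) (use F G in \<open>auto simp: c'_def scaleC_zero_left\<close>)
    have G': "(\<Sum>i\<in>G. d i *\<^sub>C z i) = (\<Sum>i\<in>F \<union> G. d' i *\<^sub>C z i)" for z :: "'i \<Rightarrow> 'c::complex_inner"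
      by (rule sum.mono_neutral_cong_left) (use F G in \<open>auto simp: d'_def scaleC_zero_left\<close>)
    show ?thesis
      unfolding R_def using F(1,2) G(1,2)
      by (intro exI[of _ "F \<union> G"] exI[of _ "\<lambda>i. c' i + d' i"])
         (simp add: F(3,4) G(3,4) F' G' sum.distrib scaleC_add_left)
  qed
  have R_scale: "R (b *\<^sub>C u) (b *\<^sub>C v)" if uv: "R u v" for u v b
  proof -
    obtain F c where F: "finite F" "F \<subseteq> S" "u = (\<Sum>i\<in>F. c i *\<^sub>C x i)" "v = (\<Sum>i\<in>F. c i *\<^sub>C y i)"
      using uv unfolding R_def by blast
    show ?thesis
      unfolding R_def using F
      by (intro exI[of _ F] exI[of _ "\<lambda>i. b * c i"]) (simp add: scaleC_sum_right scaleC_scaleC)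
  qed
  \<comment> \<open>The sign of \<open>M\<close> is left open, so the estimates below use its
    absolute value.\<close>
  have R_norm: "norm v \<le> \<bar>M\<bar> * norm u" if "R u v" for u v
  proof -
    have "norm v \<le> M * norm u" using that le unfolding R_def by blast
    also have "\<dots> \<le> \<bar>M\<bar> * norm u" by (rule mult_right_mono) auto
    finally show ?thesis .
  qed
  have R_diff: "R (u - u') (v - v')" if "R u v" "R u' v'" for u v u' v'
    using R_add[OF that(1) R_scale[OF that(2), of "-1"]]
    by (metis scaleR_minus1_left scaleR_scaleC of_real_minus of_real_1 diff_conv_add_uminus)
  have R_dom: "\<exists>v. R u v" if "u \<in> cspan (x ` S)" for u
    using that
  proof (induction rule: complex_vector.span_induct_alt)
    case base
    have "R 0 0" unfolding R_def by (intro exI[of _ "{}"]) simp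
    then show ?case by blast
  next
    case (step c u v)
    then obtain i where i: "i \<in> S" "u = x i" by blast
    have "R u (y i)" unfolding R_def i(2) using i(1)
      by (intro exI[of _ "{i}"] exI[of _ "\<lambda>_. 1"]) (simp add: scaleC_one)
    then show ?case using step R_add R_scale by metis
  qed
  define Q where "Q u v \<longleftrightarrow> (\<exists>U V. (\<forall>n. R (U n) (V n)) \<and> U \<longlonglongrightarrow> u \<and> V \<longlonglongrightarrow> v)" for u v
  have Q_ex: "\<exists>v. Q u v" for u
  proof -
    obtain U where U: "\<And>n. U n \<in> cspan (x ` S)" "U \<longlonglongrightarrow> u"
      using total closure_sequential[of u "cspan (x ` S)"] by auto
    have "\<forall>n. \<exists>v. R (U n) v" using R_dom U(1) by blast
    then obtain V where V: "\<And>n. R (U n) (V n)" using choice[of "\<lambda>n v. R (U n) v"] by blast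
    have "Cauchy V"
    proof (rule CauchyI)
      fix e :: real assume "0 < e"
      then have e: "0 < e / (\<bar>M\<bar> + 1)" by simp
      obtain N where N: "\<And>m n. m \<ge> N \<Longrightarrow> n \<ge> N \<Longrightarrow> norm (U m - U n) < e / (\<bar>M\<bar> + 1)"
        using CauchyD[OF LIMSEQ_imp_Cauchy[OF U(2)] e] by blast
      have "norm (V m - V n) < e" if "m \<ge> N" "n \<ge> N" for m n
      proof -
        have "norm (V m - V n) \<le> \<bar>M\<bar> * norm (U m - U n)" by (rule R_norm[OF R_diff[OF V V]])
        also have "\<dots> \<le> (\<bar>M\<bar> + 1) * norm (U m - U n)" by (rule mult_right_mono) auto
        also have "\<dots> < e" using N[OF that] by (simp add: pos_less_divide_eq mult.commute)
        finally show ?thesis .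
      qed
      then show "\<exists>N. \<forall>m\<ge>N. \<forall>n\<ge>N. norm (V m - V n) < e" by blast
    qed
    then obtain v where "V \<longlonglongrightarrow> v" using Cauchy_convergent convergent_def by blast
    then show ?thesis unfolding Q_def using U V by blast
  qed
  have Q_norm: "norm v \<le> \<bar>M\<bar> * norm u" if Q: "Q u v" for u v
  proof -
    obtain U V where "\<And>n. R (U n) (V n)" "U \<longlonglongrightarrow> u" "V \<longlonglongrightarrow> v" using Q unfolding Q_def by blast
    then show ?thesis
      by (intro LIMSEQ_le[OF tendsto_norm tendsto_mult_left[OF tendsto_norm]]) (auto intro: R_norm)
  qed
  have Q_add: "Q (u + u') (v + v')" if Q: "Q u v" "Q u' v'" for u v u' v'
  proof -
    obtain U V where 1: "\<And>n. R (U n) (V n)" "U \<longlonglongrightarrow> u" "V \<longlonglongrightarrow> v" using Q(1) unfolding Q_def by blast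
    obtain U' V' where 2: "\<And>n. R (U' n) (V' n)" "U' \<longlonglongrightarrow> u'" "V' \<longlonglongrightarrow> v'" using Q(2) unfolding Q_def by blast
    show ?thesis
      unfolding Q_def using 1 2
      by (intro exI[of _ "\<lambda>n. U n + U' n"] exI[of _ "\<lambda>n. V n + V' n"]) (auto intro: R_add tendsto_add)
  qed
  have Q_scale: "Q (c *\<^sub>C u) (c *\<^sub>C v)" if Q: "Q u v" for u v c
  proof -
    obtain U V where 1: "\<And>n. R (U n) (V n)" "U \<longlonglongrightarrow> u" "V \<longlonglongrightarrow> v" using Q(1) unfolding Q_def by blast
    show ?thesis
      unfolding Q_def using 1
      by (intro exI[of _ "\<lambda>n. c *\<^sub>C U n"] exI[of _ "\<lambda>n. c *\<^sub>C V n"]) (auto intro: R_scale tendsto_scaleC)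
  qed
  have Q_unique: "v = v'" if "Q u v" "Q u v'" for u v v'
  proof -
    have "Q (u + (-1) *\<^sub>C u) (v + (-1) *\<^sub>C v')" using that by (intro Q_add Q_scale)
    then show ?thesis using Q_norm scaleR_scaleC[of "-1" v'] scaleR_scaleC[of "-1" u] by fastforce
  qed
  obtain T where T: "\<And>u. Q u (T u)" using Q_ex by metis
  have "bounded_clinear T"
    by (rule bounded_clinearI[where M="\<bar>M\<bar>"])
       (blast intro: Q_unique[OF T Q_add[OF T T]] Q_unique[OF T Q_scale[OF T]] Q_norm T)+
  moreover have "T (x i) = y i" if "i \<in> S" for i
  proof -
    have "R (x i) (y i)" unfolding R_def using that
      by (intro exI[of _ "{i}"] exI[of _ "\<lambda>_. 1"]) (simp add: scaleC_one)
    then have "Q (x i) (y i)" unfolding Q_def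
      by (intro exI[of _ "\<lambda>_. x i"] exI[of _ "\<lambda>_. y i"]) simp
    then show ?thesis using Q_unique T by blast
  qed
  ultimately show ?thesis using that by blast
qed

lemma cinner_sum_sum:
  "cinner (\<Sum>i\<in>F. c i *\<^sub>C x i) (\<Sum>i\<in>G. d i *\<^sub>C (y i::'a::complex_inner)) =
    (\<Sum>i\<in>F. \<Sum>j\<in>G. cnj (c i) * d j * cinner (x i) (y j))"
  by (simp add: cinner_sum_left cinner_sum_right cinner_scaleC_left cinner_scaleC_right sum_distrib_left
      mult_ac) (rule sum.swap)

text \<open>Equal Gram matrices give equal norms of all corresponding finite combinations, so the
  extension principle applies with constant 1.\<close>

lemma isometric_extension:
  fixes x :: "'i \<Rightarrow> 'a::chilbert_space" and y :: "'i \<Rightarrow> 'b::chilbert_space"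
  assumes total: "closure (cspan (x ` S)) = UNIV"
    and eq: "\<And>i j. i \<in> S \<Longrightarrow> j \<in> S \<Longrightarrow> cinner (y i) (y j) = cinner (x i) (x j)"
  obtains T where "bounded_clinear T" "\<And>i. i \<in> S \<Longrightarrow> T (x i) = y i"
proof (rule bounded_clinear_extension[OF total, of y 1])
  fix F c assume "finite F" "F \<subseteq> S"
  then have "cinner (\<Sum>i\<in>F. c i *\<^sub>C y i) (\<Sum>i\<in>F. c i *\<^sub>C y i) = cinner (\<Sum>i\<in>F. c i *\<^sub>C x i) (\<Sum>i\<in>F. c i *\<^sub>C x i)"
    unfolding cinner_sum_sum by (intro sum.cong refl) (use eq in \<open>simp add: subset_iff\<close>)
  then show "norm (\<Sum>i\<in>F. c i *\<^sub>C y i) \<le> 1 * norm (\<Sum>i\<in>F. c i *\<^sub>C x i)"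
    using cinner_norm_eqI by fastforce
qed (use that in blast)

section \<open>Totality of elementary tensors and tensor products of operators\<close>

lemma kembed_add: "kembed (f + g) = kembed f + kembed g"
  by (simp add: kembed_def abs_completion_add)

lemma kembed_kcoef: "kembed (kcoef c f) = c *\<^sub>C kembed f"
  by (simp add: kembed_def abs_completion_scaleC)

lemma kembed_in_span: "kembed f \<in> cspan (range kvec)"
proof (induction f rule: update_induct)
  case const
  have "kembed (0::'a \<Rightarrow>\<^sub>0 complex) = 0" by (simp add: kembed_def abs_completion_zero)
  then show ?case by (simp add: complex_vector.span_zero)
next
  case (update f a b)
  have "Poly_Mapping.update a b f = f + kcoef b (Poly_Mapping.single a 1)"
    using update(1) by (intro poly_mapping_eqI) (auto simp: lookup_add lookup_update lookup_single when_def in_keys_iff)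
  then have "kembed (Poly_Mapping.update a b f) = kembed f + b *\<^sub>C kvec a"
    by (simp add: kembed_add kembed_kcoef kvec_def)
  then show ?case
    using update by (simp add: complex_vector.span_add complex_vector.span_scale complex_vector.span_base)
qed

lemma total_kvec: "closure (cspan (range (kvec :: 'a::pos_def_kernel \<Rightarrow> _))) = UNIV"
proof -
  have "x \<in> closure (cspan (range kvec))" for x :: "'a completion"
  proof -
    obtain X where X: "kcauchy X" "x = abs_completion X" by (rule completion_cases)
    show ?thesis
      unfolding closure_sequential X(2)
      by (rule exI[of _ "\<lambda>n. kembed (X n)"]) (simp add: kembed_in_span kembed_tendsto[OF X(1)])
  qed
  then show ?thesis by blast
qed

abbreviation pure_tensors :: "('a::complex_inner, 'b::complex_inner) tensor set"
  where "pure_tensors \<equiv> {u \<otimes>\<^sub>H v | u v. True}"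

lemma total_tensor: "closure (cspan (pure_tensors :: ('a::complex_inner, 'b::complex_inner) tensor set)) = UNIV"
proof -
  have "range kvec = (pure_tensors :: ('a, 'b) tensor set)"
    by (auto simp: tensor_def) (metis pure_tensor.exhaust)
  then show ?thesis using total_kvec by metis
qed

lemma tensor_ext_cinner:
  "(\<And>u v. cinner (u \<otimes>\<^sub>H v) x = cinner (u \<otimes>\<^sub>H v) y) \<Longrightarrow> x = y"
  by (rule eq_on_total_cinner[OF total_tensor]) auto

lemma tensor_ext:
  assumes "bounded_clinear S" "bounded_clinear T" "\<And>u v. S (u \<otimes>\<^sub>H v) = T (u \<otimes>\<^sub>H v)"
  shows "S = T"
  by (rule bounded_clinear_eq_on_total[OF assms(1,2) total_tensor]) (use assms(3) in auto)

lemma tensor_add_left: "(u + u') \<otimes>\<^sub>H v = u \<otimes>\<^sub>H v + u' \<otimes>\<^sub>H v"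
  by (rule tensor_ext_cinner) (simp add: cinner_tensor cinner_simps algebra_simps)

lemma tensor_add_right: "u \<otimes>\<^sub>H (v + v') = u \<otimes>\<^sub>H v + u \<otimes>\<^sub>H v'"
  by (rule tensor_ext_cinner) (simp add: cinner_tensor cinner_simps algebra_simps)

lemma tensor_scaleC_left: "(c *\<^sub>C u) \<otimes>\<^sub>H v = c *\<^sub>C (u \<otimes>\<^sub>H v)"
  by (rule tensor_ext_cinner) (simp add: cinner_tensor cinner_simps algebra_simps)

lemma tensor_scaleC_right: "u \<otimes>\<^sub>H (c *\<^sub>C v) = c *\<^sub>C (u \<otimes>\<^sub>H v)"
  by (rule tensor_ext_cinner) (simp add: cinner_tensor cinner_simps algebra_simps)

lemma tensor_zero_left: "0 \<otimes>\<^sub>H v = 0"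
  using tensor_scaleC_left[of 0 0 v] by (simp add: scaleC_zero_left)

lemma tensor_zero_right: "u \<otimes>\<^sub>H 0 = 0"
  using tensor_scaleC_right[of u 0 0] by (simp add: scaleC_zero_left)

lemma norm_tensor: "norm (u \<otimes>\<^sub>H v) = norm u * norm v"
proof -
  have "cinner (u \<otimes>\<^sub>H v) (u \<otimes>\<^sub>H v) = of_real ((norm u * norm v)\<^sup>2)"
    by (simp add: cinner_tensor cinner_self[of u] cinner_self[of v] power_mult_distrib)
  then have "(norm (u \<otimes>\<^sub>H v))\<^sup>2 = (norm u * norm v)\<^sup>2"
    unfolding cinner_self of_real_eq_iff .
  then show ?thesis by (simp add: power2_eq_iff_nonneg)
qed

text \<open>This bounds \<open>S\<close> tensored with the identity on finite sums of elementary
  tensors. The kernel \<open>?K\<close> is positive semidefinite since \<open>norm (S x)\<close> is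
  at most \<open>onorm S * norm x\<close>, and its entrywise product with the Gram matrix of the
  \<open>v i\<close> is again positive semidefinite.\<close>

lemma norm_tensor_apply_left:
  assumes S: "bounded_clinear S" and F: "finite F"
  shows "norm (\<Sum>i\<in>F. c i *\<^sub>C (S (u i) \<otimes>\<^sub>H v i)) \<le> onorm S * norm (\<Sum>i\<in>F. c i *\<^sub>C (u i \<otimes>\<^sub>H v i))"
proof -
  let ?K = "\<lambda>i j. of_real ((onorm S)\<^sup>2) * cinner (u i) (u j) - cinner (S (u i)) (S (u j))"
  have S0: "0 \<le> onorm S" by (rule onorm_pos_le[OF bounded_clinear_linear[OF S]])
  have K: "0 \<le> Re (\<Sum>i\<in>F. \<Sum>j\<in>F. cnj (d i) * d j * ?K i j)" for d
  proof -
    let ?x = "\<Sum>i\<in>F. d i *\<^sub>C u i"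
    have Sx: "S ?x = (\<Sum>i\<in>F. d i *\<^sub>C S (u i))" using S by (simp add: bounded_clinearD)
    have "(\<Sum>i\<in>F. \<Sum>j\<in>F. cnj (d i) * d j * ?K i j) =
        of_real ((onorm S)\<^sup>2) * cinner ?x ?x - cinner (S ?x) (S ?x)"
      unfolding Sx cinner_sum_sum by (simp add: sum_subtractf algebra_simps sum_distrib_left)
    also have "\<dots> = of_real ((onorm S * norm ?x)\<^sup>2 - (norm (S ?x))\<^sup>2)"
      by (simp add: cinner_self power_mult_distrib)
    finally have "Re (\<Sum>i\<in>F. \<Sum>j\<in>F. cnj (d i) * d j * ?K i j) = (onorm S * norm ?x)\<^sup>2 - (norm (S ?x))\<^sup>2"
      by (simp only: Re_complex_of_real)
    then show ?thesis using power_mono[OF bounded_clinear_norm[OF S, of ?x], of 2] by simp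
  qed
  \<comment> \<open>The Schur product theorem, with one factor a Gram matrix.\<close>
  have "0 \<le> Re (\<Sum>i\<in>F. \<Sum>j\<in>F. cnj (c i) * c j * (cinner (v i) (v j) * ?K i j))"
    by (rule psd_mult_gram[OF F K])
  also have "(\<Sum>i\<in>F. \<Sum>j\<in>F. cnj (c i) * c j * (cinner (v i) (v j) * ?K i j)) =
     of_real ((onorm S)\<^sup>2) * cinner (\<Sum>i\<in>F. c i *\<^sub>C (u i \<otimes>\<^sub>H v i)) (\<Sum>i\<in>F. c i *\<^sub>C (u i \<otimes>\<^sub>H v i))
     - cinner (\<Sum>i\<in>F. c i *\<^sub>C (S (u i) \<otimes>\<^sub>H v i)) (\<Sum>i\<in>F. c i *\<^sub>C (S (u i) \<otimes>\<^sub>H v i))"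
    unfolding cinner_sum_sum cinner_tensor by (simp add: sum_subtractf algebra_simps sum_distrib_left)
  also have "\<dots> = of_real ((onorm S * norm (\<Sum>i\<in>F. c i *\<^sub>C (u i \<otimes>\<^sub>H v i)))\<^sup>2
      - (norm (\<Sum>i\<in>F. c i *\<^sub>C (S (u i) \<otimes>\<^sub>H v i)))\<^sup>2)"
    by (simp add: cinner_self power_mult_distrib)
  finally have "(norm (\<Sum>i\<in>F. c i *\<^sub>C (S (u i) \<otimes>\<^sub>H v i)))\<^sup>2 \<le> (onorm S * norm (\<Sum>i\<in>F. c i *\<^sub>C (u i \<otimes>\<^sub>H v i)))\<^sup>2"
    unfolding Re_complex_of_real by simp
  then show ?thesis by (rule power2_le_imp_le) (use S0 in simp)
qed

text \<open>Exchanging the two factors is isometric, which carries the bound for operators on the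
  first factor over to the second.\<close>

lemma cinner_tensor_swap:
  "cinner (\<Sum>i\<in>F. c i *\<^sub>C (u i \<otimes>\<^sub>H v i)) (\<Sum>i\<in>F. c i *\<^sub>C (u i \<otimes>\<^sub>H v i)) =
   cinner (\<Sum>i\<in>F. c i *\<^sub>C (v i \<otimes>\<^sub>H u i)) (\<Sum>i\<in>F. c i *\<^sub>C (v i \<otimes>\<^sub>H u i))"
  unfolding cinner_sum_sum cinner_tensor by (simp add: mult.commute)

lemma norm_tensor_apply_right:
  assumes "bounded_clinear T" "finite F"
  shows "norm (\<Sum>i\<in>F. c i *\<^sub>C (u i \<otimes>\<^sub>H T (v i))) \<le> onorm T * norm (\<Sum>i\<in>F. c i *\<^sub>C (u i \<otimes>\<^sub>H v i))"
  using norm_tensor_apply_left[OF assms, of c v u]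
    cinner_norm_eqI[OF cinner_tensor_swap[of c u "\<lambda>i. T (v i)" F]]
    cinner_norm_eqI[OF cinner_tensor_swap[of c u v F]] by simp

text \<open>Bounding \<open>T\<close> on the second factor and then \<open>S\<close> on the first
  gives the constant \<open>onorm S * onorm T\<close>, so the assignment on elementary tensors
  extends. Totality of elementary tensors gives uniqueness, which resolves the definite
  description.\<close>

lemma tensor_op_ex:
  assumes S: "bounded_clinear S" and T: "bounded_clinear T"
  shows "bounded_clinear (S \<otimes>\<^sub>o T) \<and> (\<forall>u v. (S \<otimes>\<^sub>o T) (u \<otimes>\<^sub>H v) = S u \<otimes>\<^sub>H T v)"
proof -
  let ?x = "\<lambda>p. fst p \<otimes>\<^sub>H snd p" and ?y = "\<lambda>p. S (fst p) \<otimes>\<^sub>H T (snd p)"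
  have rng: "range ?x = pure_tensors" by (auto simp: image_iff) blast
  have total: "closure (cspan (range ?x)) = UNIV" unfolding rng by (rule total_tensor)
  have le: "norm (\<Sum>i\<in>F. c i *\<^sub>C ?y i) \<le> (onorm S * onorm T) * norm (\<Sum>i\<in>F. c i *\<^sub>C ?x i)"
    if F: "finite F" for F c
  proof -
    have "norm (\<Sum>i\<in>F. c i *\<^sub>C ?y i) \<le> onorm S * norm (\<Sum>i\<in>F. c i *\<^sub>C (fst i \<otimes>\<^sub>H T (snd i)))"
      by (rule norm_tensor_apply_left[OF S F])
    also have "\<dots> \<le> onorm S * (onorm T * norm (\<Sum>i\<in>F. c i *\<^sub>C ?x i))"
      by (intro mult_left_mono norm_tensor_apply_right[OF T F] onorm_pos_le[OF bounded_clinear_linear[OF S]])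
    finally show ?thesis by (simp add: mult.assoc)
  qed
  obtain R where R: "bounded_clinear R" "\<And>p. R (?x p) = ?y p"
    using bounded_clinear_extension[OF total le] by auto
  let ?P = "\<lambda>R. bounded_clinear R \<and> (\<forall>u v. R (u \<otimes>\<^sub>H v) = S u \<otimes>\<^sub>H T v)"
  have "?P R" using R(1) R(2)[of "(u, v)" for u v] by simp
  moreover have "R' = R" if "?P R'" for R'
    using that R tensor_ext[of R' R] R(2)[of "(u, v)" for u v] by simp
  ultimately show ?thesis unfolding tensor_op_def by (rule theI)
qed

lemma bounded_clinear_tensor_op:
  "bounded_clinear S \<Longrightarrow> bounded_clinear T \<Longrightarrow> bounded_clinear (S \<otimes>\<^sub>o T)"
  using tensor_op_ex by blast

lemma tensor_op_tensor:
  "bounded_clinear S \<Longrightarrow> bounded_clinear T \<Longrightarrow> (S \<otimes>\<^sub>o T) (u \<otimes>\<^sub>H v) = S u \<otimes>\<^sub>H T v"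
  using tensor_op_ex by blast

lemma tensor_op_id: "id \<otimes>\<^sub>o id = id"
  by (rule tensor_ext) (auto simp: tensor_op_tensor bounded_clinear_id intro!: bounded_clinear_tensor_op)

lemma tensor_op_compose:
  assumes "bounded_clinear S" "bounded_clinear T" "bounded_clinear S'" "bounded_clinear T'"
  shows "(S \<otimes>\<^sub>o T) \<circ> (S' \<otimes>\<^sub>o T') = (S \<circ> S') \<otimes>\<^sub>o (T \<circ> T')"
  by (rule tensor_ext)
     (use assms in \<open>auto simp: tensor_op_tensor bounded_clinear_compose
       intro!: bounded_clinear_compose bounded_clinear_tensor_op\<close>)

lemma cadjoint_tensor_op:
  assumes S: "bounded_clinear S" and T: "bounded_clinear T"
  shows "cadjoint (S \<otimes>\<^sub>o T) = cadjoint S \<otimes>\<^sub>o cadjoint T"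
proof (rule tensor_ext)
  note S' = bounded_clinear_cadjoint[OF S] and T' = bounded_clinear_cadjoint[OF T]
  show "bounded_clinear (cadjoint (S \<otimes>\<^sub>o T))" "bounded_clinear (cadjoint S \<otimes>\<^sub>o cadjoint T)"
    by (intro bounded_clinear_cadjoint bounded_clinear_tensor_op S T S' T')+
  show "cadjoint (S \<otimes>\<^sub>o T) (u \<otimes>\<^sub>H v) = (cadjoint S \<otimes>\<^sub>o cadjoint T) (u \<otimes>\<^sub>H v)" for u v
    by (rule tensor_ext_cinner)
       (simp add: cinner_cadjoint[symmetric] bounded_clinear_tensor_op S T S' T' tensor_op_tensor cinner_tensor)
qed

lemma tensor_op_add_left:
  assumes "bounded_clinear S" "bounded_clinear S'" "bounded_clinear T"
  shows "(\<lambda>u. S u + S' u) \<otimes>\<^sub>o T = (\<lambda>v. (S \<otimes>\<^sub>o T) v + (S' \<otimes>\<^sub>o T) v)"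
  by (rule tensor_ext)
     (use assms in \<open>auto simp: tensor_op_tensor bounded_clinear_add tensor_add_left
       intro!: bounded_clinear_add bounded_clinear_tensor_op\<close>)

lemma tensor_op_scaleC_left:
  assumes "bounded_clinear S" "bounded_clinear T"
  shows "(\<lambda>u. c *\<^sub>C S u) \<otimes>\<^sub>o T = (\<lambda>v. c *\<^sub>C (S \<otimes>\<^sub>o T) v)"
  by (rule tensor_ext)
     (use assms in \<open>auto simp: tensor_op_tensor bounded_clinear_scale tensor_scaleC_left
       intro!: bounded_clinear_scale bounded_clinear_tensor_op\<close>)

lemma tensor_op_zero_left:
  assumes "bounded_clinear T" shows "(\<lambda>_. 0) \<otimes>\<^sub>o T = (\<lambda>_. 0)"
  by (rule tensor_ext)
     (use assms in \<open>auto simp: tensor_op_tensor bounded_clinear_zero tensor_zero_left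
       intro!: bounded_clinear_zero bounded_clinear_tensor_op\<close>)

lemma tensor_op_sum_left:
  assumes "\<And>i. i \<in> F \<Longrightarrow> bounded_clinear (S i)" "bounded_clinear T"
  shows "(\<lambda>u. \<Sum>i\<in>F. S i u) \<otimes>\<^sub>o T = (\<lambda>v. \<Sum>i\<in>F. (S i \<otimes>\<^sub>o T) v)"
  using assms
proof (induction F rule: infinite_finite_induct)
  case (insert i F)
  then show ?case by (simp add: tensor_op_add_left bounded_clinear_sum)
qed (simp_all add: tensor_op_zero_left)

lemma bounded_clinear_Eket: "bounded_clinear (Eket z)"
  by (rule bounded_clinearI[where M="norm z"])
     (simp_all add: Eket_def tensor_add_left tensor_scaleC_left norm_tensor)

lemma bounded_clinear_tensor_right: "bounded_clinear (\<lambda>v. u \<otimes>\<^sub>H v)"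
  by (rule bounded_clinearI[where M="norm u"])
     (simp_all add: tensor_add_right tensor_scaleC_right norm_tensor)

lemma bounded_clinear_Ebra: "bounded_clinear (Ebra z)"
  unfolding Ebra_def by (intro bounded_clinear_cadjoint bounded_clinear_Eket)

lemma cinner_Ebra: "cinner u (Ebra z v) = cinner (u \<otimes>\<^sub>H z) v"
  unfolding Ebra_def by (simp add: cinner_cadjoint[OF bounded_clinear_Eket, symmetric]) (simp add: Eket_def)

lemma Ebra_tensor: "Ebra z (u \<otimes>\<^sub>H w) = cinner z w *\<^sub>C u"
  by (rule cinner_ext) (simp add: cinner_Ebra cinner_tensor cinner_simps)

lemma Ebra_ext:
  assumes "\<And>z. Ebra z v = Ebra z w" shows "v = w"
  by (rule tensor_ext_cinner) (metis assms cinner_Ebra)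

lemma Ebra_tensor_op_Eket:
  assumes "bounded_clinear S" "bounded_clinear T"
  shows "Ebra z ((S \<otimes>\<^sub>o T) (Eket w u)) = cinner z (T w) *\<^sub>C S u"
  using assms by (simp add: Eket_def tensor_op_tensor Ebra_tensor)

text \<open>Tensoring with the rank one operator from \<open>b\<close> to \<open>a\<close>
  compresses by \<open>Ebra b\<close> and reinserts by \<open>Eket a\<close>. This is how the blocks
  of \<open>\<phi>\<close> become elementary tensors.\<close>

lemma tensor_op_rank_one:
  assumes "bounded_clinear S"
  shows "(S \<otimes>\<^sub>o (\<lambda>\<zeta>. cinner b \<zeta> *\<^sub>C a)) v = Eket a (S (Ebra b v))"
proof -
  have r: "bounded_clinear (\<lambda>\<zeta>. cinner b \<zeta> *\<^sub>C a)"
    by (rule bounded_clinear_comp[OF bounded_clinear_scaleC_left bounded_clinear_cinner])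
  have "S \<otimes>\<^sub>o (\<lambda>\<zeta>. cinner b \<zeta> *\<^sub>C a) = (\<lambda>v. Eket a (S (Ebra b v)))"
  proof (rule tensor_ext)
    show "bounded_clinear (S \<otimes>\<^sub>o (\<lambda>\<zeta>. cinner b \<zeta> *\<^sub>C a))"
      by (rule bounded_clinear_tensor_op[OF assms r])
    show "bounded_clinear (\<lambda>v. Eket a (S (Ebra b v)))"
      by (rule bounded_clinear_comp[OF bounded_clinear_Eket bounded_clinear_comp[OF assms bounded_clinear_Ebra]])
  qed (simp add: tensor_op_tensor assms r Ebra_tensor bounded_clinearD[OF assms]
      Eket_def tensor_scaleC_left tensor_scaleC_right)
  then show ?thesis by simp
qed

text \<open>An operator on a tensor product is determined by its entries in the first factor. This
  later makes the lifted solution independent of the representation of its argument.\<close>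

lemma operator_ext_matrix:
  fixes S T :: "('a::chilbert_space, 'b::chilbert_space) tensor \<Rightarrow> ('c::chilbert_space, 'd::chilbert_space) tensor"
  assumes "bounded_clinear S" "bounded_clinear T"
    "\<And>z w u. Ebra z (S (Eket w u)) = Ebra z (T (Eket w u))"
  shows "S = T"
proof (rule tensor_ext[OF assms(1,2)])
  show "S (u \<otimes>\<^sub>H w) = T (u \<otimes>\<^sub>H w)" for u w
    using Ebra_ext assms(3) unfolding Eket_def by blast
qed

section \<open>C*-algebras of operators\<close>

lemma operator_algebra_simps [simp]:
  "carrier (operator_algebra C) = C" "mult (operator_algebra C) = (\<circ>)" "one (operator_algebra C) = id"
  "zero (operator_algebra C) = (\<lambda>_. 0)" "add (operator_algebra C) = (\<lambda>S T u. S u + T u)"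
  "smult (operator_algebra C) = (\<lambda>c T u. c *\<^sub>C T u)" "cs_star (operator_algebra C) = cadjoint"
  "cs_norm (operator_algebra C) = onorm"
  by (simp_all add: operator_algebra_def)

lemma cring_complex_ring: "cring complex_ring"
proof (rule cringI)
  show "abelian_group complex_ring"
    by (rule abelian_groupI) (auto simp: complex_ring_def intro: exI[of _ "- x" for x])
  show "comm_monoid complex_ring"
    by (rule comm_monoidI) (auto simp: complex_ring_def)
qed (auto simp: complex_ring_def algebra_simps)

lemma complex_ring_simps [simp]:
  "carrier complex_ring = UNIV" "mult complex_ring = (*)" "one complex_ring = 1"
  "zero complex_ring = 0" "add complex_ring = (+)"
  by (simp_all add: complex_ring_def)

text \<open>Plain functions carry no norm topology; convergence in operator norm is expressed in the
  Banach space of bounded real-linear maps.\<close>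

lemma onorm_diff_Blinfun:
  assumes "bounded_clinear S" "bounded_clinear T"
  shows "onorm (\<lambda>u. S u - T u) = norm (Blinfun S - Blinfun T)"
  using assms
  by (simp add: norm_blinfun.rep_eq minus_blinfun.rep_eq bounded_linear_Blinfun_apply bounded_clinear_linear)

lemma Blinfun_tendsto_apply:
  assumes "\<And>n. bounded_clinear (X n)" "(\<lambda>n. Blinfun (X n)) \<longlonglongrightarrow> L"
  shows "(\<lambda>n. X n u) \<longlonglongrightarrow> blinfun_apply L u"
  using blinfun.tendsto[OF assms(2) tendsto_const, of u] assms(1)
  by (simp add: bounded_linear_Blinfun_apply bounded_clinear_linear)

text \<open>The limit is a priori only real-linear. Norm convergence implies pointwise convergence,
  under which complex homogeneity survives.\<close>

lemma Blinfun_limit: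
  assumes X: "\<And>n. bounded_clinear (X n)" and L: "(\<lambda>n. Blinfun (X n)) \<longlonglongrightarrow> L"
  shows "bounded_clinear (blinfun_apply L)" "Blinfun (blinfun_apply L) = L"
proof -
  have "blinfun_apply L (c *\<^sub>C u) = c *\<^sub>C blinfun_apply L u" for c u
  proof (rule LIMSEQ_unique)
    show "(\<lambda>n. X n (c *\<^sub>C u)) \<longlonglongrightarrow> blinfun_apply L (c *\<^sub>C u)"
      by (rule Blinfun_tendsto_apply[OF X L])
    show "(\<lambda>n. X n (c *\<^sub>C u)) \<longlonglongrightarrow> c *\<^sub>C blinfun_apply L u"
      using tendsto_scaleC[OF Blinfun_tendsto_apply[OF X L, of u], of c] X
      by (simp add: bounded_clinear_scaleC)
  qed
  then show "bounded_clinear (blinfun_apply L)"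
    by (simp add: bounded_clinear_def blinfun.bounded_linear_right)
  show "Blinfun (blinfun_apply L) = L" by (rule blinfun_apply_inverse)
qed

lemma Blinfun_inject_clinear:
  assumes "bounded_clinear S" "bounded_clinear T" "Blinfun S = Blinfun T" shows "S = T"
  using assms by (metis bounded_linear_Blinfun_apply bounded_clinear_linear)

text \<open>Only the closure conditions: for operators the ring, module and norm axioms hold
  automatically, so that norm closedness is all that separates this from
  \<open>cstar_algebra\<close>.\<close>

definition star_algebra :: "('h::chilbert_space \<Rightarrow> 'h) set \<Rightarrow> bool"
  where "star_algebra C \<longleftrightarrow> C \<subseteq> Collect bounded_clinear \<and> id \<in> C \<and> (\<lambda>_. 0) \<in> C \<and>
    (\<forall>S\<in>C. \<forall>T\<in>C. (\<lambda>u. S u + T u) \<in> C \<and> S \<circ> T \<in> C) \<and>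
    (\<forall>c. \<forall>S\<in>C. (\<lambda>u. c *\<^sub>C S u) \<in> C) \<and> (\<forall>S\<in>C. cadjoint S \<in> C)"

lemma star_algebraD:
  assumes "star_algebra C"
  shows "C \<subseteq> Collect bounded_clinear" "S \<in> C \<Longrightarrow> bounded_clinear S" "id \<in> C" "(\<lambda>_. 0) \<in> C"
    "S \<in> C \<Longrightarrow> T \<in> C \<Longrightarrow> (\<lambda>u. S u + T u) \<in> C" "S \<in> C \<Longrightarrow> T \<in> C \<Longrightarrow> S \<circ> T \<in> C"
    "S \<in> C \<Longrightarrow> (\<lambda>u. c *\<^sub>C S u) \<in> C" "S \<in> C \<Longrightarrow> cadjoint S \<in> C"
  using assms unfolding star_algebra_def by auto

lemma star_algebra_uminus:
  assumes "star_algebra C" "S \<in> C" shows "(\<lambda>u. - S u) \<in> C"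
  using star_algebraD(7)[OF assms, of "-1"] by simp

lemma abelian_group_operator:
  assumes C: "star_algebra C" shows "abelian_group (operator_algebra C)"
proof (rule abelian_groupI)
  show "\<exists>y\<in>carrier (operator_algebra C). y \<oplus>\<^bsub>operator_algebra C\<^esub> x = \<zero>\<^bsub>operator_algebra C\<^esub>"
    if "x \<in> carrier (operator_algebra C)" for x
  proof (rule bexI)
    show "(\<lambda>u. - x u) \<in> carrier (operator_algebra C)"
      using that star_algebra_uminus[OF C] by simp
  qed auto
qed (use star_algebraD[OF C] in \<open>auto simp: algebra_simps\<close>)

lemma operator_minus:
  assumes C: "star_algebra C" and "S \<in> C" "T \<in> C"
  shows "S \<ominus>\<^bsub>operator_algebra C\<^esub> T = (\<lambda>u. S u - T u)"
proof -
  interpret abelian_group "operator_algebra C" by (rule abelian_group_operator[OF C])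
  have "\<ominus>\<^bsub>operator_algebra C\<^esub> T = (\<lambda>u. - T u)"
    by (rule minus_equality) (use assms(3) star_algebra_uminus[OF C] in \<open>auto simp: fun_eq_iff\<close>)
  then show ?thesis by (simp add: a_minus_def fun_eq_iff)
qed

text \<open>The algebraic axioms are inherited from composition and pointwise operations. For
  completeness, a Cauchy sequence converges in the Banach space of bounded linear maps, its limit is
  complex linear by \<open>Blinfun_limit\<close>, and \<open>closed\<close> returns it to
  \<open>C\<close>.\<close>

lemma cstar_algebra_operator:
  assumes C: "star_algebra C"
    and closed: "\<And>X T. (\<And>n. X n \<in> C) \<Longrightarrow> bounded_clinear T \<Longrightarrow> (\<lambda>n. Blinfun (X n)) \<longlonglongrightarrow> Blinfun T \<Longrightarrow> T \<in> C"
  shows "cstar_algebra (operator_algebra C)"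
proof -
  note D = star_algebraD[OF C]
  have ring: "ring (operator_algebra C)"
  proof (rule ringI)
    show "abelian_group (operator_algebra C)" by (rule abelian_group_operator[OF C])
    show "monoid (operator_algebra C)" by (rule monoidI) (use D in auto)
  qed (use D in \<open>auto simp: bounded_clinearD fun_eq_iff\<close>)
  have module: "module complex_ring (operator_algebra C)"
    by (rule moduleI)
       (use D abelian_group_operator[OF C] cring_complex_ring in
         \<open>auto simp: scaleC_add_left scaleC_add_right scaleC_scaleC scaleC_one\<close>)
  have norm: "0 \<le> onorm S \<and> (onorm S = 0 \<longleftrightarrow> S = (\<lambda>_. 0)) \<and> onorm (\<lambda>u. S u + T u) \<le> onorm S + onorm T \<and>
      onorm (\<lambda>u. c *\<^sub>C S u) = cmod c * onorm S \<and> onorm (S \<circ> T) \<le> onorm S * onorm T \<and>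
      onorm (cadjoint S \<circ> S) = (onorm S)\<^sup>2" if "S \<in> C" "T \<in> C" for S T c
  proof (intro conjI)
    note [simp] = D(2)[OF that(1)] D(2)[OF that(2)] bounded_clinear_linear
    show "0 \<le> onorm S" by (simp add: onorm_pos_le)
    show "onorm S = 0 \<longleftrightarrow> S = (\<lambda>_. 0)" by (simp add: onorm_eq_0 fun_eq_iff)
    show "onorm (\<lambda>u. S u + T u) \<le> onorm S + onorm T" by (simp add: onorm_triangle)
    show "onorm (\<lambda>u. c *\<^sub>C S u) = cmod c * onorm S" by (simp add: onorm_scaleC)
    show "onorm (S \<circ> T) \<le> onorm S * onorm T" by (simp add: onorm_comp_le)
    show "onorm (cadjoint S \<circ> S) = (onorm S)\<^sup>2" by (simp add: onorm_cadjoint_comp)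
  qed
  have star: "cadjoint S \<in> C \<and> cadjoint (cadjoint S) = S \<and>
      cadjoint (\<lambda>u. S u + T u) = (\<lambda>u. cadjoint S u + cadjoint T u) \<and>
      cadjoint (\<lambda>u. c *\<^sub>C S u) = (\<lambda>u. cnj c *\<^sub>C cadjoint S u) \<and>
      cadjoint (S \<circ> T) = cadjoint T \<circ> cadjoint S" if "S \<in> C" "T \<in> C" for S T c
    using D(2)[OF that(1)] D(2)[OF that(2)] D(8)[OF that(1)]
    by (simp add: cadjoint_cadjoint cadjoint_add cadjoint_scaleC cadjoint_compose)
  have complete: "\<exists>T\<in>C. (\<lambda>n. onorm (s n \<ominus>\<^bsub>operator_algebra C\<^esub> T)) \<longlonglongrightarrow> 0"
    if s: "\<And>n. s n \<in> C"
      and cau: "\<forall>\<epsilon>>0. \<exists>N::nat. \<forall>m\<ge>N. \<forall>n\<ge>N. onorm (s m \<ominus>\<^bsub>operator_algebra C\<^esub> s n) < \<epsilon>" for s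
  proof -
    have "Cauchy (\<lambda>n. Blinfun (s n))"
      using cau unfolding operator_minus[OF C s s] onorm_diff_Blinfun[OF D(2)[OF s] D(2)[OF s]]
      by (simp add: Cauchy_iff)
    then obtain L where L: "(\<lambda>n. Blinfun (s n)) \<longlonglongrightarrow> L" using Cauchy_convergent convergent_def by blast
    note lim = Blinfun_limit[OF D(2)[OF s] L]
    have LC: "blinfun_apply L \<in> C" using closed[OF s lim(1)] L lim(2) by simp
    have "(\<lambda>n. norm (Blinfun (s n) - L)) \<longlonglongrightarrow> 0" using L by (simp add: LIM_zero tendsto_norm_zero)
    then show ?thesis
      by (intro bexI[OF _ LC])
         (simp add: operator_minus[OF C s LC] onorm_diff_Blinfun[OF D(2)[OF s] lim(1)] lim(2))
  qed
  show ?thesis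
    unfolding cstar_algebra_def operator_algebra_simps
  proof (intro conjI)
    show "\<forall>c. \<forall>x\<in>C. \<forall>y\<in>C. (\<lambda>u. c *\<^sub>C x u) \<circ> y = (\<lambda>u. c *\<^sub>C (x \<circ> y) u) \<and>
         x \<circ> (\<lambda>u. c *\<^sub>C y u) = (\<lambda>u. c *\<^sub>C (x \<circ> y) u)"
      using D(2) by (auto simp: fun_eq_iff bounded_clinearD)
  qed (use ring module norm star complete in blast)+
qed

lemma star_algebra_UNIV: "star_algebra (Collect bounded_clinear)"
  unfolding star_algebra_def
  by (auto simp: bounded_clinear_id bounded_clinear_zero bounded_clinear_add bounded_clinear_compose
      bounded_clinear_scale bounded_clinear_cadjoint)

lemma cstar_algebra_bounded_operators: "cstar_algebra (operator_algebra (Collect bounded_clinear))"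
  by (rule cstar_algebra_operator[OF star_algebra_UNIV]) auto

lemma star_algebra_of_cstar:
  assumes "C \<subseteq> Collect bounded_clinear" "cstar_algebra (operator_algebra C)"
  shows "star_algebra C"
proof -
  have R: "ring (operator_algebra C)" and M: "module complex_ring (operator_algebra C)"
    and S: "\<And>x. x \<in> C \<Longrightarrow> cadjoint x \<in> C"
    using assms(2) unfolding cstar_algebra_def operator_algebra_simps by blast+
  interpret R: ring "operator_algebra C" by (rule R)
  interpret M: module complex_ring "operator_algebra C" by (rule M)
  show ?thesis
    unfolding star_algebra_def
    using assms(1) S R.a_closed R.m_closed R.one_closed R.zero_closed M.smult_closed by simp
qed

text \<open>Transport of structure along \<open>f\<close>, intended for \<open>f\<close> injective
  on the carrier; it moves an operator algebra into the type over which the universal property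
  quantifies.\<close>

definition cstar_copy :: "('a \<Rightarrow> 'b) \<Rightarrow> 'a cstar \<Rightarrow> 'b cstar"
  where "cstar_copy f C = (let g = the_inv_into (carrier C) f in
    \<lparr>carrier = f ` carrier C, mult = (\<lambda>x y. f (g x \<otimes>\<^bsub>C\<^esub> g y)), one = f \<one>\<^bsub>C\<^esub>, zero = f \<zero>\<^bsub>C\<^esub>,
     add = (\<lambda>x y. f (g x \<oplus>\<^bsub>C\<^esub> g y)), smult = (\<lambda>c x. f (c \<odot>\<^bsub>C\<^esub> g x)),
     cs_star = (\<lambda>x. f (cs_star C (g x))), cs_norm = (\<lambda>x. cs_norm C (g x))\<rparr>)"

lemma cstar_algebra_complete:
  assumes "cstar_algebra C" "\<And>n. s n \<in> carrier C"
    "\<forall>\<epsilon>>0. \<exists>N::nat. \<forall>m\<ge>N. \<forall>n\<ge>N. cs_norm C (s m \<ominus>\<^bsub>C\<^esub> s n) < \<epsilon>"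
  obtains x where "x \<in> carrier C" "(\<lambda>n. cs_norm C (s n \<ominus>\<^bsub>C\<^esub> x)) \<longlonglongrightarrow> 0"
proof -
  have "\<forall>s. (\<forall>n. s n \<in> carrier C) \<and>
       (\<forall>\<epsilon>>0. \<exists>N::nat. \<forall>m\<ge>N. \<forall>n\<ge>N. cs_norm C (s m \<ominus>\<^bsub>C\<^esub> s n) < \<epsilon>) \<longrightarrow>
       (\<exists>x\<in>carrier C. (\<lambda>n. cs_norm C (s n \<ominus>\<^bsub>C\<^esub> x)) \<longlonglongrightarrow> 0)"
    using assms(1) unfolding cstar_algebra_def by (elim conjE)
  from this[rule_format, of s] show ?thesis using assms(2,3) that by blast
qed

lemma cstar_copy:
  assumes C: "cstar_algebra C" and f: "inj_on f (carrier C)"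
  shows "cstar_algebra (cstar_copy f C)" "star_hom C (cstar_copy f C) f"
    "star_hom (cstar_copy f C) C (the_inv_into (carrier C) f)"
proof -
  let ?B = "cstar_copy f C"
  define g where "g = the_inv_into (carrier C) f"
  have gf: "g (f x) = x" if "x \<in> carrier C" for x
    using that f by (simp add: g_def the_inv_into_f_f)
  have B: "carrier ?B = f ` carrier C" "mult ?B = (\<lambda>x y. f (g x \<otimes>\<^bsub>C\<^esub> g y))" "one ?B = f \<one>\<^bsub>C\<^esub>"
    "zero ?B = f \<zero>\<^bsub>C\<^esub>" "add ?B = (\<lambda>x y. f (g x \<oplus>\<^bsub>C\<^esub> g y))" "smult ?B = (\<lambda>c x. f (c \<odot>\<^bsub>C\<^esub> g x))"
    "cs_star ?B = (\<lambda>x. f (cs_star C (g x)))" "cs_norm ?B = (\<lambda>x. cs_norm C (g x))"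
    by (simp_all add: cstar_copy_def g_def Let_def)
  have R: "ring C" and M: "module complex_ring C"
    using C unfolding cstar_algebra_def by blast+
  interpret C: ring C by (rule R)
  interpret M: module complex_ring C by (rule M)
  have smult: "c \<odot>\<^bsub>C\<^esub> x \<in> carrier C" if "x \<in> carrier C" for c x using that M.smult_closed by simp
  have ab: "abelian_group ?B"
  proof (rule abelian_groupI)
    show "\<exists>y\<in>carrier ?B. y \<oplus>\<^bsub>?B\<^esub> x = \<zero>\<^bsub>?B\<^esub>" if x: "x \<in> carrier ?B" for x
    proof -
      obtain z where z: "z \<in> carrier C" "x = f z" using x unfolding B(1) by blast
      show ?thesis by (rule bexI[of _ "f (\<ominus>\<^bsub>C\<^esub> z)"]) (auto simp: B z gf C.l_neg)
    qed
  qed (auto simp: B gf C.a_ac)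
  have ring: "ring ?B"
  proof (rule ringI)
    show "monoid ?B" by (rule monoidI) (auto simp: B gf C.m_assoc)
  qed (auto simp: B gf C.l_distr C.r_distr ab)
  have module: "module complex_ring ?B"
    by (rule moduleI)
       (use cring_complex_ring ab M.smult_l_distr M.smult_r_distr M.smult_assoc1 M.smult_one in
         \<open>auto simp: B gf smult\<close>)
  interpret BB: abelian_group ?B by (rule ab)
  \<comment> \<open>Subtraction is no field of the record but is derived from the additive inverse,
    so it is not among the equations \<open>B\<close> and has to be transported through uniqueness
    of inverses.\<close>
  have minus: "f x \<ominus>\<^bsub>?B\<^esub> f y = f (x \<ominus>\<^bsub>C\<^esub> y)" if "x \<in> carrier C" "y \<in> carrier C" for x y
  proof -
    have "\<ominus>\<^bsub>?B\<^esub> f y = f (\<ominus>\<^bsub>C\<^esub> y)"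
      by (rule BB.minus_equality) (use that in \<open>auto simp: B gf C.l_neg\<close>)
    then show ?thesis using that by (simp add: a_minus_def B gf)
  qed
  have complete: "\<exists>x\<in>carrier ?B. (\<lambda>n. cs_norm ?B (s n \<ominus>\<^bsub>?B\<^esub> x)) \<longlonglongrightarrow> 0"
    if s: "\<forall>n. s n \<in> carrier ?B"
      and cau: "\<forall>\<epsilon>>0. \<exists>N::nat. \<forall>m\<ge>N. \<forall>n\<ge>N. cs_norm ?B (s m \<ominus>\<^bsub>?B\<^esub> s n) < \<epsilon>" for s
  proof -
    have "\<forall>n. \<exists>x\<in>carrier C. s n = f x" using s by (auto simp: B)
    then obtain t where t: "\<And>n. t n \<in> carrier C" "\<And>n. s n = f (t n)" by metis
    have "\<forall>\<epsilon>>0. \<exists>N::nat. \<forall>m\<ge>N. \<forall>n\<ge>N. cs_norm C (t m \<ominus>\<^bsub>C\<^esub> t n) < \<epsilon>"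
      using cau by (simp add: t minus B gf)
    then obtain x where "x \<in> carrier C" "(\<lambda>n. cs_norm C (t n \<ominus>\<^bsub>C\<^esub> x)) \<longlonglongrightarrow> 0"
      using cstar_algebra_complete[of C t] C t(1) by blast
    then show ?thesis
      by (intro bexI[of _ "f x"]) (simp_all add: t minus B gf)
  qed
  have C': "cs_star C x \<in> carrier C" if "x \<in> carrier C" for x
    using C that unfolding cstar_algebra_def by blast
  note props = C[unfolded cstar_algebra_def]
  show "cstar_algebra ?B"
    unfolding cstar_algebra_def
  proof (intro conjI)
    show "\<forall>c. \<forall>x\<in>carrier ?B. \<forall>y\<in>carrier ?B.
       (c \<odot>\<^bsub>?B\<^esub> x) \<otimes>\<^bsub>?B\<^esub> y = c \<odot>\<^bsub>?B\<^esub> (x \<otimes>\<^bsub>?B\<^esub> y) \<and>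
       x \<otimes>\<^bsub>?B\<^esub> (c \<odot>\<^bsub>?B\<^esub> y) = c \<odot>\<^bsub>?B\<^esub> (x \<otimes>\<^bsub>?B\<^esub> y)"
      using props by (auto simp: B gf smult)
    show "\<forall>c. \<forall>x\<in>carrier ?B. \<forall>y\<in>carrier ?B.
       cs_star ?B x \<in> carrier ?B \<and> cs_star ?B (cs_star ?B x) = x \<and>
       cs_star ?B (x \<oplus>\<^bsub>?B\<^esub> y) = cs_star ?B x \<oplus>\<^bsub>?B\<^esub> cs_star ?B y \<and>
       cs_star ?B (c \<odot>\<^bsub>?B\<^esub> x) = cnj c \<odot>\<^bsub>?B\<^esub> cs_star ?B x \<and>
       cs_star ?B (x \<otimes>\<^bsub>?B\<^esub> y) = cs_star ?B y \<otimes>\<^bsub>?B\<^esub> cs_star ?B x"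
      using props by (auto simp: B gf smult C')
    show "\<forall>c. \<forall>x\<in>carrier ?B. \<forall>y\<in>carrier ?B.
       0 \<le> cs_norm ?B x \<and> (cs_norm ?B x = 0 \<longleftrightarrow> x = \<zero>\<^bsub>?B\<^esub>) \<and>
       cs_norm ?B (x \<oplus>\<^bsub>?B\<^esub> y) \<le> cs_norm ?B x + cs_norm ?B y \<and>
       cs_norm ?B (c \<odot>\<^bsub>?B\<^esub> x) = cmod c * cs_norm ?B x \<and>
       cs_norm ?B (x \<otimes>\<^bsub>?B\<^esub> y) \<le> cs_norm ?B x * cs_norm ?B y \<and>
       cs_norm ?B (cs_star ?B x \<otimes>\<^bsub>?B\<^esub> x) = (cs_norm ?B x)\<^sup>2"
    proof (intro allI ballI)
      fix c x y assume "x \<in> carrier ?B" "y \<in> carrier ?B"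
      then obtain u v where u: "u \<in> carrier C" "x = f u" and v: "v \<in> carrier C" "y = f v"
        by (auto simp: B)
      have z: "f u = f \<zero>\<^bsub>C\<^esub> \<longleftrightarrow> u = \<zero>\<^bsub>C\<^esub>" using f u(1) by (simp add: inj_on_eq_iff)
      show "0 \<le> cs_norm ?B x \<and> (cs_norm ?B x = 0 \<longleftrightarrow> x = \<zero>\<^bsub>?B\<^esub>) \<and>
       cs_norm ?B (x \<oplus>\<^bsub>?B\<^esub> y) \<le> cs_norm ?B x + cs_norm ?B y \<and>
       cs_norm ?B (c \<odot>\<^bsub>?B\<^esub> x) = cmod c * cs_norm ?B x \<and>
       cs_norm ?B (x \<otimes>\<^bsub>?B\<^esub> y) \<le> cs_norm ?B x * cs_norm ?B y \<and>
       cs_norm ?B (cs_star ?B x \<otimes>\<^bsub>?B\<^esub> x) = (cs_norm ?B x)\<^sup>2"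
        using props u(1) v(1) by (simp add: u(2) v(2) B gf smult C' z)
    qed
  qed (use ring module complete in blast)+
  show "star_hom C ?B f"
    unfolding star_hom_def by (auto simp: ring_hom_def B gf)
  show "star_hom ?B C (the_inv_into (carrier C) f)"
    unfolding star_hom_def g_def[symmetric] by (auto simp: ring_hom_def B gf smult C')
qed

section \<open>Homomorphisms, words and polynomials\<close>

lemma star_hom_compose:
  assumes "star_hom A B \<rho>" "star_hom B C \<sigma>" shows "star_hom A C (\<sigma> \<circ> \<rho>)"
  using assms unfolding star_hom_def ring_hom_def by (auto simp: Pi_iff)

lemma star_homD:
  assumes "star_hom A B \<rho>"
  shows "x \<in> carrier A \<Longrightarrow> \<rho> x \<in> carrier B" "\<rho> \<one>\<^bsub>A\<^esub> = \<one>\<^bsub>B\<^esub>"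
    "x \<in> carrier A \<Longrightarrow> y \<in> carrier A \<Longrightarrow> \<rho> (x \<otimes>\<^bsub>A\<^esub> y) = \<rho> x \<otimes>\<^bsub>B\<^esub> \<rho> y"
    "x \<in> carrier A \<Longrightarrow> y \<in> carrier A \<Longrightarrow> \<rho> (x \<oplus>\<^bsub>A\<^esub> y) = \<rho> x \<oplus>\<^bsub>B\<^esub> \<rho> y"
    "x \<in> carrier A \<Longrightarrow> \<rho> (cs_star A x) = cs_star B (\<rho> x)"
    "x \<in> carrier A \<Longrightarrow> \<rho> (c \<odot>\<^bsub>A\<^esub> x) = c \<odot>\<^bsub>B\<^esub> \<rho> x"
  using assms unfolding star_hom_def ring_hom_def by auto

lemma cstar_algebra_closed:
  assumes "cstar_algebra A"
  shows "ring A" "x \<in> carrier A \<Longrightarrow> c \<odot>\<^bsub>A\<^esub> x \<in> carrier A" "x \<in> carrier A \<Longrightarrow> cs_star A x \<in> carrier A"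
proof -
  show R: "ring A" and "x \<in> carrier A \<Longrightarrow> cs_star A x \<in> carrier A"
    using assms unfolding cstar_algebra_def by blast+
  have M: "module complex_ring A" using assms unfolding cstar_algebra_def by blast
  show "c \<odot>\<^bsub>A\<^esub> x \<in> carrier A" if "x \<in> carrier A" using module.smult_closed[OF M] that by simp
qed

lemma words_Nil [simp]: "[] \<in> words I"
  by (simp add: words_def)

lemma words_Cons [simp]:
  "l # w \<in> words I \<longleftrightarrow> (\<exists>i\<in>I. l = Gen i \<or> l = Gen_Star i) \<and> w \<in> words I"
  by (auto simp: words_def)

lemma words_append [simp]: "v @ w \<in> words I \<longleftrightarrow> v \<in> words I \<and> w \<in> words I"
  by (auto simp: words_def)

lemma word_val_simps [simp]:
  "word_val B b [] = \<one>\<^bsub>B\<^esub>" "word_val B b (l # w) = letter_val B b l \<otimes>\<^bsub>B\<^esub> word_val B b w"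
  by (simp_all add: word_val_def)

lemma word_val_closed:
  assumes A: "cstar_algebra A" and b: "b \<in> I \<rightarrow> carrier A" and "w \<in> words I"
  shows "word_val A b w \<in> carrier A"
proof -
  interpret ring A by (rule cstar_algebra_closed(1)[OF A])
  show ?thesis
    using assms(3) b
    by (induction w) (auto simp: cstar_algebra_closed(3)[OF A] Pi_iff)
qed

lemma star_hom_word_val:
  assumes A: "cstar_algebra A" and \<rho>: "star_hom A B \<rho>" and b: "b \<in> I \<rightarrow> carrier A" and "w \<in> words I"
  shows "\<rho> (word_val A b w) = word_val B (\<lambda>i. \<rho> (b i)) w"
  using assms(4)
proof (induction w)
  case Nil show ?case using star_homD(2)[OF \<rho>] by simp
next
  case (Cons l w)
  then obtain i where i: "i \<in> I" "l = Gen i \<or> l = Gen_Star i" and w: "w \<in> words I" by auto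
  have bi: "b i \<in> carrier A" using b i by blast
  then have l: "letter_val A b l \<in> carrier A" "\<rho> (letter_val A b l) = letter_val B (\<lambda>i. \<rho> (b i)) l"
    using i(2) cstar_algebra_closed(3)[OF A bi] star_homD(5)[OF \<rho> bi] by auto
  show ?case
    unfolding word_val_simps star_homD(3)[OF \<rho> l(1) word_val_closed[OF A b w]] l(2) Cons.IH[OF w] ..
qed

text \<open>The sums are those of the two rings and can be unfolded only for terms inside the
  carriers. Hence the induction over subsets of the support, which tracks membership on both
  sides.\<close>

lemma star_hom_poly_val:
  assumes A: "cstar_algebra A" and B: "cstar_algebra B" and \<rho>: "star_hom A B \<rho>"
    and b: "b \<in> I \<rightarrow> carrier A" and q: "q \<in> nc_polys I"
  shows "\<rho> (poly_val A b q) = poly_val B (\<lambda>i. \<rho> (b i)) q"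
proof -
  interpret A: ring A by (rule cstar_algebra_closed(1)[OF A])
  interpret B: ring B by (rule cstar_algebra_closed(1)[OF B])
  have z: "\<rho> \<zero>\<^bsub>A\<^esub> = \<zero>\<^bsub>B\<^esub>"
    using \<rho> A.ring_axioms B.ring_axioms ring_hom_zero unfolding star_hom_def by blast
  have wA: "word_val A b w \<in> carrier A" if "w \<in> Poly_Mapping.keys q" for w
    using word_val_closed[OF A b] that q by (auto simp: nc_polys_def)
  have wB: "\<rho> (word_val A b w) = word_val B (\<lambda>i. \<rho> (b i)) w" if "w \<in> Poly_Mapping.keys q" for w
    using star_hom_word_val[OF A \<rho> b] that q by (auto simp: nc_polys_def)
  have "\<rho> (\<Oplus>\<^bsub>A\<^esub>w\<in>F. Poly_Mapping.lookup q w \<odot>\<^bsub>A\<^esub> word_val A b w) =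
      (\<Oplus>\<^bsub>B\<^esub>w\<in>F. Poly_Mapping.lookup q w \<odot>\<^bsub>B\<^esub> word_val B (\<lambda>i. \<rho> (b i)) w)"
    if "finite F" "F \<subseteq> Poly_Mapping.keys q" for F
    using that
  proof (induction F)
    case empty then show ?case using z by simp
  next
    case (insert w F)
    have cA: "(\<lambda>w. Poly_Mapping.lookup q w \<odot>\<^bsub>A\<^esub> word_val A b w) \<in> F \<rightarrow> carrier A"
      using insert wA cstar_algebra_closed(2)[OF A] by blast
    have cB: "(\<lambda>w. Poly_Mapping.lookup q w \<odot>\<^bsub>B\<^esub> word_val B (\<lambda>i. \<rho> (b i)) w) \<in> F \<rightarrow> carrier B"
    proof
      fix v assume "v \<in> F"
      then have v: "v \<in> Poly_Mapping.keys q" using insert by auto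
      show "Poly_Mapping.lookup q v \<odot>\<^bsub>B\<^esub> word_val B (\<lambda>i. \<rho> (b i)) v \<in> carrier B"
        using star_homD(1)[OF \<rho> wA[OF v]] cstar_algebra_closed(2)[OF B] wB[OF v] by simp
    qed
    have w: "w \<in> Poly_Mapping.keys q" using insert by simp
    have "\<rho> (word_val A b w) \<in> carrier B" by (rule star_homD(1)[OF \<rho> wA[OF w]])
    then show ?case
      using insert cA cB wA[OF w] cstar_algebra_closed(2)[OF A wA[OF w]] cstar_algebra_closed(2)[OF B]
        wB[OF w, symmetric]
      by (simp add: A.finsum_insert B.finsum_insert star_homD(4,6)[OF \<rho>] A.finsum_closed)
  qed
  then show ?thesis by (simp add: poly_val_def)
qed

text \<open>Evaluation by composition and pointwise sums instead of record operations. Unlike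
  \<open>word_val\<close> and \<open>poly_val\<close> it mentions no carrier, so values can be
  compared across different operator algebras.\<close>

primrec letter_op :: "('i \<Rightarrow> 'h::chilbert_space \<Rightarrow> 'h) \<Rightarrow> 'i letter \<Rightarrow> 'h \<Rightarrow> 'h" where
  "letter_op b (Gen i) = b i"
| "letter_op b (Gen_Star i) = cadjoint (b i)"

primrec word_op :: "('i \<Rightarrow> 'h::chilbert_space \<Rightarrow> 'h) \<Rightarrow> 'i letter list \<Rightarrow> 'h \<Rightarrow> 'h" where
  "word_op b [] = id"
| "word_op b (l # w) = letter_op b l \<circ> word_op b w"

definition poly_op :: "('i \<Rightarrow> 'h::chilbert_space \<Rightarrow> 'h) \<Rightarrow> 'i nc_poly \<Rightarrow> 'h \<Rightarrow> 'h" where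
  "poly_op b q = (\<lambda>u. \<Sum>w\<in>Poly_Mapping.keys q. Poly_Mapping.lookup q w *\<^sub>C word_op b w u)"

lemma letter_val_operator: "letter_val (operator_algebra C) b l = letter_op b l"
  by (cases l) simp_all

lemma word_val_operator: "word_val (operator_algebra C) b w = word_op b w"
  by (induction w) (simp_all add: letter_val_operator)

lemma word_op_closed:
  assumes C: "star_algebra C" and b: "\<forall>i\<in>I. b i \<in> C" and "w \<in> words I"
  shows "word_op b w \<in> C"
  using assms(3) by (induction w) (auto simp: star_algebraD[OF C] b)

lemma poly_val_operator:
  assumes C: "star_algebra C" and b: "\<forall>i\<in>I. b i \<in> C" and q: "q \<in> nc_polys I"
  shows "poly_val (operator_algebra C) b q = poly_op b q"
proof -
  interpret abelian_group "operator_algebra C" by (rule abelian_group_operator[OF C])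
  have "(\<Oplus>\<^bsub>operator_algebra C\<^esub>w\<in>F. (\<lambda>u. Poly_Mapping.lookup q w *\<^sub>C word_op b w u)) =
      (\<lambda>u. \<Sum>w\<in>F. Poly_Mapping.lookup q w *\<^sub>C word_op b w u)"
    if "finite F" "F \<subseteq> Poly_Mapping.keys q" for F
    using that
  proof (induction F)
    case empty then show ?case by simp
  next
    case (insert w F)
    have "(\<lambda>u. Poly_Mapping.lookup q v *\<^sub>C word_op b v u) \<in> C" if "v \<in> insert w F" for v
    proof -
      have "v \<in> words I" using that insert(4) q by (auto simp: nc_polys_def)
      then show ?thesis by (intro star_algebraD(7)[OF C] word_op_closed[OF C b])
    qed
    then have "(\<lambda>w u. Poly_Mapping.lookup q w *\<^sub>C word_op b w u) \<in> F \<rightarrow> C"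
      "(\<lambda>u. Poly_Mapping.lookup q w *\<^sub>C word_op b w u) \<in> C" by auto
    then show ?case using insert by (simp add: finsum_insert)
  qed
  then show ?thesis by (simp add: poly_val_def poly_op_def word_val_operator)
qed

section \<open>Universality for concrete representations\<close>

definition gen_ops :: "'i set \<Rightarrow> ('i \<Rightarrow> 'h::chilbert_space \<Rightarrow> 'h) \<Rightarrow> ('h \<Rightarrow> 'h) set"
  where "gen_ops I b = poly_op b ` nc_polys I"

lemma poly_op_superset:
  assumes "finite F" "Poly_Mapping.keys q \<subseteq> F"
  shows "poly_op b q u = (\<Sum>w\<in>F. Poly_Mapping.lookup q w *\<^sub>C word_op b w u)"
  unfolding poly_op_def
  by (rule sum.mono_neutral_left) (use assms in \<open>auto simp: in_keys_iff scaleC_zero_left\<close>)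

lemma poly_op_add: "poly_op b (q + r) = (\<lambda>u. poly_op b q u + poly_op b r u)"
proof
  fix u
  let ?F = "Poly_Mapping.keys q \<union> Poly_Mapping.keys r"
  have "poly_op b (q + r) u = (\<Sum>w\<in>?F. Poly_Mapping.lookup (q + r) w *\<^sub>C word_op b w u)"
    by (rule poly_op_superset) (use Poly_Mapping.keys_add[of q r] in auto)
  also have "\<dots> = (\<Sum>w\<in>?F. Poly_Mapping.lookup q w *\<^sub>C word_op b w u) +
      (\<Sum>w\<in>?F. Poly_Mapping.lookup r w *\<^sub>C word_op b w u)"
    by (simp add: lookup_add scaleC_add_left sum.distrib)
  also have "(\<Sum>w\<in>?F. Poly_Mapping.lookup q w *\<^sub>C word_op b w u) = poly_op b q u"
    by (rule poly_op_superset[symmetric]) auto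
  also have "(\<Sum>w\<in>?F. Poly_Mapping.lookup r w *\<^sub>C word_op b w u) = poly_op b r u"
    by (rule poly_op_superset[symmetric]) auto
  finally show "poly_op b (q + r) u = poly_op b q u + poly_op b r u" .
qed

lemma poly_op_kcoef: "poly_op b (kcoef c q) = (\<lambda>u. c *\<^sub>C poly_op b q u)"
proof
  fix u
  have "poly_op b (kcoef c q) u = (\<Sum>w\<in>Poly_Mapping.keys q. Poly_Mapping.lookup (kcoef c q) w *\<^sub>C word_op b w u)"
    by (rule poly_op_superset) (auto simp: keys_kcoef)
  then show "poly_op b (kcoef c q) u = c *\<^sub>C poly_op b q u"
    by (simp add: poly_op_def scaleC_sum_right scaleC_scaleC)
qed

lemma poly_op_single: "poly_op b (Poly_Mapping.single w c) = (\<lambda>u. c *\<^sub>C word_op b w u)"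
  by (auto simp: poly_op_def fun_eq_iff scaleC_zero_left)

lemma nc_polys_add: "q \<in> nc_polys I \<Longrightarrow> r \<in> nc_polys I \<Longrightarrow> q + r \<in> nc_polys I"
  using Poly_Mapping.keys_add[of q r] unfolding nc_polys_def by blast

lemma nc_polys_kcoef: "q \<in> nc_polys I \<Longrightarrow> kcoef c q \<in> nc_polys I"
  using keys_kcoef[of c q] unfolding nc_polys_def by blast

lemma nc_polys_single: "w \<in> words I \<Longrightarrow> Poly_Mapping.single w c \<in> nc_polys I"
  unfolding nc_polys_def by (auto split: if_splits)

lemma gen_ops_add: "S \<in> gen_ops I b \<Longrightarrow> T \<in> gen_ops I b \<Longrightarrow> (\<lambda>u. S u + T u) \<in> gen_ops I b"
  unfolding gen_ops_def by (auto simp: poly_op_add[symmetric] nc_polys_add)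

lemma gen_ops_scaleC: "S \<in> gen_ops I b \<Longrightarrow> (\<lambda>u. c *\<^sub>C S u) \<in> gen_ops I b"
  unfolding gen_ops_def by (auto simp: poly_op_kcoef[symmetric] nc_polys_kcoef)

lemma gen_ops_word: "w \<in> words I \<Longrightarrow> word_op b w \<in> gen_ops I b"
  unfolding gen_ops_def
  by (rule image_eqI[OF _ nc_polys_single[of w I 1]]) (auto simp: poly_op_single scaleC_one)

lemma gen_ops_id: "id \<in> gen_ops I b"
  using gen_ops_word[of "[]"] by simp

lemma gen_ops_zero: "(\<lambda>_. 0) \<in> gen_ops I b"
  using gen_ops_scaleC[OF gen_ops_id, of 0] by (simp add: scaleC_zero_left)

text \<open>The workhorse for statements linear in \<open>x\<close>: they reduce to words.
  Membership of \<open>T\<close> is carried along because linearity of the derivations and of the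
  solution is known only on this algebra.\<close>

lemma gen_ops_induct [consumes 1, case_names zero word]:
  assumes "x \<in> gen_ops I b" and "P (\<lambda>_. 0)"
    and step: "\<And>c w T. w \<in> words I \<Longrightarrow> T \<in> gen_ops I b \<Longrightarrow> P T \<Longrightarrow> P (\<lambda>u. c *\<^sub>C word_op b w u + T u)"
  shows "P x"
proof -
  obtain q where q: "q \<in> nc_polys I" "x = poly_op b q" using assms(1) unfolding gen_ops_def by blast
  have "(\<lambda>u. \<Sum>w\<in>F. Poly_Mapping.lookup q w *\<^sub>C word_op b w u) \<in> gen_ops I b \<and>
      P (\<lambda>u. \<Sum>w\<in>F. Poly_Mapping.lookup q w *\<^sub>C word_op b w u)"
    if "finite F" "F \<subseteq> Poly_Mapping.keys q" for F
    using that
  proof (induction F)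
    case empty show ?case using assms(2) gen_ops_zero by simp
  next
    case (insert w F)
    then have w: "w \<in> words I" using q(1) by (auto simp: nc_polys_def)
    let ?T = "\<lambda>u. \<Sum>w\<in>F. Poly_Mapping.lookup q w *\<^sub>C word_op b w u"
    have T: "?T \<in> gen_ops I b" "P ?T" using insert by auto
    show ?case
      using insert(1,2) step[OF w T, of "Poly_Mapping.lookup q w"]
        gen_ops_add[OF gen_ops_scaleC[OF gen_ops_word[OF w]] T(1), of "Poly_Mapping.lookup q w"] by simp
  qed
  from this[OF finite_keys subset_refl] show ?thesis unfolding q(2) poly_op_def by (rule conjunct2)
qed

lemma gen_ops_subset:
  assumes "star_algebra C" "\<forall>i\<in>I. b i \<in> C"
  shows "gen_ops I b \<subseteq> C"
proof
  fix x assume "x \<in> gen_ops I b"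
  then show "x \<in> C"
    by (induction rule: gen_ops_induct)
       (use assms word_op_closed[OF assms] in \<open>auto intro!: star_algebraD(5)[OF assms(1)] star_algebraD(7)[OF assms(1)]
         star_algebraD(4)[OF assms(1)]\<close>)
qed

lemma gen_ops_bounded:
  assumes "\<forall>i\<in>I. bounded_clinear (b i)" "x \<in> gen_ops I b"
  shows "bounded_clinear x"
  using gen_ops_subset[OF star_algebra_UNIV, of I b] assms by blast

lemma word_op_append: "word_op b (v @ w) = word_op b v \<circ> word_op b w"
  by (induction v) (simp_all add: o_assoc)

primrec letter_star :: "'i letter \<Rightarrow> 'i letter" where
  "letter_star (Gen i) = Gen_Star i"
| "letter_star (Gen_Star i) = Gen i"

definition word_star :: "'i letter list \<Rightarrow> 'i letter list" where
  "word_star w = rev (map letter_star w)"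

lemma word_star_words: "w \<in> words I \<Longrightarrow> word_star w \<in> words I"
  by (induction w) (auto simp: word_star_def)

lemma word_op_bounded:
  "\<forall>i\<in>I. bounded_clinear (b i) \<Longrightarrow> w \<in> words I \<Longrightarrow> bounded_clinear (word_op b w)"
  using word_op_closed[OF star_algebra_UNIV, of I b w] by blast

lemma cadjoint_word_op:
  assumes b: "\<forall>i\<in>I. bounded_clinear (b i)" and "w \<in> words I"
  shows "cadjoint (word_op b w) = word_op b (word_star w)"
  using assms(2)
proof (induction w)
  case Nil show ?case using cadjoint_id by (simp add: word_star_def id_def)
next
  case (Cons l w)
  then obtain i where i: "i \<in> I" "l = Gen i \<or> l = Gen_Star i" and w: "w \<in> words I" by auto
  have "bounded_clinear (letter_op b l)" "cadjoint (letter_op b l) = letter_op b (letter_star l)"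
    using i b by (auto simp: bounded_clinear_cadjoint cadjoint_cadjoint)
  then have "cadjoint (word_op b (l # w)) = word_op b (word_star w) \<circ> letter_op b (letter_star l)"
    unfolding word_op.simps using Cons.IH[OF w] word_op_bounded[OF b w]
    by (simp only: cadjoint_compose)
  also have "\<dots> = word_op b (word_star w @ [letter_star l])"
    unfolding word_op_append by (simp add: id_def o_def)
  finally show ?case by (simp add: word_star_def del: word_op.simps)
qed

lemma cadjoint_zero: "cadjoint (\<lambda>_. 0) = (\<lambda>_. 0)"
  by (rule cadjoint_eqI) (simp add: cinner_zero_left cinner_zero_right)

lemma gen_ops_star_algebra:
  assumes b: "\<forall>i\<in>I. bounded_clinear (b i)"
  shows "star_algebra (gen_ops I b)"
proof -
  note bd = gen_ops_bounded[OF b]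
  note wb = word_op_bounded[OF b]
  have adj: "cadjoint x \<in> gen_ops I b" if "x \<in> gen_ops I b" for x
    using that
  proof (induction rule: gen_ops_induct)
    case zero
    show ?case using gen_ops_zero by (simp add: cadjoint_zero)
  next
    case (word c w T)
    have "cadjoint (\<lambda>u. c *\<^sub>C word_op b w u + T u) =
        (\<lambda>u. cnj c *\<^sub>C word_op b (word_star w) u + cadjoint T u)"
      using wb[OF word(1)] bd[OF word(2)] cadjoint_word_op[OF b word(1)]
      by (simp add: cadjoint_add cadjoint_scaleC bounded_clinear_scale)
    then show ?case
      using gen_ops_add[OF gen_ops_scaleC[OF gen_ops_word[OF word_star_words[OF word(1)]]] word(3)] by simp
  qed
  \<comment> \<open>Composition is bilinear: first the left factor is a word, where concatenation
    settles the matter, then the induction runs over the left factor.\<close>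
  have wcomp: "word_op b v \<circ> x \<in> gen_ops I b" if v: "v \<in> words I" and x: "x \<in> gen_ops I b" for v x
    using x
  proof (induction rule: gen_ops_induct)
    case zero
    show ?case using gen_ops_zero wb[OF v] by (simp add: o_def bounded_clinearD)
  next
    case (word c w T)
    have "word_op b v \<circ> (\<lambda>u. c *\<^sub>C word_op b w u + T u) = (\<lambda>u. c *\<^sub>C word_op b (v @ w) u + (word_op b v \<circ> T) u)"
      using wb[OF v] by (auto simp: fun_eq_iff bounded_clinearD word_op_append)
    then show ?case
      using gen_ops_add[OF gen_ops_scaleC[OF gen_ops_word] word(3), of "v @ w" c] v word(1) by simp
  qed
  have comp: "x \<circ> y \<in> gen_ops I b" if "x \<in> gen_ops I b" and y: "y \<in> gen_ops I b" for x y
    using that(1)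
  proof (induction rule: gen_ops_induct)
    case zero show ?case using gen_ops_zero by (simp add: o_def)
  next
    case (word c w T)
    have "(\<lambda>u. c *\<^sub>C word_op b w u + T u) \<circ> y = (\<lambda>u. c *\<^sub>C (word_op b w \<circ> y) u + (T \<circ> y) u)"
      by (auto simp: fun_eq_iff)
    then show ?case
      using gen_ops_add[OF gen_ops_scaleC[OF wcomp[OF word(1) y]] word(3), of c] by simp
  qed
  show ?thesis
    unfolding star_algebra_def
    by (intro conjI ballI allI subsetI CollectI gen_ops_id gen_ops_zero)
       (erule bd | rule gen_ops_add comp gen_ops_scaleC adj; assumption)+
qed

text \<open>The closure in operator norm. Boundedness of \<open>T\<close> is part of the definition
  since \<open>Blinfun\<close> determines only bounded maps.\<close>

definition op_closure :: "('h::chilbert_space \<Rightarrow> 'h) set \<Rightarrow> ('h \<Rightarrow> 'h) set"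
  where "op_closure C = {T. bounded_clinear T \<and> (\<exists>X. (\<forall>n. X n \<in> C) \<and> (\<lambda>n. Blinfun (X n)) \<longlonglongrightarrow> Blinfun T)}"

lemma op_closure_superset: "C \<subseteq> Collect bounded_clinear \<Longrightarrow> C \<subseteq> op_closure C"
  unfolding op_closure_def by (auto intro: exI[of _ "\<lambda>_. T" for T])

lemma Blinfun_add:
  "bounded_clinear S \<Longrightarrow> bounded_clinear T \<Longrightarrow> Blinfun (\<lambda>u. S u + T u) = Blinfun S + Blinfun T"
  by (rule blinfun_eqI)
     (simp add: bounded_linear_Blinfun_apply bounded_clinear_linear bounded_linear_add plus_blinfun.rep_eq)

lemma Blinfun_compose:
  "bounded_clinear S \<Longrightarrow> bounded_clinear T \<Longrightarrow> Blinfun (S \<circ> T) = Blinfun S o\<^sub>L Blinfun T"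
  by (rule blinfun_eqI)
     (simp add: bounded_linear_Blinfun_apply bounded_clinear_linear bounded_clinear_compose)

lemma Blinfun_tendsto_iff:
  assumes "\<And>n. bounded_clinear (X n)" "bounded_clinear T"
  shows "(\<lambda>n. Blinfun (X n)) \<longlonglongrightarrow> Blinfun T \<longleftrightarrow> (\<lambda>n. onorm (\<lambda>u. X n u - T u)) \<longlonglongrightarrow> 0"
  unfolding onorm_diff_Blinfun[OF assms]
  by (subst LIM_zero_iff[symmetric]) (rule tendsto_norm_zero_iff[symmetric])

lemma star_algebra_op_closure:
  assumes C: "star_algebra C" shows "star_algebra (op_closure C)"
proof -
  note D = star_algebraD[OF C]
  have add: "(\<lambda>u. S u + T u) \<in> op_closure C" if S: "S \<in> op_closure C" and T: "T \<in> op_closure C" for S T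
  proof -
    obtain X Y where X: "bounded_clinear S" "\<And>n. X n \<in> C" "(\<lambda>n. Blinfun (X n)) \<longlonglongrightarrow> Blinfun S"
      and Y: "bounded_clinear T" "\<And>n. Y n \<in> C" "(\<lambda>n. Blinfun (Y n)) \<longlonglongrightarrow> Blinfun T"
      using S T unfolding op_closure_def by blast
    have "(\<lambda>n. Blinfun (\<lambda>u. X n u + Y n u)) \<longlonglongrightarrow> Blinfun (\<lambda>u. S u + T u)"
      using tendsto_add[OF X(3) Y(3)] D(2)[OF X(2)] D(2)[OF Y(2)] X(1) Y(1) by (simp add: Blinfun_add)
    then show ?thesis
      unfolding op_closure_def using X Y D(5) by (auto intro!: bounded_clinear_add exI[of _ "\<lambda>n u. X n u + Y n u"])
  qed
  have comp: "S \<circ> T \<in> op_closure C" if S: "S \<in> op_closure C" and T: "T \<in> op_closure C" for S T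
  proof -
    obtain X Y where X: "bounded_clinear S" "\<And>n. X n \<in> C" "(\<lambda>n. Blinfun (X n)) \<longlonglongrightarrow> Blinfun S"
      and Y: "bounded_clinear T" "\<And>n. Y n \<in> C" "(\<lambda>n. Blinfun (Y n)) \<longlonglongrightarrow> Blinfun T"
      using S T unfolding op_closure_def by blast
    have "(\<lambda>n. Blinfun (X n \<circ> Y n)) \<longlonglongrightarrow> Blinfun (S \<circ> T)"
      using bounded_bilinear.tendsto[OF bounded_bilinear_blinfun_compose X(3) Y(3)]
        D(2)[OF X(2)] D(2)[OF Y(2)] X(1) Y(1) by (simp add: Blinfun_compose)
    then show ?thesis
      unfolding op_closure_def using X Y D(6) by (auto intro!: bounded_clinear_compose exI[of _ "\<lambda>n. X n \<circ> Y n"])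
  qed
  have adj: "cadjoint S \<in> op_closure C" if S: "S \<in> op_closure C" for S
  proof -
    obtain X where X: "bounded_clinear S" "\<And>n. X n \<in> C" "(\<lambda>n. Blinfun (X n)) \<longlonglongrightarrow> Blinfun S"
      using S unfolding op_closure_def by blast
    have Xb: "bounded_clinear (X n)" for n using X(2) D(2) by blast
    \<comment> \<open>Taking adjoints is isometric, so the adjoints converge as fast as the
      operators.\<close>
    have "onorm (\<lambda>u. cadjoint (X n) u - cadjoint S u) = onorm (\<lambda>u. X n u - S u)" for n
    proof -
      have "cadjoint (\<lambda>u. X n u - S u) = (\<lambda>u. cadjoint (X n) u - cadjoint S u)"
        by (rule cadjoint_eqI) (simp add: cinner_simps cinner_cadjoint Xb X(1))
      then show ?thesis using onorm_cadjoint[OF bounded_clinear_diff[OF Xb X(1)], of n] by simp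
    qed
    then have "(\<lambda>n. Blinfun (cadjoint (X n))) \<longlonglongrightarrow> Blinfun (cadjoint S)"
      using X(3) by (simp add: Blinfun_tendsto_iff Xb X(1) bounded_clinear_cadjoint)
    then show ?thesis
      unfolding op_closure_def using X D(8) by (auto intro!: bounded_clinear_cadjoint exI[of _ "\<lambda>n. cadjoint (X n)"])
  qed
  have sub: "C \<subseteq> op_closure C" by (rule op_closure_superset[OF D(1)])
  have scale: "(\<lambda>u. c *\<^sub>C S u) \<in> op_closure C" if S: "S \<in> op_closure C" for c S
  proof -
    \<comment> \<open>Scaling is composition with a scalar operator, so it reduces to
      products.\<close>
    have "(\<lambda>u. c *\<^sub>C u) \<in> C" using D(7)[OF D(3), of c] by simp
    then have "(\<lambda>u. c *\<^sub>C u) \<circ> S \<in> op_closure C" using comp S sub by blast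
    then show ?thesis by (simp add: o_def)
  qed
  show ?thesis
    unfolding star_algebra_def using add comp adj scale sub D(3,4) by (auto simp: op_closure_def)
qed

text \<open>Passing to the closure of the image under \<open>Blinfun\<close>, which is closed,
  replaces a diagonal sequence argument.\<close>

lemma op_closure_closed:
  assumes C: "C \<subseteq> Collect bounded_clinear"
    and X: "\<And>n. X n \<in> op_closure C" and T: "bounded_clinear T" "(\<lambda>n. Blinfun (X n)) \<longlonglongrightarrow> Blinfun T"
  shows "T \<in> op_closure C"
proof -
  have "Blinfun (X n) \<in> closure (Blinfun ` C)" for n
  proof -
    obtain Y where "\<And>m. Y m \<in> C" "(\<lambda>m. Blinfun (Y m)) \<longlonglongrightarrow> Blinfun (X n)"
      using X[of n] unfolding op_closure_def by blast
    then show ?thesis unfolding closure_sequential by (intro exI[of _ "\<lambda>m. Blinfun (Y m)"]) auto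
  qed
  then have "Blinfun T \<in> closure (Blinfun ` C)"
    by (rule closed_sequentially[OF closed_closure _ T(2)])
  then obtain Z where Z: "\<And>n. Z n \<in> Blinfun ` C" "Z \<longlonglongrightarrow> Blinfun T" unfolding closure_sequential by blast
  have "\<forall>n. \<exists>S. S \<in> C \<and> Z n = Blinfun S" using Z(1) by blast
  from choice[OF this] obtain S where S: "\<And>n. S n \<in> C \<and> Z n = Blinfun (S n)" by blast
  then have "Z = (\<lambda>n. Blinfun (S n))" by blast
  then have "(\<lambda>n. Blinfun (S n)) \<longlonglongrightarrow> Blinfun T" using Z(2) by simp
  then show ?thesis unfolding op_closure_def using T(1) S by blast
qed

lemma star_hom_mono:
  assumes "star_hom A (operator_algebra C) \<rho>" "C \<subseteq> D" shows "star_hom A (operator_algebra D) \<rho>"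
  using assms unfolding star_hom_def ring_hom_def by auto

text \<open>Brings the universal property to operators on an arbitrary Hilbert space. Each element
  of the C*-algebra generated by \<open>b\<close> is a limit of values of polynomials, and such a
  sequence of polynomials serves as its name.\<close>

lemma universal_concrete:
  fixes A :: "('h::chilbert_space \<Rightarrow> 'h) set" and b :: "'i \<Rightarrow> 'g::chilbert_space \<Rightarrow> 'g"
  assumes univ: "universal_cstar_algebra (operator_algebra A) I a K p"
    and b: "\<forall>i\<in>I. bounded_clinear (b i)"
    and rel: "\<And>k. k \<in> K \<Longrightarrow> poly_op b (p k) = (\<lambda>_. 0)"
  obtains \<rho> where "star_hom (operator_algebra A) (operator_algebra (Collect bounded_clinear)) \<rho>"
    "\<And>i. i \<in> I \<Longrightarrow> \<rho> (a i) = b i"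
proof -
  have pI: "p k \<in> nc_polys I" if "k \<in> K" for k
    using univ that unfolding universal_cstar_algebra_def by blast
  define C where "C = op_closure (gen_ops I b)"
  have bd: "gen_ops I b \<subseteq> Collect bounded_clinear" using gen_ops_bounded[OF b] by blast
  have C: "star_algebra C"
    unfolding C_def by (rule star_algebra_op_closure[OF gen_ops_star_algebra[OF b]])
  have cs: "cstar_algebra (operator_algebra C)"
    by (rule cstar_algebra_operator[OF C]) (unfold C_def, rule op_closure_closed[OF bd])
  have bC: "\<forall>i\<in>I. b i \<in> C"
    using gen_ops_word[of "[Gen i]" I b for i] op_closure_superset[OF bd] unfolding C_def by auto
  \<comment> \<open>The universal property quantifies over algebras on one fixed type, into which \<open>C\<close> has to be copied.\<close>
  define enc where "enc T = (SOME X. (\<forall>n. X n \<in> nc_polys I) \<and> (\<lambda>n. Blinfun (poly_op b (X n))) \<longlonglongrightarrow> Blinfun T)"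
    for T
  have enc: "(\<lambda>n. Blinfun (poly_op b (enc T n))) \<longlonglongrightarrow> Blinfun T" if T: "T \<in> C" for T
  proof -
    obtain Y where Y: "\<And>n. Y n \<in> gen_ops I b" "(\<lambda>n. Blinfun (Y n)) \<longlonglongrightarrow> Blinfun T"
      using T unfolding C_def op_closure_def by blast
    have "\<forall>n. \<exists>q. q \<in> nc_polys I \<and> Y n = poly_op b q" using Y(1) unfolding gen_ops_def by blast
    from choice[OF this] obtain X where "\<And>n. X n \<in> nc_polys I \<and> Y n = poly_op b (X n)" by blast
    then have "\<exists>X. (\<forall>n. X n \<in> nc_polys I) \<and> (\<lambda>n. Blinfun (poly_op b (X n))) \<longlonglongrightarrow> Blinfun T"
      using Y(2) by (intro exI[of _ X]) simp
    from someI_ex[OF this] show ?thesis unfolding enc_def by blast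
  qed
  \<comment> \<open>A sequence of polynomials has at most one limit, so its name determines the
    operator whichever sequence was chosen.\<close>
  have inj: "inj_on enc C"
  proof (rule inj_onI)
    fix S T assume ST: "S \<in> C" "T \<in> C" "enc S = enc T"
    then have "Blinfun S = Blinfun T" using enc[OF ST(1)] enc[OF ST(2)] LIMSEQ_unique by metis
    then show "S = T" using Blinfun_inject_clinear star_algebraD(2)[OF C] ST by blast
  qed
  define B where "B = cstar_copy enc (operator_algebra C)"
  have B: "cstar_algebra B" "star_hom (operator_algebra C) B enc"
    "star_hom B (operator_algebra C) (the_inv_into C enc)"
    using cstar_copy[of "operator_algebra C" enc] cs inj unfolding B_def by auto
  have "enc \<in> C \<rightarrow> carrier B" using star_homD(1)[OF B(2)] by auto
  then have bB: "(\<lambda>i. enc (b i)) \<in> I \<rightarrow> carrier B" using bC by auto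
  have "satisfies_relations B (\<lambda>i. enc (b i)) K p"
    unfolding satisfies_relations_def
  proof
    fix k assume k: "k \<in> K"
    have z: "enc (\<lambda>_. 0) = \<zero>\<^bsub>B\<^esub>" by (simp add: B_def cstar_copy_def Let_def)
    have "poly_val B (\<lambda>i. enc (b i)) (p k) = enc (poly_val (operator_algebra C) b (p k))"
      by (rule star_hom_poly_val[OF cs B(1,2), symmetric]) (use bC pI[OF k] in auto)
    also have "\<dots> = \<zero>\<^bsub>B\<^esub>" using poly_val_operator[OF C bC pI[OF k]] rel[OF k] z by simp
    finally show "poly_val B (\<lambda>i. enc (b i)) (p k) = \<zero>\<^bsub>B\<^esub>" .
  qed
  with univ B(1) bB obtain \<rho> where \<rho>: "star_hom (operator_algebra A) B \<rho>" "\<And>i. i \<in> I \<Longrightarrow> \<rho> (a i) = enc (b i)"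
    unfolding universal_cstar_algebra_def by metis
  \<comment> \<open>Decoding the names turns the homomorphism into the copy back into one into
    operators.\<close>
  let ?r = "the_inv_into C enc \<circ> \<rho>"
  have "star_hom (operator_algebra A) (operator_algebra C) ?r" by (rule star_hom_compose[OF \<rho>(1) B(3)])
  moreover have "?r (a i) = b i" if "i \<in> I" for i
    using \<rho>(2)[OF that] bC that inj by (simp add: the_inv_into_f_f)
  ultimately show ?thesis using that star_hom_mono star_algebraD(1)[OF C] by blast
qed

lemma universal_facts:
  assumes A: "concrete_cstar_algebra A" and univ: "universal_cstar_algebra (operator_algebra A) I a K p"
  shows "star_algebra A" "cstar_algebra (operator_algebra A)" "\<forall>i\<in>I. a i \<in> A"
    "\<forall>i\<in>I. bounded_clinear (a i)"
    "star_subalgebra_generated (operator_algebra A) I a = gen_ops I a"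
    "norm_dense (operator_algebra A) (gen_ops I a)"
    "\<And>k. k \<in> K \<Longrightarrow> p k \<in> nc_polys I" "\<And>k. k \<in> K \<Longrightarrow> poly_op a (p k) = (\<lambda>_. 0)"
proof -
  show cs: "cstar_algebra (operator_algebra A)" using A by (simp add: concrete_cstar_algebra_def)
  show SA: "star_algebra A" using A by (intro star_algebra_of_cstar) (simp_all add: concrete_cstar_algebra_def)
  show aA: "\<forall>i\<in>I. a i \<in> A" using univ by (auto simp: universal_cstar_algebra_def)
  then show "\<forall>i\<in>I. bounded_clinear (a i)" using star_algebraD(2)[OF SA] by blast
  show gen: "star_subalgebra_generated (operator_algebra A) I a = gen_ops I a"
    unfolding star_subalgebra_generated_def gen_ops_def
    by (intro image_cong refl poly_val_operator[OF SA aA])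
  show "norm_dense (operator_algebra A) (gen_ops I a)"
    using univ gen by (simp add: universal_cstar_algebra_def)
  show pI: "p k \<in> nc_polys I" if "k \<in> K" for k
    using univ that unfolding universal_cstar_algebra_def by blast
  show "poly_op a (p k) = (\<lambda>_. 0)" if "k \<in> K" for k
    using univ that poly_val_operator[OF SA aA pI[OF that]]
    by (simp add: universal_cstar_algebra_def satisfies_relations_def)
qed

text \<open>The common source of the gauge rotations and of the solution. The words in
  \<open>b\<close> arise from those in \<open>a\<close> by a linear map \<open>G\<close> depending
  only on the grade \<open>\<nu>\<close> of the word. As \<open>\<nu>\<close> is constant on the
  monomials of a relation, that relation for \<open>b\<close> is the image under one map of the
  relation for \<open>a\<close>. Below, \<open>G n\<close> is either multiplication by a phase or
  tensoring with a Weyl operator.\<close>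

lemma gauge_homomorphism:
  fixes A :: "('h::chilbert_space \<Rightarrow> 'h) set" and b :: "'i \<Rightarrow> 'g::chilbert_space \<Rightarrow> 'g"
  assumes A: "concrete_cstar_algebra A" and univ: "universal_cstar_algebra (operator_algebra A) I a K p"
    and b: "\<forall>i\<in>I. bounded_clinear (b i)"
    and word: "\<And>w. w \<in> words I \<Longrightarrow> word_op b w = G (\<nu> w) (word_op a w)"
    and G: "\<And>n (F::'i letter list set) c x. finite F \<Longrightarrow> (\<And>w. w \<in> F \<Longrightarrow> bounded_clinear (x w)) \<Longrightarrow>
       G n (\<lambda>u. \<Sum>w\<in>F. c w *\<^sub>C x w u) = (\<lambda>v. \<Sum>w\<in>F. c w *\<^sub>C G n (x w) v)"
    and bal: "\<And>k w w'. k \<in> K \<Longrightarrow> w \<in> Poly_Mapping.keys (p k) \<Longrightarrow> w' \<in> Poly_Mapping.keys (p k) \<Longrightarrow> \<nu> w = \<nu> w'"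
  obtains \<rho> where "star_hom (operator_algebra A) (operator_algebra (Collect bounded_clinear)) \<rho>"
    "\<And>q. q \<in> nc_polys I \<Longrightarrow> \<rho> (poly_op a q) = poly_op b q"
proof -
  note U = universal_facts[OF A univ]
  have rel: "poly_op b (p k) = (\<lambda>_. 0)" if k: "k \<in> K" for k
  \<comment> \<open>The zero polynomial has no monomial from which to read off a common
    grade.\<close>
  proof (cases "Poly_Mapping.keys (p k) = {}")
    case True then show ?thesis by (simp add: poly_op_def)
  next
    case False
    then obtain w0 where w0: "w0 \<in> Poly_Mapping.keys (p k)" by blast
    have wI: "w \<in> words I" if "w \<in> Poly_Mapping.keys (p k)" for w
      using U(7)[OF k] that by (auto simp: nc_polys_def)
    have zero: "G n (\<lambda>_. 0) = (\<lambda>_. 0)" for n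
      using G[of "{}" _ n] by simp
    have "poly_op b (p k) = (\<lambda>v. \<Sum>w\<in>Poly_Mapping.keys (p k). Poly_Mapping.lookup (p k) w *\<^sub>C G (\<nu> w0) (word_op a w) v)"
      unfolding poly_op_def
      by (intro ext sum.cong refl) (simp add: word[OF wI] bal[OF k _ w0])
    also have "\<dots> = G (\<nu> w0) (poly_op a (p k))"
      unfolding poly_op_def by (rule G[where x="word_op a" and c="Poly_Mapping.lookup (p k)", symmetric]) (use word_op_bounded[OF U(4)] wI in auto)
    also have "\<dots> = (\<lambda>_. 0)" using U(8)[OF k] zero by simp
    finally show ?thesis .
  qed
  obtain \<rho> where \<rho>: "star_hom (operator_algebra A) (operator_algebra (Collect bounded_clinear)) \<rho>"
    "\<And>i. i \<in> I \<Longrightarrow> \<rho> (a i) = b i"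
    using universal_concrete[OF univ b rel] by blast
  have "\<rho> (poly_op a q) = poly_op b q" if q: "q \<in> nc_polys I" for q
  proof -
    have "\<rho> (poly_op a q) = \<rho> (poly_val (operator_algebra A) a q)"
      using poly_val_operator[OF U(1,3) q] by simp
    also have "\<dots> = poly_val (operator_algebra (Collect bounded_clinear)) (\<lambda>i. \<rho> (a i)) q"
      by (rule star_hom_poly_val[OF U(2) cstar_algebra_bounded_operators \<rho>(1) _ q]) (use U(3) in auto)
    also have "\<dots> = poly_op (\<lambda>i. \<rho> (a i)) q"
      by (rule poly_val_operator[OF star_algebra_UNIV _ q]) (simp add: \<rho>(2) b)
    also have "\<dots> = poly_op b q"
    proof -
      have "word_op (\<lambda>i. \<rho> (a i)) w = word_op b w" if "w \<in> words I" for w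
        using that by (induction w) (auto simp: \<rho>(2))
      then show ?thesis
        using q unfolding poly_op_def nc_polys_def by (intro ext sum.cong refl) (metis (lifting) mem_Collect_eq subsetD)
    qed
    finally show ?thesis .
  qed
  with \<rho>(1) show ?thesis using that by blast
qed

section \<open>The gauge derivations\<close>

lemma star_algebra_sum:
  assumes C: "star_algebra C" and "\<And>i. i \<in> F \<Longrightarrow> T i \<in> C"
  shows "(\<lambda>u. \<Sum>i\<in>F. T i u) \<in> C"
  using assms(2)
proof (induction F rule: infinite_finite_induct)
  case (insert i F)
  then have "T i \<in> C" "(\<lambda>u. \<Sum>i\<in>F. T i u) \<in> C" by auto
  from star_algebraD(5)[OF C this] show ?case using insert by simp
qed (use star_algebraD(4)[OF C] in simp_all)

lemma gen_degree_Nil [simp]: "gen_degree j [] = 0"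
  by (simp add: gen_degree_def)

lemma gen_degree_Cons:
  "gen_degree j (l # w) = (if l = Gen j then 1 else if l = Gen_Star j then - 1 else 0) + gen_degree j w"
  by (auto simp: gen_degree_def)

lemma gen_degree_append: "gen_degree j (v @ w) = gen_degree j v + gen_degree j w"
  by (simp add: gen_degree_def)

lemma gen_degree_word_star: "gen_degree j (word_star w) = - gen_degree j w"
proof (induction w)
  case (Cons l w)
  then show ?case by (cases l) (auto simp: word_star_def gen_degree_append gen_degree_Cons)
qed (simp add: word_star_def)

text \<open>Only generators occurring in the word can have nonzero degree. This keeps all sums over
  \<open>J\<close> finite.\<close>

lemma finite_gen_degree: "finite {j. gen_degree j w \<noteq> 0}"
proof (rule finite_subset)
  show "{j. gen_degree j w \<noteq> 0} \<subseteq> Gen -` set w \<union> Gen_Star -` set w"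
  proof -
    have "gen_degree j w = 0" if "Gen j \<notin> set w" "Gen_Star j \<notin> set w" for j
      using that by (simp add: gen_degree_def)
    then show ?thesis by auto
  qed
  show "finite (Gen -` set w \<union> Gen_Star -` set w)"
    by (intro finite_UnI finite_vimageI) (auto simp: inj_on_def)
qed

text \<open>The gauge derivation on formal polynomials. That it descends to operators, where
  different polynomials may have the same value, is where balancedness enters.\<close>

definition degree_poly :: "'i \<Rightarrow> 'i nc_poly \<Rightarrow> 'i nc_poly"
  where "degree_poly j q = Poly_Mapping.mapp (\<lambda>w z. of_int (gen_degree j w) * z) q"

lemma lookup_degree_poly [simp]:
  "Poly_Mapping.lookup (degree_poly j q) w = of_int (gen_degree j w) * Poly_Mapping.lookup q w"
  by (auto simp: degree_poly_def lookup_mapp when_def in_keys_iff)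

lemma keys_degree_poly: "Poly_Mapping.keys (degree_poly j q) \<subseteq> Poly_Mapping.keys q"
  by (auto simp: in_keys_iff)

lemma degree_poly_nc_polys: "q \<in> nc_polys I \<Longrightarrow> degree_poly j q \<in> nc_polys I"
  using keys_degree_poly[of j q] unfolding nc_polys_def by blast

lemma degree_poly_add: "degree_poly j (q + r) = degree_poly j q + degree_poly j r"
  by (rule poly_mapping_eqI) (simp add: lookup_add algebra_simps)

lemma degree_poly_kcoef: "degree_poly j (kcoef z q) = kcoef z (degree_poly j q)"
  by (rule poly_mapping_eqI) simp

lemma degree_poly_single:
  "degree_poly j (Poly_Mapping.single w z) = Poly_Mapping.single w (of_int (gen_degree j w) * z)"
  by (rule poly_mapping_eqI) (auto simp: lookup_single when_def)

section \<open>Algebraic tensors and entries of block operators\<close>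

lemma algebraic_tensor_tensor_op:
  assumes "y \<in> A0" "bounded_clinear T" shows "y \<otimes>\<^sub>o T \<in> algebraic_tensor A0"
  unfolding algebraic_tensor_def using assms
  by (intro CollectI exI[of _ 1] exI[of _ "\<lambda>_. y"] exI[of _ "\<lambda>_. T"]) auto

lemma algebraic_tensor_add:
  assumes "Z \<in> algebraic_tensor A0" "Z' \<in> algebraic_tensor A0"
  shows "(\<lambda>v. Z v + Z' v) \<in> algebraic_tensor A0"
proof -
  obtain n y T where 1: "\<forall>m<n::nat. y m \<in> A0 \<and> bounded_clinear (T m)" "Z = (\<lambda>v. \<Sum>m<n. (y m \<otimes>\<^sub>o T m) v)"
    using assms(1) unfolding algebraic_tensor_def by blast
  obtain n' y' T' where 2: "\<forall>m<n'::nat. y' m \<in> A0 \<and> bounded_clinear (T' m)"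
    "Z' = (\<lambda>v. \<Sum>m<n'. (y' m \<otimes>\<^sub>o T' m) v)"
    using assms(2) unfolding algebraic_tensor_def by blast
  define z S where "z m = (if m < n then y m else y' (m - n))" and "S m = (if m < n then T m else T' (m - n))" for m
  have "(\<Sum>m<n + n'. (z m \<otimes>\<^sub>o S m) v) = Z v + Z' v" for v
  proof -
    have "{..<n + n'} = {..<n} \<union> {n..<n + n'}" by auto
    then have "(\<Sum>m<n + n'. (z m \<otimes>\<^sub>o S m) v) =
        (\<Sum>m<n. (z m \<otimes>\<^sub>o S m) v) + (\<Sum>m = n..<n + n'. (z m \<otimes>\<^sub>o S m) v)"
      by (simp add: sum.union_disjoint ivl_disj_int)
    also have "(\<Sum>m = n..<n + n'. (z m \<otimes>\<^sub>o S m) v) = (\<Sum>m<n'. (z (m + n) \<otimes>\<^sub>o S (m + n)) v)"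
      using sum.shift_bounds_nat_ivl[of "\<lambda>m. (z m \<otimes>\<^sub>o S m) v" 0 n n'] by (simp add: add.commute atLeast0LessThan)
    finally show ?thesis unfolding 1(2) 2(2) by (simp add: z_def S_def)
  qed
  moreover have "\<forall>m<n + n'. z m \<in> A0 \<and> bounded_clinear (S m)"
    using 1(1) 2(1) by (auto simp: z_def S_def)
  ultimately show ?thesis
    unfolding algebraic_tensor_def by (intro CollectI exI[of _ "n + n'"] exI[of _ z] exI[of _ S]) simp
qed

lemma algebraic_tensor_sum:
  assumes "\<And>i. i \<in> F \<Longrightarrow> Z i \<in> algebraic_tensor A0"
  shows "(\<lambda>v. \<Sum>i\<in>F. Z i v) \<in> algebraic_tensor A0"
  using assms
proof (induction F rule: infinite_finite_induct)
  case (insert i F)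
  then have "Z i \<in> algebraic_tensor A0" "(\<lambda>u. \<Sum>i\<in>F. Z i u) \<in> algebraic_tensor A0" by auto
  from algebraic_tensor_add[OF this] show ?case using insert by simp
qed (auto simp: algebraic_tensor_def intro!: exI[of _ "0::nat"])

lemma bounded_clinear_rank_one: "bounded_clinear (\<lambda>\<zeta>. cinner b \<zeta> *\<^sub>C a)"
  by (rule bounded_clinear_comp[OF bounded_clinear_scaleC_left bounded_clinear_cinner])

lemma bounded_clinear_snd: "bounded_clinear (snd :: 'a::complex_inner \<times> 'b::complex_inner \<Rightarrow> 'b)"
  by (rule bounded_clinearI[where M=1]) (auto simp: scaleC_prod_def norm_snd_le)

lemma bounded_clinear_Pair0: "bounded_clinear (Pair 0 :: 'b::complex_inner \<Rightarrow> 'a::complex_inner \<times> 'b)"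
  by (rule bounded_clinearI[where M=1]) (auto simp: scaleC_prod_def norm_prod_def scaleC_zero_right)

lemma Ebra_snd:
  fixes v :: "('h::chilbert_space, 'a::chilbert_space \<times> 'b::chilbert_space) tensor"
  shows "Ebra z ((id \<otimes>\<^sub>o snd) v) = Ebra (0, z) v"
proof -
  have "(\<lambda>v::('h, 'a \<times> 'b) tensor. Ebra z ((id \<otimes>\<^sub>o snd) v)) = Ebra (0, z)"
    by (rule tensor_ext)
       (auto simp: tensor_op_tensor bounded_clinear_id bounded_clinear_snd Ebra_tensor cinner_prod_def
         cinner_zero_left bounded_clinear_Ebra
         intro!: bounded_clinear_comp[OF bounded_clinear_Ebra] bounded_clinear_tensor_op)
  then show ?thesis by (rule fun_cong)
qed

text \<open>With lower right block zero, the entry at \<open>(\<alpha>, z)\<close> and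
  \<open>(\<beta>, w)\<close> reads off the other three blocks. The vectors \<open>(1, f t)\<close>
  and \<open>(1, g t)\<close> of the stochastic equation are the case used.\<close>

lemma block_operator_matrix:
  fixes z w :: "'k::chilbert_space" and t :: "'h::chilbert_space \<Rightarrow> 'h"
  shows "Ebra (\<alpha>, z) (block_operator t b c (\<lambda>_. 0) (Eket (\<beta>, w) u)) =
    cnj \<alpha> *\<^sub>C (t (\<beta> *\<^sub>C u) + b (u \<otimes>\<^sub>H w)) + Ebra z (c (\<beta> *\<^sub>C u))"
proof -
  have P: "Ebra (\<alpha>, z) ((id \<otimes>\<^sub>o Pair 0) v) = Ebra z v" for v :: "('h, 'k) tensor"
  proof -
    have "(\<lambda>v::('h, 'k) tensor. Ebra (\<alpha>, z) ((id \<otimes>\<^sub>o Pair 0) v)) = Ebra z"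
      by (rule tensor_ext)
         (auto simp: tensor_op_tensor bounded_clinear_id bounded_clinear_Pair0 Ebra_tensor cinner_prod_def
           cinner_zero_right bounded_clinear_Ebra
           intro!: bounded_clinear_comp[OF bounded_clinear_Ebra] bounded_clinear_tensor_op)
    then show ?thesis by (rule fun_cong)
  qed
  have "Ebra (1, 0) (Eket (\<beta>, w) u) = \<beta> *\<^sub>C u"
    by (simp add: Eket_def Ebra_tensor cinner_prod_def cinner_complex_def cinner_zero_left)
  moreover have "(id \<otimes>\<^sub>o snd) (Eket (\<beta>, w) u) = u \<otimes>\<^sub>H w"
    by (simp add: Eket_def tensor_op_tensor bounded_clinear_id bounded_clinear_snd)
  moreover have "Ebra (\<alpha>, z) (Eket (1, 0) x) = cnj \<alpha> *\<^sub>C x" for x :: 'h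
    by (simp add: Eket_def Ebra_tensor cinner_prod_def cinner_complex_def cinner_zero_right)
  ultimately show ?thesis
    unfolding block_operator_def Let_def by (simp add: bounded_clinearD[OF bounded_clinear_Ebra] P)
qed

section \<open>Gauge rotations and the derivations on the generated algebra\<close>

locale gauge_setting =
  fixes A :: "('h::chilbert_space \<Rightarrow> 'h) set"
    and I J :: "'i set" and a :: "'i \<Rightarrow> 'h \<Rightarrow> 'h"
    and K :: "'r set" and p :: "'r \<Rightarrow> 'i nc_poly"
    and e :: "'i \<Rightarrow> 'k::chilbert_space" and c :: "'i \<Rightarrow> complex"
  assumes concrete: "concrete_cstar_algebra A"
    and universal: "universal_cstar_algebra (operator_algebra A) I a K p"
    and J_sub: "J \<subseteq> I" and bal: "\<forall>j\<in>J. balanced K p j"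
    and onb: "orthonormal_basis J e"
begin

lemmas presentation = universal_facts[OF concrete universal]

abbreviation "A0 \<equiv> gen_ops I a"
abbreviation "d j \<equiv> gauge_derivation (operator_algebra A) I a j"

lemma A0_star: "star_algebra A0"
  by (rule gen_ops_star_algebra[OF presentation(4)])

lemma A0_sub: "A0 \<subseteq> A"
  by (rule gen_ops_subset[OF presentation(1,3)])

lemmas A0_D = star_algebraD[OF A0_star]

definition rot :: "'i \<Rightarrow> real \<Rightarrow> 'i \<Rightarrow> 'h \<Rightarrow> 'h" where
  "rot j \<theta> i = (\<lambda>u. (if i = j then exp (of_real \<theta> * \<i>) else 1) *\<^sub>C a i u)"

lemma rot_apply: "rot j \<theta> i u = (if i = j then exp (of_real \<theta> * \<i>) else 1) *\<^sub>C a i u"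
  by (simp add: rot_def)

lemma rot_word:
  assumes "w \<in> words I"
  shows "word_op (rot j \<theta>) w = (\<lambda>u. exp (of_real \<theta> * (\<i> * of_int (gen_degree j w))) *\<^sub>C word_op a w u)"
  using assms
proof (induction w)
  case Nil show ?case by (auto simp: scaleC_one)
next
  case (Cons l w)
  then obtain i where i: "i \<in> I" "l = Gen i \<or> l = Gen_Star i" and w: "w \<in> words I" by auto
  have b: "bounded_clinear (a i)" "bounded_clinear (cadjoint (a i))"
    using presentation(4) i(1) bounded_clinear_cadjoint by auto
  have cn: "cnj (exp (of_real \<theta> * \<i>)) = exp (of_real \<theta> * (- \<i>))" by (simp add: exp_cnj)
  have adj: "cadjoint (rot j \<theta> i) = (\<lambda>u. (if i = j then exp (of_real \<theta> * (- \<i>)) else 1) *\<^sub>C cadjoint (a i) u)"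
    unfolding rot_def cadjoint_scaleC[OF b(1)] by (auto simp: exp_cnj)
  let ?n = "\<i> * of_int (gen_degree j w)"
  from i(2) show ?case
  proof
    assume l: "l = Gen i"
    show ?case
    proof
      fix u
      have "word_op (rot j \<theta>) (l # w) u =
          (if i = j then exp (of_real \<theta> * \<i>) else 1) *\<^sub>C a i (exp (of_real \<theta> * ?n) *\<^sub>C word_op a w u)"
        by (simp only: l word_op.simps letter_op.simps o_apply Cons.IH[OF w] rot_apply)
      then show "word_op (rot j \<theta>) (l # w) u =
          exp (of_real \<theta> * (\<i> * of_int (gen_degree j (l # w)))) *\<^sub>C word_op a (l # w) u"
        by (simp add: l bounded_clinearD[OF b(1)] scaleC_scaleC gen_degree_Cons exp_add[symmetric] algebra_simps
            del: word_op.simps(2)) (simp add: algebra_simps)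
    qed
  next
    assume l: "l = Gen_Star i"
    show ?case
    proof
      fix u
      have "word_op (rot j \<theta>) (l # w) u =
          (if i = j then exp (of_real \<theta> * (- \<i>)) else 1) *\<^sub>C cadjoint (a i) (exp (of_real \<theta> * ?n) *\<^sub>C word_op a w u)"
        by (simp only: l word_op.simps letter_op.simps o_apply Cons.IH[OF w] adj)
      then show "word_op (rot j \<theta>) (l # w) u =
          exp (of_real \<theta> * (\<i> * of_int (gen_degree j (l # w)))) *\<^sub>C word_op a (l # w) u"
        by (simp add: l bounded_clinearD[OF b(2)] scaleC_scaleC gen_degree_Cons exp_add[symmetric] algebra_simps
            del: word_op.simps(2)) (simp add: algebra_simps)
    qed
  qed
qed

text \<open>Rotated values are images under a homomorphism, so equal values of \<open>q\<close> and
  \<open>r\<close> stay equal for every angle. Matrix elements of rotated values are finite sums of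
  exponentials in the angle, and their derivatives at 0 are \<open>\<i>\<close> times the matrix
  elements of the values of the degree polynomials.\<close>

lemma degree_poly_well_defined:
  assumes j: "j \<in> J" and q: "q \<in> nc_polys I" "r \<in> nc_polys I" and eq: "poly_op a q = poly_op a r"
  shows "poly_op a (degree_poly j q) = poly_op a (degree_poly j r)"
proof -
  have rot_eq: "poly_op (rot j \<theta>) q = poly_op (rot j \<theta>) r" for \<theta>
  proof -
    obtain \<rho> where "\<And>q. q \<in> nc_polys I \<Longrightarrow> \<rho> (poly_op a q) = poly_op (rot j \<theta>) q"
    proof (rule gauge_homomorphism[OF concrete universal, of "rot j \<theta>"
          "\<lambda>n x v. exp (of_real \<theta> * (\<i> * of_int n)) *\<^sub>C x v" "gen_degree j"])
      show "\<forall>i\<in>I. bounded_clinear (rot j \<theta> i)" using presentation(4) by (auto simp: rot_def intro: bounded_clinear_scale)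
      show "gen_degree j w = gen_degree j w'"
        if "k \<in> K" "w \<in> Poly_Mapping.keys (p k)" "w' \<in> Poly_Mapping.keys (p k)" for k w w'
        using bal j that unfolding balanced_def by blast
    qed (auto simp: rot_word scaleC_sum_right scaleC_scaleC mult_ac)
    then show ?thesis using q eq by metis
  qed
  \<comment> \<open>Differentiation is done on scalar matrix elements, so no derivative of
    operator-valued functions is involved.\<close>
  have deriv: "((\<lambda>\<theta>. cinner v (poly_op (rot j \<theta>) q u)) has_vector_derivative
      \<i> * cinner v (poly_op a (degree_poly j q) u)) (at 0)" if q: "q \<in> nc_polys I" for q u v
  proof -
    let ?z = "\<lambda>w. Poly_Mapping.lookup q w * cinner v (word_op a w u)"
    let ?n = "\<lambda>w. of_int (gen_degree j w) :: complex"
    have qw: "w \<in> words I" if "w \<in> Poly_Mapping.keys q" for w using q that by (auto simp: nc_polys_def)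
    have "((\<lambda>\<theta>. \<Sum>w\<in>Poly_Mapping.keys q. exp (\<theta> * (\<i> * ?n w)) * ?z w) has_field_derivative
        (\<Sum>w\<in>Poly_Mapping.keys q. \<i> * ?n w * ?z w)) (at (of_real 0))"
      by (auto intro!: derivative_eq_intros sum.cong)
    from has_vector_derivative_real_field[OF this]
    have "((\<lambda>\<theta>. \<Sum>w\<in>Poly_Mapping.keys q. exp (of_real \<theta> * (\<i> * ?n w)) * ?z w) has_vector_derivative
        (\<Sum>w\<in>Poly_Mapping.keys q. \<i> * ?n w * ?z w)) (at 0)" by simp
    moreover have "(\<Sum>w\<in>Poly_Mapping.keys q. exp (of_real \<theta> * (\<i> * ?n w)) * ?z w) =
        cinner v (poly_op (rot j \<theta>) q u)" for \<theta>
      unfolding poly_op_def cinner_sum_right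
      by (intro sum.cong refl) (simp add: rot_word qw cinner_simps)
    moreover have "(\<Sum>w\<in>Poly_Mapping.keys q. \<i> * ?n w * ?z w) = \<i> * cinner v (poly_op a (degree_poly j q) u)"
      unfolding poly_op_superset[OF finite_keys keys_degree_poly] cinner_sum_right
      by (simp add: sum_distrib_left cinner_simps mult_ac)
    ultimately show ?thesis by simp
  qed
  show ?thesis
  proof (rule ext, rule cinner_ext)
    fix u v
    have "\<i> * cinner v (poly_op a (degree_poly j q) u) = \<i> * cinner v (poly_op a (degree_poly j r) u)"
      using deriv[OF q(1), of v u] deriv[OF q(2), of v u] unfolding rot_eq by (rule vector_derivative_unique_at)
    then show "cinner v (poly_op a (degree_poly j q) u) = cinner v (poly_op a (degree_poly j r) u)" by simp
  qed
qed

lemma gauge_derivation: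
  assumes j: "j \<in> J"
  shows d_A0: "x \<in> A0 \<Longrightarrow> d j x \<in> A0"
    and d_add: "x \<in> A0 \<Longrightarrow> y \<in> A0 \<Longrightarrow> d j (\<lambda>u. x u + y u) = (\<lambda>u. d j x u + d j y u)"
    and d_scaleC: "x \<in> A0 \<Longrightarrow> d j (\<lambda>u. z *\<^sub>C x u) = (\<lambda>u. z *\<^sub>C d j x u)"
    and d_word: "w \<in> words I \<Longrightarrow> d j (word_op a w) = (\<lambda>u. of_int (gen_degree j w) *\<^sub>C word_op a w u)"
proof -
  define P where "P D \<longleftrightarrow> D \<in> A0 \<rightarrow>\<^sub>E A0 \<and>
      (\<forall>x\<in>A0. \<forall>y\<in>A0. D (\<lambda>u. x u + y u) = (\<lambda>u. D x u + D y u)) \<and>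
      (\<forall>z. \<forall>x\<in>A0. D (\<lambda>u. z *\<^sub>C x u) = (\<lambda>u. z *\<^sub>C D x u)) \<and>
      (\<forall>w\<in>words I. D (word_op a w) = (\<lambda>u. of_int (gen_degree j w) *\<^sub>C word_op a w u))" for D
  have deq: "d j = (THE D. P D)"
    by (simp add: gauge_derivation_def P_def Let_def presentation(5) word_val_operator)
  \<comment> \<open>The choice of a representing polynomial is harmless by
    \<open>degree_poly_well_defined\<close>; the restriction makes \<open>D\<close> undefined
    outside \<open>A0\<close>, as the extensional function space demands.\<close>
  define D where "D = (\<lambda>x\<in>A0. poly_op a (degree_poly j (SOME q. q \<in> nc_polys I \<and> x = poly_op a q)))"
  have D: "D (poly_op a q) = poly_op a (degree_poly j q)" if q: "q \<in> nc_polys I" for q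
  proof -
    let ?r = "SOME r. r \<in> nc_polys I \<and> poly_op a q = poly_op a r"
    have "?r \<in> nc_polys I \<and> poly_op a q = poly_op a ?r" by (rule someI[of _ q]) (use q in simp)
    then show ?thesis
      using degree_poly_well_defined[OF j q, of ?r] q by (simp add: D_def gen_ops_def)
  qed
  have PD: "P D"
    unfolding P_def
  proof (intro conjI ballI allI)
    show "D \<in> A0 \<rightarrow>\<^sub>E A0"
    proof (rule PiE_I)
      fix x assume "x \<in> A0"
      then obtain q where "q \<in> nc_polys I" "x = poly_op a q" unfolding gen_ops_def by blast
      then show "D x \<in> A0" using D degree_poly_nc_polys unfolding gen_ops_def by fastforce
    qed (simp add: D_def)
    show "D (\<lambda>u. x u + y u) = (\<lambda>u. D x u + D y u)" if xy: "x \<in> A0" "y \<in> A0" for x y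
    proof -
      obtain q r where "q \<in> nc_polys I" "x = poly_op a q" "r \<in> nc_polys I" "y = poly_op a r"
        using xy unfolding gen_ops_def by blast
      then show ?thesis
        by (simp add: poly_op_add[symmetric] D nc_polys_add degree_poly_add)
    qed
    show "D (\<lambda>u. z *\<^sub>C x u) = (\<lambda>u. z *\<^sub>C D x u)" if x: "x \<in> A0" for x z
    proof -
      obtain q where "q \<in> nc_polys I" "x = poly_op a q"
        using x unfolding gen_ops_def by blast
      then show ?thesis
        by (simp add: poly_op_kcoef[symmetric] D nc_polys_kcoef degree_poly_kcoef)
    qed
    show "D (word_op a w) = (\<lambda>u. of_int (gen_degree j w) *\<^sub>C word_op a w u)" if w: "w \<in> words I" for w
      using D[OF nc_polys_single[OF w, of 1]]
      by (simp add: poly_op_single degree_poly_single scaleC_one)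
  qed
  \<comment> \<open>Inside \<open>A0\<close> two such maps agree on words and hence by linearity;
    outside both have the same undefined value.\<close>
  have uniq: "D' = D''" if D': "P D'" and D'': "P D''" for D' D''
  proof
    fix x
    have eq: "D' x = D'' x" if "x \<in> A0"
      using that
    proof (induction rule: gen_ops_induct)
      case zero
      have "E (\<lambda>_. 0) = (\<lambda>_. 0)" if "P E" for E
      proof -
        have "\<forall>z. \<forall>x\<in>A0. E (\<lambda>u. z *\<^sub>C x u) = (\<lambda>u. z *\<^sub>C E x u)" using that unfolding P_def by (elim conjE)
        from this[rule_format, OF A0_D(4), of 0] show ?thesis by (simp add: scaleC_zero_left)
      qed
      then show ?case using D' D'' by simp
    next
      case (word z w T)
      have w: "word_op a w \<in> A0" "(\<lambda>u. z *\<^sub>C word_op a w u) \<in> A0"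
        using gen_ops_word[OF word(1)] A0_D(7) by blast+
      have "E (\<lambda>u. z *\<^sub>C word_op a w u + T u) = (\<lambda>u. z *\<^sub>C of_int (gen_degree j w) *\<^sub>C word_op a w u + E T u)"
        if "P E" for E
        using that w word(1,2) unfolding P_def by simp
      from this[OF D'] this[OF D''] show ?case using word(3) by simp
    qed
    show "D' x = D'' x"
    proof (cases "x \<in> A0")
      case False
      have "E \<in> A0 \<rightarrow>\<^sub>E A0" if "P E" for E using that unfolding P_def by (elim conjE)
      then show ?thesis using PiE_arb[OF _ False] D' D'' by metis
    qed (rule eq)
  qed
  have "P (d j)" unfolding deq by (rule theI[of P, OF PD]) (rule uniq[OF _ PD])
  note dj = this[unfolded P_def]
  show "x \<in> A0 \<Longrightarrow> d j x \<in> A0" using dj by (intro PiE_mem[of "d j" A0 "\<lambda>_. A0"]) simp_all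
  show "x \<in> A0 \<Longrightarrow> y \<in> A0 \<Longrightarrow> d j (\<lambda>u. x u + y u) = (\<lambda>u. d j x u + d j y u)"
    "x \<in> A0 \<Longrightarrow> d j (\<lambda>u. z *\<^sub>C x u) = (\<lambda>u. z *\<^sub>C d j x u)"
    "w \<in> words I \<Longrightarrow> d j (word_op a w) = (\<lambda>u. of_int (gen_degree j w) *\<^sub>C word_op a w u)"
    using dj by simp_all
qed

lemma d_zero: "j \<in> J \<Longrightarrow> d j (\<lambda>_. 0) = (\<lambda>_. 0)"
  using d_scaleC[of j "\<lambda>_. 0" 0] A0_D(4) by (simp add: scaleC_zero_left)

lemma d_step:
  assumes "j \<in> J" "w \<in> words I" "T \<in> A0"
  shows "d j (\<lambda>u. z *\<^sub>C word_op a w u + T u) = (\<lambda>u. z *\<^sub>C of_int (gen_degree j w) *\<^sub>C word_op a w u + d j T u)"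
  using d_add[OF assms(1) A0_D(7)[OF gen_ops_word[OF assms(2)]] assms(3), of z]
    d_scaleC[OF assms(1) gen_ops_word[OF assms(2)], of z] d_word[OF assms(1,2)] by simp

lemma A0_bounded: "x \<in> A0 \<Longrightarrow> bounded_clinear x"
  by (rule A0_D(2))

lemma word_bounded: "w \<in> words I \<Longrightarrow> bounded_clinear (word_op a w)"
  by (rule word_op_bounded[OF presentation(4)])

text \<open>The Leibniz rule is additivity of degrees under concatenation of words, extended by
  bilinearity through two inductions.\<close>

lemma d_compose:
  assumes j: "j \<in> J" and x: "x \<in> A0" and y: "y \<in> A0"
  shows "d j (x \<circ> y) = (\<lambda>u. d j x (y u) + x (d j y u))"
proof -
  have inner: "d j (word_op a v \<circ> y) = (\<lambda>u. d j (word_op a v) (y u) + word_op a v (d j y u))"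
    if v: "v \<in> words I" for v
    using y
  proof (induction rule: gen_ops_induct)
    case zero
    show ?case using bounded_clinearD[OF word_bounded[OF v]] by (simp add: o_def d_zero[OF j] d_word[OF j v] scaleC_zero_right)
  next
    case (word z w T)
    have vw: "v @ w \<in> words I" using v word(1) by simp
    have vT: "word_op a v \<circ> T \<in> A0" by (rule A0_D(6)[OF gen_ops_word[OF v] word(2)])
    have eq: "word_op a v \<circ> (\<lambda>u. z *\<^sub>C word_op a w u + T u) = (\<lambda>u. z *\<^sub>C word_op a (v @ w) u + (word_op a v \<circ> T) u)"
      using bounded_clinearD[OF word_bounded[OF v]] by (auto simp: word_op_append)
    show ?case
      unfolding eq d_step[OF j word(1,2)] d_step[OF j vw vT] word.IH d_word[OF j v]
      using bounded_clinearD[OF word_bounded[OF v]]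
      by (simp add: word_op_append gen_degree_append scaleC_add_left scaleC_add_right scaleC_scaleC algebra_simps)
  qed
  show ?thesis
    using x
  proof (induction rule: gen_ops_induct)
    case zero show ?case by (simp add: o_def d_zero[OF j])
  next
    case (word z w T)
    have wy: "word_op a w \<circ> y \<in> A0" "T \<circ> y \<in> A0"
      using A0_D(6) gen_ops_word[OF word(1)] word(2) y by blast+
    have eq: "(\<lambda>u. z *\<^sub>C word_op a w u + T u) \<circ> y = (\<lambda>u. z *\<^sub>C (word_op a w \<circ> y) u + (T \<circ> y) u)"
      by auto
    show ?case
      unfolding eq d_step[OF j word(1,2)] d_add[OF j A0_D(7)[OF wy(1)] wy(2)] d_scaleC[OF j wy(1)] word.IH
        inner[OF word(1)] d_word[OF j word(1)]
      by (simp add: scaleC_add_left scaleC_add_right scaleC_scaleC algebra_simps)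
  qed
qed

text \<open>The minus sign arises since the adjoint of a word exchanges copies of \<open>a j\<close>
  and of its adjoint, which negates the degree. Thus \<open>\<i>\<close> times \<open>d j\<close>,
  and not \<open>d j\<close> itself, respects adjoints.\<close>

lemma d_cadjoint:
  assumes j: "j \<in> J" and x: "x \<in> A0"
  shows "d j (cadjoint x) = (\<lambda>u. - cadjoint (d j x) u)"
  using x
proof (induction rule: gen_ops_induct)
  case zero show ?case by (simp add: cadjoint_zero d_zero[OF j])
next
  case (word z w T)
  note wb = word_bounded[OF word(1)]
  have adj: "cadjoint (\<lambda>u. z' *\<^sub>C word_op a w u + S u) = (\<lambda>u. cnj z' *\<^sub>C word_op a (word_star w) u + cadjoint S u)"
    if "bounded_clinear S" for z' S
    using wb that cadjoint_word_op[OF presentation(4) word(1)]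
    by (simp add: cadjoint_add cadjoint_scaleC bounded_clinear_scale)
  have Tb: "bounded_clinear T" "bounded_clinear (d j T)" "cadjoint T \<in> A0"
    using word(2) A0_bounded d_A0[OF j] A0_D(8) by blast+
  show ?case
    unfolding d_step[OF j word(1,2)] adj[OF Tb(1)]
      d_step[OF j word_star_words[OF word(1)] Tb(3)] scaleC_scaleC adj[OF Tb(2)] word.IH
    by (simp add: gen_degree_word_star)
qed

text \<open>The index set of the sums in the theorem. It is finite on \<open>A0\<close>, which gives
  the formally infinite sums over \<open>J\<close> their meaning.\<close>

definition supp :: "('h \<Rightarrow> 'h) \<Rightarrow> 'i set" where
  "supp x = {j. j \<in> J \<and> d j x \<noteq> (\<lambda>_. 0)}"

lemma finite_supp: "x \<in> A0 \<Longrightarrow> finite (supp x)"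
proof (induction rule: gen_ops_induct)
  case zero
  have "supp (\<lambda>_. 0) = {}" by (auto simp: supp_def d_zero)
  then show ?case by simp
next
  case (word z w T)
  have "supp (\<lambda>u. z *\<^sub>C word_op a w u + T u) \<subseteq> {j. gen_degree j w \<noteq> 0} \<union> supp T"
    by (auto simp: supp_def d_step[OF _ word(1,2)] scaleC_zero_left scaleC_zero_right)
  then show ?case using word(3) finite_gen_degree finite_subset by blast
qed

end

section \<open>The map in standard form\<close>

context gauge_setting begin

lemma e_orth: "i \<in> J \<Longrightarrow> j \<in> J \<Longrightarrow> cinner (e i) (e j) = (if i = j then 1 else 0)"
  using onb by (simp add: orthonormal_basis_def)

definition \<delta> :: "('h \<Rightarrow> 'h) \<Rightarrow> 'h \<Rightarrow> ('h, 'k) tensor" where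
  "\<delta> x = (\<lambda>u. \<Sum>j\<in>supp x. c j *\<^sub>C (d j x u \<otimes>\<^sub>H e j))"

definition \<tau> :: "('h \<Rightarrow> 'h) \<Rightarrow> 'h \<Rightarrow> 'h" where
  "\<tau> x = (\<lambda>u. - (1 / 2) *\<^sub>R (\<Sum>j\<in>supp x. (cmod (c j))\<^sup>2 *\<^sub>R d j (d j x) u))"

definition \<delta>' :: "('h \<Rightarrow> 'h) \<Rightarrow> ('h, 'k) tensor \<Rightarrow> 'h" where
  "\<delta>' x = cadjoint (\<delta> (cadjoint x))"

definition \<phi> :: "('h \<Rightarrow> 'h) \<Rightarrow> ('h, complex \<times> 'k) tensor \<Rightarrow> ('h, complex \<times> 'k) tensor" where
  "\<phi> x = block_operator (\<tau> x) (\<delta>' x) (\<delta> x) (\<lambda>_. 0)"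

text \<open>Supports vary with the element, so identities involving several elements are first
  written over one finite set containing all their supports.\<close>

lemma \<delta>_superset:
  assumes "finite F" "supp x \<subseteq> F" "F \<subseteq> J"
  shows "\<delta> x u = (\<Sum>j\<in>F. c j *\<^sub>C (d j x u \<otimes>\<^sub>H e j))"
  unfolding \<delta>_def
proof (rule sum.mono_neutral_left[OF assms(1,2)], rule ballI)
  fix j assume "j \<in> F - supp x"
  then have "d j x = (\<lambda>_. 0)" using assms(3) by (auto simp: supp_def)
  then show "c j *\<^sub>C (d j x u \<otimes>\<^sub>H e j) = 0" by (simp add: tensor_zero_left scaleC_zero_right)
qed

lemma \<tau>_superset:
  assumes "finite F" "supp x \<subseteq> F" "F \<subseteq> J"
  shows "\<tau> x u = - (1 / 2) *\<^sub>R (\<Sum>j\<in>F. (cmod (c j))\<^sup>2 *\<^sub>R d j (d j x) u)"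
  unfolding \<tau>_def
proof (intro arg_cong[where f="\<lambda>y. - (1 / 2) *\<^sub>R y"] sum.mono_neutral_left[OF assms(1,2)] ballI)
  fix j assume "j \<in> F - supp x"
  then have "j \<in> J" "d j x = (\<lambda>_. 0)" using assms(3) by (auto simp: supp_def)
  then show "(cmod (c j))\<^sup>2 *\<^sub>R d j (d j x) u = 0" by (simp add: d_zero)
qed

lemma supp_sub: "supp x \<subseteq> J"
  by (auto simp: supp_def)

lemma common_support:
  assumes "x \<in> A0" "y \<in> A0" "z \<in> A0"
  obtains F where "finite F" "F \<subseteq> J" "supp x \<subseteq> F" "supp y \<subseteq> F" "supp z \<subseteq> F"
  using that[of "supp x \<union> supp y \<union> supp z"] assms finite_supp supp_sub by auto

lemma d_bounded: "j \<in> J \<Longrightarrow> x \<in> A0 \<Longrightarrow> bounded_clinear (d j x)"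
  using d_A0 A0_bounded by blast

lemma \<delta>_bounded:
  assumes "x \<in> A0" shows "bounded_clinear (\<delta> x)"
  unfolding \<delta>_def
proof (intro bounded_clinear_sum bounded_clinear_scale)
  fix j assume "j \<in> supp x"
  then have "j \<in> J" using supp_sub by blast
  from bounded_clinear_comp[OF bounded_clinear_Eket d_bounded[OF this assms]]
  show "bounded_clinear (\<lambda>u. d j x u \<otimes>\<^sub>H e j)" by (simp add: Eket_def)
qed

lemma \<tau>_A0:
  assumes x: "x \<in> A0" shows "\<tau> x \<in> A0"
proof -
  have "(\<lambda>u. \<Sum>j\<in>supp x. (complex_of_real (- (1 / 2) * (cmod (c j))\<^sup>2)) *\<^sub>C d j (d j x) u) \<in> A0"
    by (intro star_algebra_sum[OF A0_star] A0_D(7) d_A0 x) (use supp_sub in auto)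
  then show ?thesis
    unfolding \<tau>_def scaleR_scaleC scaleC_sum_right scaleC_scaleC of_real_mult .
qed

text \<open>An explicit form of the adjoint block: \<open>Ebra (e j)\<close> extracts the component
  along \<open>e j\<close>, and the sign is that of \<open>d_cadjoint\<close>. The support of
  \<open>cadjoint x\<close> appears because the block is defined through it.\<close>

lemma \<delta>'_apply:
  assumes x: "x \<in> A0" and F: "finite F" "supp (cadjoint x) \<subseteq> F" "F \<subseteq> J"
  shows "\<delta>' x v = - (\<Sum>j\<in>F. cnj (c j) *\<^sub>C d j x (Ebra (e j) v))"
proof -
  have "cadjoint (\<delta> (cadjoint x)) = (\<lambda>v. - (\<Sum>j\<in>F. cnj (c j) *\<^sub>C d j x (Ebra (e j) v)))"
  proof (rule cadjoint_eqI)
    fix u v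
    have "cinner (\<delta> (cadjoint x) u) v = (\<Sum>j\<in>F. cnj (c j) * cinner (d j (cadjoint x) u) (Ebra (e j) v))"
      unfolding \<delta>_superset[OF F] cinner_sum_left cinner_scaleC_left cinner_Ebra ..
    also have "\<dots> = (\<Sum>j\<in>F. - (cnj (c j) * cinner u (d j x (Ebra (e j) v))))"
    proof (intro sum.cong refl)
      fix j assume "j \<in> F"
      then have j: "j \<in> J" using F(3) by blast
      show "cnj (c j) * cinner (d j (cadjoint x) u) (Ebra (e j) v) = - (cnj (c j) * cinner u (d j x (Ebra (e j) v)))"
        unfolding d_cadjoint[OF j x] by (simp add: cinner_simps cinner_cadjoint2[OF d_bounded[OF j x]])
    qed
    finally show "cinner (\<delta> (cadjoint x) u) v = cinner u (- (\<Sum>j\<in>F. cnj (c j) *\<^sub>C d j x (Ebra (e j) v)))"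
      by (simp add: cinner_simps cinner_sum_right sum_negf)
  qed
  then show ?thesis by (simp add: \<delta>'_def)
qed

lemma \<delta>_additive:
  assumes "x \<in> A0" "y \<in> A0"
  shows "\<delta> (\<lambda>u. x u + y u) = (\<lambda>u. \<delta> x u + \<delta> y u)"
proof
  fix u
  obtain F where F: "finite F" "F \<subseteq> J" "supp x \<subseteq> F" "supp y \<subseteq> F" "supp (\<lambda>u. x u + y u) \<subseteq> F"
    using common_support[OF assms A0_D(5)[OF assms]] .
  show "\<delta> (\<lambda>u. x u + y u) u = \<delta> x u + \<delta> y u"
    unfolding \<delta>_superset[OF F(1,3,2)] \<delta>_superset[OF F(1,4,2)] \<delta>_superset[OF F(1,5,2)] sum.distrib[symmetric]
    using F(2) by (intro sum.cong refl)
      (auto simp: d_add[OF _ assms] subset_iff tensor_add_left scaleC_add_right)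
qed

lemma \<delta>_scaleC:
  assumes "x \<in> A0" shows "\<delta> (\<lambda>u. z *\<^sub>C x u) = (\<lambda>u. z *\<^sub>C \<delta> x u)"
proof
  fix u
  obtain F where F: "finite F" "F \<subseteq> J" "supp x \<subseteq> F" "supp (\<lambda>u. z *\<^sub>C x u) \<subseteq> F"
    using common_support[OF assms A0_D(7)[OF assms] assms] .
  show "\<delta> (\<lambda>u. z *\<^sub>C x u) u = z *\<^sub>C \<delta> x u"
    unfolding \<delta>_superset[OF F(1,3,2)] \<delta>_superset[OF F(1,4,2)] scaleC_sum_right
    using F(2) by (intro sum.cong refl)
      (auto simp: d_scaleC[OF _ assms] subset_iff tensor_scaleC_left scaleC_scaleC mult_ac)
qed

lemma \<tau>_additive:
  assumes "x \<in> A0" "y \<in> A0"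
  shows "\<tau> (\<lambda>u. x u + y u) = (\<lambda>u. \<tau> x u + \<tau> y u)"
proof
  fix u
  obtain F where F: "finite F" "F \<subseteq> J" "supp x \<subseteq> F" "supp y \<subseteq> F" "supp (\<lambda>u. x u + y u) \<subseteq> F"
    using common_support[OF assms A0_D(5)[OF assms]] .
  show "\<tau> (\<lambda>u. x u + y u) u = \<tau> x u + \<tau> y u"
    unfolding \<tau>_superset[OF F(1,3,2)] \<tau>_superset[OF F(1,4,2)] \<tau>_superset[OF F(1,5,2)]
      scaleR_add_right[symmetric] sum.distrib[symmetric]
    using F(2) by (intro arg_cong[where f="\<lambda>y. - (1 / 2) *\<^sub>R y"] sum.cong refl)
      (auto simp: d_add[OF _ assms] d_add[OF _ d_A0[OF _ assms(1)] d_A0[OF _ assms(2)]] subset_iff scaleR_add_right)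
qed

lemma \<tau>_scaleC:
  assumes "x \<in> A0" shows "\<tau> (\<lambda>u. z *\<^sub>C x u) = (\<lambda>u. z *\<^sub>C \<tau> x u)"
proof
  fix u
  obtain F where F: "finite F" "F \<subseteq> J" "supp x \<subseteq> F" "supp (\<lambda>u. z *\<^sub>C x u) \<subseteq> F"
    using common_support[OF assms A0_D(7)[OF assms] assms] .
  show "\<tau> (\<lambda>u. z *\<^sub>C x u) u = z *\<^sub>C \<tau> x u"
    unfolding \<tau>_superset[OF F(1,3,2)] \<tau>_superset[OF F(1,4,2)] scaleR_scaleC scaleC_sum_right
    using F(2) by (intro sum.cong refl)
      (auto simp: d_scaleC[OF _ assms] d_scaleC[OF _ d_A0[OF _ assms]] subset_iff scaleC_scaleC mult_ac)
qed

lemma \<tau>_cadjoint: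
  assumes x: "x \<in> A0" shows "\<tau> (cadjoint x) = cadjoint (\<tau> x)"
proof (rule cadjoint_eqI[symmetric])
  fix u v
  have x': "cadjoint x \<in> A0" by (rule A0_D(8)[OF x])
  obtain F where F: "finite F" "F \<subseteq> J" "supp x \<subseteq> F" "supp (cadjoint x) \<subseteq> F"
    using common_support[OF x x' x] .
  \<comment> \<open>The two minus signs from the two derivations cancel, so the second power
    respects adjoints although the first does not.\<close>
  have dd: "d j (d j (cadjoint x)) = cadjoint (d j (d j x))" if j: "j \<in> J" for j
  proof -
    have c: "cadjoint (d j x) \<in> A0" by (rule A0_D(8)[OF d_A0[OF j x]])
    have "d j (\<lambda>u. - cadjoint (d j x) u) = (\<lambda>u. - d j (cadjoint (d j x)) u)"
      using d_scaleC[OF j c, of "-1"] by simp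
    then show ?thesis
      unfolding d_cadjoint[OF j x] by (simp add: d_cadjoint[OF j d_A0[OF j x]])
  qed
  have "cinner (\<tau> x u) v = - (1 / 2) * (\<Sum>j\<in>F. (cmod (c j))\<^sup>2 * cinner (d j (d j x) u) v)"
    unfolding \<tau>_superset[OF F(1,3,2)] by (simp add: cinner_simps cinner_sum_left)
  also have "\<dots> = - (1 / 2) * (\<Sum>j\<in>F. (cmod (c j))\<^sup>2 * cinner u (d j (d j (cadjoint x)) v))"
    using F(2) by (intro arg_cong[where f="\<lambda>y. - (1 / 2) * y"] sum.cong refl)
      (auto simp: dd subset_iff cinner_cadjoint d_bounded d_A0 x)
  finally show "cinner (\<tau> x u) v = cinner u (\<tau> (cadjoint x) v)"
    unfolding \<tau>_superset[OF F(1,4,2)] by (simp add: cinner_simps cinner_sum_right)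
qed

lemma \<delta>_compose:
  assumes x: "x \<in> A0" and y: "y \<in> A0"
  shows "\<delta> (x \<circ> y) u = \<delta> x (y u) + ampliation x (\<delta> y u)"
proof -
  obtain F where F: "finite F" "F \<subseteq> J" "supp x \<subseteq> F" "supp y \<subseteq> F" "supp (x \<circ> y) \<subseteq> F"
    using common_support[OF x y A0_D(6)[OF x y]] .
  have amp: "bounded_clinear (ampliation x :: ('h, 'k) tensor \<Rightarrow> _)" "ampliation x (u \<otimes>\<^sub>H v) = x u \<otimes>\<^sub>H v"
    for u and v :: 'k
    unfolding ampliation_def
    by (simp_all add: A0_bounded[OF x] bounded_clinear_id bounded_clinear_tensor_op tensor_op_tensor)
  show ?thesis
    unfolding \<delta>_superset[OF F(1,3,2)] \<delta>_superset[OF F(1,4,2)] \<delta>_superset[OF F(1,5,2)]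
      bounded_clinear_sumD[OF amp(1)] sum.distrib[symmetric]
    using F(2) by (intro sum.cong refl)
      (auto simp: d_compose[OF _ x y] bounded_clinear_scaleC[OF amp(1)] amp(2) tensor_add_left scaleC_add_right subset_iff)
qed

text \<open>The second-order Leibniz rule leaves the cross term
  \<open>2 *\<^sub>R d j x (d j y u)\<close>. The factor \<open>-1/2\<close> in
  \<open>\<tau>\<close> turns it into the negative sum that the right-hand side yields by
  orthonormality of the \<open>e j\<close>.\<close>

lemma \<tau>_compose:
  assumes x: "x \<in> A0" and y: "y \<in> A0"
  shows "\<tau> (x \<circ> y) u - \<tau> x (y u) - x (\<tau> y u) = \<delta>' x (\<delta> y u)"
proof -
  have x': "cadjoint x \<in> A0" by (rule A0_D(8)[OF x])
  define F where "F = supp x \<union> supp y \<union> supp (x \<circ> y) \<union> supp (cadjoint x)"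
  have F: "finite F" "F \<subseteq> J" "supp x \<subseteq> F" "supp y \<subseteq> F" "supp (x \<circ> y) \<subseteq> F" "supp (cadjoint x) \<subseteq> F"
    unfolding F_def using finite_supp x y x' A0_D(6) supp_sub by auto
  have dd: "d j (d j (x \<circ> y)) u = d j (d j x) (y u) + 2 *\<^sub>R d j x (d j y u) + x (d j (d j y) u)" if j: "j \<in> J" for j
  proof -
    note dx = d_A0[OF j x] and dy = d_A0[OF j y]
    have "d j (x \<circ> y) = (\<lambda>u. (d j x \<circ> y) u + (x \<circ> d j y) u)" by (simp add: d_compose[OF j x y])
    then have "d j (d j (x \<circ> y)) = (\<lambda>u. d j (d j x \<circ> y) u + d j (x \<circ> d j y) u)"
      by (simp only: d_add[OF j A0_D(6)[OF dx y] A0_D(6)[OF x dy]])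
    then show ?thesis by (simp add: d_compose[OF j dx y] d_compose[OF j x dy] scaleR_2)
  qed
  \<comment> \<open>Orthonormality leaves a single term of the sum.\<close>
  have \<delta>y: "Ebra (e j) (\<delta> y u) = c j *\<^sub>C d j y u" if j: "j \<in> F" for j
  proof -
    have "Ebra (e j) (\<delta> y u) = (\<Sum>i\<in>F. c i *\<^sub>C cinner (e j) (e i) *\<^sub>C d i y u)"
      unfolding \<delta>_superset[OF F(1,4,2)]
      by (simp add: bounded_clinearD[OF bounded_clinear_Ebra] Ebra_tensor)
    also have "\<dots> = (\<Sum>i\<in>F. if i = j then c j *\<^sub>C d j y u else 0)"
      using F(2) j by (intro sum.cong refl) (auto simp: e_orth subset_iff scaleC_one scaleC_zero_left scaleC_zero_right)
    also have "\<dots> = c j *\<^sub>C d j y u" using j F(1) by simp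
    finally show ?thesis .
  qed
  have rhs: "\<delta>' x (\<delta> y u) = - (\<Sum>j\<in>F. (cmod (c j))\<^sup>2 *\<^sub>R d j x (d j y u))"
    unfolding \<delta>'_apply[OF x F(1,6,2)]
  proof (intro arg_cong[where f=uminus] sum.cong refl)
    fix j assume j: "j \<in> F"
    then have jJ: "j \<in> J" using F(2) by blast
    have "cnj (c j) * c j = of_real ((cmod (c j))\<^sup>2)" by (simp add: complex_norm_square mult.commute del: of_real_power)
    then show "cnj (c j) *\<^sub>C d j x (Ebra (e j) (\<delta> y u)) = (cmod (c j))\<^sup>2 *\<^sub>R d j x (d j y u)"
      by (simp add: \<delta>y[OF j] bounded_clinear_scaleC[OF d_bounded[OF jJ x]] scaleC_scaleC scaleR_scaleC)
  qed
  have x_sum: "x (\<tau> y u) = - (1 / 2) *\<^sub>R (\<Sum>j\<in>F. (cmod (c j))\<^sup>2 *\<^sub>R x (d j (d j y) u))"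
    unfolding \<tau>_superset[OF F(1,4,2)] by (simp add: bounded_clinearD[OF A0_bounded[OF x]])
  have "\<tau> (x \<circ> y) u - \<tau> x (y u) - x (\<tau> y u) = - (1 / 2) *\<^sub>R (\<Sum>j\<in>F. (cmod (c j))\<^sup>2 *\<^sub>R
      (d j (d j (x \<circ> y)) u - d j (d j x) (y u) - x (d j (d j y) u)))"
    unfolding x_sum \<tau>_superset[OF F(1,3,2)] \<tau>_superset[OF F(1,5,2)]
    by (simp add: scaleR_diff_right sum_subtractf)
  also have "\<dots> = - (1 / 2) *\<^sub>R (\<Sum>j\<in>F. (cmod (c j))\<^sup>2 *\<^sub>R (2 *\<^sub>R d j x (d j y u)))"
    using F(2) by (intro arg_cong[where f="\<lambda>y. - (1 / 2) *\<^sub>R y"] sum.cong refl) (auto simp: dd subset_iff)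
  also have "\<dots> = - (\<Sum>j\<in>F. (cmod (c j))\<^sup>2 *\<^sub>R d j x (d j y u))"
    by (simp add: scaleR_sum_right sum_negf)
  finally show ?thesis unfolding rhs .
qed

lemma \<delta>_matrix:
  assumes x: "x \<in> A0" shows "\<delta> x \<circ> Ebra (1::complex) \<in> matrix_space A"
proof -
  have "Ebra z \<circ> (\<delta> x \<circ> Ebra (1::complex)) \<circ> Eket w \<in> A" for z and w :: complex
  proof -
    have "(\<lambda>u. \<Sum>j\<in>supp x. (w * c j * cinner z (e j)) *\<^sub>C d j x u) \<in> A"
      by (intro star_algebra_sum[OF presentation(1)] star_algebraD(7)[OF presentation(1)] subsetD[OF A0_sub] d_A0 x)
         (use supp_sub in auto)
    moreover have "(Ebra z \<circ> (\<delta> x \<circ> Ebra (1::complex)) \<circ> Eket w) u =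
        (\<Sum>j\<in>supp x. (w * c j * cinner z (e j)) *\<^sub>C d j x u)" for u
    proof -
      have "Ebra (1::complex) (Eket w u) = w *\<^sub>C u" by (simp add: Eket_def Ebra_tensor cinner_complex_def)
      then have "(Ebra z \<circ> (\<delta> x \<circ> Ebra (1::complex)) \<circ> Eket w) u = w *\<^sub>C Ebra z (\<delta> x u)"
        by (simp add: bounded_clinear_scaleC[OF \<delta>_bounded[OF x]] bounded_clinear_scaleC[OF bounded_clinear_Ebra])
      then show ?thesis
        by (simp add: \<delta>_def bounded_clinearD[OF bounded_clinear_Ebra] Ebra_tensor scaleC_sum_right scaleC_scaleC mult.assoc)
    qed
    ultimately show ?thesis by presburger
  qed
  then show ?thesis
    unfolding matrix_space_def
    using bounded_clinear_compose[OF \<delta>_bounded[OF x] bounded_clinear_Ebra] by auto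
qed

lemma ampliation_matrix:
  assumes x: "x \<in> A0" shows "(ampliation x :: ('h, 'k) tensor \<Rightarrow> _) \<in> matrix_space A"
proof -
  note b = A0_bounded[OF x] bounded_clinear_id
  have "Ebra z \<circ> (ampliation x :: ('h, 'k) tensor \<Rightarrow> _) \<circ> Eket w = (\<lambda>u. cinner z w *\<^sub>C x u)" for z w :: 'k
    by (rule ext) (simp add: ampliation_def Eket_def tensor_op_tensor[OF b] Ebra_tensor)
  then show ?thesis
    unfolding matrix_space_def using bounded_clinear_tensor_op[OF b] star_algebraD(7)[OF presentation(1)] A0_sub x
    by (auto simp: ampliation_def)
qed

lemma standard_form: "standard_form A A0 \<tau> \<delta>' \<delta> (ampliation :: _ \<Rightarrow> ('h, 'k) tensor \<Rightarrow> _)"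
  unfolding standard_form_def
proof (intro conjI ballI allI)
  show "dense_star_subalgebra A A0"
    unfolding dense_star_subalgebra_def
    using A0_sub A0_D(3,5,6,7,8) presentation(6) by simp
  show "\<tau> \<in> A0 \<rightarrow> A" using \<tau>_A0 A0_sub by blast
  show "op_linear_on A0 \<tau>" "op_linear_on A0 \<delta>"
    unfolding op_linear_on_def using \<tau>_additive \<tau>_scaleC \<delta>_additive \<delta>_scaleC by auto
  show "(ampliation :: _ \<Rightarrow> ('h, 'k) tensor \<Rightarrow> _) \<in> A0 \<rightarrow> matrix_space A" using ampliation_matrix by blast
  show "op_linear_on A0 (ampliation :: _ \<Rightarrow> ('h, 'k) tensor \<Rightarrow> _)"
    unfolding op_linear_on_def ampliation_def
    using A0_bounded by (auto simp: tensor_op_add_left tensor_op_scaleC_left bounded_clinear_id)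
  show "(ampliation id :: ('h, 'k) tensor \<Rightarrow> _) = id" by (simp add: ampliation_def tensor_op_id)
  fix x assume x: "x \<in> A0"
  show "\<tau> (cadjoint x) = cadjoint (\<tau> x)" by (rule \<tau>_cadjoint[OF x])
  show "\<delta> x \<circ> Ebra (1::complex) \<in> matrix_space A" by (rule \<delta>_matrix[OF x])
  show "\<delta>' x = cadjoint (\<delta> (cadjoint x))" by (simp add: \<delta>'_def)
  show "(ampliation (cadjoint x) :: ('h, 'k) tensor \<Rightarrow> _) = cadjoint (ampliation x)"
    by (simp add: ampliation_def cadjoint_tensor_op A0_bounded x bounded_clinear_id cadjoint_id)
  fix y assume y: "y \<in> A0"
  show "(ampliation (x \<circ> y) :: ('h, 'k) tensor \<Rightarrow> _) = ampliation x \<circ> ampliation y"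
    unfolding ampliation_def by (simp add: tensor_op_compose A0_bounded x y bounded_clinear_id)
  show "\<tau> (x \<circ> y) u - \<tau> x (y u) - x (\<tau> y u) = \<delta>' x (\<delta> y u)" for u by (rule \<tau>_compose[OF x y])
  show "\<delta> (x \<circ> y) u = \<delta> x (y u) + ampliation x (\<delta> y u)" for u by (rule \<delta>_compose[OF x y])
qed

text \<open>Each of the three nonzero blocks is a finite sum of operators on \<open>h\<close>
  tensored with rank one operators built from \<open>(1, 0)\<close> and the
  \<open>(0, e j)\<close>.\<close>

lemma \<phi>_algebraic:
  assumes x: "x \<in> A0" shows "\<phi> x \<in> algebraic_tensor A0"
proof -
  have x': "cadjoint x \<in> A0" by (rule A0_D(8)[OF x])
  obtain F where F: "finite F" "F \<subseteq> J" "supp x \<subseteq> F" "supp (cadjoint x) \<subseteq> F"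
    using common_support[OF x x' x] .
  let ?r = "\<lambda>b a \<zeta>. cinner b \<zeta> *\<^sub>C (a :: complex \<times> 'k)"
  have "\<phi> x v = (\<tau> x \<otimes>\<^sub>o ?r (1, 0) (1, 0)) v
      + ((\<Sum>j\<in>F. ((\<lambda>u. (- cnj (c j)) *\<^sub>C d j x u) \<otimes>\<^sub>o ?r (0, e j) (1, 0)) v)
       + (\<Sum>j\<in>F. ((\<lambda>u. c j *\<^sub>C d j x u) \<otimes>\<^sub>o ?r (1, 0) (0, e j)) v))" for v
  proof -
    let ?v0 = "Ebra (1, 0) v"
    note Ek = bounded_clinearD[OF bounded_clinear_Eket[of "(1::complex, 0::'k)"]]
    have P: "bounded_clinear (id \<otimes>\<^sub>o Pair 0 :: ('h, 'k) tensor \<Rightarrow> ('h, complex \<times> 'k) tensor)"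
      by (intro bounded_clinear_tensor_op bounded_clinear_id bounded_clinear_Pair0)
    have "(\<Sum>j\<in>F. ((\<lambda>u. c j *\<^sub>C d j x u) \<otimes>\<^sub>o ?r (1, 0) (0, e j)) v) = (id \<otimes>\<^sub>o Pair 0) (\<delta> x ?v0)"
      unfolding \<delta>_superset[OF F(1,3,2)] bounded_clinear_sumD[OF P]
    proof (intro sum.cong refl)
      fix j assume "j \<in> F"
      then have "bounded_clinear (\<lambda>u. c j *\<^sub>C d j x u)" using F(2) x by (intro bounded_clinear_scale d_bounded) auto
      then show "((\<lambda>u. c j *\<^sub>C d j x u) \<otimes>\<^sub>o ?r (1, 0) (0, e j)) v = (id \<otimes>\<^sub>o Pair 0) (c j *\<^sub>C (d j x ?v0 \<otimes>\<^sub>H e j))"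
        by (simp add: tensor_op_rank_one bounded_clinear_scaleC[OF P] tensor_op_tensor bounded_clinear_id
            bounded_clinear_Pair0 Eket_def tensor_scaleC_left)
    qed
    moreover have "(\<Sum>j\<in>F. ((\<lambda>u. (- cnj (c j)) *\<^sub>C d j x u) \<otimes>\<^sub>o ?r (0, e j) (1, 0)) v) =
        Eket (1, 0) (\<delta>' x ((id \<otimes>\<^sub>o snd) v))"
      unfolding \<delta>'_apply[OF x F(1,4,2)] Ek sum_negf[symmetric]
    proof (intro sum.cong refl)
      fix j assume "j \<in> F"
      then have "bounded_clinear (\<lambda>u. (- cnj (c j)) *\<^sub>C d j x u)" using F(2) x by (intro bounded_clinear_scale d_bounded) auto
      then show "((\<lambda>u. (- cnj (c j)) *\<^sub>C d j x u) \<otimes>\<^sub>o ?r (0, e j) (1, 0)) v =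
          - (cnj (c j) *\<^sub>C Eket (1, 0) (d j x (Ebra (e j) ((id \<otimes>\<^sub>o snd) v))))"
        by (simp add: tensor_op_rank_one Ebra_snd Ek)
    qed
    moreover have "(\<tau> x \<otimes>\<^sub>o ?r (1, 0) (1, 0)) v = Eket (1, 0) (\<tau> x ?v0)"
      by (rule tensor_op_rank_one[OF A0_bounded[OF \<tau>_A0[OF x]]])
    ultimately show ?thesis
      by (simp add: \<phi>_def block_operator_def Let_def Ek add.assoc)
  qed
  then have eq: "\<phi> x = (\<lambda>v. (\<tau> x \<otimes>\<^sub>o ?r (1, 0) (1, 0)) v
      + ((\<Sum>j\<in>F. ((\<lambda>u. (- cnj (c j)) *\<^sub>C d j x u) \<otimes>\<^sub>o ?r (0, e j) (1, 0)) v)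
       + (\<Sum>j\<in>F. ((\<lambda>u. c j *\<^sub>C d j x u) \<otimes>\<^sub>o ?r (1, 0) (0, e j)) v)))" by (rule ext)
  show ?thesis
    unfolding eq
    by (intro algebraic_tensor_add algebraic_tensor_sum algebraic_tensor_tensor_op \<tau>_A0 bounded_clinear_rank_one
        A0_D(7) d_A0 x) (use F(2) in auto)
qed

text \<open>The entry that drives the weak equation, written as a combination of derivations over a
  common finite support. The two sums come from the adjoint block and from
  \<open>\<delta>\<close>.\<close>

lemma \<phi>_matrix:
  assumes x: "x \<in> A0" and F: "finite F" "F \<subseteq> J" "supp x \<subseteq> F" "supp (cadjoint x) \<subseteq> F"
  shows "Ebra (1, f) (\<phi> x (Eket (1, g) u)) =
    \<tau> x u - (\<Sum>j\<in>F. (cnj (c j) * cinner (e j) g) *\<^sub>C d j x u) + (\<Sum>j\<in>F. (c j * cinner f (e j)) *\<^sub>C d j x u)"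
proof -
  have "\<delta>' x (u \<otimes>\<^sub>H g) = - (\<Sum>j\<in>F. (cnj (c j) * cinner (e j) g) *\<^sub>C d j x u)"
    unfolding \<delta>'_apply[OF x F(1,4,2)]
    using F(2) by (intro arg_cong[where f=uminus] sum.cong refl)
      (auto simp: Ebra_tensor bounded_clinear_scaleC[OF d_bounded[OF _ x]] subset_iff scaleC_scaleC)
  moreover have "Ebra f (\<delta> x u) = (\<Sum>j\<in>F. (c j * cinner f (e j)) *\<^sub>C d j x u)"
    unfolding \<delta>_superset[OF F(1,3,2)]
    by (simp add: bounded_clinearD[OF bounded_clinear_Ebra] Ebra_tensor scaleC_scaleC)
  ultimately show ?thesis
    unfolding \<phi>_def block_operator_matrix by (simp add: scaleC_one)
qed

end

section \<open>Step functions and Weyl operators\<close>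

definition piece :: "real \<Rightarrow> real \<Rightarrow> 'k::complex_inner \<Rightarrow> real \<Rightarrow> 'k"
  where "piece a b z = (\<lambda>t. if a \<le> t \<and> t < b then z else 0)"

lemma step_fun_zero: "step_fun (\<lambda>_. 0)"
  unfolding step_fun_def by (rule exI[of _ 0]) simp

lemma step_fun_add_piece:
  assumes "step_fun f" "0 \<le> a" shows "step_fun (\<lambda>t. f t + piece a b z t)"
proof -
  obtain n :: nat and a' b' z' where f: "\<forall>m<n. 0 \<le> a' m" "f = (\<lambda>t. \<Sum>m<n. if a' m \<le> t \<and> t < b' m then z' m else 0)"
    using assms(1) unfolding step_fun_def by blast
  let ?a = "a'(n := a)" and ?b = "b'(n := b)" and ?z = "z'(n := z)"
  have "(\<forall>m<Suc n. 0 \<le> ?a m) \<and>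
      (\<lambda>t. f t + piece a b z t) = (\<lambda>t. \<Sum>m<Suc n. if ?a m \<le> t \<and> t < ?b m then ?z m else 0)"
    using f assms(2) by (auto simp: less_Suc_eq piece_def intro!: ext sum.cong)
  then show ?thesis unfolding step_fun_def by blast
qed

text \<open>The intervals in the definition of a step function may overlap; a step function is
  treated as a finite sum of pieces and never brought to a disjoint form.\<close>

lemma step_fun_induct [consumes 1, case_names zero piece]:
  assumes "step_fun f" and "P (\<lambda>_. 0)"
    and step: "\<And>g a b z. step_fun g \<Longrightarrow> P g \<Longrightarrow> 0 \<le> a \<Longrightarrow> P (\<lambda>t. g t + piece a b z t)"
  shows "P f"
proof -
  obtain n :: nat and a b z where f: "\<forall>m<n. 0 \<le> a m" "f = (\<lambda>t. \<Sum>m<n. if a m \<le> t \<and> t < b m then z m else 0)"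
    using assms(1) unfolding step_fun_def by blast
  have "step_fun (\<lambda>t. \<Sum>m<k. piece (a m) (b m) (z m) t) \<and> P (\<lambda>t. \<Sum>m<k. piece (a m) (b m) (z m) t)"
    if "k \<le> n" for k
    using that
  proof (induction k)
    case 0 show ?case using assms(2) step_fun_zero by simp
  next
    case (Suc k)
    then have "step_fun (\<lambda>t. \<Sum>m<k. piece (a m) (b m) (z m) t)" "P (\<lambda>t. \<Sum>m<k. piece (a m) (b m) (z m) t)"
      and "0 \<le> a k" using f(1) by auto
    from step[OF this, of "b k" "z k"] step_fun_add_piece[OF this(1,3), of "b k" "z k"]
    show ?case by simp
  qed
  from this[of n] show ?thesis by (simp add: f(2) piece_def)
qed

lemma step_fun_piece: "0 \<le> a \<Longrightarrow> step_fun (piece a b z)"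
  using step_fun_add_piece[OF step_fun_zero, of a b z] by simp

lemma step_fun_add:
  assumes "step_fun f" "step_fun g" shows "step_fun (\<lambda>t. f t + g t)"
  using assms(2)
proof (induction rule: step_fun_induct)
  case (piece g a b z)
  then show ?case using step_fun_add_piece[OF piece.IH piece.hyps(2)] by (simp add: add.assoc)
qed (use assms(1) in simp)

lemma step_fun_map:
  assumes "step_fun f" "\<And>x y. F (x + y) = F x + F y" "F 0 = 0" shows "step_fun (\<lambda>t. F (f t))"
  using assms(1)
proof (induction rule: step_fun_induct)
  case zero show ?case using assms(3) step_fun_zero by simp
next
  case (piece g a b z)
  have "(\<lambda>t. F (g t + piece a b z t)) = (\<lambda>t. F (g t) + piece a b (F z) t)"
    by (auto simp: assms(2,3) piece_def)
  then show ?case using step_fun_add_piece[OF piece.IH piece.hyps(2)] by simp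
qed

lemma step_fun_if:
  assumes "step_fun f" "0 \<le> a" shows "step_fun (\<lambda>t. if a \<le> t \<and> t < b then f t else 0)"
  using assms(1)
proof (induction rule: step_fun_induct)
  case zero show ?case using step_fun_zero by simp
next
  case (piece g a' b' z)
  have "(\<lambda>t. if a \<le> t \<and> t < b then g t + piece a' b' z t else 0) =
      (\<lambda>t. (if a \<le> t \<and> t < b then g t else 0) + piece (max a a') (min b b') z t)"
    by (auto simp: piece_def)
  then show ?case using step_fun_add_piece[OF piece.IH, of "max a a'"] assms(2) by simp
qed

lemma step_fun_cinner:
  assumes "step_fun f" "step_fun g" shows "step_fun (\<lambda>t. cinner (f t) (g t))"
  using assms(1)
proof (induction rule: step_fun_induct)
  case zero show ?case using step_fun_zero by (simp add: cinner_zero_left)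
next
  case (piece h a b z)
  have "step_fun (\<lambda>t. cinner z (g t))"
    by (rule step_fun_map[OF assms(2)]) (simp_all add: cinner_simps)
  from step_fun_add[OF piece.IH step_fun_if[OF this piece.hyps(2), of b]]
  show ?case by (rule back_subst[of step_fun]) (auto simp: piece_def cinner_simps)
qed

lemma step_fun_neg: "step_fun f \<Longrightarrow> t < 0 \<Longrightarrow> f t = 0"
  by (induction rule: step_fun_induct) (auto simp: piece_def)

lemma step_fun_cut:
  assumes "step_fun f" "0 \<le> t" shows "step_fun (cut {0..<t} f)" "step_fun (cut {t..} f)"
proof -
  show 1: "step_fun (cut {0..<t} f)"
    using step_fun_if[OF assms(1), of 0 t] by (simp add: cut_def)
  show "step_fun (cut {t..} f)"
    using assms(1)
  proof (induction rule: step_fun_induct)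
    case zero show ?case using step_fun_zero by (simp add: cut_def)
  next
    case (piece g a b z)
    have "cut {t..} (\<lambda>s. g s + piece a b z s) = (\<lambda>s. cut {t..} g s + piece (max a t) b z s)"
      by (auto simp: cut_def piece_def)
    then show ?case using step_fun_add_piece[OF piece.IH, of "max a t"] assms(2) by simp
  qed
qed

section \<open>Measurability, integrals and primitives of step functions\<close>

lemma simple_function_piece: "simple_function half_line (piece a b z)"
proof -
  have "{t \<in> space half_line. a \<le> t \<and> t < b} = {0..} \<inter> {a..<b}" by (auto simp: space_restrict_space)
  also have "\<dots> \<in> sets half_line"
    unfolding sets_restrict_space by (rule imageI) simp
  finally have "{t \<in> space half_line. a \<le> t \<and> t < b} \<in> sets half_line" .
  then show ?thesis unfolding piece_def by (intro simple_function_If) auto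
qed

lemma step_fun_simple: "step_fun f \<Longrightarrow> simple_function half_line f"
proof (induction rule: step_fun_induct)
  case (piece g a b z)
  then show ?case using simple_function_compose2[OF piece.IH simple_function_piece, of "(+)"] by simp
qed simp

lemma step_fun_strongly_measurable: "step_fun f \<Longrightarrow> strongly_measurable half_line f"
  unfolding strongly_measurable_def using step_fun_simple by (intro exI[of _ "\<lambda>_. f"]) auto

lemma piece_integral:
  fixes z :: complex
  assumes "0 \<le> a"
  shows "integrable half_line (piece a b z)" "(\<integral>t. piece a b z t \<partial>half_line) = of_real (max 0 (b - a)) * z"
proof -
  have ab: "{a..<b} \<subseteq> {0..}" using assms by auto
  have eq: "piece a b z = (\<lambda>t. indicator {a..<b} t *\<^sub>R z)" by (auto simp: piece_def indicator_def)
  have s: "{a..<b} \<in> sets half_line" using ab by (auto simp: sets_restrict_space intro!: image_eqI[of _ _ "{a..<b}"])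
  have em: "emeasure half_line {a..<b} = ennreal (max 0 (b - a))"
    using ab by (simp add: emeasure_restrict_space max_def)
  show "integrable half_line (piece a b z)"
    unfolding eq using s em by (intro integrable_scaleR_left) (simp add: integrable_real_indicator)
  have "measure half_line {a..<b} = max 0 (b - a)" unfolding measure_def em by (simp add: max_def)
  then show "(\<integral>t. piece a b z t \<partial>half_line) = of_real (max 0 (b - a)) * z"
    unfolding eq using s em ab
    by (subst integral_scaleR_left) (auto simp: integrable_real_indicator scaleR_conv_of_real space_restrict_space Int_absorb2)
qed

lemma step_fun_integrable:
  fixes h :: "real \<Rightarrow> complex"
  assumes "step_fun h" shows "integrable half_line h"
  using assms by (induction rule: step_fun_induct) (auto intro: piece_integral)

text \<open>The function is the length of the part of \<open>{a..<b}\<close> lying before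
  \<open>t\<close>: continuous, and locally affine away from the two end points. An empty interval
  is covered by the outer maximum.\<close>

lemma piece_primitive:
  fixes a b :: real
  shows "continuous_on UNIV (\<lambda>t. max 0 (min b t - a))"
    and "t \<noteq> a \<Longrightarrow> t \<noteq> b \<Longrightarrow>
      ((\<lambda>t. max 0 (min b t - a)) has_vector_derivative (if a \<le> t \<and> t < b then 1 else 0)) (at t)"
proof -
  show "continuous_on UNIV (\<lambda>t. max 0 (min b t - a))" by (intro continuous_intros)
  assume t: "t \<noteq> a" "t \<noteq> b"
  consider "t < a" | "a < t" "t < b" | "a < t" "b < t" using t by linarith
  then show "((\<lambda>t. max 0 (min b t - a)) has_vector_derivative (if a \<le> t \<and> t < b then 1 else 0)) (at t)"
  proof cases
    case 1
    have "((\<lambda>_. 0::real) has_vector_derivative 0) (at t)" by (rule has_vector_derivative_const)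
    from has_vector_derivative_transform_within_open[OF this, of "{..<a}" "\<lambda>t. max 0 (min b t - a)"] 1
    show ?thesis by auto
  next
    case 2
    have "((\<lambda>t. t - a) has_vector_derivative 1) (at t)" by (auto intro!: derivative_eq_intros)
    from has_vector_derivative_transform_within_open[OF this, of "{a<..<b}" "\<lambda>t. max 0 (min b t - a)"] 2
    show ?thesis by auto
  next
    case 3
    have "((\<lambda>_. max 0 (b - a)) has_vector_derivative 0) (at t)" by (rule has_vector_derivative_const)
    from has_vector_derivative_transform_within_open[OF this, of "{max a b<..}" "\<lambda>t. max 0 (min b t - a)"] 3
    show ?thesis by auto
  qed
qed

lemma cut_add: "cut S (\<lambda>t. f t + g t) = (\<lambda>t. cut S f t + cut S g t)"
  by (auto simp: cut_def)

lemma cut_integrable: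
  fixes h :: "real \<Rightarrow> complex"
  assumes "step_fun h" shows "integrable half_line (cut {0..<t} h)"
proof -
  have "step_fun (cut {0..<t} h)" using step_fun_if[OF assms, of 0 t] by (simp add: cut_def)
  then show ?thesis by (rule step_fun_integrable)
qed

text \<open>Continuity together with differentiability off a finite set is the form required by the
  fundamental theorem of calculus for the weak equation.\<close>

lemma step_fun_primitive:
  fixes h :: "real \<Rightarrow> complex"
  assumes "step_fun h"
  shows "continuous_on UNIV (\<lambda>t. \<integral>s. cut {0..<t} h s \<partial>half_line) \<and>
    (\<exists>S. finite S \<and> (\<forall>t. t \<notin> S \<longrightarrow> ((\<lambda>t. \<integral>s. cut {0..<t} h s \<partial>half_line) has_vector_derivative h t) (at t)))"
  using assms
proof (induction rule: step_fun_induct)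
  case zero show ?case by (auto simp: cut_def)
next
  case (piece g a b z)
  have cp: "cut {0..<t} (piece a b z) = piece a (min b t) z" for t
    using piece.hyps(2) by (auto simp: cut_def piece_def)
  have eq: "(\<lambda>t. \<integral>s. cut {0..<t} (\<lambda>t. g t + piece a b z t) s \<partial>half_line) =
      (\<lambda>t. (\<integral>s. cut {0..<t} g s \<partial>half_line) + of_real (max 0 (min b t - a)) * z)"
    unfolding cut_add cp
    by (rule ext, subst Bochner_Integration.integral_add)
       (use piece piece_integral cut_integrable in auto)
  obtain S where S: "finite S"
    "\<And>t. t \<notin> S \<Longrightarrow> ((\<lambda>t. \<integral>s. cut {0..<t} g s \<partial>half_line) has_vector_derivative g t) (at t)"
    using piece.IH by blast
  have "((\<lambda>t. \<integral>s. cut {0..<t} (\<lambda>t. g t + piece a b z t) s \<partial>half_line) has_vector_derivative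
      (g t + piece a b z t)) (at t)" if t: "t \<notin> S \<union> {a, b}" for t
  proof -
    have "((\<lambda>t. of_real (max 0 (min b t - a)) * z) has_vector_derivative
        of_real (if a \<le> t \<and> t < b then 1 else 0) * z) (at t)"
      by (rule has_vector_derivative_mult_left[OF has_vector_derivative_of_real[OF
            piece_primitive(2)[folded has_real_derivative_iff_has_vector_derivative]]]) (use t in auto)
    moreover have "of_real (if a \<le> t \<and> t < b then 1 else 0) * z = piece a b z t" by (simp add: piece_def)
    ultimately show ?thesis
      unfolding eq using has_vector_derivative_add[OF S(2)] t by auto
  qed
  moreover have "continuous_on UNIV (\<lambda>t. \<integral>s. cut {0..<t} (\<lambda>t. g t + piece a b z t) s \<partial>half_line)"
    unfolding eq using piece.IH piece_primitive(1)
    by (intro continuous_on_add continuous_on_mult_right continuous_on_of_real) auto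
  ultimately show ?case using S(1) by (intro conjI exI[of _ "S \<union> {a, b}"]) auto
qed

lemma integral_cut_split:
  fixes h :: "real \<Rightarrow> complex"
  assumes "step_fun h" "0 \<le> t"
  shows "(\<integral>s. h s \<partial>half_line) = (\<integral>s. cut {0..<t} h s \<partial>half_line) + (\<integral>s. cut {t..} h s \<partial>half_line)"
proof -
  have "h = (\<lambda>s. cut {0..<t} h s + cut {t..} h s)"
    using step_fun_neg[OF assms(1)] assms(2) by (auto simp: cut_def fun_eq_iff)
  then have "(\<integral>s. h s \<partial>half_line) = (\<integral>s. cut {0..<t} h s + cut {t..} h s \<partial>half_line)" by simp
  also have "\<dots> = (\<integral>s. cut {0..<t} h s \<partial>half_line) + (\<integral>s. cut {t..} h s \<partial>half_line)"
    by (intro Bochner_Integration.integral_add step_fun_integrable step_fun_cut assms)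
  finally show ?thesis .
qed

section \<open>Exponential vectors and Weyl operators\<close>

text \<open>The inner product of the one-particle space on plain functions, so that sums and cuts
  need no passage through \<open>l2fun\<close>. On step functions it agrees with the kernel of
  \<open>l2fun\<close>.\<close>

definition ip :: "(real \<Rightarrow> 'k::complex_inner) \<Rightarrow> (real \<Rightarrow> 'k) \<Rightarrow> complex"
  where "ip f g = (\<integral>t. cinner (f t) (g t) \<partial>half_line)"

lemma ip_integrable: "step_fun f \<Longrightarrow> step_fun g \<Longrightarrow> integrable half_line (\<lambda>t. cinner (f t) (g t))"
  by (intro step_fun_integrable step_fun_cinner)

lemma ip_add_right: "step_fun f \<Longrightarrow> step_fun g \<Longrightarrow> step_fun h \<Longrightarrow> ip f (\<lambda>t. g t + h t) = ip f g + ip f h"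
  unfolding ip_def by (simp add: cinner_add_right ip_integrable)

lemma ip_commute: "ip f g = cnj (ip g f)"
  unfolding ip_def by (subst Bochner_Integration.integral_cnj[symmetric]) (simp add: cinner_commute[symmetric])

lemma ip_add_left: "step_fun f \<Longrightarrow> step_fun g \<Longrightarrow> step_fun h \<Longrightarrow> ip (\<lambda>t. g t + h t) f = ip g f + ip h f"
  unfolding ip_def by (simp add: cinner_add_left ip_integrable)

lemma ip_uminus_right: "ip f (\<lambda>t. - g t) = - ip f g"
  unfolding ip_def by (simp add: cinner_minus_right)

lemma ip_uminus_left: "ip (\<lambda>t. - g t) f = - ip g f"
  unfolding ip_def by (simp add: cinner_minus_left)

lemma ip_self_real: "cnj (ip f f) = ip f f"
  using ip_commute[of f f] by simp

lemma ip_self: "of_real (\<integral>t. (norm (f t))\<^sup>2 \<partial>half_line) = ip f f"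
  unfolding ip_def cinner_self by (rule integral_complex_of_real[symmetric])

lemma step_fun_square_integrable:
  assumes "step_fun f" shows "integrable half_line (\<lambda>t. (norm (f t))\<^sup>2)"
  using integrable_Re[OF ip_integrable[OF assms assms]] by (simp add: power2_norm_eq_cinner)

lemma Rep_Abs_step:
  assumes "step_fun f" shows "Rep_l2fun (Abs_l2fun f) = f"
  by (rule Abs_l2fun_inverse) (use step_fun_strongly_measurable step_fun_square_integrable assms in auto)

lemma cinner_expv:
  assumes "step_fun f" "step_fun g" shows "cinner (expv f) (expv g) = exp (ip f g)"
  unfolding expv_def cinner_exp_vector kern_l2fun_def Rep_Abs_step[OF assms(1)] Rep_Abs_step[OF assms(2)] ip_def ..

lemma nexpv_expv: "nexpv f = exp (- ip f f / 2) *\<^sub>C expv f"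
  unfolding nexpv_def scaleR_scaleC ip_self[symmetric]
  by (simp add: exp_of_real[symmetric] del: exp_of_real)

lemma nexpv_exp_domain: "step_fun f \<Longrightarrow> nexpv f \<in> exp_domain"
  unfolding nexpv_expv exp_domain_def
  by (intro complex_vector.span_scale complex_vector.span_base) auto

definition is_weyl :: "(real \<Rightarrow> 'k::complex_inner) \<Rightarrow> ('k noise \<Rightarrow> 'k noise) \<Rightarrow> bool"
  where "is_weyl w W \<longleftrightarrow> bounded_clinear W \<and>
    (\<forall>g. step_fun g \<longrightarrow> W (expv g) = exp (- ip w w / 2 - ip w g) *\<^sub>C expv (\<lambda>t. g t + w t)) \<and>
    (\<forall>z. (\<forall>g. step_fun g \<longrightarrow> cinner (expv g) z = 0) \<longrightarrow> W z = z)"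

text \<open>Exponential vectors of step functions are in fact total, but taking the Weyl operator to be the
  identity on the orthogonal complement of their span makes this density unnecessary.\<close>

definition weyl :: "(real \<Rightarrow> 'k::complex_inner) \<Rightarrow> 'k noise \<Rightarrow> 'k noise"
  where "weyl w = (SOME W. is_weyl w W)"

lemma noise_total:
  "closure (cspan ({expv g | g. step_fun g} \<union> {z :: 'k::complex_inner noise. \<forall>g. step_fun g \<longrightarrow> cinner (expv g) z = 0})) = UNIV"
proof -
  have "{z :: 'k noise. \<forall>x\<in>{expv g | g. step_fun g}. cinner x z = 0} =
      {z. \<forall>g. step_fun g \<longrightarrow> cinner (expv g) z = 0}" by auto
  then show ?thesis using total_union_orthogonal[of "{expv g | g. step_fun g} :: 'k noise set"] by simp
qed

text \<open>The scalar factor is chosen so that its exponents cancel the terms involving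
  \<open>w\<close> in \<open>ip (f + w) (g + w)\<close>. Inner products of exponential vectors are
  therefore preserved, and \<open>isometric_extension\<close> supplies the operator.\<close>

lemma weyl_exists:
  fixes w :: "real \<Rightarrow> 'k::complex_inner"
  assumes w: "step_fun w" shows "is_weyl w (weyl w)"
proof -
  \<comment> \<open>The sum type indexes the two parts of the total set: \<open>Inl\<close> the
    exponential vectors of step functions, \<open>Inr\<close> the vectors orthogonal to all of
    them.\<close>
  define S where "S = Inl ` {g :: real \<Rightarrow> 'k. step_fun g} \<union> Inr ` {z :: 'k noise. \<forall>g. step_fun g \<longrightarrow> cinner (expv g) z = 0}"
  define x where "x = case_sum (\<lambda>g. expv g) (\<lambda>z :: 'k noise. z)"
  define y where "y = case_sum (\<lambda>g. exp (- ip w w / 2 - ip w g) *\<^sub>C expv (\<lambda>t. g t + w t)) (\<lambda>z :: 'k noise. z)"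
  have "x ` S = {expv g | g. step_fun g} \<union> {z. \<forall>g. step_fun g \<longrightarrow> cinner (expv g) z = 0}"
    unfolding S_def x_def by (auto simp: image_Un image_image)
  then have total: "closure (cspan (x ` S)) = UNIV" using noise_total by simp
  have 1: "cinner (y (Inl f)) (y (Inl g)) = cinner (x (Inl f)) (x (Inl g))" if f: "step_fun f" and g: "step_fun g" for f g
  proof -
    have "cinner (y (Inl f)) (y (Inl g)) = cnj (exp (- ip w w / 2 - ip w f)) * exp (- ip w w / 2 - ip w g) *
        exp (ip (\<lambda>t. f t + w t) (\<lambda>t. g t + w t))"
      unfolding y_def by (simp add: cinner_simps cinner_expv step_fun_add f g w)
    also have "\<dots> = exp (cnj (- ip w w / 2 - ip w f) + (- ip w w / 2 - ip w g) + (ip f g + ip f w + (ip w g + ip w w)))"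
      unfolding ip_add_left[OF step_fun_add[OF g w] f w] ip_add_right[OF f g w] ip_add_right[OF w g w]
      by (simp only: exp_add exp_cnj)
    also have "cnj (- ip w w / 2 - ip w f) + (- ip w w / 2 - ip w g) + (ip f g + ip f w + (ip w g + ip w w)) = ip f g"
      by (simp add: ip_self_real ip_commute[of w f] field_simps)
    finally show ?thesis by (simp add: x_def cinner_expv f g)
  qed
  have 2: "cinner (y (Inl f)) (y (Inr z)) = 0 \<and> cinner (x (Inl f)) (x (Inr z)) = 0 \<and>
      cinner (y (Inr z)) (y (Inl f)) = 0 \<and> cinner (x (Inr z)) (x (Inl f)) = 0"
    if f: "step_fun f" and z: "\<forall>g. step_fun g \<longrightarrow> cinner (expv g) z = 0" for f z
  proof -
    have "cinner (expv (\<lambda>t. f t + w t)) z = 0" "cinner (expv f) z = 0" using z f w step_fun_add by blast+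
    moreover from this have "cinner z (expv (\<lambda>t. f t + w t)) = 0" "cinner z (expv f) = 0"
      by (metis cinner_commute complex_cnj_zero)+
    ultimately show ?thesis by (simp add: x_def y_def cinner_simps)
  qed
  have "cinner (y i) (y j) = cinner (x i) (x j)" if "i \<in> S" "j \<in> S" for i j
    using that 1 2 unfolding S_def by (auto simp: x_def y_def)
  then obtain W where W: "bounded_clinear W" "\<And>i. i \<in> S \<Longrightarrow> W (x i) = y i"
    using isometric_extension[OF total, of y] by blast
  have "W (expv g) = exp (- ip w w / 2 - ip w g) *\<^sub>C expv (\<lambda>t. g t + w t)" if "step_fun g" for g
    using W(2)[of "Inl g"] that by (simp add: S_def x_def y_def)
  moreover have "W z = z" if "\<forall>g. step_fun g \<longrightarrow> cinner (expv g) z = 0" for z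
    using W(2)[of "Inr z"] that by (simp add: S_def x_def y_def)
  ultimately have "is_weyl w W" unfolding is_weyl_def using W(1) by blast
  then show ?thesis unfolding weyl_def by (rule someI[of "is_weyl w"])
qed

lemma weyl_bounded: "step_fun w \<Longrightarrow> bounded_clinear (weyl w)"
  using weyl_exists unfolding is_weyl_def by blast

lemma weyl_expv:
  "step_fun w \<Longrightarrow> step_fun g \<Longrightarrow> weyl w (expv g) = exp (- ip w w / 2 - ip w g) *\<^sub>C expv (\<lambda>t. g t + w t)"
  using weyl_exists unfolding is_weyl_def by blast

lemma weyl_orthogonal:
  "step_fun w \<Longrightarrow> \<forall>g. step_fun g \<longrightarrow> cinner (expv g) z = 0 \<Longrightarrow> weyl w z = z"
  using weyl_exists unfolding is_weyl_def by blast

lemma noise_op_ext: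
  fixes S T :: "'k::complex_inner noise \<Rightarrow> 'b::chilbert_space"
  assumes "bounded_clinear S" "bounded_clinear T" "\<And>g. step_fun g \<Longrightarrow> S (expv g) = T (expv g)"
    "\<And>z. \<forall>g. step_fun g \<longrightarrow> cinner (expv g) z = 0 \<Longrightarrow> S z = T z"
  shows "S = T"
  by (rule bounded_clinear_eq_on_total[OF assms(1,2) noise_total]) (use assms(3,4) in auto)

lemma weyl_zero: "weyl (\<lambda>_. 0) = id"
  by (rule noise_op_ext)
     (auto simp: weyl_bounded step_fun_zero bounded_clinear_id weyl_expv weyl_orthogonal ip_def cinner_zero_left scaleC_one)

text \<open>In general the product differs from the Weyl operator of the sum by the phase
  \<open>exp (- \<i> * Im (ip w w'))\<close>, which is 1 under the hypothesis.\<close>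

lemma weyl_compose:
  assumes w: "step_fun w" "step_fun w'" and real: "Im (ip w w') = 0"
  shows "weyl w \<circ> weyl w' = weyl (\<lambda>t. w t + w' t)"
proof (rule noise_op_ext)
  show "bounded_clinear (weyl w \<circ> weyl w')" "bounded_clinear (weyl (\<lambda>t. w t + w' t))"
    by (intro bounded_clinear_compose weyl_bounded step_fun_add w)+
  show "(weyl w \<circ> weyl w') z = weyl (\<lambda>t. w t + w' t) z" if "\<forall>g. step_fun g \<longrightarrow> cinner (expv g) z = 0" for z
    using that by (simp add: weyl_orthogonal w step_fun_add)
  fix g :: "real \<Rightarrow> 'a" assume g: "step_fun g"
  have sym: "ip w' w = ip w w'"
    using real ip_commute[of w' w] by (simp add: complex_eq_iff)
  have "(weyl w \<circ> weyl w') (expv g) =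
      (exp (- ip w' w' / 2 - ip w' g) * exp (- ip w w / 2 - ip w (\<lambda>t. g t + w' t))) *\<^sub>C expv (\<lambda>t. (g t + w' t) + w t)"
    using weyl_expv[OF w(1) step_fun_add[OF g w(2)]]
    by (simp add: weyl_expv w g bounded_clinear_scaleC[OF weyl_bounded[OF w(1)]] scaleC_scaleC)
  also have "exp (- ip w' w' / 2 - ip w' g) * exp (- ip w w / 2 - ip w (\<lambda>t. g t + w' t)) =
      exp (- ip (\<lambda>t. w t + w' t) (\<lambda>t. w t + w' t) / 2 - ip (\<lambda>t. w t + w' t) g)"
    unfolding exp_add[symmetric] ip_add_right[OF w(1) g w(2)] ip_add_left[OF g w]
      ip_add_left[OF step_fun_add[OF w] w] ip_add_right[OF w(1) w] ip_add_right[OF w(2) w] sym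
    by (rule arg_cong[where f=exp]) (simp add: field_simps)
  also have "(\<lambda>t. (g t + w' t) + w t) = (\<lambda>t. g t + (w t + w' t))" by (simp add: add_ac)
  finally show "(weyl w \<circ> weyl w') (expv g) = weyl (\<lambda>t. w t + w' t) (expv g)"
    using weyl_expv[OF step_fun_add[OF w] g] by simp
qed

lemma step_fun_uminus: "step_fun f \<Longrightarrow> step_fun (\<lambda>t. - f t)"
  by (rule step_fun_map[of f uminus]) auto

text \<open>The identity is tested by pairing the members of the total set. On two exponential
  vectors it is a comparison of exponents; mixed pairs give zero on both sides; on the orthogonal
  part both operators are the identity.\<close>

lemma cadjoint_weyl:
  assumes w: "step_fun w" shows "cadjoint (weyl w) = weyl (\<lambda>t. - w t)"
proof -
  note w' = step_fun_uminus[OF w] and wb = weyl_bounded[OF w]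
  have ex: "cinner (weyl w (expv f)) (expv g) = cinner (expv f) (weyl (\<lambda>t. - w t) (expv g))"
    if f: "step_fun f" and g: "step_fun g" for f g
  proof -
    have "cinner (weyl w (expv f)) (expv g) = exp (cnj (- ip w w / 2 - ip w f) + (ip f g + ip w g))"
      by (simp add: weyl_expv w f cinner_simps cinner_expv step_fun_add g ip_add_left exp_add exp_cnj)
    also have "cnj (- ip w w / 2 - ip w f) + (ip f g + ip w g) =
        (- ip (\<lambda>t. - w t) (\<lambda>t. - w t) / 2 - ip (\<lambda>t. - w t) g) + (ip f g + ip f (\<lambda>t. - w t))"
      by (simp add: ip_self_real ip_commute[of w f] ip_uminus_left ip_uminus_right)
    also have "exp \<dots> = exp (- ip (\<lambda>t. - w t) (\<lambda>t. - w t) / 2 - ip (\<lambda>t. - w t) g) * exp (ip f (\<lambda>t. g t + - w t))"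
      unfolding ip_add_right[OF f g w'] by (rule exp_add)
    also have "\<dots> = cinner (expv f) (weyl (\<lambda>t. - w t) (expv g))"
      unfolding weyl_expv[OF w' g] cinner_scaleC_right cinner_expv[OF f step_fun_add[OF g w']] ..
    finally show ?thesis .
  qed
  \<comment> \<open>A Weyl operator sends exponential vectors of step functions to multiples of such
    vectors, so orthogonality to all of them is kept.\<close>
  have ort: "cinner (weyl v (expv f)) z = 0 \<and> cinner z (weyl v (expv f)) = 0"
    if v: "step_fun v" and f: "step_fun f" and z: "\<forall>g. step_fun g \<longrightarrow> cinner (expv g) z = 0"
    for v f and z :: "'a noise"
  proof -
    have "cinner (expv (\<lambda>t. f t + v t)) z = 0" using z f v step_fun_add by blast
    moreover from this have "cinner z (expv (\<lambda>t. f t + v t)) = 0"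
      by (metis cinner_commute complex_cnj_zero)
    ultimately show ?thesis by (simp add: weyl_expv v f cinner_simps)
  qed
  show ?thesis
  proof (rule noise_op_ext)
    show "bounded_clinear (cadjoint (weyl w))" "bounded_clinear (weyl (\<lambda>t. - w t))"
      by (intro bounded_clinear_cadjoint weyl_bounded w w')+
    fix g :: "real \<Rightarrow> 'a" assume g: "step_fun g"
    show "cadjoint (weyl w) (expv g) = weyl (\<lambda>t. - w t) (expv g)"
    proof (rule eq_on_total_cinner[OF noise_total])
      fix x :: "'a noise"
      assume "x \<in> {expv g |g. step_fun g} \<union> {z. \<forall>g. step_fun g \<longrightarrow> cinner (expv g) z = 0}"
      then consider f where "step_fun f" "x = expv f" | "\<forall>g. step_fun g \<longrightarrow> cinner (expv g) x = 0" by blast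
      then show "cinner x (cadjoint (weyl w) (expv g)) = cinner x (weyl (\<lambda>t. - w t) (expv g))"
      proof cases
        case 2
        then show ?thesis
          unfolding cinner_cadjoint[OF wb, symmetric] weyl_orthogonal[OF w 2]
          using ort[OF w' g 2] cinner_commute[of x "expv g"] 2 g by simp
      qed (simp add: cinner_cadjoint[OF wb, symmetric] ex g)
    qed
  next
    fix z :: "'a noise" assume z: "\<forall>g. step_fun g \<longrightarrow> cinner (expv g) z = 0"
    show "cadjoint (weyl w) z = weyl (\<lambda>t. - w t) z"
    proof (rule eq_on_total_cinner[OF noise_total])
      fix x :: "'a noise"
      assume "x \<in> {expv g |g. step_fun g} \<union> {z. \<forall>g. step_fun g \<longrightarrow> cinner (expv g) z = 0}"
      then consider f where "step_fun f" "x = expv f" | "\<forall>g. step_fun g \<longrightarrow> cinner (expv g) x = 0" by blast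
      then show "cinner x (cadjoint (weyl w) z) = cinner x (weyl (\<lambda>t. - w t) z)"
      proof cases
        case 1
        then show ?thesis
          unfolding cinner_cadjoint[OF wb, symmetric] weyl_orthogonal[OF w' z]
          using ort[OF w 1(1) z] z 1 by simp
      next
        case 2
        show ?thesis
          unfolding cinner_cadjoint[OF wb, symmetric] weyl_orthogonal[OF w' z] weyl_orthogonal[OF w 2] ..
      qed
    qed
  qed
qed

section \<open>Weyl operators in time and measurability\<close>

definition prim :: "(real \<Rightarrow> complex) \<Rightarrow> real \<Rightarrow> complex"
  where "prim h t = (\<integral>s. cut {0..<t} h s \<partial>half_line)"

abbreviation weyl_time :: "real \<Rightarrow> 'k::complex_inner \<Rightarrow> 'k noise \<Rightarrow> 'k noise"
  where "weyl_time t \<nu> \<equiv> weyl (piece 0 t \<nu>)"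

lemma step_piece: "step_fun (piece 0 t \<nu>)"
  by (rule step_fun_piece) simp

lemma step_cinner_left: "step_fun g \<Longrightarrow> step_fun (\<lambda>s. cinner \<nu> (g s))"
  by (rule step_fun_map[of g "cinner \<nu>"]) (simp_all add: cinner_simps)

lemma step_cinner_right: "step_fun g \<Longrightarrow> step_fun (\<lambda>s. cinner (g s) \<nu>)"
  by (rule step_fun_map[of g "\<lambda>x. cinner x \<nu>"]) (simp_all add: cinner_simps)

lemma ip_piece_piece:
  "0 \<le> s \<Longrightarrow> 0 \<le> t \<Longrightarrow> ip (piece 0 s \<mu>) (piece 0 t \<nu>) = of_real (min s t) * cinner \<mu> \<nu>"
proof -
  assume "0 \<le> s" "0 \<le> t"
  have "(\<lambda>r. cinner (piece 0 s \<mu> r) (piece 0 t \<nu> r)) = piece 0 (min s t) (cinner \<mu> \<nu>)"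
    by (auto simp: piece_def cinner_simps)
  then show ?thesis
    unfolding ip_def using piece_integral(2)[of 0 "min s t" "cinner \<mu> \<nu>"] \<open>0 \<le> s\<close> \<open>0 \<le> t\<close> by simp
qed

lemma ip_piece_left: "ip (piece 0 t \<nu>) g = prim (\<lambda>s. cinner \<nu> (g s)) t"
  unfolding ip_def prim_def by (rule Bochner_Integration.integral_cong) (auto simp: piece_def cut_def cinner_simps)

lemma ip_piece_right: "ip f (piece 0 t \<nu>) = prim (\<lambda>s. cinner (f s) \<nu>) t"
  unfolding ip_def prim_def by (rule Bochner_Integration.integral_cong) (auto simp: piece_def cut_def cinner_simps)

lemma prim_cut: "prim (\<lambda>s. cinner (cut {0..<t} f s) \<nu>) t = prim (\<lambda>s. cinner (f s) \<nu>) t"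
  "prim (\<lambda>s. cinner \<nu> (cut {0..<t} f s)) t = prim (\<lambda>s. cinner \<nu> (f s)) t"
  unfolding prim_def by (rule Bochner_Integration.integral_cong; auto simp: cut_def)+

lemma continuous_prim: "step_fun h \<Longrightarrow> continuous_on UNIV (prim h)"
  using step_fun_primitive[of h] by (simp add: prim_def[abs_def])

lemma prim_derivative:
  assumes "step_fun h"
  obtains S where "finite S" "\<And>t. t \<notin> S \<Longrightarrow> (prim h has_vector_derivative h t) (at t)"
  using step_fun_primitive[OF assms] by (auto simp: prim_def[abs_def])

lemma weyl_time_expv:
  assumes "0 \<le> t" "step_fun g"
  shows "weyl_time t \<nu> (expv g) =
    exp (- of_real t * cinner \<nu> \<nu> / 2 - prim (\<lambda>s. cinner \<nu> (g s)) t) *\<^sub>C expv (\<lambda>s. g s + piece 0 t \<nu> s)"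
  using weyl_expv[OF step_piece assms(2), of t \<nu>]
  unfolding ip_piece_piece[OF assms(1) assms(1)] unfolding ip_piece_left using assms(1) by simp

text \<open>The formula behind adaptedness and the equation: the exponent depends on
  \<open>t\<close> only through a linear term and the primitives of two step functions.\<close>

lemma weyl_time_matrix:
  assumes t: "0 \<le> t" and f: "step_fun f" and g: "step_fun g"
  shows "cinner (nexpv f) (weyl_time t \<nu> (nexpv g)) =
    exp (ip f g - ip f f / 2 - ip g g / 2 - of_real t * cinner \<nu> \<nu> / 2
      - prim (\<lambda>s. cinner \<nu> (g s)) t + prim (\<lambda>s. cinner (f s) \<nu>) t)"
proof -
  have "cinner (nexpv f) (weyl_time t \<nu> (nexpv g)) = cnj (exp (- ip f f / 2)) * (exp (- ip g g / 2) *
     (exp (- of_real t * cinner \<nu> \<nu> / 2 - prim (\<lambda>s. cinner \<nu> (g s)) t) * exp (ip f (\<lambda>s. g s + piece 0 t \<nu> s))))"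
    unfolding nexpv_expv bounded_clinear_scaleC[OF weyl_bounded[OF step_piece]] weyl_time_expv[OF t g]
      cinner_scaleC_left cinner_scaleC_right cinner_expv[OF f step_fun_add[OF g step_piece]] by (simp only: mult_ac)
  also have "\<dots> = exp (cnj (- ip f f / 2) + (- ip g g / 2 +
     ((- of_real t * cinner \<nu> \<nu> / 2 - prim (\<lambda>s. cinner \<nu> (g s)) t) + (ip f g + prim (\<lambda>s. cinner (f s) \<nu>) t))))"
    unfolding ip_add_right[OF f g step_piece] ip_piece_right by (simp only: exp_add exp_cnj)
  also have "cnj (- ip f f / 2) + (- ip g g / 2 +
     ((- of_real t * cinner \<nu> \<nu> / 2 - prim (\<lambda>s. cinner \<nu> (g s)) t) + (ip f g + prim (\<lambda>s. cinner (f s) \<nu>) t))) =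
     ip f g - ip f f / 2 - ip g g / 2 - of_real t * cinner \<nu> \<nu> / 2
      - prim (\<lambda>s. cinner \<nu> (g s)) t + prim (\<lambda>s. cinner (f s) \<nu>) t"
    by (simp add: ip_self_real)
  finally show ?thesis .
qed

lemma cinner_nexpv:
  assumes f: "step_fun f" and g: "step_fun g"
  shows "cinner (nexpv f) (nexpv g) = exp (ip f g - ip f f / 2 - ip g g / 2)"
proof -
  have "cinner (nexpv f) (nexpv g) = cnj (exp (- ip f f / 2)) * (exp (- ip g g / 2) * exp (ip f g))"
    unfolding nexpv_expv cinner_scaleC_left cinner_scaleC_right cinner_expv[OF f g] by (simp only: mult_ac)
  also have "\<dots> = exp (cnj (- ip f f / 2) + (- ip g g / 2 + ip f g))" by (simp only: exp_add exp_cnj)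
  finally show ?thesis by (simp add: ip_self_real algebra_simps)
qed

lemma ip_split:
  assumes "step_fun f" "step_fun g" "0 \<le> t"
  shows "ip f g = ip (cut {0..<t} f) (cut {0..<t} g) + ip (cut {t..} f) (cut {t..} g)"
proof -
  have c: "(\<lambda>s. cinner (cut S f s) (cut S g s)) = cut S (\<lambda>s. cinner (f s) (g s))" for S
    by (auto simp: cut_def cinner_simps)
  show ?thesis
    unfolding ip_def c by (rule integral_cut_split[OF step_fun_cinner[OF assms(1,2)] assms(3)])
qed

text \<open>The shift lives on \<open>{0..<t}\<close>, so the terms of the exponent that involve it
  see only the past of \<open>f\<close> and \<open>g\<close>, while \<open>ip\<close> splits
  additively into past and future.\<close>

lemma weyl_time_adapted:
  assumes t: "0 \<le> t" and f: "step_fun f" and g: "step_fun g"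
  shows "cinner (nexpv f) (weyl_time t \<nu> (nexpv g)) =
    cinner (nexpv (cut {t..} f)) (nexpv (cut {t..} g)) *
    cinner (nexpv (cut {0..<t} f)) (weyl_time t \<nu> (nexpv (cut {0..<t} g)))"
  unfolding weyl_time_matrix[OF t f g] weyl_time_matrix[OF t step_fun_cut(1)[OF f t] step_fun_cut(1)[OF g t]]
    cinner_nexpv[OF step_fun_cut(2)[OF f t] step_fun_cut(2)[OF g t]] prim_cut exp_add[symmetric]
    ip_split[OF f g t] ip_split[OF f f t] ip_split[OF g g t]
  by (rule arg_cong[where f=exp]) (simp add: field_simps)

lemma norm_diff_sq: "(norm (x - y))\<^sup>2 = (norm x)\<^sup>2 + (norm y)\<^sup>2 - 2 * Re (cinner x (y::'a::complex_inner))"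
  unfolding power2_norm_eq_cinner[symmetric] by (simp add: cinner_simps cinner_commute[of y x])

text \<open>Weyl operators preserve norms, so the squared distance of two values is twice the
  squared norm of \<open>expv g\<close> minus twice the real part of their inner product. That inner
  product, \<open>C\<close>, is an explicit continuous function of \<open>s\<close>.\<close>

lemma continuous_weyl_time:
  fixes \<nu> :: "'k::complex_inner"
  assumes g: "step_fun g" shows "continuous_on {0..} (\<lambda>t. weyl_time t \<nu> (expv g))"
  unfolding continuous_on_def
proof
  fix t :: real assume "t \<in> {0..}"
  then have t: "0 \<le> t" by simp
  let ?n = "cinner \<nu> \<nu>" and ?A = "prim (\<lambda>s. cinner \<nu> (g s))"
  define C where "C s = exp (cnj (- of_real s * ?n / 2 - ?A s) + (- of_real t * ?n / 2 - ?A t)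
      + (ip g g + cnj (?A t) + (?A s + of_real (min s t) * ?n)))" for s
  have pr: "prim (\<lambda>s. cinner (g s) \<nu>) t = cnj (?A t)" for t
    unfolding ip_piece_left[symmetric] ip_piece_right[symmetric] by (rule ip_commute)
  have C: "cinner (weyl_time s \<nu> (expv g)) (weyl_time t \<nu> (expv g)) = C s" if s: "0 \<le> s" for s
  proof -
    have "ip (\<lambda>r. g r + piece 0 s \<nu> r) (\<lambda>r. g r + piece 0 t \<nu> r) = ip g g + cnj (?A t) + (?A s + of_real (min s t) * ?n)"
      using ip_add_left[OF step_fun_add[OF g step_piece] g step_piece]
        ip_add_right[OF g g step_piece] ip_add_right[OF step_piece g step_piece]
      by (simp add: ip_piece_left[of s] ip_piece_right pr ip_piece_piece[OF s t, unfolded ip_piece_right])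
    then show ?thesis
      unfolding weyl_time_expv[OF s g] weyl_time_expv[OF t g] cinner_scaleC_left cinner_scaleC_right
        cinner_expv[OF step_fun_add[OF g step_piece] step_fun_add[OF g step_piece]] C_def
      by (simp only: exp_add exp_cnj mult_ac)
  qed
  \<comment> \<open>The Weyl operator for \<open>- \<nu>\<close> is both a left inverse and the
    adjoint of that for \<open>\<nu>\<close>, so the norm does not depend on the time.\<close>
  have nrm: "(norm (weyl_time s \<nu> (expv g)))\<^sup>2 = Re (exp (ip g g))" if s: "0 \<le> s" for s
  proof -
    have "weyl_time s (- \<nu>) \<circ> weyl_time s \<nu> = weyl (\<lambda>r. piece 0 s (- \<nu>) r + piece 0 s \<nu> r)"
      by (rule weyl_compose[OF step_piece step_piece])
         (simp add: ip_piece_piece[OF s s] cinner_minus_left cinner_self)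
    also have "(\<lambda>r. piece 0 s (- \<nu>) r + piece 0 s \<nu> r) = (\<lambda>_. 0)" by (auto simp: piece_def)
    finally have "weyl_time s (- \<nu>) (weyl_time s \<nu> x) = x" for x
      unfolding weyl_zero by (metis comp_apply id_apply)
    moreover have "(\<lambda>r. - piece 0 s \<nu> r) = piece 0 s (- \<nu>)" by (auto simp: piece_def)
    ultimately show ?thesis
      unfolding power2_norm_eq_cinner[symmetric] cinner_cadjoint[OF weyl_bounded[OF step_piece]]
        cadjoint_weyl[OF step_piece] by (simp add: cinner_expv[OF g g])
  qed
  have "continuous_on {0..} C"
    unfolding C_def using continuous_on_subset[OF continuous_prim[OF step_cinner_left[OF g]]]
    by (intro continuous_intros) auto
  then have "(C \<longlongrightarrow> C t) (at t within {0..})"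
    unfolding continuous_on_def using t by auto
  then have "((\<lambda>s. 2 * Re (exp (ip g g)) - 2 * Re (C s)) \<longlongrightarrow> 2 * Re (exp (ip g g)) - 2 * Re (C t)) (at t within {0..})"
    by (intro tendsto_intros)
  moreover have "Re (C t) = Re (exp (ip g g))"
    unfolding C[OF t, symmetric] nrm[OF t, symmetric] by (rule power2_norm_eq_cinner)
  ultimately have lim: "((\<lambda>s. 2 * Re (exp (ip g g)) - 2 * Re (C s)) \<longlongrightarrow> 0) (at t within {0..})" by simp
  have "((\<lambda>s. (norm (weyl_time s \<nu> (expv g) - weyl_time t \<nu> (expv g)))\<^sup>2) \<longlongrightarrow> 0) (at t within {0..})"
  proof (rule Lim_transform_eventually[OF lim])
    show "\<forall>\<^sub>F s in at t within {0..}. 2 * Re (exp (ip g g)) - 2 * Re (C s) =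
        (norm (weyl_time s \<nu> (expv g) - weyl_time t \<nu> (expv g)))\<^sup>2"
      unfolding eventually_at_filter
      by (rule always_eventually) (auto simp: norm_diff_sq nrm t C)
  qed
  from tendsto_real_sqrt[OF this]
  have "((\<lambda>s. norm (weyl_time s \<nu> (expv g) - weyl_time t \<nu> (expv g))) \<longlongrightarrow> 0) (at t within {0..})" by simp
  then show "((\<lambda>s. weyl_time s \<nu> (expv g)) \<longlongrightarrow> weyl_time t \<nu> (expv g)) (at t within {0..})"
    by (rule Lim_null[THEN iffD2, OF tendsto_norm_zero_cancel])
qed

section \<open>Strong measurability and local boundedness\<close>

text \<open>A class stable under sums, bounded operators, inner products and restriction to
  intervals, and small enough to give local integrability and local square-integrability.
  Measurability is by simple functions since the spaces may be nonseparable.\<close>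

definition tame :: "(real \<Rightarrow> 'a::real_normed_vector) \<Rightarrow> bool"
  where "tame F \<longleftrightarrow> strongly_measurable half_line F \<and> (\<forall>T. \<exists>B. \<forall>t\<in>{0..T}. norm (F t) \<le> B)"

lemma strongly_measurable_compose2:
  assumes "strongly_measurable M f" "strongly_measurable M g"
    and h: "\<And>X Y x y. X \<longlonglongrightarrow> x \<Longrightarrow> Y \<longlonglongrightarrow> y \<Longrightarrow> (\<lambda>n. h (X n) (Y n)) \<longlonglongrightarrow> h x y"
  shows "strongly_measurable M (\<lambda>t. h (f t) (g t))"
proof -
  obtain r where r: "\<And>n. simple_function M (r n)" "AE t in M. (\<lambda>n. r n t) \<longlonglongrightarrow> f t"
    using assms(1) unfolding strongly_measurable_def by blast
  obtain s where s: "\<And>n. simple_function M (s n)" "AE t in M. (\<lambda>n. s n t) \<longlonglongrightarrow> g t"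
    using assms(2) unfolding strongly_measurable_def by blast
  have "AE t in M. (\<lambda>n. h (r n t) (s n t)) \<longlonglongrightarrow> h (f t) (g t)"
    using r(2) s(2) by eventually_elim (rule h)
  then show ?thesis
    unfolding strongly_measurable_def
    using simple_function_compose2[OF r(1) s(1)] by (intro exI[of _ "\<lambda>n t. h (r n t) (s n t)"]) auto
qed

text \<open>Sampling \<open>F\<close> at the left grid point of mesh \<open>1 / Suc n\<close> gives
  convergence by continuity. Beyond time \<open>n\<close> the sample point is 0, which keeps the
  range finite and is harmless since each \<open>t\<close> is eventually below
  \<open>n\<close>.\<close>

lemma strongly_measurable_continuous:
  fixes F :: "real \<Rightarrow> 'a::real_normed_vector"
  assumes F: "continuous_on {0..} F" shows "strongly_measurable half_line F"
  unfolding strongly_measurable_def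
proof (intro exI[of _ "\<lambda>n t. F (if t < real n then real_of_int \<lfloor>t * real (Suc n)\<rfloor> / real (Suc n) else 0)"] conjI allI AE_I2)
  fix n
  let ?k = "\<lambda>t. if t < real n then real_of_int \<lfloor>t * real (Suc n)\<rfloor> / real (Suc n) else 0"
  have "?k \<in> borel_measurable borel" by measurable
  then have km: "?k \<in> borel_measurable half_line"
    by (intro measurable_restrict_space1 measurable_completion) simp
  have "?k ` space half_line \<subseteq> (\<lambda>i. real_of_int i / real (Suc n)) ` {0..int (n * Suc n)}"
  proof
    fix y assume "y \<in> ?k ` space half_line"
    then obtain t where "t \<in> space half_line" and y: "y = ?k t" by (rule imageE)
    then have t: "0 \<le> t" "y = ?k t" by (simp_all add: space_restrict_space)
    show "y \<in> (\<lambda>i. real_of_int i / real (Suc n)) ` {0..int (n * Suc n)}"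
    proof (cases "t < real n")
      case True
      then have "t * real (Suc n) \<le> real n * real (Suc n)" by (intro mult_right_mono) auto
      then have "\<lfloor>t * real (Suc n)\<rfloor> \<le> \<lfloor>real n * real (Suc n)\<rfloor>" by (rule floor_mono)
      also have "\<dots> = int (n * Suc n)" by (simp only: of_nat_mult[symmetric] floor_of_nat)
      finally have "\<lfloor>t * real (Suc n)\<rfloor> \<le> int (n * Suc n)" .
      then show ?thesis using True t by (intro image_eqI[of _ _ "\<lfloor>t * real (Suc n)\<rfloor>"]) auto
    next
      case False then show ?thesis using t by (intro image_eqI[of _ _ 0]) auto
    qed
  qed
  then have "finite (?k ` space half_line)" by (rule finite_subset) simp
  with km have "simple_function half_line ?k" by (rule simple_function_borel_measurable)
  then show "simple_function half_line (\<lambda>t. F (?k t))" by (rule simple_function_compose1)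
next
  fix t :: real assume "t \<in> space half_line"
  then have t: "0 \<le> t" by (simp add: space_restrict_space)
  let ?k = "\<lambda>n. if t < real n then real_of_int \<lfloor>t * real (Suc n)\<rfloor> / real (Suc n) else 0"
  have lim: "?k \<longlonglongrightarrow> t"
  proof (rule LIM_zero_cancel, rule Lim_null_comparison[OF _ LIMSEQ_inverse_real_of_nat])
    obtain N :: nat where N: "t < real N" using reals_Archimedean2 by blast
    have "norm (?k n - t) \<le> inverse (real (Suc n))" if "n \<ge> N" for n
    proof -
      have "t < real n" using N that by linarith
      moreover have "\<bar>real_of_int \<lfloor>t * real (Suc n)\<rfloor> - t * real (Suc n)\<bar> \<le> 1" by linarith
      ultimately have "\<bar>(?k n - t) * real (Suc n)\<bar> \<le> 1" by (simp add: left_diff_distrib)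
      then show ?thesis by (simp add: abs_mult field_simps)
    qed
    then show "\<forall>\<^sub>F n in sequentially. norm (?k n - t) \<le> inverse (real (Suc n))"
      unfolding eventually_sequentially by blast
  qed
  have "\<forall>n. ?k n \<in> {0..}" using t by simp
  with F lim t show "(\<lambda>n. F (?k n)) \<longlonglongrightarrow> F t"
    unfolding continuous_on_sequentially by (auto simp: o_def)
qed

lemma tame_continuous: "continuous_on {0..} F \<Longrightarrow> tame F"
  unfolding tame_def
proof (intro conjI strongly_measurable_continuous allI)
  fix T assume "continuous_on {0..} F"
  then have "compact (F ` {0..T})"
    by (intro compact_continuous_image) (auto intro: continuous_on_subset)
  then show "\<exists>B. \<forall>t\<in>{0..T}. norm (F t) \<le> B" using compact_imp_bounded bounded_iff by (metis imageI)
qed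

lemma tame_add:
  assumes "tame F" "tame G" shows "tame (\<lambda>t. F t + G t)"
  unfolding tame_def
proof (intro conjI allI)
  show "strongly_measurable half_line (\<lambda>t. F t + G t)"
    using assms unfolding tame_def by (intro strongly_measurable_compose2[where h="(+)"]) (auto intro: tendsto_add)
  fix T
  obtain B C where "\<forall>t\<in>{0..T}. norm (F t) \<le> B" "\<forall>t\<in>{0..T}. norm (G t) \<le> C"
    using assms unfolding tame_def by meson
  then have "\<forall>t\<in>{0..T}. norm (F t + G t) \<le> B + C" by (meson add_mono norm_triangle_le)
  then show "\<exists>B. \<forall>t\<in>{0..T}. norm (F t + G t) \<le> B" by blast
qed

lemma tame_zero: "tame (\<lambda>_. 0)"
  by (rule tame_continuous) simp

lemma tame_sum: "(\<And>i. i \<in> I \<Longrightarrow> tame (F i)) \<Longrightarrow> tame (\<lambda>t. \<Sum>i\<in>I. F i t)"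
  by (induction I rule: infinite_finite_induct) (auto intro: tame_zero tame_add)

lemma tame_bounded_clinear:
  assumes T: "bounded_clinear T" and F: "tame F" shows "tame (\<lambda>t. T (F t))"
  unfolding tame_def
proof (intro conjI allI)
  show "strongly_measurable half_line (\<lambda>t. T (F t))"
    using F unfolding tame_def
    by (intro strongly_measurable_compose2[where h="\<lambda>x _. T x", where g=F]) (auto intro: bounded_clinear_tendsto[OF T])
  fix S
  obtain B where B: "\<forall>t\<in>{0..S}. norm (F t) \<le> B" using F unfolding tame_def by meson
  have "norm (T (F t)) \<le> onorm T * B" if "t \<in> {0..S}" for t
    using bounded_clinear_norm[OF T, of "F t"] mult_left_mono[OF B[rule_format, OF that] onorm_pos_le[OF bounded_clinear_linear[OF T]]]
    by linarith
  then show "\<exists>B. \<forall>t\<in>{0..S}. norm (T (F t)) \<le> B" by blast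
qed

lemma tame_cinner:
  assumes "tame F" "tame G" shows "tame (\<lambda>t. cinner (F t) (G t))"
  unfolding tame_def
proof (intro conjI allI)
  show "strongly_measurable half_line (\<lambda>t. cinner (F t) (G t))"
    using assms unfolding tame_def by (intro strongly_measurable_compose2[where h=cinner]) (auto intro: tendsto_cinner)
  fix T
  obtain B C where B: "\<forall>t\<in>{0..T}. norm (F t) \<le> B" and C: "\<forall>t\<in>{0..T}. norm (G t) \<le> C"
    using assms unfolding tame_def by meson
  have "norm (cinner (F t) (G t)) \<le> B * C" if t: "t \<in> {0..T}" for t
  proof -
    have "norm (F t) * norm (G t) \<le> B * C"
      using B C t norm_ge_zero order_trans by (intro mult_mono) (blast intro: order_trans[OF norm_ge_zero])+
    then show ?thesis using cinner_Cauchy_Schwarz[of "F t" "G t"] by linarith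
  qed
  then show "\<exists>B. \<forall>t\<in>{0..T}. norm (cinner (F t) (G t)) \<le> B" by blast
qed

lemma simple_function_indicator_half_line: "simple_function half_line (indicator {a..<b::real} :: real \<Rightarrow> real)"
proof -
  have "indicator {a..<b} = (\<lambda>t. if a \<le> t \<and> t < b then 1 else 0::real)" by (auto simp: indicator_def)
  moreover have "simple_function half_line (\<lambda>t. Re (piece a b 1 t))"
    by (rule simple_function_compose1[OF simple_function_piece])
  moreover have "(\<lambda>t. Re (piece a b 1 t)) = (\<lambda>t. if a \<le> t \<and> t < b then 1 else 0::real)" by (auto simp: piece_def)
  ultimately show ?thesis by simp
qed

lemma tame_interval:
  fixes F :: "real \<Rightarrow> 'a::real_normed_vector"
  assumes F: "tame F" shows "tame (\<lambda>t. if a \<le> t \<and> t < b then F t else 0)"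
proof -
  have eq: "(\<lambda>t. if a \<le> t \<and> t < b then F t else 0) = (\<lambda>t. indicator {a..<b} t *\<^sub>R F t)"
    by (auto simp: indicator_def)
  have "strongly_measurable half_line (indicator {a..<b} :: real \<Rightarrow> real)"
    unfolding strongly_measurable_def using simple_function_indicator_half_line
    by (intro exI[of _ "\<lambda>_. indicator {a..<b}"]) auto
  then have "strongly_measurable half_line (\<lambda>t. indicator {a..<b} t *\<^sub>R F t)"
    using F unfolding tame_def
    by (intro strongly_measurable_compose2[where h="\<lambda>r x. r *\<^sub>R x"]) (auto intro: tendsto_scaleR)
  moreover have "\<exists>B. \<forall>t\<in>{0..T}. norm (indicator {a..<b} t *\<^sub>R F t) \<le> B" for T
  proof -
    obtain B where "\<forall>t\<in>{0..T}. norm (F t) \<le> B" using F unfolding tame_def by meson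
    then have "\<forall>t\<in>{0..T}. norm (indicator {a..<b} t *\<^sub>R F t) \<le> B"
      by (auto simp: indicator_def intro: order_trans[OF norm_ge_zero])
    then show ?thesis by blast
  qed
  ultimately show ?thesis unfolding eq tame_def by blast
qed

lemma set_integrable_bounded:
  fixes F :: "real \<Rightarrow> 'a::euclidean_space"
  assumes F: "F \<in> borel_measurable half_line" and B: "\<And>t. t \<in> {0..T} \<Longrightarrow> norm (F t) \<le> B"
  shows "set_integrable lebesgue {0..T} F"
proof -
  define G where "G t = (if t \<in> {0..} then F t else 0)" for t
  have G: "G \<in> borel_measurable lebesgue"
    unfolding G_def by (rule borel_measurable_if_I[OF F]) simp
  have eq: "(\<lambda>t. indicator {0..T} t *\<^sub>R F t) = (\<lambda>t. indicator {0..T} t *\<^sub>R G t)"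
    by (auto simp: G_def indicator_def)
  show ?thesis
    unfolding set_integrable_def eq
  proof (rule Bochner_Integration.integrable_bound)
    show "integrable lebesgue (\<lambda>t. indicator {0..T} t *\<^sub>R B)"
      by (intro integrable_scaleR_left) (simp add: integrable_real_indicator emeasure_lborel_Icc_eq)
    show "(\<lambda>t. indicator {0..T} t *\<^sub>R G t) \<in> borel_measurable lebesgue"
      using G by (intro borel_measurable_scaleR borel_measurable_indicator) auto
    show "AE t in lebesgue. norm (indicator {0..T} t *\<^sub>R G t) \<le> norm (indicator {0..T} t *\<^sub>R B)"
      using B by (intro AE_I2) (auto simp: indicator_def G_def intro: order_trans[OF _ abs_ge_self])
  qed
qed

lemma strongly_measurable_complex:
  fixes F :: "real \<Rightarrow> complex"
  assumes "strongly_measurable half_line F" shows "F \<in> borel_measurable half_line"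
proof -
  have "strongly_measurable half_line (\<lambda>_. 1::complex)" by (rule strongly_measurable_continuous) simp
  from strongly_measurable_cinner[OF this assms] show ?thesis by (simp add: cinner_complex_def)
qed

lemma tame_set_integrable:
  fixes F :: "real \<Rightarrow> complex"
  assumes "tame F" shows "set_integrable lebesgue {0..T} F"
  using assms strongly_measurable_complex set_integrable_bounded unfolding tame_def by metis

lemma tame_norm_measurable:
  fixes F :: "real \<Rightarrow> 'a::complex_inner"
  assumes "tame F" shows "(\<lambda>t. norm (F t)) \<in> borel_measurable half_line"
proof -
  have "(\<lambda>t. cinner (F t) (F t)) \<in> borel_measurable half_line"
    using assms strongly_measurable_cinner unfolding tame_def by blast
  then have "(\<lambda>t. sqrt (Re (cinner (F t) (F t)))) \<in> borel_measurable half_line" by measurable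
  then show ?thesis by (simp add: norm_eq_sqrt_cinner[symmetric])
qed

lemma tame_locally_integrable:
  fixes F :: "real \<Rightarrow> 'a::complex_inner"
  assumes "tame F" shows "locally_integrable F"
  unfolding locally_integrable_def
proof (intro conjI allI impI)
  show "strongly_measurable half_line F" using assms by (simp add: tame_def)
  fix T :: real
  obtain B where "\<forall>t\<in>{0..T}. norm (F t) \<le> B" using assms unfolding tame_def by meson
  then show "set_integrable lebesgue {0..T} (\<lambda>t. norm (F t))"
    by (intro set_integrable_bounded[where B=B] tame_norm_measurable assms) simp
qed

lemma tame_locally_square_integrable:
  fixes F :: "real \<Rightarrow> 'a::complex_inner"
  assumes "tame F" shows "locally_square_integrable F"
  unfolding locally_square_integrable_def
proof (intro conjI allI impI)
  show "strongly_measurable half_line F" using assms by (simp add: tame_def)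
  fix T :: real
  obtain B where B: "\<forall>t\<in>{0..T}. norm (F t) \<le> B" using assms unfolding tame_def by meson
  have "(\<lambda>t. (norm (F t))\<^sup>2) \<in> borel_measurable half_line" using tame_norm_measurable[OF assms] by measurable
  then show "set_integrable lebesgue {0..T} (\<lambda>t. (norm (F t))\<^sup>2)"
    using B by (intro set_integrable_bounded[where B="B\<^sup>2"]) (auto intro: power_mono)
qed

section \<open>The solution\<close>

lemma step_fun_tame: "step_fun f \<Longrightarrow> tame f"
proof (induction rule: step_fun_induct)
  case (piece g a b z)
  have "tame (\<lambda>_. z)" by (rule tame_continuous) simp
  from tame_add[OF piece.IH tame_interval[OF this, of a b]] show ?case by (simp add: piece_def)
qed (rule tame_zero)

text \<open>Facts about the solution are available for nonnegative times only, whereas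
  \<open>tame\<close> takes functions on the whole line.\<close>

lemma tame_cong:
  assumes "tame F" "\<And>t. 0 \<le> t \<Longrightarrow> F t = G t" shows "tame G"
proof -
  obtain s where s: "\<And>n. simple_function half_line (s n)" "AE t in half_line. (\<lambda>n. s n t) \<longlonglongrightarrow> F t"
    using assms(1) unfolding tame_def strongly_measurable_def by blast
  have "AE t in half_line. (\<lambda>n. s n t) \<longlonglongrightarrow> G t"
    using s(2) by (rule AE_mp) (auto simp: assms(2) space_restrict_space intro!: AE_I2)
  then have "strongly_measurable half_line G" unfolding strongly_measurable_def using s(1) by blast
  then show ?thesis using assms unfolding tame_def by simp
qed

lemma process_domain_subspace: "complex_vector.subspace (process_domain :: ('h::chilbert_space, 'k::chilbert_space noise) tensor set)"
  unfolding alg_tensor_space_def by (rule complex_vector.subspace_span)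

lemma process_domain_tensor: "\<eta> \<in> exp_domain \<Longrightarrow> u \<otimes>\<^sub>H \<eta> \<in> process_domain"
  unfolding alg_tensor_space_def by (intro complex_vector.span_base) auto

lemma alg_tensor_space_base: "\<xi> \<in> U \<Longrightarrow> \<xi> \<otimes>\<^sub>H \<zeta> \<in> alg_tensor_space U UNIV"
  unfolding alg_tensor_space_def by (intro complex_vector.span_base) auto

text \<open>Scalars are absorbed into the first factor, so every element of the span is a plain sum
  of elementary tensors, the form in which \<open>alg_tensor_op\<close> is defined.\<close>

lemma alg_tensor_space_rep:
  assumes U: "complex_vector.subspace U" and "\<theta> \<in> alg_tensor_space U UNIV"
  shows "\<exists>(n::nat) \<xi> \<zeta>. (\<forall>m<n. \<xi> m \<in> U) \<and> \<theta> = (\<Sum>m<n. \<xi> m \<otimes>\<^sub>H \<zeta> m)"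
  using assms(2) unfolding alg_tensor_space_def
proof (induction rule: complex_vector.span_induct_alt)
  case base show ?case by (intro exI[of _ 0]) simp
next
  case (step z \<theta>1 \<theta>2)
  obtain u v where uv: "\<theta>1 = u \<otimes>\<^sub>H v" "u \<in> U" using step(1) by blast
  obtain n :: nat and \<xi> \<zeta> where n: "\<forall>m<n. \<xi> m \<in> U" "\<theta>2 = (\<Sum>m<n. \<xi> m \<otimes>\<^sub>H \<zeta> m)" using step(2) by blast
  let ?\<xi> = "\<xi>(n := z *\<^sub>C u)" and ?\<zeta> = "\<zeta>(n := v)"
  have "z *\<^sub>C u \<in> U" using U uv(2) by (rule complex_vector.subspace_scale)
  then have "\<forall>m<Suc n. ?\<xi> m \<in> U" using n(1) by (auto simp: less_Suc_eq)
  moreover have "z *\<^sub>C \<theta>1 + \<theta>2 = (\<Sum>m<Suc n. ?\<xi> m \<otimes>\<^sub>H ?\<zeta> m)"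
    using n(2) uv(1) by (simp add: tensor_scaleC_left add.commute)
  ultimately show ?case by blast
qed

text \<open>For bounded \<open>X\<close> every representation of the argument yields the value of
  the bounded tensor product, so the definite description is resolved.\<close>

lemma alg_tensor_op_eq:
  assumes D: "complex_vector.subspace D" and X: "bounded_clinear X" and T: "bounded_clinear T"
    and \<theta>: "\<theta> \<in> alg_tensor_space D UNIV"
  shows "alg_tensor_op D X T \<theta> = (X \<otimes>\<^sub>o T) \<theta>"
proof -
  have eq: "(X \<otimes>\<^sub>o T) (\<Sum>m<n. \<xi> m \<otimes>\<^sub>H \<zeta> m) = (\<Sum>m<n. X (\<xi> m) \<otimes>\<^sub>H T (\<zeta> m))" for n :: nat and \<xi> \<zeta>
    by (simp add: bounded_clinear_sumD[OF bounded_clinear_tensor_op[OF X T]] tensor_op_tensor X T)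
  show ?thesis
    unfolding alg_tensor_op_def
  proof (rule the_equality)
    obtain n :: nat and \<xi> \<zeta> where "\<forall>m<n. \<xi> m \<in> D" "\<theta> = (\<Sum>m<n. \<xi> m \<otimes>\<^sub>H \<zeta> m)"
      using alg_tensor_space_rep[OF D \<theta>] by blast
    then show "\<exists>(n::nat) \<xi> \<zeta>. (\<forall>m<n. \<xi> m \<in> D) \<and> \<theta> = (\<Sum>m<n. \<xi> m \<otimes>\<^sub>H \<zeta> m) \<and>
        (X \<otimes>\<^sub>o T) \<theta> = (\<Sum>m<n. X (\<xi> m) \<otimes>\<^sub>H T (\<zeta> m))"
      using eq by (intro exI[of _ n] exI[of _ \<xi>] exI[of _ \<zeta>]) simp
  qed (use eq in auto)
qed

lemma bounded_clinear_proj_noise: "bounded_clinear \<Delta>"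
  unfolding proj_noise_def
  by (intro bounded_clinear_tensor_op bounded_clinear_id bounded_clinear_comp[OF bounded_clinear_Pair0 bounded_clinear_snd])

lemma bounded_clinear_proj_time: "bounded_clinear \<Delta>\<^sup>\<bottom>"
  unfolding proj_time_def[abs_def] by (intro bounded_clinear_diff bounded_clinear_ident bounded_clinear_proj_noise)

primrec letter_shift :: "('i \<Rightarrow> 'k::complex_inner) \<Rightarrow> 'i letter \<Rightarrow> 'k" where
  "letter_shift m (Gen i) = m i"
| "letter_shift m (Gen_Star i) = - m i"

text \<open>With the generator shifts \<open>\<mu>\<close> below this is the vector
  \<open>\<nu>(w)\<close> of the overview, in the recursive form that fits products of Weyl
  operators.\<close>

primrec word_shift :: "('i \<Rightarrow> 'k::complex_inner) \<Rightarrow> 'i letter list \<Rightarrow> 'k" where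
  "word_shift m [] = 0"
| "word_shift m (l # w) = letter_shift m l + word_shift m w"

section \<open>Shift vectors of words and the construction of the solution\<close>

context gauge_setting begin

definition \<mu> :: "'i \<Rightarrow> 'k" where
  "\<mu> i = (if i \<in> J then c i *\<^sub>C e i else 0)"

abbreviation "shift \<equiv> word_shift \<mu>"

text \<open>Connects the recursive shift with degrees: the Weyl calculus uses the recursion,
  balancedness and the derivations use the sum.\<close>

lemma shift_eq:
  assumes "finite F" "F \<subseteq> J" "\<And>j. j \<in> J \<Longrightarrow> gen_degree j w \<noteq> 0 \<Longrightarrow> j \<in> F"
  shows "shift w = (\<Sum>j\<in>F. (of_int (gen_degree j w) * c j) *\<^sub>C e j)"
proof -
  \<comment> \<open>Degrees of letters can cancel in a longer word, so the induction runs with a set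
    containing all indices from \<open>J\<close> that occur. Terms of degree zero are discarded
    afterwards.\<close>
  have letters: "shift w = (\<Sum>j\<in>G. (of_int (gen_degree j w) * c j) *\<^sub>C e j)"
    if "finite G" "G \<subseteq> J" "\<forall>j\<in>J. Gen j \<in> set w \<or> Gen_Star j \<in> set w \<longrightarrow> j \<in> G" for G
    using that(3)
  proof (induction w)
    case Nil show ?case by (simp add: scaleC_zero_left)
  next
    case (Cons l w)
    obtain i s where i: "(l = Gen i \<and> s = 1) \<or> (l = Gen_Star i \<and> s = (- 1::complex))" by (cases l) auto
    have "letter_shift \<mu> l = s *\<^sub>C \<mu> i" using i by (auto simp: scaleC_one)
    also have "s *\<^sub>C \<mu> i = (\<Sum>j\<in>G. if j = i then (s * c i) *\<^sub>C e i else 0)"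
      using that(1,2) i Cons.prems by (auto simp: \<mu>_def scaleC_scaleC scaleC_zero_right)
    also have "\<dots> = (\<Sum>j\<in>G. ((if j = i then s else 0) * c j) *\<^sub>C e j)"
      by (intro sum.cong refl) (simp add: scaleC_zero_left)
    finally have "shift (l # w) = (\<Sum>j\<in>G. ((if j = i then s else 0) * c j) *\<^sub>C e j) +
        (\<Sum>j\<in>G. (of_int (gen_degree j w) * c j) *\<^sub>C e j)"
      using Cons by simp
    also have "\<dots> = (\<Sum>j\<in>G. (of_int (gen_degree j (l # w)) * c j) *\<^sub>C e j)"
    proof -
      have "complex_of_int (gen_degree j (l # w)) = (if j = i then s else 0) + of_int (gen_degree j w)" for j
        using i by (auto simp: gen_degree_Cons)
      then show ?thesis by (simp only: sum.distrib[symmetric] scaleC_add_left[symmetric] distrib_right[symmetric])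
    qed
    finally show ?case .
  qed
  define L where "L = F \<union> (J \<inter> (Gen -` set w \<union> Gen_Star -` set w))"
  have "finite (Gen -` set w \<union> Gen_Star -` set w)"
    by (intro finite_UnI finite_vimageI) (auto simp: inj_on_def)
  then have L: "finite L" "L \<subseteq> J" "F \<subseteq> L" using assms(1,2) by (auto simp: L_def)
  have "shift w = (\<Sum>j\<in>L. (of_int (gen_degree j w) * c j) *\<^sub>C e j)"
    by (rule letters[OF L(1,2)]) (auto simp: L_def)
  also have "\<dots> = (\<Sum>j\<in>F. (of_int (gen_degree j w) * c j) *\<^sub>C e j)"
    using assms(3) L(2) by (intro sum.mono_neutral_right L) (auto simp: scaleC_zero_left)
  finally show ?thesis .
qed

lemma shift_balanced:
  assumes "k \<in> K" "w \<in> Poly_Mapping.keys (p k)" "w' \<in> Poly_Mapping.keys (p k)"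
  shows "shift w = shift w'"
proof -
  have deg: "gen_degree j w = gen_degree j w'" if "j \<in> J" for j
    using bal assms that unfolding balanced_def by blast
  let ?F = "J \<inter> {j. gen_degree j w \<noteq> 0}"
  have fin: "finite ?F" by (rule finite_subset[OF _ finite_gen_degree[of w]]) blast
  have "shift w = (\<Sum>j\<in>?F. (of_int (gen_degree j w) * c j) *\<^sub>C e j)"
    by (rule shift_eq[OF fin]) auto
  also have "\<dots> = (\<Sum>j\<in>?F. (of_int (gen_degree j w') * c j) *\<^sub>C e j)"
    by (intro sum.cong refl) (simp add: deg)
  also have "\<dots> = shift w'"
    by (rule shift_eq[OF fin, symmetric]) (auto simp: deg)
  finally show ?thesis .
qed

lemma \<mu>_real: "Im (cinner (\<mu> i) (\<mu> j)) = 0"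
  by (auto simp: \<mu>_def cinner_simps e_orth)

lemma \<mu>_shift_real: "Im (cinner (\<mu> i) (shift w)) = 0"
proof (induction w)
  case (Cons l w)
  then show ?case by (cases l) (auto simp: cinner_simps \<mu>_real)
qed (simp add: cinner_simps)

definition flow :: "real \<Rightarrow> 'i \<Rightarrow> ('h, 'k noise) tensor \<Rightarrow> ('h, 'k noise) tensor" where
  "flow t i = a i \<otimes>\<^sub>o weyl_time t (\<mu> i)"

lemma weyl_time_bounded: "bounded_clinear (weyl_time t \<nu>)"
  by (rule weyl_bounded[OF step_piece])

lemma weyl_time_compose:
  assumes "0 \<le> t" "Im (cinner \<mu>' \<nu>) = 0"
  shows "weyl_time t \<mu>' \<circ> weyl_time t \<nu> = weyl_time t (\<mu>' + \<nu>)"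
proof -
  have "(\<lambda>s. piece 0 t \<mu>' s + piece 0 t \<nu> s) = piece 0 t (\<mu>' + \<nu>)" by (auto simp: piece_def)
  then show ?thesis
    using weyl_compose[OF step_piece step_piece, of t \<mu>' t \<nu>] assms by (simp add: ip_piece_piece)
qed

lemma weyl_time_uminus: "cadjoint (weyl_time t \<nu>) = weyl_time t (- \<nu>)"
proof -
  have "(\<lambda>s. - piece 0 t \<nu> s) = piece 0 t (- \<nu>)" by (auto simp: piece_def)
  then show ?thesis by (simp add: cadjoint_weyl[OF step_piece])
qed

text \<open>Along the word the operators on both tensor factors multiply separately; the Weyl
  factors add their shifts because the inner products of shifts are real.\<close>

lemma flow_word:
  assumes t: "0 \<le> t" and "w \<in> words I"
  shows "word_op (flow t) w = word_op a w \<otimes>\<^sub>o weyl_time t (shift w)"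
  using assms(2)
proof (induction w)
  case Nil
  have "piece 0 t (0::'k) = (\<lambda>_. 0)" by (auto simp: piece_def)
  then have "weyl_time t (0::'k) = id" by (simp add: weyl_zero)
  then show ?case by (simp only: word_op.simps word_shift.simps tensor_op_id)
next
  case (Cons l w)
  then obtain i where i: "i \<in> I" "l = Gen i \<or> l = Gen_Star i" and w: "w \<in> words I" by auto
  have ai: "bounded_clinear (a i)" using presentation(4) i(1) by blast
  have L: "bounded_clinear (letter_op a l)" using i(2) ai bounded_clinear_cadjoint by auto
  have "letter_op (flow t) l = letter_op a l \<otimes>\<^sub>o weyl_time t (letter_shift \<mu> l)"
    using i(2) by (auto simp: flow_def cadjoint_tensor_op ai weyl_time_bounded weyl_time_uminus)
  moreover have "Im (cinner (letter_shift \<mu> l) (shift w)) = 0"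
    using i(2) \<mu>_shift_real[of i w] by (auto simp: cinner_simps)
  ultimately show ?case
    unfolding word_op.simps Cons.IH[OF w]
    by (simp only: tensor_op_compose[OF L weyl_time_bounded word_bounded[OF w] weyl_time_bounded]
        weyl_time_compose[OF t] word_shift.simps)
qed

definition sol :: "('h, 'k) process_map" where
  "sol t = (SOME \<rho>. star_hom (operator_algebra A) (operator_algebra (Collect bounded_clinear)) \<rho> \<and>
    (\<forall>q\<in>nc_polys I. \<rho> (poly_op a q) = poly_op (flow t) q))"

lemma sol:
  assumes t: "0 \<le> t"
  shows sol_star_hom: "star_hom (operator_algebra A) (operator_algebra (Collect bounded_clinear)) (sol t)"
    and sol_poly: "q \<in> nc_polys I \<Longrightarrow> sol t (poly_op a q) = poly_op (flow t) q"
proof -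
  obtain \<rho> where "star_hom (operator_algebra A) (operator_algebra (Collect bounded_clinear)) \<rho>"
    "\<And>q. q \<in> nc_polys I \<Longrightarrow> \<rho> (poly_op a q) = poly_op (flow t) q"
  proof (rule gauge_homomorphism[OF concrete universal, of "flow t" "\<lambda>n x. x \<otimes>\<^sub>o weyl_time t n" shift])
    show "\<forall>i\<in>I. bounded_clinear (flow t i)"
      using presentation(4) weyl_time_bounded by (auto simp: flow_def intro: bounded_clinear_tensor_op)
    show "word_op (flow t) w = word_op a w \<otimes>\<^sub>o weyl_time t (shift w)" if "w \<in> words I" for w
      by (rule flow_word[OF t that])
    show "(\<lambda>u. \<Sum>w\<in>F. z w *\<^sub>C x w u) \<otimes>\<^sub>o weyl_time t n = (\<lambda>v. \<Sum>w\<in>F. z w *\<^sub>C (x w \<otimes>\<^sub>o weyl_time t n) v)"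
      if "finite F" "\<And>w. w \<in> F \<Longrightarrow> bounded_clinear (x w)" for n and F :: "'i letter list set" and z x
      using that by (simp add: tensor_op_sum_left bounded_clinear_scale weyl_time_bounded tensor_op_scaleC_left)
    show "shift w = shift w'" if "k \<in> K" "w \<in> Poly_Mapping.keys (p k)" "w' \<in> Poly_Mapping.keys (p k)" for k w w'
      by (rule shift_balanced[OF that])
  qed blast
  then have "\<exists>\<rho>. star_hom (operator_algebra A) (operator_algebra (Collect bounded_clinear)) \<rho> \<and>
    (\<forall>q\<in>nc_polys I. \<rho> (poly_op a q) = poly_op (flow t) q)" by blast
  from someI_ex[OF this] have "star_hom (operator_algebra A) (operator_algebra (Collect bounded_clinear)) (sol t) \<and>
    (\<forall>q\<in>nc_polys I. sol t (poly_op a q) = poly_op (flow t) q)"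
    unfolding sol_def .
  then show "star_hom (operator_algebra A) (operator_algebra (Collect bounded_clinear)) (sol t)"
    "q \<in> nc_polys I \<Longrightarrow> sol t (poly_op a q) = poly_op (flow t) q" by blast+
qed

context
  fixes t :: real assumes t: "0 \<le> t"
begin

lemmas sol_hom = star_homD[OF sol_star_hom[OF t], simplified]

lemma sol_bounded: "x \<in> A0 \<Longrightarrow> bounded_clinear (sol t x)"
  using sol_hom(1) A0_sub by auto

lemma sol_add: "x \<in> A0 \<Longrightarrow> y \<in> A0 \<Longrightarrow> sol t (\<lambda>u. x u + y u) = (\<lambda>\<xi>. sol t x \<xi> + sol t y \<xi>)"
  using sol_hom(4) A0_sub by auto

lemma sol_scaleC: "x \<in> A0 \<Longrightarrow> sol t (\<lambda>u. z *\<^sub>C x u) = (\<lambda>\<xi>. z *\<^sub>C sol t x \<xi>)"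
  using sol_hom(6) A0_sub by auto

lemma sol_word: "w \<in> words I \<Longrightarrow> sol t (word_op a w) = word_op a w \<otimes>\<^sub>o weyl_time t (shift w)"
  using sol_poly[OF t nc_polys_single[of w I 1]] by (simp add: poly_op_single scaleC_one flow_word[OF t])

lemma sol_zero: "sol t (\<lambda>_. 0) = (\<lambda>_. 0)"
  using sol_scaleC[OF A0_D(3), of 0] by (simp add: scaleC_zero_left)

lemma sol_step:
  assumes "w \<in> words I" "T \<in> A0"
  shows "sol t (\<lambda>u. z *\<^sub>C word_op a w u + T u) =
    (\<lambda>\<xi>. z *\<^sub>C (word_op a w \<otimes>\<^sub>o weyl_time t (shift w)) \<xi> + sol t T \<xi>)"
  using sol_add[OF A0_D(7)[OF gen_ops_word[OF assms(1)]] assms(2), of z]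
    sol_scaleC[OF gen_ops_word[OF assms(1)], of z] sol_word[OF assms(1)] by simp

lemma sol_sum:
  "(\<And>m. m < n \<Longrightarrow> y m \<in> A0) \<Longrightarrow> sol t (\<lambda>u. \<Sum>m<n. z m *\<^sub>C y m u) = (\<lambda>\<xi>. \<Sum>m<(n::nat). z m *\<^sub>C sol t (y m) \<xi>)"
proof (induction n)
  case 0 show ?case by (simp add: sol_zero)
next
  case (Suc n)
  have "(\<lambda>u. \<Sum>m<n. z m *\<^sub>C y m u) \<in> A0"
    by (intro star_algebra_sum[OF A0_star] A0_D(7)) (use Suc in auto)
  then show ?case
    using Suc by (simp add: sol_add A0_D(7) sol_scaleC)
qed

text \<open>On a word the operator is a tensor product, so the claim is
  \<open>weyl_time_adapted\<close> for its second factor; both sides are linear in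
  \<open>x\<close>.\<close>

lemma sol_adapted:
  assumes f: "step_fun f" and g: "step_fun g" and x: "x \<in> A0"
  shows "Ebra (nexpv f) (sol t x (Eket (nexpv g) u)) =
    cinner (nexpv (cut {t..} f)) (nexpv (cut {t..} g)) *\<^sub>C
      Ebra (nexpv (cut {0..<t} f)) (sol t x (Eket (nexpv (cut {0..<t} g)) u))"
  using x
proof (induction rule: gen_ops_induct)
  case zero show ?case by (simp add: sol_zero bounded_clinearD[OF bounded_clinear_Ebra] scaleC_zero_right)
next
  case (word z w T)
  have m: "Ebra \<xi> ((word_op a w \<otimes>\<^sub>o weyl_time t (shift w)) (Eket \<eta> u)) =
      cinner \<xi> (weyl_time t (shift w) \<eta>) *\<^sub>C word_op a w u" for \<xi> \<eta> :: "'k noise"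
    by (rule Ebra_tensor_op_Eket[OF word_bounded[OF word(1)] weyl_time_bounded])
  show ?case
    unfolding sol_step[OF word(1,2)] bounded_clinear_addD[OF bounded_clinear_Ebra]
      bounded_clinear_scaleC[OF bounded_clinear_Ebra] m word.IH weyl_time_adapted[OF t f g, of "shift w"]
    by (simp add: scaleC_add_right scaleC_scaleC mult_ac)
qed

text \<open>The entries of the sum of the \<open>sol t (y m) \<otimes>\<^sub>o T m\<close> are the
  images under \<open>sol t\<close> of the entries of \<open>Z\<close>. They depend on
  \<open>Z\<close> alone and determine the operator, so any two representations of \<open>Z\<close>
  give the same value.\<close>

lemma lifted_eq:
  fixes T :: "nat \<Rightarrow> complex \<times> 'k \<Rightarrow> complex \<times> 'k"
  assumes y: "\<forall>m<n. y m \<in> A0 \<and> bounded_clinear (T m)" and Z: "Z = (\<lambda>v. \<Sum>m<n. (y m \<otimes>\<^sub>o T m) v)"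
    and \<theta>: "\<theta> \<in> alg_tensor_space process_domain UNIV"
  shows "lifted A0 sol t Z \<theta> = (\<Sum>m<n. (sol t (y m) \<otimes>\<^sub>o T m) \<theta>)"
proof -
  have bd: "bounded_clinear (\<lambda>\<theta>. \<Sum>m<n. (sol t (y m) \<otimes>\<^sub>o T m) \<theta>)"
    if "\<forall>m<n. y m \<in> A0 \<and> bounded_clinear (T m)"
    for n :: nat and y and T :: "nat \<Rightarrow> complex \<times> 'k \<Rightarrow> complex \<times> 'k"
    using that by (intro bounded_clinear_sum bounded_clinear_tensor_op sol_bounded) auto
  have matrix: "Ebra z (\<Sum>m<n. (sol t (y m) \<otimes>\<^sub>o T m) (Eket w \<xi>)) =
      sol t (\<lambda>u. Ebra z (\<Sum>m<n. (y m \<otimes>\<^sub>o T m) (Eket w u))) \<xi>"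
    if yT: "\<forall>m<n. y m \<in> A0 \<and> bounded_clinear (T m)"
    for n :: nat and y z w \<xi> and T :: "nat \<Rightarrow> complex \<times> 'k \<Rightarrow> complex \<times> 'k"
  proof -
    have "(\<lambda>u. Ebra z (\<Sum>m<n. (y m \<otimes>\<^sub>o T m) (Eket w u))) = (\<lambda>u. \<Sum>m<n. cinner z (T m w) *\<^sub>C y m u)"
      unfolding bounded_clinear_sumD[OF bounded_clinear_Ebra]
      by (intro ext sum.cong refl Ebra_tensor_op_Eket) (use yT A0_bounded in auto)
    moreover have "Ebra z (\<Sum>m<n. (sol t (y m) \<otimes>\<^sub>o T m) (Eket w \<xi>)) = (\<Sum>m<n. cinner z (T m w) *\<^sub>C sol t (y m) \<xi>)"
      unfolding bounded_clinear_sumD[OF bounded_clinear_Ebra]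
      by (intro sum.cong refl Ebra_tensor_op_Eket) (use yT sol_bounded in auto)
    ultimately show ?thesis using yT by (simp add: sol_sum)
  qed
  have alg: "alg_tensor_op process_domain (sol t x) S \<theta> = (sol t x \<otimes>\<^sub>o S) \<theta>"
    if "x \<in> A0" "bounded_clinear S" for x and S :: "complex \<times> 'k \<Rightarrow> complex \<times> 'k"
    by (rule alg_tensor_op_eq[OF process_domain_subspace sol_bounded[OF that(1)] that(2) \<theta>])
  show ?thesis
    unfolding lifted_def
  proof (rule the_equality)
    show "\<exists>n' y' T'. (\<forall>m<n'::nat. y' m \<in> A0 \<and> bounded_clinear (T' m)) \<and> Z = (\<lambda>v. \<Sum>m<n'. (y' m \<otimes>\<^sub>o T' m) v) \<and>
        (\<Sum>m<n. (sol t (y m) \<otimes>\<^sub>o T m) \<theta>) = (\<Sum>m<n'. alg_tensor_op process_domain (sol t (y' m)) (T' m) \<theta>)"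
      by (rule exI[of _ n], rule exI[of _ y], rule exI[of _ T]) (use y Z alg in simp)
  next
    fix \<eta> assume "\<exists>n' y' T'. (\<forall>m<n'::nat. y' m \<in> A0 \<and> bounded_clinear (T' m)) \<and> Z = (\<lambda>v. \<Sum>m<n'. (y' m \<otimes>\<^sub>o T' m) v) \<and>
        \<eta> = (\<Sum>m<n'. alg_tensor_op process_domain (sol t (y' m)) (T' m) \<theta>)"
    then obtain n' y' T' where y': "\<forall>m<n'::nat. y' m \<in> A0 \<and> bounded_clinear (T' m)"
      and Z': "Z = (\<lambda>v. \<Sum>m<n'. (y' m \<otimes>\<^sub>o T' m) v)"
      and \<eta>: "\<eta> = (\<Sum>m<n'. alg_tensor_op process_domain (sol t (y' m)) (T' m) \<theta>)" by blast
    have "(\<lambda>\<theta>. \<Sum>m<n'. (sol t (y' m) \<otimes>\<^sub>o T' m) \<theta>) = (\<lambda>\<theta>. \<Sum>m<n. (sol t (y m) \<otimes>\<^sub>o T m) \<theta>)"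
      by (rule operator_ext_matrix[OF bd[OF y'] bd[OF y]])
         (use matrix[OF y'] matrix[OF y] Z Z' in \<open>simp add: fun_eq_iff\<close>)
    then show "\<eta> = (\<Sum>m<n. (sol t (y m) \<otimes>\<^sub>o T m) \<theta>)"
      unfolding \<eta> using alg y' by (simp add: fun_eq_iff)
  qed
qed


end

end

context gauge_setting begin

text \<open>Three nested reductions by linearity, over words, elementary tensors of the domain and
  exponential vectors, lead to the continuity of \<open>weyl_time\<close>.\<close>

lemma tame_sol:
  assumes x: "x \<in> A0" and \<xi>: "\<xi> \<in> process_domain"
  shows "tame (\<lambda>t. sol t x \<xi>)"
  using x
proof (induction rule: gen_ops_induct)
  case zero show ?case by (rule tame_cong[OF tame_zero]) (simp add: sol_zero)
next
  case (word z w T)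
  have weyl: "tame (\<lambda>t. weyl_time t (shift w) v)" if "v \<in> exp_domain" for v
    using that unfolding exp_domain_def
  proof (induction rule: complex_vector.span_induct_alt)
    case base show ?case using tame_zero by (simp add: bounded_clinear_zeroD[OF weyl_time_bounded])
  next
    case (step b v v')
    then obtain g where "step_fun g" "v = expv g" by blast
    then have "tame (\<lambda>t. weyl_time t (shift w) v)" using continuous_weyl_time by (auto intro: tame_continuous)
    from tame_add[OF tame_bounded_clinear[OF bounded_clinear_scale[OF bounded_clinear_ident, of b] this] step(2)]
    show ?case
      by (simp add: bounded_clinear_addD[OF weyl_time_bounded] bounded_clinear_scaleC[OF weyl_time_bounded])
  qed
  note bd = bounded_clinear_tensor_op[OF word_bounded[OF word(1)] weyl_time_bounded]
  have "tame (\<lambda>t. (word_op a w \<otimes>\<^sub>o weyl_time t (shift w)) \<xi>)"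
    using \<xi> unfolding alg_tensor_space_def
  proof (induction rule: complex_vector.span_induct_alt)
    case base show ?case using tame_zero by (simp add: bounded_clinear_zeroD[OF bd])
  next
    case (step b \<xi>1 \<xi>2)
    then obtain u v where uv: "\<xi>1 = u \<otimes>\<^sub>H v" "v \<in> exp_domain" by blast
    from tame_add[OF tame_bounded_clinear[OF bounded_clinear_scale[OF bounded_clinear_tensor_right, of b "word_op a w u"]
          weyl[OF uv(2)]] step(2)]
    show ?case
      by (simp add: bounded_clinear_addD[OF bd] bounded_clinear_scaleC[OF bd] uv(1) tensor_op_tensor
          word_bounded[OF word(1)] weyl_time_bounded)
  qed
  from tame_add[OF tame_bounded_clinear[OF bounded_clinear_scale[OF bounded_clinear_ident, of z] this] word.IH]
  show ?case by (rule tame_cong) (simp add: sol_step[OF _ word(1,2)])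
qed

section \<open>The lifted solution as an integrable process\<close>

lemma alg_tensor_space_scaleC: "\<theta> \<in> alg_tensor_space U V \<Longrightarrow> z *\<^sub>C \<theta> \<in> alg_tensor_space U V"
  unfolding alg_tensor_space_def by (rule complex_vector.span_scale)

lemma alg_tensor_space_add:
  "\<theta> \<in> alg_tensor_space U V \<Longrightarrow> \<theta>' \<in> alg_tensor_space U V \<Longrightarrow> \<theta> + \<theta>' \<in> alg_tensor_space U V"
  unfolding alg_tensor_space_def by (rule complex_vector.span_add)

lemma nexpv_process_domain: "step_fun f \<Longrightarrow> u \<otimes>\<^sub>H nexpv f \<in> process_domain"
  by (intro process_domain_tensor nexpv_exp_domain)

context
  fixes Z :: "('h, complex \<times> 'k) tensor \<Rightarrow> ('h, complex \<times> 'k) tensor"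
  assumes Z: "Z \<in> algebraic_tensor A0"
begin

text \<open>The representation is fixed before the time, so one finite sum describes the whole
  process.\<close>

lemma lifted_rep:
  obtains n :: nat and y and T :: "nat \<Rightarrow> complex \<times> 'k \<Rightarrow> complex \<times> 'k"
  where "\<forall>m<n. y m \<in> A0" "\<forall>m<n. bounded_clinear (T m)"
    "Z = (\<lambda>v. \<Sum>m<n. (y m \<otimes>\<^sub>o T m) v)"
    "\<forall>t\<ge>0. \<forall>\<theta>\<in>alg_tensor_space process_domain UNIV.
      lifted A0 sol t Z \<theta> = (\<Sum>m<n. (sol t (y m) \<otimes>\<^sub>o T m) \<theta>)"
proof -
  obtain n :: nat and y and T :: "nat \<Rightarrow> complex \<times> 'k \<Rightarrow> complex \<times> 'k"
    where 1: "\<forall>m<n. y m \<in> A0 \<and> bounded_clinear (T m)" "Z = (\<lambda>v. \<Sum>m<n. (y m \<otimes>\<^sub>o T m) v)"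
    using Z unfolding algebraic_tensor_def by blast
  show ?thesis
    by (rule that[of n y T]) (use 1 lifted_eq[OF _ 1] in auto)
qed

lemma lifted_linear:
  assumes "0 \<le> t" "\<theta> \<in> alg_tensor_space process_domain UNIV" "\<theta>' \<in> alg_tensor_space process_domain UNIV"
  shows "lifted A0 sol t Z (z *\<^sub>C \<theta> + \<theta>') = z *\<^sub>C lifted A0 sol t Z \<theta> + lifted A0 sol t Z \<theta>'"
proof -
  obtain n :: nat and y T where r: "\<forall>m<n. y m \<in> A0" "\<forall>m<n. bounded_clinear (T m)"
    "Z = (\<lambda>v. \<Sum>m<n. (y m \<otimes>\<^sub>o T m) v)"
    "\<forall>t\<ge>0. \<forall>\<theta>\<in>alg_tensor_space process_domain UNIV.
      lifted A0 sol t Z \<theta> = (\<Sum>m<n. (sol t (y m) \<otimes>\<^sub>o T m) \<theta>)" using lifted_rep .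
  have bd: "bounded_clinear (sol t (y m) \<otimes>\<^sub>o T m)" if "m < n" for m
    using r that by (intro bounded_clinear_tensor_op sol_bounded assms(1)) auto
  have "z *\<^sub>C \<theta> + \<theta>' \<in> alg_tensor_space process_domain UNIV"
    by (intro alg_tensor_space_add alg_tensor_space_scaleC assms)
  then show ?thesis
    using bd assms by (simp add: r(4) bounded_clinear_addD bounded_clinear_scaleC scaleC_sum_right sum.distrib)
qed

text \<open>Taking entries commutes with the solution. Adaptedness and the equation for the lifted
  map thereby reduce to statements about \<open>sol t\<close> on \<open>A0\<close>.\<close>

lemma lifted_matrix:
  assumes t: "0 \<le> t" and \<xi>: "\<xi> \<in> process_domain"
  shows "Ebra \<zeta> (lifted A0 sol t Z (Eket \<eta> \<xi>)) = sol t (\<lambda>u. Ebra \<zeta> (Z (Eket \<eta> u))) \<xi>"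
proof -
  obtain n :: nat and y T where r: "\<forall>m<n. y m \<in> A0" "\<forall>m<n. bounded_clinear (T m)"
    "Z = (\<lambda>v. \<Sum>m<n. (y m \<otimes>\<^sub>o T m) v)"
    "\<forall>t\<ge>0. \<forall>\<theta>\<in>alg_tensor_space process_domain UNIV.
      lifted A0 sol t Z \<theta> = (\<Sum>m<n. (sol t (y m) \<otimes>\<^sub>o T m) \<theta>)" using lifted_rep .
  have dom: "Eket \<eta> \<xi> \<in> alg_tensor_space process_domain UNIV"
    unfolding Eket_def by (rule alg_tensor_space_base[OF \<xi>])
  have "(\<lambda>u. Ebra \<zeta> (Z (Eket \<eta> u))) = (\<lambda>u. \<Sum>m<n. cinner \<zeta> (T m \<eta>) *\<^sub>C y m u)"
    unfolding r(3) bounded_clinear_sumD[OF bounded_clinear_Ebra]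
    by (intro ext sum.cong refl Ebra_tensor_op_Eket) (use r A0_bounded in auto)
  moreover have "Ebra \<zeta> (lifted A0 sol t Z (Eket \<eta> \<xi>)) = (\<Sum>m<n. cinner \<zeta> (T m \<eta>) *\<^sub>C sol t (y m) \<xi>)"
    unfolding r(4)[rule_format, OF t dom] bounded_clinear_sumD[OF bounded_clinear_Ebra]
    by (intro sum.cong refl Ebra_tensor_op_Eket) (use r sol_bounded[OF t] in auto)
  ultimately show ?thesis using r(1) by (simp add: sol_sum[OF t])
qed

lemma matrix_A0: "(\<lambda>u. Ebra \<zeta> (Z (Eket \<eta> u))) \<in> A0"
proof -
  obtain n :: nat and y T where r: "\<forall>m<n. y m \<in> A0" "\<forall>m<n. bounded_clinear (T m)"
    "Z = (\<lambda>v. \<Sum>m<n. (y m \<otimes>\<^sub>o T m) v)"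
    "\<forall>t\<ge>0. \<forall>\<theta>\<in>alg_tensor_space process_domain UNIV.
      lifted A0 sol t Z \<theta> = (\<Sum>m<n. (sol t (y m) \<otimes>\<^sub>o T m) \<theta>)" using lifted_rep .
  have "(\<lambda>u. Ebra \<zeta> (Z (Eket \<eta> u))) = (\<lambda>u. \<Sum>m<n. cinner \<zeta> (T m \<eta>) *\<^sub>C y m u)"
    unfolding r(3) bounded_clinear_sumD[OF bounded_clinear_Ebra]
    by (intro ext sum.cong refl Ebra_tensor_op_Eket) (use r A0_bounded in auto)
  then show ?thesis using r(1) by (auto intro!: star_algebra_sum[OF A0_star] A0_D(7))
qed

lemma tame_lifted:
  assumes "\<theta> \<in> alg_tensor_space process_domain UNIV"
  shows "tame (\<lambda>t. lifted A0 sol t Z \<theta>)"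
proof -
  obtain n :: nat and y T where r: "\<forall>m<n. y m \<in> A0" "\<forall>m<n. bounded_clinear (T m)"
    "Z = (\<lambda>v. \<Sum>m<n. (y m \<otimes>\<^sub>o T m) v)"
    "\<forall>t\<ge>0. \<forall>\<theta>\<in>alg_tensor_space process_domain UNIV.
      lifted A0 sol t Z \<theta> = (\<Sum>m<n. (sol t (y m) \<otimes>\<^sub>o T m) \<theta>)" using lifted_rep .
  have pure: "tame (\<lambda>t. lifted A0 sol t Z (\<xi> \<otimes>\<^sub>H \<zeta>))" if \<xi>: "\<xi> \<in> process_domain" for \<xi> \<zeta>
  proof (rule tame_cong)
    show "tame (\<lambda>t. \<Sum>m<n. Eket (T m \<zeta>) (sol t (y m) \<xi>))"
      by (intro tame_sum tame_bounded_clinear[OF bounded_clinear_Eket] tame_sol \<xi> r(1)[rule_format]) simp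
    show "(\<Sum>m<n. Eket (T m \<zeta>) (sol t (y m) \<xi>)) = lifted A0 sol t Z (\<xi> \<otimes>\<^sub>H \<zeta>)" if "0 \<le> t" for t
      unfolding r(4)[rule_format, OF that alg_tensor_space_base[OF \<xi>]]
      by (intro sum.cong refl) (simp add: tensor_op_tensor r sol_bounded[OF that] Eket_def)
  qed
  \<comment> \<open>Membership is carried through the induction because \<open>lifted_linear\<close>
    holds only on the algebraic domain.\<close>
  have "tame (\<lambda>t. lifted A0 sol t Z \<theta>) \<and> \<theta> \<in> alg_tensor_space process_domain UNIV"
    using assms unfolding alg_tensor_space_def[where V=UNIV]
  proof (induction rule: complex_vector.span_induct_alt)
    case base
    obtain \<xi> where \<xi>: "\<xi> \<in> (process_domain :: ('h, 'k noise) tensor set)"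
      unfolding alg_tensor_space_def using complex_vector.span_zero by blast
    show ?case using pure[OF \<xi>, of 0] by (simp add: tensor_zero_right complex_vector.span_zero)
  next
    case (step z \<theta>1 \<theta>2)
    then obtain u v where uv: "\<theta>1 = u \<otimes>\<^sub>H v" "u \<in> process_domain" by blast
    have dom: "\<theta>1 \<in> alg_tensor_space process_domain UNIV" "\<theta>2 \<in> alg_tensor_space process_domain UNIV"
      unfolding uv(1) using alg_tensor_space_base[OF uv(2)] step(2)
      by (blast, unfold alg_tensor_space_def[where V=UNIV], blast)
    have "tame (\<lambda>t. z *\<^sub>C lifted A0 sol t Z \<theta>1 + lifted A0 sol t Z \<theta>2)"
      using pure[OF uv(2), of v] step(2) unfolding uv(1)
      by (intro tame_add tame_bounded_clinear[OF bounded_clinear_scale[OF bounded_clinear_ident]]) auto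
    then have "tame (\<lambda>t. lifted A0 sol t Z (z *\<^sub>C \<theta>1 + \<theta>2))"
      by (rule tame_cong) (simp add: lifted_linear dom)
    moreover have "z *\<^sub>C \<theta>1 + \<theta>2 \<in> alg_tensor_space process_domain UNIV"
      by (intro alg_tensor_space_add alg_tensor_space_scaleC dom)
    ultimately show ?case unfolding alg_tensor_space_def[where V=UNIV] by simp
  qed
  then show ?thesis ..
qed

text \<open>The vector moves with time through \<open>f t\<close>. Adding one piece to
  \<open>f\<close> adds the process at the fixed vector \<open>(0, z)\<close>, restricted to an
  interval.\<close>

lemma tame_lifted_step:
  assumes f: "step_fun f" and \<xi>: "\<xi> \<in> process_domain"
  shows "tame (\<lambda>t. lifted A0 sol t Z (\<xi> \<otimes>\<^sub>H (\<alpha>, f t)))"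
  using f
proof (induction rule: step_fun_induct)
  case zero show ?case by (rule tame_lifted[OF alg_tensor_space_base[OF \<xi>]])
next
  case (piece g b b' z)
  have "tame (\<lambda>t. lifted A0 sol t Z (\<xi> \<otimes>\<^sub>H (\<alpha>, g t)) +
      (if b \<le> t \<and> t < b' then lifted A0 sol t Z (\<xi> \<otimes>\<^sub>H (0, z)) else 0))"
    by (intro tame_add piece.IH tame_interval tame_lifted alg_tensor_space_base[OF \<xi>])
  then show ?case
  proof (rule tame_cong)
    fix t :: real assume t: "0 \<le> t"
    have "lifted A0 sol t Z (\<xi> \<otimes>\<^sub>H (\<alpha>, g t + z)) =
        lifted A0 sol t Z (\<xi> \<otimes>\<^sub>H (0, z)) + lifted A0 sol t Z (\<xi> \<otimes>\<^sub>H (\<alpha>, g t))"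
      using lifted_linear[OF t alg_tensor_space_base[OF \<xi>] alg_tensor_space_base[OF \<xi>], of 1 "(0, z)" "(\<alpha>, g t)"]
      by (simp add: scaleC_one tensor_add_right[symmetric] add.commute)
    then show "lifted A0 sol t Z (\<xi> \<otimes>\<^sub>H (\<alpha>, g t)) +
        (if b \<le> t \<and> t < b' then lifted A0 sol t Z (\<xi> \<otimes>\<^sub>H (0, z)) else 0) =
        lifted A0 sol t Z (\<xi> \<otimes>\<^sub>H (\<alpha>, g t + piece b b' z t))"
      by (simp add: piece_def add.commute)
  qed
qed

lemma integrable_process_lifted: "integrable_process (\<lambda>t. lifted A0 sol t Z)"
  unfolding integrable_process_def
proof (intro conjI allI impI ballI)
  fix f g :: "real \<Rightarrow> 'k" and \<xi> \<zeta> :: "complex \<times> 'k"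
  assume "step_fun f \<and> step_fun g"
  then have f: "step_fun f" and g: "step_fun g" by auto
  show "AE t in half_line. \<forall>u::'h.
      Ebra (nexpv f) (Ebra \<xi> (lifted A0 sol t Z (Eket \<zeta> (Eket (nexpv g) u)))) =
      cinner (nexpv (cut {t..} f)) (nexpv (cut {t..} g)) *\<^sub>C
        Ebra (nexpv (cut {0..<t} f)) (Ebra \<xi> (lifted A0 sol t Z (Eket \<zeta> (Eket (nexpv (cut {0..<t} g)) u))))"
  proof (intro AE_I2 allI)
    fix t :: real and u :: 'h assume "t \<in> space half_line"
    then have t: "0 \<le> t" by (simp add: space_restrict_space)
    have "Eket (nexpv g) u \<in> process_domain" "Eket (nexpv (cut {0..<t} g)) u \<in> process_domain"
      unfolding Eket_def by (intro nexpv_process_domain g step_fun_cut t)+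
    then show "Ebra (nexpv f) (Ebra \<xi> (lifted A0 sol t Z (Eket \<zeta> (Eket (nexpv g) u)))) =
      cinner (nexpv (cut {t..} f)) (nexpv (cut {t..} g)) *\<^sub>C
        Ebra (nexpv (cut {0..<t} f)) (Ebra \<xi> (lifted A0 sol t Z (Eket \<zeta> (Eket (nexpv (cut {0..<t} g)) u))))"
      by (simp only: lifted_matrix[OF t]) (rule sol_adapted[OF t f g matrix_A0])
  qed
next
  show "strongly_measurable half_line (\<lambda>t. lifted A0 sol t Z \<theta>)"
    if "\<theta> \<in> alg_tensor_space process_domain UNIV" for \<theta>
    using tame_lifted[OF that] by (simp add: tame_def)
next
  fix u :: 'h and f :: "real \<Rightarrow> 'k" assume f: "step_fun f"
  note tl = tame_lifted_step[OF f nexpv_process_domain[OF f]]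
  show "locally_integrable (\<lambda>t. \<Delta>\<^sup>\<bottom> (lifted A0 sol t Z ((u \<otimes>\<^sub>H nexpv f) \<otimes>\<^sub>H (1, f t))))"
    by (rule tame_locally_integrable[OF tame_bounded_clinear[OF bounded_clinear_proj_time tl]])
  show "locally_square_integrable (\<lambda>t. \<Delta> (lifted A0 sol t Z ((u \<otimes>\<^sub>H nexpv f) \<otimes>\<^sub>H (1, f t))))"
    by (rule tame_locally_square_integrable[OF tame_bounded_clinear[OF bounded_clinear_proj_noise tl]])
qed

end

section \<open>The integral equation on words and on the generated algebra\<close>

abbreviation drift :: "('h \<Rightarrow> 'h) \<Rightarrow> 'k \<Rightarrow> 'k \<Rightarrow> 'h \<Rightarrow> 'h" where
  "drift x f g \<equiv> \<lambda>u. Ebra (1, f) (\<phi> x (Eket (1, g) u))"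

lemma drift_eq: "drift x f g u = \<tau> x u + \<delta>' x (u \<otimes>\<^sub>H g) + Ebra f (\<delta> x u)"
  unfolding \<phi>_def block_operator_matrix by (simp add: scaleC_one)

lemma \<delta>'_additive:
  assumes x: "x \<in> A0" and y: "y \<in> A0"
  shows "\<delta>' (\<lambda>u. x u + y u) v = \<delta>' x v + \<delta>' y v"
  using A0_D(8)[OF x] A0_D(8)[OF y]
  by (simp add: \<delta>'_def cadjoint_add A0_bounded x y \<delta>_additive \<delta>_bounded)

lemma \<delta>'_scaleC:
  assumes x: "x \<in> A0" shows "\<delta>' (\<lambda>u. z *\<^sub>C x u) v = z *\<^sub>C \<delta>' x v"
  using A0_D(8)[OF x] by (simp add: \<delta>'_def cadjoint_scaleC A0_bounded x \<delta>_scaleC \<delta>_bounded)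

lemma drift_step:
  assumes w: "w \<in> words I" and T: "T \<in> A0"
  shows "drift (\<lambda>u. z *\<^sub>C word_op a w u + T u) f g =
    (\<lambda>u. z *\<^sub>C drift (word_op a w) f g u + drift T f g u)"
proof -
  have x: "word_op a w \<in> A0" "(\<lambda>u. z *\<^sub>C word_op a w u) \<in> A0"
    using gen_ops_word[OF w] A0_D(7) by blast+
  show ?thesis
    by (rule ext, unfold drift_eq
      \<tau>_additive[OF x(2) T] \<tau>_scaleC[OF x(1)] \<delta>_additive[OF x(2) T] \<delta>_scaleC[OF x(1)]
      \<delta>'_additive[OF x(2) T] \<delta>'_scaleC[OF x(1)]
      bounded_clinear_addD[OF bounded_clinear_Ebra] bounded_clinear_scaleC[OF bounded_clinear_Ebra])
      (simp add: scaleC_add_right algebra_simps)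
qed

text \<open>On a word every derivation is multiplication by a degree, so the entry is a scalar
  multiple of the word. Its three parts come from \<open>\<delta>\<close>, from the adjoint block
  and from \<open>\<tau>\<close>.\<close>

lemma drift_word:
  assumes w: "w \<in> words I"
  shows "drift (word_op a w) f g u =
    (cinner f (shift w) - cinner (shift w) g - cinner (shift w) (shift w) / 2) *\<^sub>C word_op a w u"
proof -
  let ?x = "word_op a w" and ?n = "\<lambda>j. of_int (gen_degree j w) :: complex"
  have x: "?x \<in> A0" by (rule gen_ops_word[OF w])
  define F where "F = supp ?x \<union> supp (cadjoint ?x) \<union> (J \<inter> {j. gen_degree j w \<noteq> 0})"
  have "finite (J \<inter> {j. gen_degree j w \<noteq> 0})"
    by (rule finite_subset[OF _ finite_gen_degree[of w]]) blast
  then have F: "finite F" "F \<subseteq> J" "supp ?x \<subseteq> F" "supp (cadjoint ?x) \<subseteq> F"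
    using finite_supp x A0_D(8)[OF x] supp_sub unfolding F_def by auto
  have sh: "shift w = (\<Sum>j\<in>F. (?n j * c j) *\<^sub>C e j)"
    by (rule shift_eq[OF F(1,2)]) (simp add: F_def)
  have dw: "d j ?x u = ?n j *\<^sub>C ?x u" "d j (d j ?x) u = (?n j * ?n j) *\<^sub>C ?x u" if "j \<in> F" for j
  proof -
    have j: "j \<in> J" using that F(2) by blast
    show "d j ?x u = ?n j *\<^sub>C ?x u" by (simp add: d_word[OF j w])
    show "d j (d j ?x) u = (?n j * ?n j) *\<^sub>C ?x u"
      by (simp add: d_word[OF j w] d_scaleC[OF j x] scaleC_scaleC)
  qed
  have 1: "cinner f (shift w) = (\<Sum>j\<in>F. ?n j * (c j * cinner f (e j)))"
    unfolding sh cinner_sum_right by (simp add: cinner_scaleC_right mult.assoc)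
  have 2: "cinner (shift w) g = (\<Sum>j\<in>F. ?n j * (cnj (c j) * cinner (e j) g))"
    unfolding sh cinner_sum_left by (simp add: cinner_scaleC_left mult.assoc)
  \<comment> \<open>By orthonormality the squared norm of the shift is exactly the quadratic
    expression in the degrees that \<open>\<tau>\<close> contains.\<close>
  have 3: "cinner (shift w) (shift w) = (\<Sum>j\<in>F. of_real ((cmod (c j))\<^sup>2) * (?n j * ?n j))"
  proof -
    have ev: "cinner (e i) (shift w) = ?n i * c i" if i: "i \<in> F" for i
    proof -
      have "cinner (e i) (shift w) = (\<Sum>j\<in>F. if j = i then ?n i * c i else 0)"
        unfolding sh cinner_sum_right using F(2) i
        by (intro sum.cong refl) (auto simp: cinner_scaleC_right e_orth subset_iff)
      then show ?thesis using i F(1) by simp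
    qed
    have "cinner (shift w) (shift w) = (\<Sum>i\<in>F. cnj (?n i * c i) * cinner (e i) (shift w))"
      by (subst (1) sh) (simp add: cinner_sum_left cinner_scaleC_left)
    also have "\<dots> = (\<Sum>j\<in>F. of_real ((cmod (c j))\<^sup>2) * (?n j * ?n j))"
      by (intro sum.cong refl) (simp add: ev complex_norm_square mult_ac del: of_real_power)
    finally show ?thesis .
  qed
  have \<tau>: "\<tau> ?x u = (- (cinner (shift w) (shift w) / 2)) *\<^sub>C ?x u"
  proof -
    have "\<tau> ?x u = - (1 / 2) *\<^sub>R (\<Sum>j\<in>F. (of_real ((cmod (c j))\<^sup>2) * (?n j * ?n j)) *\<^sub>C ?x u)"
      unfolding \<tau>_superset[OF F(1,3,2)]
      by (intro arg_cong[where f="\<lambda>y. - (1 / 2) *\<^sub>R y"] sum.cong refl) (simp only: dw scaleR_scaleC scaleC_scaleC)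
    then show ?thesis
      unfolding complex_vector.scale_sum_left[symmetric] 3[symmetric] scaleR_scaleC scaleC_scaleC by simp
  qed
  have b: "(\<Sum>j\<in>F. (cnj (c j) * cinner (e j) g) *\<^sub>C d j ?x u) = cinner (shift w) g *\<^sub>C ?x u"
    unfolding 2 complex_vector.scale_sum_left by (intro sum.cong refl) (simp add: dw scaleC_scaleC mult_ac)
  have k: "(\<Sum>j\<in>F. (c j * cinner f (e j)) *\<^sub>C d j ?x u) = cinner f (shift w) *\<^sub>C ?x u"
    unfolding 1 complex_vector.scale_sum_left by (intro sum.cong refl) (simp add: dw scaleC_scaleC mult_ac)
  show ?thesis
    unfolding \<phi>_matrix[OF x F] \<tau> b k
    by (simp add: complex_vector.scale_left_diff_distrib complex_vector.scale_minus_left algebra_simps)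
qed

text \<open>The matrix element is \<open>exp (H s)\<close>, and the bracket in the integrand is the
  derivative of \<open>H\<close> off the finite set \<open>S \<union> S'\<close>, so the fundamental
  theorem of calculus applies.\<close>

lemma weyl_time_integral:
  assumes f: "step_fun f" and g: "step_fun g" and t: "0 \<le> t"
  shows "((\<lambda>s. (cinner (f s) \<nu> - cinner \<nu> (g s) - cinner \<nu> \<nu> / 2) * cinner (nexpv f) (weyl_time s \<nu> (nexpv g)))
    has_integral cinner (nexpv f) (weyl_time t \<nu> (nexpv g)) - cinner (nexpv f) (weyl_time 0 \<nu> (nexpv g))) {0..t}"
proof -
  define H where "H s = ip f g - ip f f / 2 - ip g g / 2 - of_real s * cinner \<nu> \<nu> / 2
      - prim (\<lambda>s. cinner \<nu> (g s)) s + prim (\<lambda>s. cinner (f s) \<nu>) s" for s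
  have E: "cinner (nexpv f) (weyl_time s \<nu> (nexpv g)) = exp (H s)" if "0 \<le> s" for s
    unfolding weyl_time_matrix[OF that f g] H_def ..
  obtain S where S: "finite S"
    "\<And>s. s \<notin> S \<Longrightarrow> (prim (\<lambda>s. cinner \<nu> (g s)) has_vector_derivative cinner \<nu> (g s)) (at s)"
    using prim_derivative[OF step_cinner_left[OF g]] by metis
  obtain S' where S': "finite S'"
    "\<And>s. s \<notin> S' \<Longrightarrow> (prim (\<lambda>s. cinner (f s) \<nu>) has_vector_derivative cinner (f s) \<nu>) (at s)"
    using prim_derivative[OF step_cinner_right[OF f]] by metis
  have "((\<lambda>s. (cinner (f s) \<nu> - cinner \<nu> (g s) - cinner \<nu> \<nu> / 2) * exp (H s)) has_integral exp (H t) - exp (H 0)) {0..t}"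
  proof (rule fundamental_theorem_of_calculus_interior_strong[of "S \<union> S'"])
    show "finite (S \<union> S')" using S S' by simp
    show "continuous_on {0..t} (\<lambda>s. exp (H s))"
      unfolding H_def
      using continuous_on_subset[OF continuous_prim[OF step_cinner_left[OF g]]]
        continuous_on_subset[OF continuous_prim[OF step_cinner_right[OF f]]]
      by (intro continuous_intros) auto
    fix s assume s: "s \<in> {0<..<t} - (S \<union> S')"
    have lin: "((\<lambda>s. of_real s * cinner \<nu> \<nu> / 2) has_vector_derivative cinner \<nu> \<nu> / 2) (at s)"
      by (auto intro!: derivative_eq_intros)
    have "(H has_vector_derivative (0 - cinner \<nu> \<nu> / 2 - cinner \<nu> (g s) + cinner (f s) \<nu>)) (at s)"
      unfolding H_def
      by (intro has_vector_derivative_add has_vector_derivative_diff has_vector_derivative_const lin S(2) S'(2))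
         (use s in auto)
    from field_vector_diff_chain_at[OF this, of exp "exp (H s)"]
    have "(exp \<circ> H has_vector_derivative (0 - cinner \<nu> \<nu> / 2 - cinner \<nu> (g s) + cinner (f s) \<nu>) * exp (H s)) (at s)"
      by (simp add: DERIV_exp)
    then show "((\<lambda>s. exp (H s)) has_vector_derivative (cinner (f s) \<nu> - cinner \<nu> (g s) - cinner \<nu> \<nu> / 2) * exp (H s)) (at s)"
      by (simp add: o_def algebra_simps)
  qed (rule t)
  then show ?thesis
    unfolding E[OF t] E[OF order_refl] by (rule has_integral_eq[rotated]) (simp add: E)
qed

text \<open>By linearity only the contribution of a word is new. There
  \<open>cinner u (word_op a w v)\<close> factors out, and the noise part is
  \<open>weyl_time_integral\<close>.\<close>

lemma sol_integral:
  assumes x: "x \<in> A0" and f: "step_fun f" and g: "step_fun g" and t: "0 \<le> t"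
  shows "((\<lambda>s. cinner (u \<otimes>\<^sub>H nexpv f) (sol s (drift x (f s) (g s)) (v \<otimes>\<^sub>H nexpv g)))
    has_integral cinner (u \<otimes>\<^sub>H nexpv f) (sol t x (v \<otimes>\<^sub>H nexpv g)) -
      cinner (u \<otimes>\<^sub>H nexpv f) (sol 0 x (v \<otimes>\<^sub>H nexpv g))) {0..t}"
  using x
proof (induction rule: gen_ops_induct)
  case zero
  have z: "(\<lambda>_. 0) \<in> A0" by (rule A0_D(4))
  have "drift (\<lambda>_. 0) f g = (\<lambda>_. 0)" for f g
    using \<tau>_scaleC[OF z, of 0] \<delta>_scaleC[OF z, of 0] \<delta>'_scaleC[OF z, of 0]
    by (simp add: drift_eq scaleC_zero_left bounded_clinear_zeroD[OF bounded_clinear_Ebra])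
  then have "cinner (u \<otimes>\<^sub>H nexpv f) (sol s (drift (\<lambda>_. 0) (f s) (g s)) (v \<otimes>\<^sub>H nexpv g)) = 0" if "s \<in> {0..t}" for s
    using that by (simp add: sol_zero cinner_zero_right)
  then have "((\<lambda>s. cinner (u \<otimes>\<^sub>H nexpv f) (sol s (drift (\<lambda>_. 0) (f s) (g s)) (v \<otimes>\<^sub>H nexpv g))) has_integral 0) {0..t}"
    by (rule has_integral_is_0)
  then show ?case using t by (simp add: sol_zero cinner_zero_right)
next
  case (word z w T)
  have wA: "word_op a w \<in> A0" by (rule gen_ops_word[OF word(1)])
  let ?E = "\<lambda>s. cinner (nexpv f) (weyl_time s (shift w) (nexpv g))"
  let ?k = "\<lambda>s. cinner (f s) (shift w) - cinner (shift w) (g s) - cinner (shift w) (shift w) / 2"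
  let ?q = "z * cinner u (word_op a w v)"
  have W: "sol s (word_op a w) (v \<otimes>\<^sub>H nexpv g) = word_op a w v \<otimes>\<^sub>H weyl_time s (shift w) (nexpv g)" if "0 \<le> s" for s
    by (simp add: sol_word[OF that word(1)] tensor_op_tensor word_bounded[OF word(1)] weyl_time_bounded)
  have I: "((\<lambda>s. ?q * (?k s * ?E s) + cinner (u \<otimes>\<^sub>H nexpv f) (sol s (drift T (f s) (g s)) (v \<otimes>\<^sub>H nexpv g)))
    has_integral ?q * (?E t - ?E 0) + (cinner (u \<otimes>\<^sub>H nexpv f) (sol t T (v \<otimes>\<^sub>H nexpv g)) -
      cinner (u \<otimes>\<^sub>H nexpv f) (sol 0 T (v \<otimes>\<^sub>H nexpv g)))) {0..t}"
    by (intro has_integral_add has_integral_mult_right weyl_time_integral[OF f g t] word.IH)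
  have EQ: "?q * (?k s * ?E s) + cinner (u \<otimes>\<^sub>H nexpv f) (sol s (drift T (f s) (g s)) (v \<otimes>\<^sub>H nexpv g)) =
      cinner (u \<otimes>\<^sub>H nexpv f) (sol s (drift (\<lambda>u. z *\<^sub>C word_op a w u + T u) (f s) (g s)) (v \<otimes>\<^sub>H nexpv g))"
    if "s \<in> {0..t}" for s
  proof -
    have s: "0 \<le> s" using that by simp
    have TA: "drift T (f s) (g s) \<in> A0" by (rule matrix_A0[OF \<phi>_algebraic[OF word(2)]])
    have kA: "(\<lambda>u. ?k s *\<^sub>C word_op a w u) \<in> A0" by (rule A0_D(7)[OF wA])
    show ?thesis
      unfolding drift_step[OF word(1,2)] drift_word[OF word(1)]
        sol_add[OF s A0_D(7)[OF kA] TA] sol_scaleC[OF s kA] sol_scaleC[OF s wA] W[OF s]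
      by (simp add: cinner_add_right cinner_scaleC_right cinner_tensor mult_ac)
  qed
  have V: "?q * ?E s + cinner (u \<otimes>\<^sub>H nexpv f) (sol s T (v \<otimes>\<^sub>H nexpv g)) =
      cinner (u \<otimes>\<^sub>H nexpv f) (sol s (\<lambda>u. z *\<^sub>C word_op a w u + T u) (v \<otimes>\<^sub>H nexpv g))" if s: "0 \<le> s" for s
    unfolding sol_add[OF s A0_D(7)[OF wA] word(2)] sol_scaleC[OF s wA] W[OF s]
    by (simp add: cinner_add_right cinner_scaleC_right cinner_tensor mult_ac)
  have "?q * (?E t - ?E 0) + (cinner (u \<otimes>\<^sub>H nexpv f) (sol t T (v \<otimes>\<^sub>H nexpv g)) -
      cinner (u \<otimes>\<^sub>H nexpv f) (sol 0 T (v \<otimes>\<^sub>H nexpv g))) =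
    (?q * ?E t + cinner (u \<otimes>\<^sub>H nexpv f) (sol t T (v \<otimes>\<^sub>H nexpv g))) -
    (?q * ?E 0 + cinner (u \<otimes>\<^sub>H nexpv f) (sol 0 T (v \<otimes>\<^sub>H nexpv g)))"
    by (simp add: algebra_simps)
  with has_integral_eq[OF EQ I] show ?case unfolding V[OF t] V[OF order_refl] by (simp only:)
qed

section \<open>Verification of the properties of the solution\<close>

lemma sol_zero_time:
  assumes "x \<in> A0" shows "sol 0 x = ampliation x"
  using assms
proof (induction rule: gen_ops_induct)
  case zero show ?case by (simp add: sol_zero ampliation_def tensor_op_zero_left bounded_clinear_id)
next
  case (word z w T)
  have "piece 0 0 (shift w) = (\<lambda>_. 0)" by (auto simp: piece_def fun_eq_iff)
  then have W: "weyl_time 0 (shift w) = id" by (simp add: weyl_zero)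
  note wb = word_bounded[OF word(1)]
  show ?case
    unfolding sol_step[OF order_refl word(1,2)] W word.IH ampliation_def
    by (simp add: tensor_op_add_left tensor_op_scaleC_left wb bounded_clinear_scale A0_bounded[OF word(2)] bounded_clinear_id)
qed

lemma adapted_family: "adapted_family A0 sol"
  unfolding adapted_family_def
proof (intro conjI allI impI ballI)
  fix t :: real and \<xi> x y z
  assume t: "0 \<le> t" and x: "x \<in> A0" and y: "y \<in> A0"
  show "sol t (\<lambda>u. x u + y u) \<xi> = sol t x \<xi> + sol t y \<xi>" by (simp add: sol_add[OF t x y])
  show "sol t (\<lambda>u. z *\<^sub>C x u) \<xi> = z *\<^sub>C sol t x \<xi>" by (simp add: sol_scaleC[OF t x])
next
  fix x assume x: "x \<in> A0"
  show "operator_process (\<lambda>t. sol t x)"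
    unfolding operator_process_def
  proof (intro conjI allI impI ballI)
    show "clinear_on process_domain (sol t x)" if "0 \<le> t" for t
      unfolding clinear_on_def using sol_bounded[OF that x] by (simp add: bounded_clinear_addD bounded_clinear_scaleC)
    show "(\<lambda>t. cinner \<eta> (sol t x \<xi>)) \<in> borel_measurable half_line" if \<xi>: "\<xi> \<in> process_domain" for \<xi> \<eta>
    proof -
      have "tame (\<lambda>t. cinner \<eta> (sol t x \<xi>))"
        by (intro tame_bounded_clinear[OF bounded_clinear_cinner] tame_sol x \<xi>)
      then show ?thesis using strongly_measurable_complex unfolding tame_def by blast
    qed
    show "Ebra (nexpv f) (sol t x (Eket (nexpv g) u)) =
      cinner (nexpv (cut {t..} f)) (nexpv (cut {t..} g)) *\<^sub>C
        Ebra (nexpv (cut {0..<t} f)) (sol t x (Eket (nexpv (cut {0..<t} g)) u))"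
      if "0 \<le> t" "step_fun f \<and> step_fun g" for t and f g :: "real \<Rightarrow> 'k" and u
      using sol_adapted that x by blast
  qed
qed

lemma strong_solution: "strong_solution A0 \<phi> sol"
  unfolding strong_solution_def
proof (intro conjI ballI allI impI)
  show "adapted_family A0 sol" by (rule adapted_family)
next
  fix x \<xi> assume "x \<in> A0" then show "sol 0 x \<xi> = ampliation x \<xi>" by (simp add: sol_zero_time)
next
  fix x assume x: "x \<in> A0"
  show "integrable_process (\<lambda>t. lifted A0 sol t (\<phi> x))"
    by (rule integrable_process_lifted[OF \<phi>_algebraic[OF x]])
next
  fix x and u v :: 'h and f g :: "real \<Rightarrow> 'k" and t :: real
  assume x: "x \<in> A0" and *: "step_fun f \<and> step_fun g \<and> 0 \<le> t"
  note \<phi>x = \<phi>_algebraic[OF x]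
  define F where "F = (\<lambda>s. cinner (u \<otimes>\<^sub>H nexpv f)
               (Ebra (1, f s) (lifted A0 sol s (\<phi> x) (Eket (1, g s) (v \<otimes>\<^sub>H nexpv g)))))"
  have f: "step_fun f" and g: "step_fun g" and t: "0 \<le> t" using * by auto
  \<comment> \<open>The time-dependent vector in the bra is the constant \<open>(1, 0)\<close> plus
    the image of a step function under a bounded map, so \<open>F\<close> is an inner product of two
    tame functions.\<close>
  have "tame F"
  proof -
    have "tame (\<lambda>s. (u \<otimes>\<^sub>H nexpv f) \<otimes>\<^sub>H ((1, 0) + (0, f s) :: complex \<times> 'k))"
      by (intro tame_bounded_clinear[OF bounded_clinear_tensor_right] tame_add
          tame_bounded_clinear[OF bounded_clinear_Pair0 step_fun_tame[OF f]]) (auto intro: tame_continuous)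
    from tame_cinner[OF this tame_lifted_step[OF \<phi>x g nexpv_process_domain[OF g]]]
    show ?thesis by (simp add: F_def cinner_Ebra Eket_def)
  qed
  then have int: "set_integrable lebesgue {0..t} F" by (rule tame_set_integrable)
  have "(F has_integral cinner (u \<otimes>\<^sub>H nexpv f) (sol t x (v \<otimes>\<^sub>H nexpv g)) -
      cinner (u \<otimes>\<^sub>H nexpv f) (sol 0 x (v \<otimes>\<^sub>H nexpv g))) {0..t}"
    by (rule has_integral_eq[OF _ sol_integral[OF x f g t]])
       (simp add: F_def lifted_matrix[OF \<phi>x] nexpv_process_domain g)
  \<comment> \<open>The equation was obtained for the gauge integral, which coincides with the
    Lebesgue integral for the set-integrable \<open>F\<close>.\<close>
  then have "cinner (u \<otimes>\<^sub>H nexpv f) (sol t x (v \<otimes>\<^sub>H nexpv g) - sol 0 x (v \<otimes>\<^sub>H nexpv g)) = (LINT s:{0..t}|lebesgue. F s)"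
    unfolding set_lebesgue_integral_eq_integral(2)[OF int] by (simp add: cinner_diff_right integral_unique)
  with int show "let F = (\<lambda>s. cinner (u \<otimes>\<^sub>H nexpv f)
               (Ebra (1, f s) (lifted A0 sol s (\<phi> x) (Eket (1, g s) (v \<otimes>\<^sub>H nexpv g)))))
         in set_integrable lebesgue {0..t} F \<and>
            cinner (u \<otimes>\<^sub>H nexpv f) (sol t x (v \<otimes>\<^sub>H nexpv g) - sol 0 x (v \<otimes>\<^sub>H nexpv g)) =
            (LINT s:{0..t}|lebesgue. F s)"
    unfolding F_def[symmetric] Let_def by blast
qed

text \<open>Inherited from the homomorphism property: \<open>cadjoint x \<circ> y\<close> goes to
  \<open>cadjoint (sol t x) \<circ> sol t y\<close>, and the adjoint is moved across the inner
  product.\<close>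

lemma weakly_multiplicative: "weakly_multiplicative A0 sol"
  unfolding weakly_multiplicative_def
proof (intro ballI allI impI)
  fix x y \<zeta> \<xi> and t :: real assume x: "x \<in> A0" and y: "y \<in> A0" and t: "0 \<le> t"
  have "sol t (cadjoint x \<circ> y) = cadjoint (sol t x) \<circ> sol t y"
  proof -
    have "x \<in> A" "y \<in> A" "cadjoint x \<in> A" using x y A0_D(8)[OF x] A0_sub by blast+
    then show ?thesis by (simp only: sol_hom(3)[OF t] sol_hom(5)[OF t])
  qed
  then show "cinner (sol t x \<zeta>) (sol t y \<xi>) = cinner \<zeta> (sol t (cadjoint x \<circ> y) \<xi>)"
    by (simp add: cinner_cadjoint[OF sol_bounded[OF t x]])
qed

lemma star_homomorphic: "star_homomorphic A A0 sol"
  unfolding star_homomorphic_def using sol_star_hom by blast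

end

theorem theorem5p7:
  fixes A :: "('h::chilbert_space \<Rightarrow> 'h) set"
    and I J :: "'i set" and a :: "'i \<Rightarrow> 'h \<Rightarrow> 'h"
    and K :: "'r set" and p :: "'r \<Rightarrow> 'i nc_poly"
    and e :: "'i \<Rightarrow> 'k::chilbert_space" and c :: "'i \<Rightarrow> complex"
  assumes "concrete_cstar_algebra A"
    and "universal_cstar_algebra (operator_algebra A) I a K p"
    and "J \<subseteq> I" and "\<forall>j\<in>J. balanced K p j"
    and "orthonormal_basis J e"
    and "A0 = star_subalgebra_generated (operator_algebra A) I a"
    and "d = gauge_derivation (operator_algebra A) I a"
    and "\<delta> = (\<lambda>x u. \<Sum>j | j \<in> J \<and> d j x \<noteq> (\<lambda>_. 0). c j *\<^sub>C (d j x u \<otimes>\<^sub>H e j))"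
    and "\<tau> = (\<lambda>x u. - (1 / 2) *\<^sub>R (\<Sum>j | j \<in> J \<and> d j x \<noteq> (\<lambda>_. 0). (cmod (c j))\<^sup>2 *\<^sub>R d j (d j x) u))"
    and "\<pi> = (\<lambda>x. ampliation x)"
    and "\<delta>' = (\<lambda>x. cadjoint (\<delta> (cadjoint x)))"
    and "\<phi> = (\<lambda>x. block_operator (\<tau> x) (\<delta>' x) (\<delta> x) (\<lambda>v. \<pi> x v - ampliation x v))"
  shows "standard_form A A0 \<tau> \<delta>' \<delta> \<pi> \<and>
    (\<forall>x\<in>A0. \<phi> x \<in> algebraic_tensor A0 \<and> \<phi> x = block_operator (\<tau> x) (\<delta>' x) (\<delta> x) (\<lambda>_. 0)) \<and>
    (\<exists>j. strong_solution A0 \<phi> j \<and> weakly_multiplicative A0 j \<and>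
       ((\<forall>i\<in>I. cadjoint (a i) \<circ> a i = id) \<longrightarrow> star_homomorphic A A0 j))"
proof -
  interpret G: gauge_setting A I J a K p e c
    by unfold_locales (use assms(1-5) in auto)
  have A0: "A0 = gen_ops I a" using assms(6) G.presentation(5) by simp
  have \<delta>: "\<delta> = G.\<delta>" by (intro ext) (simp add: assms(7,8) G.\<delta>_def G.supp_def)
  have \<tau>: "\<tau> = G.\<tau>" by (intro ext) (simp add: assms(7,9) G.\<tau>_def G.supp_def)
  have \<delta>': "\<delta>' = G.\<delta>'" by (intro ext) (simp add: assms(11) \<delta> G.\<delta>'_def)
  have \<phi>: "\<phi> = G.\<phi>" by (intro ext) (simp add: assms(10,12) \<delta> \<tau> \<delta>' G.\<phi>_def)
  \<comment> \<open>The homomorphism in the lower right block is the ampliation itself, so the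
    difference there vanishes.\<close>
  have "\<phi> x = block_operator (\<tau> x) (\<delta>' x) (\<delta> x) (\<lambda>_. 0)" for x
    by (simp add: assms(10,12))
  then show ?thesis
    using G.standard_form G.\<phi>_algebraic G.strong_solution G.weakly_multiplicative G.star_homomorphic
    unfolding A0 \<delta> \<tau> \<delta>' assms(10) \<phi> by blast
qed

end
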